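(* Let $U$ be an open subset of $\mathbb{H}^n$, let $\widetilde U\subset\mathbb{CP}^{2n+1}$ be its twistor space and let $L=L_{-3}$ be the holomorphic line bundle over $\widetilde U$. Consider the composition $$\tau_*\circ\pi_\tau:\ \mathcal{E}^{(0,1)}(\widetilde U,L)\to\mathcal{E}^{(0,1)}_\tau(\widetilde U,L)\to\mathcal{C}^\infty(U,\mathbb{C}^2).$$ If $\varOmega\in\mathcal{E}^{(0,1)}(\widetilde U,L)$ is $\bar\partial$-closed, then $\tau_*\circ\pi_\tau(\varOmega)\in\mathcal{R}(U)$, and $\tau_*\circ\pi_\tau$ induces an isomorphism $$\mathcal{P}:\ H^1(\widetilde U,L)\to\mathcal{R}(U),$$ where $H^1(\widetilde U,L)$ is the first Dolbeault cohomology group of $\widetilde U$ with values in $L$.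
   Context: Quaternionic notation. $\mathbb{H}^n$ is identified with $\mathbb{C}^{2n}$ by $(\alpha_1,\beta_1,\dots,\alpha_n,\beta_n)^T\mapsto(\alpha_1+k\beta_1,\dots,\alpha_n+k\beta_n)^T$, where $q_\ell=x_0^\ell+ix_1^\ell+jx_2^\ell+kx_3^\ell$, $\alpha_\ell=x_0^\ell+ix_1^\ell$, $\beta_\ell=x_3^\ell+ix_2^\ell$. A smooth $\psi=\psi_{0'}+k\psi_{1'}:U\to\mathbb{H}$ ($\psi_{0'},\psi_{1'}$ complex valued) is monogenic if $\partial_{x_0^\ell}\psi+i\partial_{x_1^\ell}\psi+j\partial_{x_2^\ell}\psi+k\partial_{x_3^\ell}\psi=0$ for all $\ell$, equivalently $\partial_{\beta_\ell}\psi_{1'}-\partial_{\bar\alpha_\ell}\psi_{0'}=0$ and $\partial_{\alpha_\ell}\psi_{1'}+\partial_{\bar\beta_\ell}\psi_{0'}=0$ for $\ell=1,\dots,n$. $\mathcal{R}(U)$ is the space of monogenic functions, viewed as the space of such pairs $(\psi_{0'},\psi_{1'})\in\mathcal{C}^\infty(U,\mathbb{C}^2)$. Twistor space. The map $$\mathbb{CP}^1\times U\to\mathbb{CP}^{2n+1},\quad ([\pi_0:\pi_1],x)\mapsto[\pi_0:\pi_1:\pi_0\alpha_1-\pi_1\bar\beta_1:\pi_0\beta_1+\pi_1\bar\alpha_1:\dots:\pi_0\alpha_n-\pi_1\bar\beta_n:\pi_0\beta_n+\pi_1\bar\alpha_n]$$ with $x=(\alpha_1,\beta_1,\dots,\alpha_n,\beta_n)^T$,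 is a diffeomorphism onto an open subset $\widetilde U$ of $\mathbb{CP}^{2n+1}$; $\widetilde U$ carries the complex structure induced from $\mathbb{CP}^{2n+1}$ (not the product structure). Via this diffeomorphism let $\tau:\widetilde U\to U$ be the projection to $U$ and $\zeta:\widetilde U\to\mathbb{CP}^1$ the projection to $\mathbb{CP}^1$; $\zeta$ is holomorphic. Let $\mathfrak{X}_i=\{\pi_i\neq0\}\subset\mathbb{CP}^1$, with coordinates $z=\pi_1/\pi_0$ on $\mathfrak{X}_0\cong\mathbb{C}$ and $w=\pi_0/\pi_1$ on $\mathfrak{X}_1\cong\mathbb{C}$, and $\widetilde U_i\cong\mathfrak{X}_i\times U$. Line bundles. $Q_k\to\mathbb{CP}^1$ ($k\in\mathbb{Z}$) is the holomorphic line bundle whose sections are pairs $f_i:\mathfrak{X}_i\to\mathbb{C}$ with $f_1(z^{-1})=z^{-k}f_0(z)$ for $z\in\mathbb{C}^\ast$. $L_k:=\zeta^*Q_k$; its smooth sections over $\widetilde U$ are pairs of smooth functions $f_i:\mathfrak{X}_i\times U\to\mathbb{C}$ with $f_1(z^{-1},x)=z^{-k}f_0(z,x)$. $L:=L_{-3}$. Forms. $\Lambda^{(0,1)}$ is the bundle of $(0,1)$-forms on $\widetilde U$; $\mathcal{E}^{(0,q)}(\widetilde U,L)$ is the space of smooth $L$-valued $(0,q)$-forms. $K\subset\Lambda^{(0,1)}$ is the subbundle of $(0,1)$-forms that vanish on $\ker(T\tau_{\mathbb{C}})$; it has corank 1. $\Lambda_\tau^{(0,1)}:=\Lambda^{(0,1)}/K$,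 trivialized by the class of $d\bar z$ over $\widetilde U_0$ and of $d\bar w$ over $\widetilde U_1$ (written again $d\bar z,d\bar w$). $\mathcal{E}^{(0,1)}_\tau(\widetilde U,L)$ is the space of smooth sections of $\Lambda_\tau^{(0,1)}\otimes L$, and $\pi_\tau:\mathcal{E}^{(0,1)}(\widetilde U,L)\to\mathcal{E}^{(0,1)}_\tau(\widetilde U,L)$ is the quotient map (restriction of forms to the fibres of $\tau$). Integration. An element of $\mathcal{E}^{(0,1)}_\tau(\widetilde U,L)$ is a pair $(h_0\,d\bar z,h_1\,d\bar w)$ with $h_i:\mathfrak{X}_i\times U\to\mathbb{C}$ smooth and $h_1(z^{-1},x)=-z^{3}\bar z^{2}h_0(z,x)$, $z\in\mathbb{C}^\ast$. Then $\tau_*(h_0\,d\bar z,h_1\,d\bar w):=(\psi_{0'},\psi_{1'})$ with $$\psi_{A'}(x)=\frac{1}{2\pi i}\int_{\mathbb{C}}z^A h_0(z,x)\,d\bar z\wedge dz,\qquad A=0,1,\ x\in U.$$ *)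

theory Defs
  imports "HOL-Analysis.Analysis" "HOL-Library.Function_Algebras"
begin

section \<open>Smooth maps\<close>

text \<open>
  The definitions are only used for open \<open>S\<close>. Continuity of all iterated directional derivatives in all constant
  directions, together with differentiability at each stage, is the usual notion of a
  \<open>C\<^sup>k\<close> map between finite-dimensional spaces.
\<close>

fun Ck_on :: "nat \<Rightarrow> 'a::real_normed_vector set \<Rightarrow> ('a \<Rightarrow> 'b::real_normed_vector) \<Rightarrow> bool" where
  "Ck_on 0 S f \<longleftrightarrow> continuous_on S f"
| "Ck_on (Suc m) S f \<longleftrightarrow> (\<forall>x\<in>S. f differentiable (at x)) \<and>
     (\<forall>v. Ck_on m S (\<lambda>x. frechet_derivative f (at x) v))"

definition smooth_on :: "'a::real_normed_vector set \<Rightarrow> ('a \<Rightarrow> 'b::real_normed_vector) \<Rightarrow> bool" where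
  "smooth_on S f \<longleftrightarrow> (\<forall>m. Ck_on m S f)"


section \<open>Quaternions and monogenic functions\<close>

text \<open>
  The pair \<open>(a, b)\<close> stands for the quaternion \<open>a + k b\<close>. With \<open>a = x\<^sub>0 + i x\<^sub>1\<close> and
  \<open>b = x\<^sub>3 + i x\<^sub>2\<close> this is \<open>x\<^sub>0 + i x\<^sub>1 + j x\<^sub>2 + k x\<^sub>3\<close>, since \<open>k i = j\<close>. The
  product below follows from \<open>a k = k (cnj a)\<close> and \<open>k k = -1\<close>.
  A point of \<open>quat ^ 'n\<close> is \<open>(\<alpha>\<^sub>1, \<beta>\<^sub>1, \<dots>, \<alpha>\<^sub>n, \<beta>\<^sub>n)\<close>, grouped in pairs \<open>(\<alpha>\<^sub>l, \<beta>\<^sub>l)\<close>.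
\<close>

type_synonym quat = "complex \<times> complex"

definition qmult :: "quat \<Rightarrow> quat \<Rightarrow> quat" where
  "qmult p q = (fst p * fst q - cnj (snd p) * snd q, cnj (fst p) * snd q + snd p * fst q)"

definition q1 :: quat where "q1 = (1, 0)"
definition qi :: quat where "qi = (\<i>, 0)"
definition qj :: quat where "qj = (0, \<i>)"
definition qk :: quat where "qk = (0, 1)"

text \<open>
  The partial derivatives along \<open>x\<^sub>0\<close>, \<open>x\<^sub>1\<close>, \<open>x\<^sub>2\<close>, \<open>x\<^sub>3\<close> of the \<open>l\<close>-th quaternionic
  coordinate are the directional derivatives along \<open>q1\<close>, \<open>qi\<close>, \<open>qj\<close>, \<open>qk\<close> in slot \<open>l\<close>.
\<close>

definition partial_q :: "quat \<Rightarrow> 'n::finite \<Rightarrow> (quat ^ 'n \<Rightarrow> quat) \<Rightarrow> quat ^ 'n \<Rightarrow> quat" where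
  "partial_q e l \<psi> x = frechet_derivative \<psi> (at x) (axis l e)"

text \<open>
  Functions and forms on an open set are represented by total functions that vanish outside of
  it, so that the function spaces below are genuine complex vector spaces.
\<close>

definition smooth_maps :: "(quat ^ 'n::finite) set \<Rightarrow> (quat ^ 'n \<Rightarrow> complex \<times> complex) set" where
  "smooth_maps U = {\<psi>. smooth_on U \<psi> \<and> (\<forall>x. x \<notin> U \<longrightarrow> \<psi> x = 0)}"

text \<open>The pair \<open>\<psi> x = (\<psi>\<^sub>0 x, \<psi>\<^sub>1 x)\<close> is read as the quaternion \<open>\<psi>\<^sub>0 x + k \<psi>\<^sub>1 x\<close>.\<close>

definition monogenic :: "(quat ^ 'n::finite) set \<Rightarrow> (quat ^ 'n \<Rightarrow> quat) set" where
  "monogenic U = {\<psi> \<in> smooth_maps U. \<forall>x\<in>U. \<forall>l.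
     partial_q q1 l \<psi> x + qmult qi (partial_q qi l \<psi> x)
       + qmult qj (partial_q qj l \<psi> x) + qmult qk (partial_q qk l \<psi> x) = 0}"


section \<open>Twistor space\<close>

definition hscale :: "complex \<Rightarrow> (complex \<times> complex) ^ 'n::finite \<Rightarrow> (complex \<times> complex) ^ 'n" where
  "hscale c \<xi> = (\<chi> l. (c * fst (\<xi> $ l), c * snd (\<xi> $ l)))"

text \<open>
  The point of \<open>\<complex>\<pp>\<^sup>2\<^sup>n\<^sup>+\<^sup>1\<close> with homogeneous coordinates \<open>[\<pi>\<^sub>0 : \<pi>\<^sub>1 : \<xi>]\<close>, as the set of all
  its homogeneous coordinate vectors.
\<close>

definition proj_point ::
  "complex \<Rightarrow> complex \<Rightarrow> (complex \<times> complex) ^ 'n::finite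
     \<Rightarrow> (complex \<times> complex \<times> ((complex \<times> complex) ^ 'n)) set" where
  "proj_point \<pi>0 \<pi>1 \<xi> = {(c * \<pi>0, c * \<pi>1, hscale c \<xi>) | c. c \<noteq> 0}"

definition twistor_coord ::
  "complex \<Rightarrow> complex \<Rightarrow> quat ^ 'n::finite \<Rightarrow> (complex \<times> complex) ^ 'n" where
  "twistor_coord \<pi>0 \<pi>1 x =
     (\<chi> l. (\<pi>0 * fst (x $ l) - \<pi>1 * cnj (snd (x $ l)),
           \<pi>0 * snd (x $ l) + \<pi>1 * cnj (fst (x $ l))))"

definition twistor_space ::
  "(quat ^ 'n::finite) set \<Rightarrow> (complex \<times> complex \<times> ((complex \<times> complex) ^ 'n)) set set" where
  "twistor_space U =
     {proj_point \<pi>0 \<pi>1 (twistor_coord \<pi>0 \<pi>1 x) | \<pi>0 \<pi>1 x. (\<pi>0, \<pi>1) \<noteq> (0, 0) \<and> x \<in> U}"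

text \<open>
  As \<open>(\<pi>\<^sub>0, \<pi>\<^sub>1) \<noteq> 0\<close> on twistor space, it is covered by the two standard affine charts
  \<open>\<pi>\<^sub>0 \<noteq> 0\<close> with coordinates \<open>(z, \<xi>)\<close> for \<open>[1 : z : \<xi>]\<close>, and \<open>\<pi>\<^sub>1 \<noteq> 0\<close> with coordinates
  \<open>(w, \<xi>)\<close> for \<open>[w : 1 : \<xi>]\<close>. The complex structure induced from projective space is that of
  these holomorphic charts. \<open>chart0 U\<close> and \<open>chart1 U\<close> are their images, open in
  \<open>\<complex>\<^sup>2\<^sup>n\<^sup>+\<^sup>1\<close>, and \<open>chart_change\<close> is the coordinate change on \<open>\<pi>\<^sub>0 \<pi>\<^sub>1 \<noteq> 0\<close>.
  In them \<open>\<zeta>\<close> is the projection to the first coordinate.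
\<close>

type_synonym 'n affine = "complex \<times> ((complex \<times> complex) ^ 'n)"

definition chart0 :: "(quat ^ 'n::finite) set \<Rightarrow> 'n affine set" where
  "chart0 U = {(z, \<xi>). proj_point 1 z \<xi> \<in> twistor_space U}"

definition chart1 :: "(quat ^ 'n::finite) set \<Rightarrow> 'n affine set" where
  "chart1 U = {(w, \<xi>). proj_point w 1 \<xi> \<in> twistor_space U}"

definition chart_change :: "'n::finite affine \<Rightarrow> 'n affine" where
  "chart_change p = (inverse (fst p), hscale (inverse (fst p)) (snd p))"

definition ascale :: "complex \<Rightarrow> 'n::finite affine \<Rightarrow> 'n affine" where
  "ascale c v = (c * fst v, hscale c (snd v))"


section \<open>Dolbeault complex of the line bundles \<open>L\<^sub>k\<close>\<close>

text \<open>
  In a chart, a \<open>(0,1)\<close>-form assigns to each point a conjugate-linear functional on tangent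
  vectors.
\<close>

type_synonym 'n form01 = "'n affine \<Rightarrow> 'n affine \<Rightarrow> complex"

definition pullback ::
  "('a::real_normed_vector \<Rightarrow> 'b::real_normed_vector) \<Rightarrow> ('b \<Rightarrow> 'b \<Rightarrow> complex) \<Rightarrow> 'a \<Rightarrow> 'a \<Rightarrow> complex" where
  "pullback \<phi> \<omega> p v = \<omega> (\<phi> p) (frechet_derivative \<phi> (at p) v)"

definition smooth_fun :: "'n::finite affine set \<Rightarrow> ('n affine \<Rightarrow> complex) \<Rightarrow> bool" where
  "smooth_fun V f \<longleftrightarrow> smooth_on V f \<and> (\<forall>p. p \<notin> V \<longrightarrow> f p = 0)"

definition conj_linear :: "('n::finite affine \<Rightarrow> complex) \<Rightarrow> bool" where
  "conj_linear g \<longleftrightarrow> (\<forall>u v. g (u + v) = g u + g v) \<and> (\<forall>c v. g (ascale c v) = cnj c * g v)"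

definition smooth_form01 :: "'n::finite affine set \<Rightarrow> 'n form01 \<Rightarrow> bool" where
  "smooth_form01 V \<omega> \<longleftrightarrow> (\<forall>p\<in>V. conj_linear (\<omega> p)) \<and> (\<forall>v. smooth_on V (\<lambda>p. \<omega> p v))
     \<and> (\<forall>p. p \<notin> V \<longrightarrow> (\<forall>v. \<omega> p v = 0))"

text \<open>
  Sections of \<open>L\<^sub>k\<close> and \<open>L\<^sub>k\<close>-valued \<open>(0,1)\<close>-forms, as pairs of local representatives in the two
  charts and the two trivializations; the transition rule is \<open>f\<^sub>1 = z\<^sup>-\<^sup>k f\<^sub>0\<close>.
\<close>

definition sections ::
  "int \<Rightarrow> (quat ^ 'n::finite) set \<Rightarrow> (('n affine \<Rightarrow> complex) \<times> ('n affine \<Rightarrow> complex)) set" where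
  "sections k U = {(f0, f1). smooth_fun (chart0 U) f0 \<and> smooth_fun (chart1 U) f1 \<and>
     (\<forall>p\<in>chart0 U. fst p \<noteq> 0 \<longrightarrow> f1 (chart_change p) = fst p powi (- k) * f0 p)}"

definition forms01 ::
  "int \<Rightarrow> (quat ^ 'n::finite) set \<Rightarrow> ('n form01 \<times> 'n form01) set" where
  "forms01 k U = {(\<omega>0, \<omega>1). smooth_form01 (chart0 U) \<omega>0 \<and> smooth_form01 (chart1 U) \<omega>1 \<and>
     (\<forall>p\<in>chart0 U. fst p \<noteq> 0 \<longrightarrow>
        (\<forall>v. pullback chart_change \<omega>1 p v = fst p powi (- k) * \<omega>0 p v))}"

text \<open>
  \<open>dbar_dir g p\<close> is the conjugate-linear part of the differential of \<open>g\<close> at \<open>p\<close>, i.e.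
  \<open>v \<mapsto> \<Sum>\<^sub>a (\<partial>g/\<partial>z\<bar>\<^sub>a) cnj v\<^sub>a\<close>.
\<close>

definition dbar_dir :: "('n::finite affine \<Rightarrow> complex) \<Rightarrow> 'n affine \<Rightarrow> 'n affine \<Rightarrow> complex" where
  "dbar_dir g p v =
     (frechet_derivative g (at p) v + \<i> * frechet_derivative g (at p) (ascale \<i> v)) / 2"

definition dbar0 ::
  "(quat ^ 'n::finite) set \<Rightarrow> ('n affine \<Rightarrow> complex) \<times> ('n affine \<Rightarrow> complex)
     \<Rightarrow> 'n form01 \<times> 'n form01" where
  "dbar0 U f =
     ((\<lambda>p v. if p \<in> chart0 U then dbar_dir (fst f) p v else 0),
      (\<lambda>p v. if p \<in> chart1 U then dbar_dir (snd f) p v else 0))"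

text \<open>
  \<open>dbar\<close> of a \<open>(0,1)\<close>-form \<open>\<omega>\<close> evaluated on the constant vector fields \<open>u\<close>, \<open>v\<close>:
  \<open>\<Sum>\<^sub>a\<^sub>,\<^sub>b (\<partial>\<omega>\<^sub>b/\<partial>z\<bar>\<^sub>a) (dz\<bar>\<^sub>a \<and> dz\<bar>\<^sub>b) (u, v)\<close>.
\<close>

definition dbar1 :: "'n::finite form01 \<Rightarrow> 'n affine \<Rightarrow> 'n affine \<Rightarrow> 'n affine \<Rightarrow> complex" where
  "dbar1 \<omega> p u v = dbar_dir (\<lambda>q. \<omega> q v) p u - dbar_dir (\<lambda>q. \<omega> q u) p v"

definition closed_forms01 ::
  "int \<Rightarrow> (quat ^ 'n::finite) set \<Rightarrow> ('n form01 \<times> 'n form01) set" where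
  "closed_forms01 k U = {\<Omega> \<in> forms01 k U.
     (\<forall>p\<in>chart0 U. \<forall>u v. dbar1 (fst \<Omega>) p u v = 0) \<and>
     (\<forall>p\<in>chart1 U. \<forall>u v. dbar1 (snd \<Omega>) p u v = 0)}"

definition cohomologous ::
  "int \<Rightarrow> (quat ^ 'n::finite) set \<Rightarrow> (('n form01 \<times> 'n form01) \<times> ('n form01 \<times> 'n form01)) set" where
  "cohomologous k U = {(\<Omega>, \<Omega>'). \<Omega> \<in> closed_forms01 k U \<and> \<Omega>' \<in> closed_forms01 k U \<and>
     (\<exists>f\<in>sections k U. \<Omega> - \<Omega>' = dbar0 U f)}"

definition H1 :: "int \<Rightarrow> (quat ^ 'n::finite) set \<Rightarrow> ('n form01 \<times> 'n form01) set set" where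
  "H1 k U = closed_forms01 k U // cohomologous k U"

definition H1_class ::
  "int \<Rightarrow> (quat ^ 'n::finite) set \<Rightarrow> 'n form01 \<times> 'n form01 \<Rightarrow> ('n form01 \<times> 'n form01) set" where
  "H1_class k U \<Omega> = cohomologous k U `` {\<Omega>}"

definition form_scale :: "complex \<Rightarrow> 'n form01 \<times> 'n form01 \<Rightarrow> 'n form01 \<times> 'n form01" where
  "form_scale c \<Omega> = ((\<lambda>p v. c * fst \<Omega> p v), (\<lambda>p v. c * snd \<Omega> p v))"

text \<open>The vector space operations on classes, through representatives.\<close>

definition H1_add ::
  "int \<Rightarrow> (quat ^ 'n::finite) set \<Rightarrow> ('n form01 \<times> 'n form01) set \<Rightarrow> ('n form01 \<times> 'n form01) set
     \<Rightarrow> ('n form01 \<times> 'n form01) set" where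
  "H1_add k U A B = (\<Union>\<Omega>\<in>A. \<Union>\<Omega>'\<in>B. H1_class k U (\<Omega> + \<Omega>'))"

definition H1_scale ::
  "int \<Rightarrow> (quat ^ 'n::finite) set \<Rightarrow> complex \<Rightarrow> ('n form01 \<times> 'n form01) set
     \<Rightarrow> ('n form01 \<times> 'n form01) set" where
  "H1_scale k U c A = (\<Union>\<Omega>\<in>A. H1_class k U (form_scale c \<Omega>))"


section \<open>Restriction to the fibres of \<open>\<tau>\<close> and integration along them\<close>

text \<open>The fibre of \<open>\<tau>\<close> over \<open>x\<close> in the two charts, parametrized by \<open>z\<close> and \<open>w\<close>.\<close>

definition fibre0 :: "quat ^ 'n::finite \<Rightarrow> complex \<Rightarrow> 'n affine" where
  "fibre0 x z = (z, twistor_coord 1 z x)"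

definition fibre1 :: "quat ^ 'n::finite \<Rightarrow> complex \<Rightarrow> 'n affine" where
  "fibre1 x w = (w, twistor_coord w 1 x)"

text \<open>
  A pair \<open>(h\<^sub>0, h\<^sub>1)\<close> of functions of \<open>(z, x)\<close> and \<open>(w, x)\<close> stands for
  \<open>(h\<^sub>0 dz\<bar>, h\<^sub>1 dw\<bar>)\<close>; the transition rule combines \<open>z\<^sup>-\<^sup>k\<close> with \<open>dw\<bar> = - dz\<bar> / z\<bar>\<^sup>2\<close>.
\<close>

type_synonym 'n relform = "complex \<times> (quat ^ 'n) \<Rightarrow> complex"

definition forms01_tau ::
  "int \<Rightarrow> (quat ^ 'n::finite) set \<Rightarrow> ('n relform \<times> 'n relform) set" where
  "forms01_tau k U = {(h0, h1). smooth_on (UNIV \<times> U) h0 \<and> smooth_on (UNIV \<times> U) h1 \<and>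
     (\<forall>z x. x \<notin> U \<longrightarrow> h0 (z, x) = 0 \<and> h1 (z, x) = 0) \<and>
     (\<forall>z x. z \<noteq> 0 \<longrightarrow> x \<in> U \<longrightarrow>
        h1 (inverse z, x) = - (z powi (- k)) * cnj z ^ 2 * h0 (z, x))}"

text \<open>
  The class of a \<open>(0,1)\<close>-form modulo forms vanishing on the vertical vectors is its pullback to
  the fibres. The pullback is \<open>h\<^sub>0 dz\<bar>\<close> (resp. \<open>h\<^sub>1 dw\<bar>\<close>), and its value on the tangent vector
  \<open>1\<close> is the coefficient.
\<close>

definition pi_tau :: "'n::finite form01 \<times> 'n form01 \<Rightarrow> 'n relform \<times> 'n relform" where
  "pi_tau \<Omega> =
     ((\<lambda>(z, x). pullback (fibre0 x) (fst \<Omega>) z 1),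
      (\<lambda>(w, x). pullback (fibre1 x) (snd \<Omega>) w 1))"

text \<open>The factor \<open>2 \<i>\<close> in the integrand comes from \<open>dz\<bar> \<and> dz = 2 \<i> dx \<and> dy\<close>.\<close>

definition tau_push ::
  "'n::finite relform \<times> 'n relform \<Rightarrow> quat ^ 'n \<Rightarrow> complex \<times> complex" where
  "tau_push h x =
     (1 / (2 * pi * \<i>) * (\<integral>z. fst h (z, x) * (2 * \<i>) \<partial>lborel),
      1 / (2 * pi * \<i>) * (\<integral>z. z * fst h (z, x) * (2 * \<i>) \<partial>lborel))"

definition map_scale :: "complex \<Rightarrow> ('a \<Rightarrow> complex \<times> complex) \<Rightarrow> 'a \<Rightarrow> complex \<times> complex" where
  "map_scale c \<psi> x = (c * fst (\<psi> x), c * snd (\<psi> x))"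

definition H1_linear_iso ::
  "int \<Rightarrow> (quat ^ 'n::finite) set \<Rightarrow> (quat ^ 'n \<Rightarrow> complex \<times> complex) set
     \<Rightarrow> (('n form01 \<times> 'n form01) set \<Rightarrow> quat ^ 'n \<Rightarrow> complex \<times> complex) \<Rightarrow> bool" where
  "H1_linear_iso k U R P \<longleftrightarrow> bij_betw P (H1 k U) R \<and>
     (\<forall>A\<in>H1 k U. \<forall>B\<in>H1 k U. P (H1_add k U A B) = P A + P B) \<and>
     (\<forall>c. \<forall>A\<in>H1 k U. P (H1_scale k U c A) = map_scale c (P A))"

end

theory Submission
  imports Defs "HOL-Complex_Analysis.Complex_Analysis" "HOL-Real_Asymp.Real_Asymp"
begin

text \<open>
  In the coordinates \<open>(z, x)\<close> a \<open>(0,1)\<close>-form is given by a fibre component \<open>h\<close> and horizontal components \<open>g\<^sub>e\<close>. Being a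
  form with values in \<open>L\<^sub>-\<^sub>3\<close> on the whole twistor space makes \<open>h\<close> decay like \<open>|z|\<^sup>-\<^sup>5\<close> and \<open>g\<^sub>e\<close> like \<open>|z|\<^sup>-\<^sup>2\<close> (with all
  derivatives), and closedness contains the equation \<open>\<partial>g\<^sub>e / \<partial>z\<bar> = X\<^sub>e h\<close> with \<open>X\<^sub>e\<close> affine in \<open>z\<close>. Integrating it over the
  fibre kills the left hand side and leaves the monogenic equation for the two moments of \<open>h\<close>.

  If both moments vanish, the Cauchy transform of \<open>h\<close> in \<open>z\<close> is a section of \<open>L\<^sub>-\<^sub>3\<close>: the vanishing moments are the
  two obstructions to its decay at infinity. Its \<open>dbar\<close> agrees with the form in the fibre direction, and the horizontal components of
  the difference are holomorphic along the fibres and decay, so they vanish by Liouville's theorem. Hence the kernel consists of exact forms.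
  Surjectivity comes from an explicit closed form for each monogenic function, whose closedness in the remaining horizontal directions
  again follows from Liouville's theorem.
\<close>

section \<open>Calculus of smooth maps\<close>

text \<open>On each fibre of \<tau>, a projective line, L has degree -3: no nonzero holomorphic
  section, and first cohomology of dimension two, dual to the span of 1 and z. This is why exactly
  two moments of \<open>h\<close> enter and why the Liouville arguments succeed. The obstacle is
  that the complex structure is not that of the product: a (0,1) vector along a slice of fixed z
  becomes, in the coordinates (z, x), an antiholomorphic derivative minus z times a holomorphic
  derivative in a direction turned by the antilinear map \<open>quatJ\<close>. The coefficient z
  costs one order of decay, so orders have to be counted throughout. Behaviour at infinity is
  encoded by smoothness in 1/z after removal of a power, a condition stable under all derivatives
  and hence suited to differentiation under the integral. Forms are evaluated on the frame of fibre
  and slice directions; the slice components carry the weight 1 + |z|^2 by which the twisted slice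
  operator exceeds the operator dbar of the affine chart, and with it the correction terms in the
  closedness equation cancel.\<close>

lemma frechet_derivative_cong_open:
  assumes "open S" "x \<in> S" "\<And>y. y \<in> S \<Longrightarrow> f y = g y"
  shows "frechet_derivative f (at x) = frechet_derivative g (at x)"
proof -
  \<comment> \<open>\<open>frechet_derivative\<close> is a choice applied to this predicate, so an
    equivalence for every \<open>D\<close> gives equal values, at points without a derivative
    too.\<close>
  have "(f has_derivative D) (at x) \<longleftrightarrow> (g has_derivative D) (at x)" for D
    using assms has_derivative_transform_within_open[of f D x UNIV S g]
      has_derivative_transform_within_open[of g D x UNIV S f] by auto
  thus ?thesis unfolding frechet_derivative_def by simp
qed

lemma differentiable_cong_open:
  assumes "open S" "x \<in> S" "\<And>y. y \<in> S \<Longrightarrow> f y = g y"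
  shows "f differentiable (at x) \<longleftrightarrow> g differentiable (at x)"
  using assms has_derivative_transform_within_open[of f _ x UNIV S g]
      has_derivative_transform_within_open[of g _ x UNIV S f]
  unfolding differentiable_def by metis

lemma Ck_on_cong:
  assumes "open S" "\<And>x. x \<in> S \<Longrightarrow> f x = g x"
  shows "Ck_on m S f \<longleftrightarrow> Ck_on m S g"
  using assms(2)
proof (induction m arbitrary: f g)
  case 0
  then show ?case by (auto intro: continuous_on_cong[THEN iffD1])
next
  case (Suc m)
  have "Ck_on m S (\<lambda>x. frechet_derivative f (at x) v) \<longleftrightarrow> Ck_on m S (\<lambda>x. frechet_derivative g (at x) v)" for v
    by (rule Suc.IH) (use frechet_derivative_cong_open[OF assms(1), of _ f g] Suc.prems in auto)
  then show ?case
    using differentiable_cong_open[OF assms(1), of _ f g] Suc.prems by auto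
qed

lemma smooth_on_cong:
  assumes "open S" "\<And>x. x \<in> S \<Longrightarrow> f x = g x"
  shows "smooth_on S f \<longleftrightarrow> smooth_on S g"
  unfolding smooth_on_def using Ck_on_cong[OF assms] by auto

lemma Ck_on_Suc_imp_has_derivative:
  "Ck_on (Suc m) S f \<Longrightarrow> x \<in> S \<Longrightarrow> (f has_derivative frechet_derivative f (at x)) (at x)"
  using frechet_derivative_works[of f "at x"] by simp

lemma Ck_on_SucD: "Ck_on (Suc m) S f \<Longrightarrow> Ck_on m S f"
proof (induction m arbitrary: f)
  case 0
  then have "f differentiable_on S"
    unfolding differentiable_on_def by (auto intro: differentiable_at_withinI)
  then show ?case by (simp add: differentiable_imp_continuous_on)
qed auto

lemma Ck_on_continuous_on: "Ck_on m S f \<Longrightarrow> continuous_on S f"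
  by (induction m) (use Ck_on_SucD in auto)

lemma smooth_onI_Suc: "(\<And>m. Ck_on m S f) \<Longrightarrow> smooth_on S f"
  by (simp add: smooth_on_def)

lemma smooth_on_continuous_on: "smooth_on S f \<Longrightarrow> continuous_on S f"
  unfolding smooth_on_def using Ck_on_continuous_on by blast

lemma smooth_on_differentiable: "smooth_on S f \<Longrightarrow> x \<in> S \<Longrightarrow> f differentiable (at x)"
  unfolding smooth_on_def using Ck_on.simps(2) by blast

lemma smooth_on_has_derivative:
  "smooth_on S f \<Longrightarrow> x \<in> S \<Longrightarrow> (f has_derivative frechet_derivative f (at x)) (at x)"
  using smooth_on_differentiable frechet_derivative_works by blast

lemma smooth_on_frechet_derivative:
  "smooth_on S f \<Longrightarrow> smooth_on S (\<lambda>x. frechet_derivative f (at x) v)"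
  unfolding smooth_on_def using Ck_on.simps(2) by blast

text \<open>The introduction rule of every induction on the order: an explicit formula
  \<open>F\<close> for the derivative can be differentiated further, whereas
  \<open>frechet_derivative\<close> is a bare choice.\<close>

lemma Ck_on_Suc_has_derivative:
  assumes "open S" "\<And>x. x \<in> S \<Longrightarrow> (f has_derivative F x) (at x)" "\<And>v. Ck_on m S (\<lambda>x. F x v)"
  shows "Ck_on (Suc m) S f"
proof -
  have "frechet_derivative f (at x) = F x" if "x \<in> S" for x
    using assms(2)[OF that] frechet_derivative_at by metis
  then have "Ck_on m S (\<lambda>x. frechet_derivative f (at x) v)" for v
    using Ck_on_cong[OF assms(1), of "\<lambda>x. frechet_derivative f (at x) v" "\<lambda>x. F x v"] assms(3) by simp
  then show ?thesis using assms(2) by (auto simp: differentiable_def)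
qed

section \<open>Closure of \<open>Ck_on\<close> under algebraic operations and composition\<close>

lemma Ck_on_const: "Ck_on m S (\<lambda>x. c)"
  by (induction m arbitrary: c) (auto simp: frechet_derivative_const)

lemma Ck_on_bounded_linear_comp:
  assumes L: "bounded_linear L" and S: "open S"
  shows "Ck_on m S f \<Longrightarrow> Ck_on m S (\<lambda>x. L (f x))"
proof (induction m arbitrary: f)
  case 0
  then show ?case using bounded_linear.continuous_on[OF L] by auto
next
  case (Suc m)
  show ?case
  proof (rule Ck_on_Suc_has_derivative[OF S])
    fix x assume "x \<in> S"
    have "(f has_derivative frechet_derivative f (at x)) (at x)"
      by (intro Ck_on_Suc_imp_has_derivative[OF Suc.prems(1)] \<open>x \<in> S\<close>)
    then show "((\<lambda>x. L (f x)) has_derivative (\<lambda>v. L (frechet_derivative f (at x) v))) (at x)"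
      by (rule bounded_linear.has_derivative[OF L])
  next
    fix v show "Ck_on m S (\<lambda>x. L (frechet_derivative f (at x) v))"
      using Suc by auto
  qed
qed

lemma Ck_on_add:
  assumes S: "open S"
  shows "Ck_on m S f \<Longrightarrow> Ck_on m S g \<Longrightarrow> Ck_on m S (\<lambda>x. f x + g x)"
proof (induction m arbitrary: f g)
  case 0
  then show ?case by (auto intro: continuous_on_add)
next
  case (Suc m)
  show ?case
  proof (rule Ck_on_Suc_has_derivative[OF S])
    fix x assume "x \<in> S"
    have "(f has_derivative frechet_derivative f (at x)) (at x)"
       "(g has_derivative frechet_derivative g (at x)) (at x)"
      using Ck_on_Suc_imp_has_derivative[OF Suc.prems(1) \<open>x \<in> S\<close>]
        Ck_on_Suc_imp_has_derivative[OF Suc.prems(2) \<open>x \<in> S\<close>] by simp_all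
    then show "((\<lambda>x. f x + g x) has_derivative
        (\<lambda>v. frechet_derivative f (at x) v + frechet_derivative g (at x) v)) (at x)"
      by (rule has_derivative_add)
  next
    fix v show "Ck_on m S (\<lambda>x. frechet_derivative f (at x) v + frechet_derivative g (at x) v)"
      using Suc by auto
  qed
qed

lemma Ck_on_bounded_bilinear:
  assumes B: "bounded_bilinear B" and S: "open S"
  shows "Ck_on m S f \<Longrightarrow> Ck_on m S g \<Longrightarrow> Ck_on m S (\<lambda>x. B (f x) (g x))"
proof (induction m arbitrary: f g)
  case 0
  then show ?case using bounded_bilinear.continuous_on[OF B] by auto
next
  case (Suc m)
  show ?case
  proof (rule Ck_on_Suc_has_derivative[OF S])
    fix x assume "x \<in> S"
    have "(f has_derivative frechet_derivative f (at x)) (at x)"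
       "(g has_derivative frechet_derivative g (at x)) (at x)"
      using Ck_on_Suc_imp_has_derivative[OF Suc.prems(1) \<open>x \<in> S\<close>]
        Ck_on_Suc_imp_has_derivative[OF Suc.prems(2) \<open>x \<in> S\<close>] by simp_all
    then show "((\<lambda>x. B (f x) (g x)) has_derivative
        (\<lambda>v. B (f x) (frechet_derivative g (at x) v) + B (frechet_derivative f (at x) v) (g x))) (at x)"
      by (rule bounded_bilinear.FDERIV[OF B])
  next
    fix v
    \<comment> \<open>The product rule mixes differentiated and undifferentiated factors, so the
      factors themselves are used at the lower order as well.\<close>
    have "Ck_on m S f" "Ck_on m S g" using Suc.prems Ck_on_SucD by blast+
    then show "Ck_on m S (\<lambda>x. B (f x) (frechet_derivative g (at x) v) + B (frechet_derivative f (at x) v) (g x))"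
      using Suc by (intro Ck_on_add[OF S]) auto
  qed
qed

lemma Ck_on_sum:
  assumes "open S" "\<And>i. i \<in> I \<Longrightarrow> Ck_on m S (f i)"
  shows "Ck_on m S (\<lambda>x. \<Sum>i\<in>I. f i x)"
  using assms(2) by (induction I rule: infinite_finite_induct) (simp_all add: Ck_on_const Ck_on_add[OF assms(1)])

text \<open>\<open>Ck_on\<close> controls derivatives only along constant directions, while the
  chain rule evaluates the derivative of \<open>g\<close> along a direction that moves with the
  point. Expanding that direction in the finite basis of the middle space makes the derivative a sum
  of products to which the induction applies; hence the Euclidean type of that space.\<close>

lemma Ck_on_compose:
  fixes f :: "'a::real_normed_vector \<Rightarrow> 'b::euclidean_space"
  assumes S: "open S" and T: "open T" and fS: "f ` S \<subseteq> T"
  shows "Ck_on m T g \<Longrightarrow> Ck_on m S f \<Longrightarrow> Ck_on m S (\<lambda>x. g (f x))"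
proof (induction m arbitrary: g)
  case 0
  then show ?case using continuous_on_compose2[OF _ _ fS] by simp
next
  case (Suc m)
  have lin: "(g has_derivative frechet_derivative g (at y)) (at y)" if "y \<in> T" for y
    by (rule Ck_on_Suc_imp_has_derivative[OF Suc.prems(1) that])
  show ?case
  proof (rule Ck_on_Suc_has_derivative[OF S])
    fix x assume x: "x \<in> S"
    have "(f has_derivative frechet_derivative f (at x)) (at x)"
      by (intro Ck_on_Suc_imp_has_derivative[OF Suc.prems(2)] \<open>x \<in> S\<close>)
    have fx: "f x \<in> T" using x fS by blast
    note 1 = has_derivative_compose[OF \<open>(f has_derivative frechet_derivative f (at x)) (at x)\<close> lin[OF fx]]
    have l: "linear (frechet_derivative g (at (f x)))" 
      by (rule has_derivative_linear[OF lin[OF fx]])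
    have "frechet_derivative g (at (f x)) u =
        (\<Sum>b\<in>Basis. (u \<bullet> b) *\<^sub>R frechet_derivative g (at (f x)) b)" for u
      using linear_sum[OF l, of "\<lambda>b. (u \<bullet> b) *\<^sub>R b" Basis]
      by (simp add: linear_cmul[OF l] euclidean_representation)
    then show "((\<lambda>x. g (f x)) has_derivative
        (\<lambda>v. \<Sum>b\<in>Basis. (frechet_derivative f (at x) v \<bullet> b) *\<^sub>R frechet_derivative g (at (f x)) b)) (at x)"
      by (intro has_derivative_eq_rhs[OF 1] ext)
  next
    fix v
    have "Ck_on m S f" using Suc.prems Ck_on_SucD by blast
    moreover have "Ck_on m T (\<lambda>y. frechet_derivative g (at y) b)" for b
      using Suc.prems(1) by simp
    ultimately have "Ck_on m S (\<lambda>x. frechet_derivative g (at (f x)) b)" for b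
      by (intro Suc.IH[of "\<lambda>y. frechet_derivative g (at y) b"])
    moreover have "Ck_on m S (\<lambda>x. frechet_derivative f (at x) v)"
      using Suc.prems(2) by simp
    then have "Ck_on m S (\<lambda>x. frechet_derivative f (at x) v \<bullet> b)" for b
      by (rule Ck_on_bounded_linear_comp[OF bounded_linear_inner_left S])
    ultimately show "Ck_on m S (\<lambda>x. \<Sum>b\<in>Basis. (frechet_derivative f (at x) v \<bullet> b) *\<^sub>R
        frechet_derivative g (at (f x)) b)"
      by (intro Ck_on_sum[OF S] Ck_on_bounded_bilinear[OF bounded_bilinear_scaleR S])
  qed
qed

named_theorems smooth_intros

lemma smooth_on_const [smooth_intros]: "smooth_on S (\<lambda>x. c)"
  by (simp add: smooth_on_def Ck_on_const)

lemma smooth_on_bounded_linear_comp: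
  "bounded_linear L \<Longrightarrow> open S \<Longrightarrow> smooth_on S f \<Longrightarrow> smooth_on S (\<lambda>x. L (f x))"
  unfolding smooth_on_def by (rule allI, rule Ck_on_bounded_linear_comp) simp_all

lemma smooth_on_bounded_bilinear:
  "bounded_bilinear B \<Longrightarrow> open S \<Longrightarrow> smooth_on S f \<Longrightarrow> smooth_on S g \<Longrightarrow> smooth_on S (\<lambda>x. B (f x) (g x))"
  unfolding smooth_on_def by (rule allI, rule Ck_on_bounded_bilinear) simp_all

lemma smooth_on_add [smooth_intros]:
  "open S \<Longrightarrow> smooth_on S f \<Longrightarrow> smooth_on S g \<Longrightarrow> smooth_on S (\<lambda>x. f x + g x)"
  unfolding smooth_on_def by (rule allI, rule Ck_on_add) simp_all

lemma smooth_on_sum [smooth_intros]: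
  "open S \<Longrightarrow> (\<And>i. i \<in> I \<Longrightarrow> smooth_on S (f i)) \<Longrightarrow> smooth_on S (\<lambda>x. \<Sum>i\<in>I. f i x)"
  unfolding smooth_on_def by (rule allI, rule Ck_on_sum) simp_all

lemma smooth_on_compose:
  fixes f :: "'a::real_normed_vector \<Rightarrow> 'b::euclidean_space"
  shows "smooth_on T g \<Longrightarrow> smooth_on S f \<Longrightarrow> open S \<Longrightarrow> open T \<Longrightarrow> (\<And>x. x \<in> S \<Longrightarrow> f x \<in> T)
    \<Longrightarrow> smooth_on S (\<lambda>x. g (f x))"
  unfolding smooth_on_def by (rule allI, rule Ck_on_compose[of S T]) auto

lemma Ck_on_bounded_linear: "bounded_linear L \<Longrightarrow> open S \<Longrightarrow> Ck_on m S L"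
proof (cases m)
  case 0
  assume "bounded_linear L" then show ?thesis using linear_continuous_on 0 by auto
next
  case (Suc k)
  assume L: "bounded_linear L" and S: "open S"
  show ?thesis unfolding Suc
    by (rule Ck_on_Suc_has_derivative[OF S, of _ "\<lambda>x. L"])
       (auto simp: Ck_on_const bounded_linear_imp_has_derivative[OF L])
qed

lemma smooth_on_bounded_linear: "bounded_linear L \<Longrightarrow> open S \<Longrightarrow> smooth_on S L"
  by (simp add: smooth_on_def Ck_on_bounded_linear)

lemma smooth_on_id [smooth_intros]: "open S \<Longrightarrow> smooth_on S (\<lambda>x. x)"
  by (rule smooth_on_bounded_linear) (auto simp: bounded_linear_ident)

lemmas smooth_on_fst [smooth_intros] = smooth_on_bounded_linear_comp[OF bounded_linear_fst]
lemmas smooth_on_snd [smooth_intros] = smooth_on_bounded_linear_comp[OF bounded_linear_snd]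
lemmas smooth_on_cnj [smooth_intros] = smooth_on_bounded_linear_comp[OF bounded_linear_cnj]
lemmas smooth_on_Re [smooth_intros] = smooth_on_bounded_linear_comp[OF bounded_linear_Re]
lemmas smooth_on_Im [smooth_intros] = smooth_on_bounded_linear_comp[OF bounded_linear_Im]
lemmas smooth_on_minus [smooth_intros] = smooth_on_bounded_linear_comp[OF bounded_linear_minus[OF bounded_linear_ident]]
lemmas smooth_on_scaleR [smooth_intros] = smooth_on_bounded_bilinear[OF bounded_bilinear_scaleR]
lemmas smooth_on_mult [smooth_intros] = smooth_on_bounded_bilinear[OF bounded_bilinear_mult]

lemma smooth_on_diff [smooth_intros]:
  "open S \<Longrightarrow> smooth_on S f \<Longrightarrow> smooth_on S g \<Longrightarrow> smooth_on S (\<lambda>x. f x - g x)"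
  using smooth_on_add[of S f "\<lambda>x. - g x"] smooth_on_minus[of S g] by simp

lemma smooth_on_power [smooth_intros]:
  fixes f :: "'a::real_normed_vector \<Rightarrow> 'b::real_normed_algebra_1"
  shows "open S \<Longrightarrow> smooth_on S f \<Longrightarrow> smooth_on S (\<lambda>x. f x ^ n)"
  by (induction n) (auto intro: smooth_intros)

lemma smooth_on_Pair [smooth_intros]:
  assumes "open S" "smooth_on S f" "smooth_on S g"
  shows "smooth_on S (\<lambda>x. (f x, g x))"
proof -
  have "bounded_linear (\<lambda>x. (x, 0))" "bounded_linear (\<lambda>x. (0, x))"
    by (auto intro!: bounded_linear_Pair bounded_linear_ident bounded_linear_zero)
  from smooth_on_add[OF assms(1) smooth_on_bounded_linear_comp[OF this(1) assms(1,2)]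
      smooth_on_bounded_linear_comp[OF this(2) assms(1,3)]]
  show ?thesis by simp
qed

text \<open>The derivative \<open>- (inverse x * h * inverse x)\<close> is again built from
  \<open>inverse\<close>, so the induction on the order closes without a formula for higher
  derivatives.\<close>

lemma smooth_on_inverse_basic: "smooth_on (- {0}) (inverse :: 'a::real_normed_field \<Rightarrow> 'a)"
proof (rule smooth_onI_Suc)
  fix m
  have o: "open (- {0::'a})" by auto
  show "Ck_on m (- {0}) (inverse :: 'a \<Rightarrow> 'a)"
  proof (induction m)
    case 0 show ?case by (auto intro: continuous_intros)
  next
    case (Suc m)
    show ?case
      by (rule Ck_on_Suc_has_derivative[OF o, of _ "\<lambda>x h. - (inverse x * h * inverse x)"])
         (auto intro!: has_derivative_inverse' Ck_on_bounded_bilinear[OF bounded_bilinear_mult o] Suc.IH Ck_on_const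
           Ck_on_bounded_linear_comp[OF bounded_linear_minus[OF bounded_linear_ident] o])
  qed
qed

lemma smooth_on_inverse [smooth_intros]:
  fixes f :: "'a::real_normed_vector \<Rightarrow> 'b::{real_normed_field,euclidean_space}"
  assumes "open S" "smooth_on S f" "\<And>x. x \<in> S \<Longrightarrow> f x \<noteq> 0"
  shows "smooth_on S (\<lambda>x. inverse (f x))"
  by (rule smooth_on_compose[OF smooth_on_inverse_basic assms(2,1)]) (use assms in auto)

lemma smooth_on_divide [smooth_intros]:
  fixes f :: "'a::real_normed_vector \<Rightarrow> 'b::{real_normed_field,euclidean_space}"
  assumes "open S" "smooth_on S f" "smooth_on S g" "\<And>x. x \<in> S \<Longrightarrow> g x \<noteq> 0"
  shows "smooth_on S (\<lambda>x. f x / g x)"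
  using smooth_on_mult[OF assms(1,2) smooth_on_inverse[OF assms(1,3,4)]] by (simp add: field_simps)


section \<open>Symmetry of second derivatives\<close>

lemma norm_increment_le:
  fixes \<phi> :: "real \<Rightarrow> 'b::real_normed_vector"
  assumes "\<And>s. s \<in> {0..t} \<Longrightarrow> (\<phi> has_vector_derivative \<phi>' s) (at s)"
    and "\<And>s. s \<in> {0..t} \<Longrightarrow> norm (\<phi>' s) \<le> B" and "0 \<le> t"
  shows "norm (\<phi> t - \<phi> 0) \<le> B * t"
proof -
  have "norm (\<phi> t - \<phi> 0) \<le> B * norm (t - 0)"
  proof (rule differentiable_bound[of "{0..t}" \<phi> "\<lambda>s h. h *\<^sub>R \<phi>' s"])
    fix s assume s: "s \<in> {0..t}"
    show "(\<phi> has_derivative (\<lambda>h. h *\<^sub>R \<phi>' s)) (at s within {0..t})"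
      using assms(1)[OF s] has_vector_derivative_def has_derivative_at_withinI by blast
    show "onorm (\<lambda>h. h *\<^sub>R \<phi>' s) \<le> B"
      by (rule onorm_le) (use assms(2)[OF s] in \<open>simp add: mult.commute[of B] mult_left_mono\<close>)
  qed (use assms(3) in auto)
  then show ?thesis using assms(3) by simp
qed

lemma has_vector_derivative_along_line:
  assumes "(f has_derivative D) (at (a + s *\<^sub>R u))"
  shows "((\<lambda>s. f (a + s *\<^sub>R u)) has_vector_derivative D u) (at s)"
proof -
  have "((\<lambda>s. a + s *\<^sub>R u) has_vector_derivative u) (at s)"
    by (auto intro!: derivative_eq_intros)
  from vector_derivative_diff_chain_within[OF this, of f D] show ?thesis
    using assms by (auto simp: o_def intro: has_derivative_at_withinI)
qed

text \<open>The mean value inequality is applied twice to the second difference over a parallelogram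
  of side t: in direction \<open>v\<close> to the derivative along \<open>u\<close>, then in
  direction \<open>u\<close> to the difference of \<open>f\<close> between two parallel sides.
  Continuity of the mixed derivative at \<open>x\<close> gives the error
  \<open>e * t * t\<close>.\<close>

lemma second_difference_approx:
  fixes u v :: "'a::real_normed_vector"
  assumes S: "open S" "x \<in> S" and f: "Ck_on 2 S f" and e: "e > 0"
  defines "A \<equiv> frechet_derivative (\<lambda>y. frechet_derivative f (at y) u) (at x) v"
  shows "\<exists>d>0. \<forall>t. 0 < t \<and> t < d \<longrightarrow>
    norm (f (x + t *\<^sub>R u + t *\<^sub>R v) - f (x + t *\<^sub>R u) - f (x + t *\<^sub>R v) + f x - (t * t) *\<^sub>R A) \<le> e * t * t"
proof -
  define g where "g y = frechet_derivative f (at y) u" for y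
  define gv where "gv y = frechet_derivative g (at y) v" for y
  have f1: "Ck_on (Suc (Suc 0)) S f" using f by (simp add: numeral_2_eq_2)
  then have g1: "Ck_on (Suc 0) S g" unfolding g_def[abs_def] by (simp del: Ck_on.simps(1))
  then have cont: "continuous_on S gv" unfolding gv_def[abs_def] by simp
  have A: "A = gv x" by (simp add: A_def g_def[abs_def] gv_def)
  from S obtain r where r: "r > 0" "ball x r \<subseteq> S" by (meson openE)
  from cont S e obtain d0 where d0: "d0 > 0" "\<And>y. y \<in> S \<Longrightarrow> dist y x < d0 \<Longrightarrow> dist (gv y) (gv x) < e"
    unfolding continuous_on_iff by blast
  \<comment> \<open>The extra 1 keeps \<open>K\<close> positive when both directions vanish, so that
    \<open>d\<close> may be defined by division.\<close>
  define K where "K = norm u + norm v + 1"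
  have K: "K > 0" by (simp add: K_def add_nonneg_pos)
  define d where "d = min r d0 / K"
  have "d > 0" using r d0 K by (simp add: d_def)
  have near: "x + s *\<^sub>R u + q *\<^sub>R v \<in> S \<and> dist (x + s *\<^sub>R u + q *\<^sub>R v) x < d0"
    if "0 \<le> s" "s \<le> t" "0 \<le> q" "q \<le> t" "t < d" for s q t
  proof -
    have "norm (s *\<^sub>R u + q *\<^sub>R v) \<le> s * norm u + q * norm v"
      using norm_triangle_ineq[of "s *\<^sub>R u" "q *\<^sub>R v"] that by simp
    also have "\<dots> \<le> t * norm u + t * norm v"
      using that by (intro add_mono mult_right_mono) auto
    also have "\<dots> \<le> t * K" using that by (simp add: K_def algebra_simps)
    also have "\<dots> < d * K" using that K by simp
    also have "\<dots> = min r d0" using K by (simp add: d_def)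
    finally have "dist (x + s *\<^sub>R u + q *\<^sub>R v) x < min r d0"
      by (simp add: dist_norm add.assoc)
    then show ?thesis using r(2) by (auto simp: dist_commute)
  qed
  have "norm (f (x + t *\<^sub>R u + t *\<^sub>R v) - f (x + t *\<^sub>R u) - f (x + t *\<^sub>R v) + f x - (t * t) *\<^sub>R A) \<le> e * t * t"
    if t: "0 < t" "t < d" for t
  proof -
    have inner: "norm (g (x + s *\<^sub>R u + t *\<^sub>R v) - g (x + s *\<^sub>R u) - t *\<^sub>R A) \<le> e * t"
      if s: "s \<in> {0..t}" for s
    proof -
      define \<psi> where "\<psi> q = g ((x + s *\<^sub>R u) + q *\<^sub>R v) - q *\<^sub>R A" for q
      have "norm (\<psi> t - \<psi> 0) \<le> e * t"
      proof (rule norm_increment_le[of t \<psi> "\<lambda>q. gv (x + s *\<^sub>R u + q *\<^sub>R v) - A"])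
        fix q assume q: "q \<in> {0..t}"
        have n: "x + s *\<^sub>R u + q *\<^sub>R v \<in> S" "dist (x + s *\<^sub>R u + q *\<^sub>R v) x < d0"
          using near[of s t q] s q t by auto
        have "((\<lambda>q. g ((x + s *\<^sub>R u) + q *\<^sub>R v)) has_vector_derivative gv (x + s *\<^sub>R u + q *\<^sub>R v)) (at q)"
          unfolding gv_def
          by (rule has_vector_derivative_along_line[OF Ck_on_Suc_imp_has_derivative[OF g1 n(1)]])
        then show "(\<psi> has_vector_derivative gv (x + s *\<^sub>R u + q *\<^sub>R v) - A) (at q)"
          unfolding \<psi>_def[abs_def] by (auto intro!: derivative_eq_intros)
        show "norm (gv (x + s *\<^sub>R u + q *\<^sub>R v) - A) \<le> e"
          using d0(2)[OF n] by (simp add: dist_norm A)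
      qed (use t in auto)
      then show ?thesis by (simp add: \<psi>_def algebra_simps)
    qed
    define \<theta> where "\<theta> s = f ((x + t *\<^sub>R v) + s *\<^sub>R u) - f (x + s *\<^sub>R u) - s *\<^sub>R (t *\<^sub>R A)" for s
    have "norm (\<theta> t - \<theta> 0) \<le> (e * t) * t"
    proof (rule norm_increment_le[of t \<theta> "\<lambda>s. g ((x + t *\<^sub>R v) + s *\<^sub>R u) - g (x + s *\<^sub>R u) - t *\<^sub>R A"])
      fix s assume s: "s \<in> {0..t}"
      have n: "(x + t *\<^sub>R v) + s *\<^sub>R u \<in> S" "x + s *\<^sub>R u \<in> S"
        using near[of s t t] near[of s t 0] s t by (auto simp: add_ac)
      show "(\<theta> has_vector_derivative g ((x + t *\<^sub>R v) + s *\<^sub>R u) - g (x + s *\<^sub>R u) - t *\<^sub>R A) (at s)"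
        unfolding \<theta>_def[abs_def] g_def
        using has_vector_derivative_along_line[OF Ck_on_Suc_imp_has_derivative[OF f1 n(1)]]
          has_vector_derivative_along_line[OF Ck_on_Suc_imp_has_derivative[OF f1 n(2)]]
        by (auto intro!: derivative_eq_intros)
      show "norm (g ((x + t *\<^sub>R v) + s *\<^sub>R u) - g (x + s *\<^sub>R u) - t *\<^sub>R A) \<le> e * t"
        using inner[OF s] by (simp add: add_ac)
    qed (use t in auto)
    moreover have "\<theta> t - \<theta> 0 = f (x + t *\<^sub>R u + t *\<^sub>R v) - f (x + t *\<^sub>R u) - f (x + t *\<^sub>R v) + f x - (t * t) *\<^sub>R A"
      by (simp add: \<theta>_def algebra_simps)
    ultimately show ?thesis by simp
  qed
  then show ?thesis using \<open>d > 0\<close> by blast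
qed

text \<open>The second difference is symmetric in \<open>u\<close> and \<open>v\<close>, so after
  division by t^2 both mixed derivatives approximate the same quantity.\<close>

lemma frechet_derivative_commute:
  assumes S: "open S" "x \<in> S" and f: "Ck_on 2 S f"
  shows "frechet_derivative (\<lambda>y. frechet_derivative f (at y) u) (at x) v
    = frechet_derivative (\<lambda>y. frechet_derivative f (at y) v) (at x) u" (is "?A = ?B")
proof (rule ccontr)
  assume "?A \<noteq> ?B"
  \<comment> \<open>Two errors of size \<open>e * t * t\<close> bound the gap by
    \<open>2 * e\<close>, less than its assumed size \<open>3 * e\<close>.\<close>
  define e where "e = norm (?A - ?B) / 3"
  have e: "e > 0" using \<open>?A \<noteq> ?B\<close> by (simp add: e_def)
  from second_difference_approx[OF S f e, of u v] obtain d1 where d1: "d1 > 0"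
    "\<And>t. 0 < t \<Longrightarrow> t < d1 \<Longrightarrow> norm (f (x + t *\<^sub>R u + t *\<^sub>R v) - f (x + t *\<^sub>R u) - f (x + t *\<^sub>R v) + f x - (t * t) *\<^sub>R ?A) \<le> e * t * t"
    by blast
  from second_difference_approx[OF S f e, of v u] obtain d2 where d2: "d2 > 0"
    "\<And>t. 0 < t \<Longrightarrow> t < d2 \<Longrightarrow> norm (f (x + t *\<^sub>R v + t *\<^sub>R u) - f (x + t *\<^sub>R v) - f (x + t *\<^sub>R u) + f x - (t * t) *\<^sub>R ?B) \<le> e * t * t"
    by blast
  define t where "t = min d1 d2 / 2"
  have t: "0 < t" "t < d1" "t < d2" using d1 d2 by (auto simp: t_def)
  define F where "F = f (x + t *\<^sub>R u + t *\<^sub>R v) - f (x + t *\<^sub>R u) - f (x + t *\<^sub>R v) + f x"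
  have "norm (F - (t * t) *\<^sub>R ?A) \<le> e * t * t" using d1(2)[OF t(1,2)] by (simp add: F_def)
  moreover have "norm (F - (t * t) *\<^sub>R ?B) \<le> e * t * t"
    using d2(2)[OF t(1,3)] by (simp add: F_def algebra_simps)
  ultimately have "norm ((F - (t * t) *\<^sub>R ?B) - (F - (t * t) *\<^sub>R ?A)) \<le> e * t * t + e * t * t"
    by (intro norm_triangle_le_diff) simp
  moreover have "(F - (t * t) *\<^sub>R ?B) - (F - (t * t) *\<^sub>R ?A) = (t * t) *\<^sub>R (?A - ?B)"
    by (simp add: algebra_simps)
  ultimately have "norm ((t * t) *\<^sub>R (?A - ?B)) \<le> e * t * t + e * t * t"
    by simp
  then have "(t * t) * norm (?A - ?B) \<le> (t * t) * (2 * e)"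
    unfolding norm_scaleR using t by (simp add: algebra_simps)
  then have "norm (?A - ?B) \<le> 2 * e" using t by simp
  then show False using e by (simp add: e_def)
qed

section \<open>Integration over the complex plane\<close>

lemma borel_measurable_Complex_pair:
  "(\<lambda>(x, y). Complex x y) \<in> borel_measurable (lborel \<Otimes>\<^sub>M lborel)"
proof -
  have "(\<lambda>(x, y). Complex x y) = (\<lambda>p. complex_of_real (fst p) + \<i> * complex_of_real (snd p))"
    by (auto simp: fun_eq_iff Complex_eq)
  moreover have "\<dots> \<in> borel_measurable (lborel \<Otimes>\<^sub>M lborel)" by measurable
  ultimately show ?thesis by simp
qed

text \<open>Lebesgue measure is determined by its values on boxes; this identification opens the way
  to Fubini in the real and imaginary parts.\<close>

lemma lborel_complex_eq: "lborel = distr (lborel \<Otimes>\<^sub>M lborel) borel (\<lambda>(x, y). Complex x y)"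
proof (rule lborel_eqI)
  fix l u :: complex
  assume le: "\<And>b. b \<in> Basis \<Longrightarrow> l \<bullet> b \<le> u \<bullet> b"
  have "(\<lambda>(x, y). Complex x y) -` box l u = {Re l<..<Re u} \<times> {Im l<..<Im u}"
    by (auto simp: box_def Basis_complex_def)
  then have "emeasure (distr (lborel \<Otimes>\<^sub>M lborel) borel (\<lambda>(x, y). Complex x y)) (box l u)
      = emeasure (lborel \<Otimes>\<^sub>M lborel) ({Re l<..<Re u} \<times> {Im l<..<Im u})"
    using borel_measurable_Complex_pair by (subst emeasure_distr) (auto simp: space_pair_measure)
  also have "\<dots> = emeasure lborel {Re l<..<Re u} * emeasure lborel {Im l<..<Im u}"
    by (rule lborel.emeasure_pair_measure_Times) auto
  also have "\<dots> = ennreal (\<Prod>b\<in>Basis. (u - l) \<bullet> b)"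
    using le[of 1] le[of \<i>] by (simp add: Basis_complex_def ennreal_mult)
  finally show "emeasure (distr (lborel \<Otimes>\<^sub>M lborel) borel (\<lambda>(x, y). Complex x y)) (box l u)
      = ennreal (\<Prod>b\<in>Basis. (u - l) \<bullet> b)" .
qed simp

lemma integrable_complex_iff:
  fixes f :: "complex \<Rightarrow> 'b::{banach, second_countable_topology}"
  assumes "f \<in> borel_measurable borel"
  shows "integrable lborel f \<longleftrightarrow> integrable (lborel \<Otimes>\<^sub>M lborel) (\<lambda>(x, y). f (Complex x y))"
  using integrable_distr_eq[OF borel_measurable_Complex_pair assms]
  by (subst lborel_complex_eq) (simp add: case_prod_unfold)

lemma
  fixes f :: "complex \<Rightarrow> 'b::{banach, second_countable_topology}"
  assumes f: "integrable lborel f"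
  shows integral_complex_iterated: "integral\<^sup>L lborel f = (\<integral>x. (\<integral>y. f (Complex x y) \<partial>lborel) \<partial>lborel)"
    and integral_complex_iterated': "integral\<^sup>L lborel f = (\<integral>y. (\<integral>x. f (Complex x y) \<partial>lborel) \<partial>lborel)"
proof -
  have m: "f \<in> borel_measurable borel" using f by auto
  then have i: "integrable (lborel \<Otimes>\<^sub>M lborel) (\<lambda>(x, y). f (Complex x y))"
    using integrable_complex_iff f by blast
  have "integral\<^sup>L lborel f = integral\<^sup>L (lborel \<Otimes>\<^sub>M lborel) (\<lambda>(x, y). f (Complex x y))"
    using integral_distr[OF borel_measurable_Complex_pair m]
    by (subst lborel_complex_eq) (simp add: case_prod_unfold)
  then show "integral\<^sup>L lborel f = (\<integral>x. (\<integral>y. f (Complex x y) \<partial>lborel) \<partial>lborel)"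
    "integral\<^sup>L lborel f = (\<integral>y. (\<integral>x. f (Complex x y) \<partial>lborel) \<partial>lborel)"
    using lborel_pair.integral_fst'[OF i] lborel_pair.integral_snd[OF i] by simp_all
qed

text \<open>\<open>2 * arctan (sqrt x)\<close> is an explicit primitive on the positive half line,
  and reflection gives the other half. This is the one-variable factor of a majorant on the
  plane.\<close>

lemma integrable_sqrt_weight: "integrable lborel (\<lambda>x::real. 1 / (sqrt \<bar>x\<bar> * (1 + \<bar>x\<bar>)))"
proof -
  define g where "g x = 1 / (sqrt \<bar>x\<bar> * (1 + \<bar>x\<bar>))" for x :: real
  have "set_integrable lborel (einterval 0 \<infinity>) g"
  proof (rule interval_integral_FTC_nonneg(1)[where F="\<lambda>x. 2 * arctan (sqrt x)" and A=0 and B=pi])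
    fix x :: real assume "0 < ereal x" "ereal x < \<infinity>"
    then have x: "x > 0" by simp
    have "((\<lambda>x. 2 * arctan (sqrt x)) has_field_derivative
        2 * (inverse (1 + (sqrt x)\<^sup>2) * (inverse (sqrt x) / 2))) (at x)"
      using x by (auto intro!: derivative_eq_intros)
    moreover have "2 * (inverse (1 + (sqrt x)\<^sup>2) * (inverse (sqrt x) / 2)) = g x"
      using x by (simp add: g_def divide_simps)
    ultimately show "((\<lambda>x. 2 * arctan (sqrt x)) has_field_derivative g x) (at x)" by simp
    show "isCont g x" unfolding g_def[abs_def] using x by (auto intro!: continuous_intros)
  next
    have "((\<lambda>x. 2 * arctan (sqrt x)) \<longlongrightarrow> 2 * arctan (sqrt 0)) (at_right 0)"
      by (intro tendsto_intros)
    then show "(((\<lambda>x. 2 * arctan (sqrt x)) \<circ> real_of_ereal) \<longlongrightarrow> 0) (at_right 0)"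
      by (simp add: zero_ereal_def ereal_tendsto_simps)
    have "((\<lambda>x. 2 * arctan (sqrt x)) \<longlongrightarrow> 2 * (pi/2)) at_top"
      by (intro tendsto_intros filterlim_compose[OF tendsto_arctan_at_top] sqrt_at_top)
    then show "(((\<lambda>x. 2 * arctan (sqrt x)) \<circ> real_of_ereal) \<longlongrightarrow> pi) (at_left \<infinity>)"
      by (simp add: ereal_tendsto_simps)
  qed (auto simp: g_def)
  then have 1: "integrable lborel (\<lambda>x. indicator {0<..} x * g x)"
    by (simp add: set_integrable_def einterval_def greaterThan_def zero_ereal_def)
  from lborel_integrable_real_affine[OF this, of "-1" 0]
  have 2: "integrable lborel (\<lambda>x. indicator {0<..} (-x) * g (-x))" by simp
  have "(\<lambda>x. indicator {0<..} x * g x + indicator {0<..} (-x) * g (-x)) = g"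
    by (auto simp: fun_eq_iff g_def indicator_def)
  with Bochner_Integration.integrable_add[OF 1 2] show ?thesis by (simp add: g_def[abs_def])
qed

text \<open>By |Re z| |Im z| \<le> |z|^2 and (1 + |Re z|)(1 + |Im z|) \<le> (1 + |z|)^2 the weight
  lies below a product of one-variable weights, which Fubini handles without polar coordinates. It
  is the size of the Cauchy kernel times decay of order 2.\<close>

lemma integrable_plane_weight: "integrable lborel (\<lambda>u::complex. 1 / (norm u * (1 + norm u)\<^sup>2))"
proof -
  define g where "g x = 1 / (sqrt \<bar>x\<bar> * (1 + \<bar>x\<bar>))" for x :: real
  have g: "integrable lborel g" unfolding g_def[abs_def] by (rule integrable_sqrt_weight)
  have gm [measurable]: "g \<in> borel_measurable borel" using g by auto
  have "integrable (lborel \<Otimes>\<^sub>M lborel) (\<lambda>(x, y). g x * g y)"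
  proof (rule lborel_pair.Fubini_integrable)
    show "(\<lambda>(x, y). g x * g y) \<in> borel_measurable (lborel \<Otimes>\<^sub>M lborel)" by measurable
    show "integrable lborel (\<lambda>x. \<integral>y. norm (case (x, y) of (x, y) \<Rightarrow> g x * g y) \<partial>lborel)"
      using g by (simp add: abs_mult)
    show "AE x in lborel. integrable lborel (\<lambda>y. case (x, y) of (x, y) \<Rightarrow> g x * g y)"
      using g by simp
  qed
  then have "integrable (lborel \<Otimes>\<^sub>M lborel) (\<lambda>(x, y). (\<lambda>z. g (Re z) * g (Im z)) (Complex x y))"
    by simp
  then have "integrable lborel (\<lambda>z. g (Re z) * g (Im z))"
    by (subst integrable_complex_iff) measurable
  then show ?thesis
  proof (rule Bochner_Integration.integrable_bound)
    have "norm (1 / (norm z * (1 + norm z)\<^sup>2)) \<le> norm (g (Re z) * g (Im z))" if z: "Re z \<noteq> 0" "Im z \<noteq> 0" for z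
    proof -
      have "sqrt \<bar>Re z\<bar> * sqrt \<bar>Im z\<bar> \<le> sqrt (norm z) * sqrt (norm z)"
        by (intro mult_mono real_sqrt_le_mono abs_Re_le_cmod abs_Im_le_cmod) auto
      moreover have "(1 + \<bar>Re z\<bar>) * (1 + \<bar>Im z\<bar>) \<le> (1 + norm z) * (1 + norm z)"
        by (intro mult_mono add_mono abs_Re_le_cmod abs_Im_le_cmod) auto
      ultimately have "(sqrt \<bar>Re z\<bar> * sqrt \<bar>Im z\<bar>) * ((1 + \<bar>Re z\<bar>) * (1 + \<bar>Im z\<bar>)) \<le> norm z * (1 + norm z)\<^sup>2"
        unfolding power2_eq_square by (intro mult_mono mult_nonneg_nonneg) (auto intro: abs_Re_le_cmod abs_Im_le_cmod)
      moreover have "(sqrt \<bar>Re z\<bar> * sqrt \<bar>Im z\<bar>) * ((1 + \<bar>Re z\<bar>) * (1 + \<bar>Im z\<bar>)) > 0" using z by simp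
      ultimately have "1 / (norm z * (1 + norm z)\<^sup>2) \<le> 1 / ((sqrt \<bar>Re z\<bar> * sqrt \<bar>Im z\<bar>) * ((1 + \<bar>Re z\<bar>) * (1 + \<bar>Im z\<bar>)))"
        by (intro divide_left_mono) auto
      then show ?thesis by (simp add: g_def abs_mult mult_ac)
    qed note bnd = this
    \<comment> \<open>On the axes \<open>g\<close> takes the value 0 of a division by zero and the
      comparison fails; the axes form a null set.\<close>
    have "AE z in lborel. Re z \<noteq> 0 \<and> Im z \<noteq> 0"
    proof -
      have "AE p in lborel \<Otimes>\<^sub>M lborel. (\<lambda>(x, y). x \<noteq> (0::real) \<and> y \<noteq> (0::real)) p"
      proof -
        have "AE x in lborel. AE y in lborel. (x::real) \<noteq> 0 \<and> y \<noteq> (0::real)"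
          using AE_lborel_singleton[of "0::real"]
        proof (rule eventually_mono)
          fix x :: real assume "x \<noteq> 0"
          then show "AE y in lborel. x \<noteq> 0 \<and> y \<noteq> (0::real)" 
            using AE_lborel_singleton[of "0::real"] by simp
        qed
        moreover have "{x \<in> space (lborel \<Otimes>\<^sub>M lborel). fst x \<noteq> (0::real) \<and> snd x \<noteq> (0::real)} \<in> sets (lborel \<Otimes>\<^sub>M (lborel :: real measure))"
          by measurable
        ultimately show ?thesis unfolding case_prod_unfold
          using lborel_pair.AE_pair_iff[of "\<lambda>x y. (x::real) \<noteq> 0 \<and> y \<noteq> (0::real)"] by blast
      qed
      then show ?thesis
        by (subst lborel_complex_eq, subst AE_distr_iff[OF borel_measurable_Complex_pair])
           (auto simp: case_prod_unfold)
    qed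
    then show "AE z in lborel. norm (1 / (norm z * (1 + norm z)\<^sup>2)) \<le> norm (g (Re z) * g (Im z))"
      by (rule eventually_mono) (rule bnd, auto)
  qed measurable
qed

lemma integrable_plane_weight3:
  assumes "n \<ge> 3"
  shows "integrable lborel (\<lambda>u::complex. 1 / (1 + norm u) ^ n)"
proof (rule Bochner_Integration.integrable_bound[OF integrable_plane_weight])
  have "norm (1 / (1 + norm z) ^ n) \<le> norm (1 / (norm z * (1 + norm z)\<^sup>2))" if "z \<noteq> 0" for z :: complex
  proof -
    have "norm z * (1 + norm z)\<^sup>2 \<le> (1 + norm z) * (1 + norm z)\<^sup>2"
      by (intro mult_right_mono) auto
    also have "\<dots> = (1 + norm z) ^ 3" by (simp add: power3_eq_cube power2_eq_square)
    also have "\<dots> \<le> (1 + norm z) ^ n" using assms by (intro power_increasing) auto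
    finally have "1 / (1 + norm z) ^ n \<le> 1 / (norm z * (1 + norm z)\<^sup>2)"
      using that by (intro divide_left_mono mult_pos_pos zero_less_power) (auto intro: add_pos_nonneg)
    then show ?thesis by (simp add: abs_mult)
  qed
  then show "AE z in lborel. norm (1 / (1 + norm z) ^ n) \<le> norm (1 / (norm (z::complex) * (1 + norm z)\<^sup>2))"
    using AE_lborel_singleton[of "0::complex"] by (auto elim!: eventually_mono)
qed measurable


text \<open>The fundamental theorem of calculus in the direction \<open>e\<close> turns the integral
  over the square into boundary values of \<open>F\<close> on two opposite sides: two values of size
  \<open>C / (1 + real n)\<^sup>2\<close> over a side of length 2n.\<close>

lemma integral_box_partial_bound:
  fixes F :: "complex \<Rightarrow> complex" and n :: nat
  assumes der: "\<And>z. (F has_derivative D z) (at z)"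
    and cont: "continuous_on UNIV (\<lambda>z. D z e)"
    and bound: "\<And>z. norm (F z) \<le> C / (1 + norm z) ^ 2"
    and e: "e = 1 \<or> e = \<i>"
  defines "Q \<equiv> {z. \<bar>Re z\<bar> \<le> real n \<and> \<bar>Im z\<bar> \<le> real n}"
  shows "integrable lborel (\<lambda>z. indicator Q z *\<^sub>R D z e)"
    and "norm (\<integral>z. indicator Q z *\<^sub>R D z e \<partial>lborel) \<le> 4 * C * real n / (1 + real n)\<^sup>2"
proof -
  have Q: "Q = cbox (Complex (- real n) (- real n)) (Complex (real n) (real n))"
    by (auto simp: Q_def in_cbox_complex_iff abs_le_iff)
  then have "compact Q" by simp
  then show int: "integrable lborel (\<lambda>z. indicator Q z *\<^sub>R D z e)"
    by (rule borel_integrable_compact) (rule continuous_on_subset[OF cont], simp)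
  define I :: "real set" where "I = {- real n .. real n}"
  \<comment> \<open>The first argument of \<open>G\<close> and \<open>d\<close> runs along
    \<open>e\<close>, the second across it, so that both directions share one computation.\<close>
  define G where "G s t = (if e = 1 then F (Complex s t) else F (Complex t s))" for s t
  define d where "d s t = (if e = 1 then D (Complex s t) e else D (Complex t s) e)" for s t
  have C: "0 \<le> C" using order_trans[OF norm_ge_zero bound[of 0]] by simp
  have "continuous_on UNIV (\<lambda>s. d s t)" for t
  proof -
    have "continuous_on UNIV (\<lambda>s. Complex s t)" "continuous_on UNIV (\<lambda>s. Complex t s)"
      by (auto simp: Complex_eq intro!: continuous_intros)
    from continuous_on_compose2[OF cont this(1)] continuous_on_compose2[OF cont this(2)]
    show ?thesis by (cases "e = 1") (simp_all add: d_def)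
  qed
  note contd = this
  have G: "((\<lambda>s. G s t) has_vector_derivative d s t) (at s within I)" for s t
  proof -
    have 1: "((\<lambda>s. F (\<i> * of_real t + s *\<^sub>R 1)) has_vector_derivative D (\<i> * of_real t + s *\<^sub>R 1) 1) (at s)"
      "((\<lambda>s. F (of_real t + s *\<^sub>R \<i>)) has_vector_derivative D (of_real t + s *\<^sub>R \<i>) \<i>) (at s)"
      by (rule has_vector_derivative_along_line[OF der])+
    have "\<i> * of_real t + s *\<^sub>R 1 = Complex s t" "of_real t + s *\<^sub>R \<i> = Complex t s" for s
      by (auto simp: complex_eq_iff)
    with 1 e show ?thesis
      by (auto simp: G_def d_def intro: has_vector_derivative_at_within)
  qed
  have inner: "(\<integral>s. indicator I s *\<^sub>R d s t \<partial>lborel) = G n t - G (- real n) t" for t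
    unfolding I_def by (rule integral_FTC_atLeastAtMost) (use G contd in \<open>auto simp: I_def intro: continuous_on_subset\<close>)
  have "(\<integral>z. indicator Q z *\<^sub>R D z e \<partial>lborel) = (\<integral>t. (\<integral>s. indicator I t *\<^sub>R (indicator I s *\<^sub>R d s t) \<partial>lborel) \<partial>lborel)"
  proof (cases "e = 1")
    case True
    have "indicator Q (Complex s t) *\<^sub>R D (Complex s t) e = indicator I t *\<^sub>R (indicator I s *\<^sub>R d s t)" for s t
      using True by (auto simp: Q_def I_def d_def indicator_def)
    then show ?thesis by (simp add: integral_complex_iterated'[OF int])
  next
    case False
    have "indicator Q (Complex t s) *\<^sub>R D (Complex t s) e = indicator I t *\<^sub>R (indicator I s *\<^sub>R d s t)" for s t
      using False by (auto simp: Q_def I_def d_def indicator_def)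
    then show ?thesis by (simp add: integral_complex_iterated[OF int])
  qed
  also have "\<dots> = (\<integral>t. indicator I t *\<^sub>R (G n t - G (- real n) t) \<partial>lborel)"
    by (simp only: integral_scaleR_right inner)
  finally have eq: "(\<integral>z. indicator Q z *\<^sub>R D z e \<partial>lborel) = (\<integral>t. indicator I t *\<^sub>R (G n t - G (- real n) t) \<partial>lborel)" .
  have "continuous_on UNIV (\<lambda>t. G s t)" for s
  proof -
    have "continuous_on UNIV (\<lambda>s. Complex s t)" "continuous_on UNIV (\<lambda>s. Complex t s)" for t
      by (auto simp: Complex_eq intro!: continuous_intros)
    moreover have "continuous_on UNIV F"
      using der by (meson continuous_at_imp_continuous_on has_derivative_continuous)
    ultimately have "continuous_on UNIV (\<lambda>t. F (Complex s t))" "continuous_on UNIV (\<lambda>t. F (Complex t s))"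
      by (auto intro: continuous_on_compose2[of UNIV F UNIV])
    then show ?thesis by (cases "e = 1") (simp_all add: G_def)
  qed
  then have iG: "integrable lborel (\<lambda>t. indicator I t *\<^sub>R (G n t - G (- real n) t))"
    unfolding I_def by (intro borel_integrable_compact) (auto intro!: continuous_intros intro: continuous_on_subset)
  have iw: "integrable lborel (\<lambda>t. indicator I t *\<^sub>R (2 * C / (1 + real n)\<^sup>2))"
    unfolding I_def by (rule borel_integrable_compact) auto
  have Fb: "norm (F z) \<le> C / (1 + real n)\<^sup>2" if "norm z \<ge> real n" for z
    using that C by (intro order_trans[OF bound] divide_left_mono power_mono mult_pos_pos zero_less_power)
      (auto intro: add_pos_nonneg)
  have cn: "norm (Complex s t) \<ge> real n" "norm (Complex t s) \<ge> real n" if "\<bar>s\<bar> = real n" for s t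
    using abs_Re_le_cmod[of "Complex s t"] abs_Im_le_cmod[of "Complex t s"] that by simp_all
  have "norm (G n t - G (- real n) t) \<le> 2 * C / (1 + real n)\<^sup>2" for t
  proof -
    have "norm (G n t) \<le> C / (1 + real n)\<^sup>2" "norm (G (- real n) t) \<le> C / (1 + real n)\<^sup>2"
      unfolding G_def using cn Fb by auto
    then show ?thesis using norm_triangle_ineq4[of "G n t" "G (- real n) t"] by simp
  qed
  then have "norm (\<integral>t. indicator I t *\<^sub>R (G n t - G (- real n) t) \<partial>lborel) \<le> (\<integral>t. indicator I t *\<^sub>R (2 * C / (1 + real n)\<^sup>2) \<partial>lborel)"
    by (intro Bochner_Integration.integral_norm_bound_integral iw iG) (auto simp: indicator_def)
  also have "\<dots> = 4 * C * real n / (1 + real n)\<^sup>2"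
    by (simp add: I_def)
  finally show "norm (\<integral>z. indicator Q z *\<^sub>R D z e \<partial>lborel) \<le> 4 * C * real n / (1 + real n)\<^sup>2"
    by (simp add: eq)
qed

text \<open>Stokes' theorem on growing squares: decay of order 2 on a boundary of length O(n) leaves
  O(1/n). Integrability over the plane is assumed for the combination of the partial derivatives, so
  the two are separated only inside each square and the limit is taken for the combination.\<close>

lemma integral_dbar_eq_0:
  fixes F :: "complex \<Rightarrow> complex"
  assumes der: "\<And>z. (F has_derivative D z) (at z)"
    and cont: "continuous_on UNIV (\<lambda>z. D z 1)" "continuous_on UNIV (\<lambda>z. D z \<i>)"
    and bound: "\<And>z. norm (F z) \<le> C / (1 + norm z) ^ 2"
    and int: "integrable lborel (\<lambda>z. D z 1 + \<i> * D z \<i>)"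
  shows "(\<integral>z. D z 1 + \<i> * D z \<i> \<partial>lborel) = 0"
proof -
  define Q where "Q n = {z. \<bar>Re z\<bar> \<le> real n \<and> \<bar>Im z\<bar> \<le> real n}" for n :: nat
  define J where "J n = (\<integral>z. indicator (Q n) z *\<^sub>R (D z 1 + \<i> * D z \<i>) \<partial>lborel)" for n
  have [measurable]: "Q n \<in> sets borel" for n
    unfolding Q_def by measurable
  have "J \<longlonglongrightarrow> (\<integral>z. D z 1 + \<i> * D z \<i> \<partial>lborel)"
    unfolding J_def
  proof (rule integral_dominated_convergence[where w="\<lambda>z. norm (D z 1 + \<i> * D z \<i>)"])
    show "AE z in lborel. (\<lambda>n. indicator (Q n) z *\<^sub>R (D z 1 + \<i> * D z \<i>)) \<longlonglongrightarrow> D z 1 + \<i> * D z \<i>"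
    proof (rule AE_I2)
      fix z :: complex
      obtain N where N: "norm z \<le> real N" using real_arch_simple by blast
      have "eventually (\<lambda>n. indicator (Q n) z *\<^sub>R (D z 1 + \<i> * D z \<i>) = D z 1 + \<i> * D z \<i>) sequentially"
        using eventually_ge_at_top[of N]
      proof eventually_elim
        case (elim n)
        then have "z \<in> Q n" using N abs_Re_le_cmod[of z] abs_Im_le_cmod[of z] unfolding Q_def by auto
        then show ?case by simp
      qed
      then show "(\<lambda>n. indicator (Q n) z *\<^sub>R (D z 1 + \<i> * D z \<i>)) \<longlonglongrightarrow> D z 1 + \<i> * D z \<i>"
        by (rule tendsto_eventually)
    qed
    show "(\<lambda>z. D z 1 + \<i> * D z \<i>) \<in> borel_measurable lborel" using int by auto
    show "(\<lambda>z. indicator (Q n) z *\<^sub>R (D z 1 + \<i> * D z \<i>)) \<in> borel_measurable lborel" for n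
      using int by (intro borel_measurable_scaleR) auto
    show "integrable lborel (\<lambda>z. norm (D z 1 + \<i> * D z \<i>))" using int by auto
  qed (auto simp: indicator_def)
  moreover have "J \<longlonglongrightarrow> 0"
  proof (rule Lim_null_comparison)
    show "eventually (\<lambda>n. norm (J n) \<le> 8 * C * real n / (1 + real n)\<^sup>2) sequentially"
    proof (rule always_eventually, rule allI)
      fix n
      note b1 = integral_box_partial_bound[OF der cont(1) bound disjI1[OF refl], of n, folded Q_def]
      note b2 = integral_box_partial_bound[OF der cont(2) bound disjI2[OF refl], of n, folded Q_def]
      have "J n = (\<integral>z. indicator (Q n) z *\<^sub>R D z 1 + \<i> * (indicator (Q n) z *\<^sub>R D z \<i>) \<partial>lborel)"
        unfolding J_def by (rule Bochner_Integration.integral_cong) (auto simp: algebra_simps)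
      also have "\<dots> = (\<integral>z. indicator (Q n) z *\<^sub>R D z 1 \<partial>lborel) + \<i> * (\<integral>z. indicator (Q n) z *\<^sub>R D z \<i> \<partial>lborel)"
        by (simp only: Bochner_Integration.integral_add[OF b1(1) integrable_mult_right[OF b2(1)]] integral_mult_right_zero)
      finally have "norm (J n) \<le> norm (\<integral>z. indicator (Q n) z *\<^sub>R D z 1 \<partial>lborel) + norm (\<integral>z. indicator (Q n) z *\<^sub>R D z \<i> \<partial>lborel)"
        by (metis norm_triangle_ineq norm_mult norm_ii mult_1)
      also have "\<dots> \<le> 4 * C * real n / (1 + real n)\<^sup>2 + 4 * C * real n / (1 + real n)\<^sup>2"
        using b1(2) b2(2) by (intro add_mono) auto
      finally show "norm (J n) \<le> 8 * C * real n / (1 + real n)\<^sup>2" by simp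
    qed
    show "(\<lambda>n. 8 * C * real n / (1 + real n)\<^sup>2) \<longlonglongrightarrow> 0"
      by real_asymp
  qed
  ultimately show ?thesis by (rule LIMSEQ_unique)
qed

section \<open>The Cauchy-Pompeiu formula\<close>

lemma one_plus_norm_power_le: "(1 + norm z) ^ 2 \<le> 2 * (1 + (norm z)\<^sup>2)"
proof -
  have "0 \<le> (1 - norm z)\<^sup>2" by simp
  then show ?thesis by (simp add: power2_eq_square algebra_simps)
qed

text \<open>Up to normalisation the integrand is the area density of the Fubini-Study metric in an
  affine coordinate; it is comparable to \<open>1 / (1 + norm v) ^ 4\<close>.\<close>

lemma integrable_fubini_study: "integrable lborel (\<lambda>v::complex. 1 / (1 + (norm v)\<^sup>2)\<^sup>2)"
proof (rule Bochner_Integration.integrable_bound)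
  show "integrable lborel (\<lambda>v::complex. 4 * (1 / (1 + norm v) ^ 4))"
    by (rule integrable_mult_right[OF integrable_plane_weight3]) simp
  have "norm (1 / (1 + (norm v)\<^sup>2)\<^sup>2) \<le> norm (4 * (1 / (1 + norm v) ^ 4))" for v :: complex
  proof -
    have "((1 + norm v) ^ 2)\<^sup>2 \<le> (2 * (1 + (norm v)\<^sup>2))\<^sup>2"
      by (rule power_mono[OF one_plus_norm_power_le]) simp
    moreover have "((1 + norm v) ^ 2)\<^sup>2 = (1 + norm v) ^ 4" by (simp flip: power_mult)
    moreover have "(2 * (1 + (norm v)\<^sup>2))\<^sup>2 = 4 * (1 + (norm v)\<^sup>2)\<^sup>2"
      by (simp only: power_mult_distrib) simp
    ultimately have "(1 + norm v) ^ 4 \<le> 4 * (1 + (norm v)\<^sup>2)\<^sup>2" by simp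
    moreover have "0 < 1 + norm v" "0 < 1 + (norm v)\<^sup>2"
      by (auto intro: add_pos_nonneg)
    then have "0 < (1 + norm v) ^ 4" "0 < (1 + (norm v)\<^sup>2)\<^sup>2"
      by (auto intro: zero_less_power)
    ultimately show ?thesis by (simp add: field_simps)
  qed
  then show "AE v in lborel. norm (1 / (1 + (norm v)\<^sup>2)\<^sup>2) \<le> norm (4 * (1 / (1 + norm (v::complex)) ^ 4))"
    by simp
qed measurable

text \<open>The value is \<open>pi\<close>, but only its positivity matters.\<close>

definition fs_area :: real where
  "fs_area = (\<integral>v. 1 / (1 + (norm v)\<^sup>2)\<^sup>2 \<partial>(lborel :: complex measure))"

text \<open>A nonnegative integrand with zero integral vanishes almost everywhere, while this one
  vanishes nowhere and the plane is not a null set.\<close>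

lemma fs_area_pos: "fs_area > 0"
proof -
  have "fs_area \<noteq> 0"
  proof
    assume "fs_area = 0"
    then have "AE v in (lborel :: complex measure). 1 / (1 + (norm v)\<^sup>2)\<^sup>2 = 0"
      unfolding fs_area_def using integral_nonneg_eq_0_iff_AE[OF integrable_fubini_study] by simp
    moreover have "1 + (norm v)\<^sup>2 \<noteq> 0" for v :: complex
      using zero_le_power2[of "norm v"] by linarith
    ultimately have "AE v in (lborel :: complex measure). False" by simp
    then have "ae_filter (lborel :: complex measure) = bot"
      by (simp only: eventually_False)
    then show False by (simp add: ae_filter_eq_bot_iff)
  qed
  moreover have "fs_area \<ge> 0" unfolding fs_area_def by (rule Bochner_Integration.integral_nonneg) simp
  ultimately show ?thesis by simp
qed

lemma
  fixes g :: "complex \<Rightarrow> 'b::{banach, second_countable_topology}"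
  assumes c: "c \<noteq> 0" and [measurable]: "g \<in> borel_measurable borel"
  shows integral_complex_affine: "integral\<^sup>L lborel g = (\<integral>x. c\<^sup>2 *\<^sub>R g (t + c *\<^sub>R x) \<partial>lborel)"
    and integrable_complex_affine: "integrable lborel g \<longleftrightarrow> integrable lborel (\<lambda>x. g (t + c *\<^sub>R x))"
proof -
  have eq: "lborel = density (distr lborel borel (\<lambda>x::complex. t + c *\<^sub>R x)) (\<lambda>_. ennreal (c\<^sup>2))"
    using lborel_affine[of c t] c by simp
  then have "integral\<^sup>L lborel g = integral\<^sup>L (density (distr lborel borel (\<lambda>x::complex. t + c *\<^sub>R x)) (\<lambda>_. ennreal (c\<^sup>2))) g"
    by simp
  also have "\<dots> = (\<integral>x. c\<^sup>2 *\<^sub>R g x \<partial>(distr lborel borel (\<lambda>x::complex. t + c *\<^sub>R x)))"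
    by (rule integral_density) auto
  also have "\<dots> = (\<integral>x. c\<^sup>2 *\<^sub>R g (t + c *\<^sub>R x) \<partial>lborel)"
    by (rule integral_distr) auto
  finally show "integral\<^sup>L lborel g = (\<integral>x. c\<^sup>2 *\<^sub>R g (t + c *\<^sub>R x) \<partial>lborel)" .
  have "integrable lborel g \<longleftrightarrow> integrable (density (distr lborel borel (\<lambda>x::complex. t + c *\<^sub>R x)) (\<lambda>_. ennreal (c\<^sup>2))) g"
    using eq by simp
  also have "\<dots> \<longleftrightarrow> integrable (distr lborel borel (\<lambda>x::complex. t + c *\<^sub>R x)) (\<lambda>x. c\<^sup>2 *\<^sub>R g x)"
    by (rule integrable_density) auto
  also have "\<dots> \<longleftrightarrow> integrable lborel (\<lambda>x. c\<^sup>2 *\<^sub>R g (t + c *\<^sub>R x))"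
    by (rule integrable_distr_eq) auto
  also have "\<dots> \<longleftrightarrow> integrable lborel (\<lambda>x. g (t + c *\<^sub>R x))"
  proof
    assume "integrable lborel (\<lambda>x. c\<^sup>2 *\<^sub>R g (t + c *\<^sub>R x))"
    then have "integrable lborel (\<lambda>x. inverse (c\<^sup>2) *\<^sub>R (c\<^sup>2 *\<^sub>R g (t + c *\<^sub>R x)))"
      by (rule integrable_scaleR_right)
    then show "integrable lborel (\<lambda>x. g (t + c *\<^sub>R x))" using c by simp
  qed (rule integrable_scaleR_right)
  finally show "integrable lborel g \<longleftrightarrow> integrable lborel (\<lambda>x. g (t + c *\<^sub>R x))" .
qed

lemma
  fixes g :: "complex \<Rightarrow> 'b::{banach, second_countable_topology}"
  assumes "g \<in> borel_measurable borel"
  shows integral_complex_reflect: "(\<integral>x. g (t - x) \<partial>lborel) = integral\<^sup>L lborel g"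
    and integrable_complex_reflect: "integrable lborel (\<lambda>x. g (t - x)) \<longleftrightarrow> integrable lborel g"
  using integral_complex_affine[of "-1" g t] integrable_complex_affine[of "-1" g t] assms by simp_all

text \<open>The kernel 1/u is written as \<open>cnj u / (u * cnj u)\<close>, and adding
  \<open>e\<^sup>2\<close> to the denominator makes it smooth at 0 without leaving the majorant
  1/|u|. The bound \<open>1 / (2 * e)\<close> is the inequality between arithmetic and geometric
  mean.\<close>

lemma regularized_kernel_bound:
  fixes u :: complex
  assumes "e > 0"
  shows "norm (cnj u / (u * cnj u + of_real (e\<^sup>2))) \<le> 1 / (2 * e)"
    and "norm (cnj u / (u * cnj u + of_real (e\<^sup>2))) \<le> 1 / norm u"
    and "u * cnj u + of_real (e\<^sup>2) \<noteq> 0"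
    and "norm (u * cnj u + of_real (e\<^sup>2)) = (norm u)\<^sup>2 + e\<^sup>2"
proof -
  have eq: "u * cnj u + of_real (e\<^sup>2) = of_real ((norm u)\<^sup>2 + e\<^sup>2)"
    by (simp add: complex_norm_square[symmetric])
  have pos: "(norm u)\<^sup>2 + e\<^sup>2 > 0" using assms by (simp add: add_nonneg_pos)
  then show n: "norm (u * cnj u + of_real (e\<^sup>2)) = (norm u)\<^sup>2 + e\<^sup>2"
    unfolding eq norm_of_real by simp
  then show "u * cnj u + of_real (e\<^sup>2) \<noteq> 0" using pos by (metis less_irrefl norm_zero)
  have "0 \<le> (norm u - e)\<^sup>2" by simp
  then have "2 * e * norm u \<le> (norm u)\<^sup>2 + e\<^sup>2" by (simp add: power2_eq_square algebra_simps)
  then show "norm (cnj u / (u * cnj u + of_real (e\<^sup>2))) \<le> 1 / (2 * e)"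
    using assms pos by (simp only: norm_divide n complex_mod_cnj) (simp add: field_simps)
  show "norm (cnj u / (u * cnj u + of_real (e\<^sup>2))) \<le> 1 / norm u"
    using pos by (cases "u = 0") (simp_all only: norm_divide n complex_mod_cnj, simp_all add: field_simps power2_eq_square)
qed

lemma regularized_kernel_has_derivative:
  fixes u :: complex
  assumes "e > 0"
  shows "((\<lambda>u. cnj u / (u * cnj u + of_real (e\<^sup>2))) has_derivative
     (\<lambda>v. (of_real (e\<^sup>2) * cnj v - (cnj u)\<^sup>2 * v) / (u * cnj u + of_real (e\<^sup>2))\<^sup>2)) (at u)"
proof -
  note nz = regularized_kernel_bound(3)[OF assms, of u]
  have "((\<lambda>u. cnj u / (u * cnj u + of_real (e\<^sup>2))) has_derivative
     (\<lambda>v. (cnj v * (u * cnj u + of_real (e\<^sup>2)) - cnj u * (u * cnj v + v * cnj u))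
        / ((u * cnj u + of_real (e\<^sup>2)) * (u * cnj u + of_real (e\<^sup>2))))) (at u)"
    by (rule has_derivative_divide'[where f=cnj and f'=cnj and g="\<lambda>u. u * cnj u + of_real (e\<^sup>2)", OF _ _ nz])
       (auto intro!: derivative_eq_intros bounded_linear_imp_has_derivative bounded_linear_cnj)
  moreover have "cnj v * (u * cnj u + of_real (e\<^sup>2)) - cnj u * (u * cnj v + v * cnj u)
     = of_real (e\<^sup>2) * cnj v - (cnj u)\<^sup>2 * v" for v
    by (simp add: algebra_simps power2_eq_square)
  ultimately show ?thesis by (simp only: power2_eq_square[of "u * cnj u + of_real (e\<^sup>2)"])
qed

text \<open>The antiholomorphic derivative \<open>q\<close> of the regularised kernel is a smooth
  approximation of a point mass, so Stokes' theorem applies on the whole plane and no disc around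
  the singularity has to be cut out. Rescaling by \<open>e\<close> turns \<open>q\<close> into the
  Fubini-Study density.\<close>

lemma regularized_cauchy_pompeiu:
  fixes \<phi> :: "complex \<Rightarrow> complex"
  assumes der: "\<And>z. (\<phi> has_derivative D z) (at z)"
    and cont: "continuous_on UNIV (\<lambda>z. D z 1)" "continuous_on UNIV (\<lambda>z. D z \<i>)"
    and bound: "\<And>z. norm (\<phi> z) \<le> C / (1 + norm z) ^ 2"
    and dbar_bound: "\<And>z. norm (D z 1 + \<i> * D z \<i>) \<le> C / (1 + norm z) ^ 2"
    and e: "e > 0"
  shows "(\<integral>u. (D u 1 + \<i> * D u \<i>) * (cnj u / (u * cnj u + of_real (e\<^sup>2))) \<partial>lborel)
     = - 2 * (\<integral>v. \<phi> (e *\<^sub>R v) / (1 + (norm v)\<^sup>2)\<^sup>2 \<partial>lborel)"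
proof -
  define k where "k u = cnj u / (u * cnj u + of_real (e\<^sup>2))" for u
  define Dk where "Dk u v = (of_real (e\<^sup>2) * cnj v - (cnj u)\<^sup>2 * v) / (u * cnj u + of_real (e\<^sup>2))\<^sup>2" for u v
  define q where "q u = of_real (e\<^sup>2) / (u * cnj u + of_real (e\<^sup>2))\<^sup>2" for u
  note nz = regularized_kernel_bound(3)[OF e]
  have k: "(k has_derivative Dk u) (at u)" for u
    unfolding k_def[abs_def] Dk_def[abs_def] by (rule regularized_kernel_has_derivative[OF e])
  have kb: "norm (k u) \<le> 1 / (2 * e)" "norm (k u) \<le> 1 / norm u" for u
    unfolding k_def using regularized_kernel_bound[OF e] by auto
  have Dk2: "Dk u 1 + \<i> * Dk u \<i> = 2 * q u" for u
    using nz[of u] by (simp add: Dk_def q_def add_divide_distrib[symmetric] algebra_simps)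
  have cphi: "continuous_on UNIV \<phi>"
    using der by (meson continuous_at_imp_continuous_on has_derivative_continuous)
  have ck: "continuous_on UNIV k" "continuous_on UNIV q" "continuous_on UNIV (\<lambda>u. Dk u v)" for v
    unfolding k_def[abs_def] q_def[abs_def] Dk_def using nz
    by (auto intro!: continuous_intros)
  have C: "0 \<le> C" using order_trans[OF norm_ge_zero bound[of 0]] by simp
  define F where "F u = \<phi> u * k u" for u
  define DF where "DF u v = \<phi> u * Dk u v + D u v * k u" for u v
  have DF: "(F has_derivative DF u) (at u)" for u
    unfolding F_def[abs_def] DF_def[abs_def] by (rule has_derivative_mult[OF der k])
  have DFe: "DF u 1 + \<i> * DF u \<i> = (D u 1 + \<i> * D u \<i>) * k u + 2 * (\<phi> u * q u)" for u
  proof -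
    have "DF u 1 + \<i> * DF u \<i> = (D u 1 + \<i> * D u \<i>) * k u + \<phi> u * (Dk u 1 + \<i> * Dk u \<i>)"
      by (simp add: DF_def algebra_simps)
    then show ?thesis by (simp add: Dk2)
  qed
  have i1: "integrable lborel (\<lambda>u. (D u 1 + \<i> * D u \<i>) * k u)"
  proof (rule Bochner_Integration.integrable_bound)
    show "integrable lborel (\<lambda>u::complex. C * (1 / (norm u * (1 + norm u)\<^sup>2)))"
      using integrable_plane_weight by (rule integrable_mult_right)
    show "(\<lambda>u. (D u 1 + \<i> * D u \<i>) * k u) \<in> borel_measurable lborel"
      by (auto intro!: borel_measurable_continuous_onI continuous_intros ck cont)
    show "AE u in lborel. norm ((D u 1 + \<i> * D u \<i>) * k u) \<le> norm (C * (1 / (norm u * (1 + norm u)\<^sup>2)))"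
    proof (rule AE_I2)
      fix u :: complex
      have "norm ((D u 1 + \<i> * D u \<i>) * k u) \<le> (C / (1 + norm u) ^ 2) * (1 / norm u)"
        unfolding norm_mult by (intro mult_mono dbar_bound kb) (use C in auto)
      then show "norm ((D u 1 + \<i> * D u \<i>) * k u) \<le> norm (C * (1 / (norm u * (1 + norm u)\<^sup>2)))"
        using C by (simp add: mult_ac)
    qed
  qed
  have i2: "integrable lborel (\<lambda>u. \<phi> u * q u)"
  proof (rule Bochner_Integration.integrable_bound)
    show "integrable lborel (\<lambda>u::complex. (C / (2 * e)) * (1 / (norm u * (1 + norm u)\<^sup>2)))"
      using integrable_plane_weight by (rule integrable_mult_right)
    show "(\<lambda>u. \<phi> u * q u) \<in> borel_measurable lborel"
      by (auto intro!: borel_measurable_continuous_onI continuous_intros ck cphi)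
    \<comment> \<open>\<open>q\<close> is estimated by \<open>1 / (2 * e * norm u)\<close> rather
      than by its true decay, so that the integrable weight on the plane applies again.\<close>
    have "norm (\<phi> u * q u) \<le> norm ((C / (2 * e)) * (1 / (norm u * (1 + norm u)\<^sup>2)))" if "u \<noteq> 0" for u
    proof -
      have "0 \<le> (norm u - e)\<^sup>2" by simp
      then have "2 * e * norm u \<le> (norm u)\<^sup>2 + e\<^sup>2" by (simp add: power2_eq_square algebra_simps)
      then have "e\<^sup>2 * (2 * e * norm u) \<le> ((norm u)\<^sup>2 + e\<^sup>2) * ((norm u)\<^sup>2 + e\<^sup>2)"
        using e by (intro mult_mono) auto
      moreover have "(norm u)\<^sup>2 + e\<^sup>2 > 0" using e by (simp add: add_nonneg_pos)
      moreover have "a / c \<le> 1 / b" if "a * b \<le> c" "0 < b" "0 < c" for a b c :: real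
        using that by (simp add: field_simps)
      ultimately have "e\<^sup>2 / ((norm u)\<^sup>2 + e\<^sup>2)\<^sup>2 \<le> 1 / (2 * e * norm u)"
        using e that by (simp only: power2_eq_square[of "_ + _"]) simp
      then have "norm (q u) \<le> 1 / (2 * e * norm u)"
        unfolding q_def norm_divide norm_power regularized_kernel_bound(4)[OF e] by (simp add: norm_power)
      then have "norm (\<phi> u * q u) \<le> (C / (1 + norm u) ^ 2) * (1 / (2 * e * norm u))"
        unfolding norm_mult using C by (intro mult_mono bound) auto
      then show ?thesis using C e by (simp add: mult_ac)
    qed
    then show "AE u in lborel. norm (\<phi> u * q u) \<le> norm ((C / (2 * e)) * (1 / (norm u * (1 + norm u)\<^sup>2)))"
      using AE_lborel_singleton[of "0::complex"] by (auto elim!: eventually_mono)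
  qed
  have "(\<integral>u. DF u 1 + \<i> * DF u \<i> \<partial>lborel) = 0"
  proof (rule integral_dbar_eq_0[OF DF])
    show "continuous_on UNIV (\<lambda>u. DF u 1)" "continuous_on UNIV (\<lambda>u. DF u \<i>)"
      unfolding DF_def by (auto intro!: continuous_intros ck cont cphi)
    show "norm (F z) \<le> (C / (2 * e)) / (1 + norm z) ^ 2" for z
    proof -
      have "norm (F z) \<le> (C / (1 + norm z) ^ 2) * (1 / (2 * e))"
        unfolding F_def norm_mult by (intro mult_mono bound kb) (use C in auto)
      then show ?thesis by (simp add: mult_ac)
    qed
    show "integrable lborel (\<lambda>z. DF z 1 + \<i> * DF z \<i>)"
      unfolding DFe using i1 i2 by (intro Bochner_Integration.integrable_add integrable_mult_right) auto
  qed
  then have "(\<integral>u. (D u 1 + \<i> * D u \<i>) * k u \<partial>lborel) + 2 * (\<integral>u. \<phi> u * q u \<partial>lborel) = 0"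
    unfolding DFe by (subst (asm) Bochner_Integration.integral_add[OF i1 integrable_mult_right[OF i2]]) simp
  then have eq: "(\<integral>u. (D u 1 + \<i> * D u \<i>) * k u \<partial>lborel) = - 2 * (\<integral>u. \<phi> u * q u \<partial>lborel)"
    by (simp add: eq_neg_iff_add_eq_0)
  \<comment> \<open>Substitution u = e v; the Jacobian \<open>e\<^sup>2\<close> cancels the scaling
    of \<open>q\<close>.\<close>
  have "(\<integral>u. \<phi> u * q u \<partial>lborel) = (\<integral>v. e\<^sup>2 *\<^sub>R (\<phi> (e *\<^sub>R v) * q (e *\<^sub>R v)) \<partial>lborel)"
    using i2 e integral_complex_affine[of e "\<lambda>u. \<phi> u * q u" 0] by simp
  also have "\<dots> = (\<integral>v. \<phi> (e *\<^sub>R v) / (1 + (norm v)\<^sup>2)\<^sup>2 \<partial>lborel)"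
  proof (rule Bochner_Integration.integral_cong[OF refl])
    fix v :: complex
    have "(complex_of_real (norm v))\<^sup>2 = v * cnj v" by (metis complex_norm_square of_real_power)
    then have "(e *\<^sub>R v) * cnj (e *\<^sub>R v) + of_real (e\<^sup>2) = of_real (e\<^sup>2) * (1 + of_real ((norm v)\<^sup>2))"
      by (simp add: scaleR_conv_of_real algebra_simps power2_eq_square[of "complex_of_real e"])
    then have "q (e *\<^sub>R v) = of_real (e\<^sup>2) / (of_real (e\<^sup>2) * (1 + of_real ((norm v)\<^sup>2)))\<^sup>2"
      by (simp only: q_def)
    then have A: "of_real (e\<^sup>2) * q (e *\<^sub>R v) = 1 / (1 + of_real ((norm v)\<^sup>2))\<^sup>2"
      using e by (simp add: power_mult_distrib power2_eq_square)
    have "e\<^sup>2 *\<^sub>R (\<phi> (e *\<^sub>R v) * q (e *\<^sub>R v)) = \<phi> (e *\<^sub>R v) * (of_real (e\<^sup>2) * q (e *\<^sub>R v))"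
      by (simp add: scaleR_conv_of_real mult_ac)
    also have "\<dots> = \<phi> (e *\<^sub>R v) / (1 + (norm v)\<^sup>2)\<^sup>2" by (simp only: A) simp
    finally show "e\<^sup>2 *\<^sub>R (\<phi> (e *\<^sub>R v) * q (e *\<^sub>R v)) = \<phi> (e *\<^sub>R v) / (1 + (norm v)\<^sup>2)\<^sup>2" .
  qed
  finally show ?thesis using eq by (simp add: k_def)
qed

text \<open>Limit of the regularised identity: the left side is dominated by 1/|u| times the decay,
  and on the right \<open>\<phi> (e n *\<^sub>R v)\<close> tends to \<open>\<phi> 0\<close>. The
  factor 2 appears because \<open>D u 1 + \<i> * D u \<i>\<close> is twice the Wirtinger
  derivative.\<close>

lemma cauchy_pompeiu:
  fixes \<phi> :: "complex \<Rightarrow> complex"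
  assumes der: "\<And>z. (\<phi> has_derivative D z) (at z)"
    and cont: "continuous_on UNIV (\<lambda>z. D z 1)" "continuous_on UNIV (\<lambda>z. D z \<i>)"
    and bound: "\<And>z. norm (\<phi> z) \<le> C / (1 + norm z) ^ 2"
    and dbar_bound: "\<And>z. norm (D z 1 + \<i> * D z \<i>) \<le> C / (1 + norm z) ^ 2"
  shows "(\<integral>u. (D u 1 + \<i> * D u \<i>) / u \<partial>lborel) = - 2 * of_real fs_area * \<phi> 0"
proof -
  define e where "e n = 1 / real (Suc n)" for n
  have e: "e n > 0" for n by (simp add: e_def)
  have e0: "e \<longlonglongrightarrow> 0" unfolding e_def using LIMSEQ_inverse_real_of_nat by (simp add: inverse_eq_divide)
  have C: "0 \<le> C" using order_trans[OF norm_ge_zero bound[of 0]] by simp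
  have cphi: "continuous_on UNIV \<phi>"
    using der by (meson continuous_at_imp_continuous_on has_derivative_continuous)
  have [measurable]: "\<phi> \<in> borel_measurable borel" using cphi by (rule borel_measurable_continuous_onI)
  have m1: "(\<lambda>z. D z 1 + \<i> * D z \<i>) \<in> borel_measurable lborel"
    by (auto intro!: borel_measurable_continuous_onI continuous_intros cont)
  have lim: "(\<lambda>n. \<integral>u. (D u 1 + \<i> * D u \<i>) * (cnj u / (u * cnj u + of_real ((e n)\<^sup>2))) \<partial>lborel)
      \<longlonglongrightarrow> (\<integral>u. (D u 1 + \<i> * D u \<i>) / u \<partial>lborel)"
  proof (rule integral_dominated_convergence[where w="\<lambda>u. C * (1 / (norm u * (1 + norm u)\<^sup>2))"])
    show "integrable lborel (\<lambda>u::complex. C * (1 / (norm u * (1 + norm u)\<^sup>2)))"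
      using integrable_plane_weight by (rule integrable_mult_right)
    have "(\<lambda>n. (D u 1 + \<i> * D u \<i>) * (cnj u / (u * cnj u + of_real ((e n)\<^sup>2)))) \<longlonglongrightarrow> (D u 1 + \<i> * D u \<i>) / u"
      if "u \<noteq> 0" for u
    proof -
      have "(\<lambda>n. (D u 1 + \<i> * D u \<i>) * (cnj u / (u * cnj u + of_real ((e n)\<^sup>2))))
         \<longlonglongrightarrow> (D u 1 + \<i> * D u \<i>) * (cnj u / (u * cnj u + of_real (0\<^sup>2)))"
        by (intro tendsto_intros e0) (use that in auto)
      then show ?thesis using that by simp
    qed
    then show "AE u in lborel. (\<lambda>n. (D u 1 + \<i> * D u \<i>) * (cnj u / (u * cnj u + of_real ((e n)\<^sup>2)))) \<longlonglongrightarrow> (D u 1 + \<i> * D u \<i>) / u"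
      using AE_lborel_singleton[of "0::complex"] by (auto elim!: eventually_mono)
    show "AE u in lborel. norm ((D u 1 + \<i> * D u \<i>) * (cnj u / (u * cnj u + of_real ((e n)\<^sup>2)))) \<le> C * (1 / (norm u * (1 + norm u)\<^sup>2))" for n
    proof (rule AE_I2)
      fix u :: complex
      have "norm ((D u 1 + \<i> * D u \<i>) * (cnj u / (u * cnj u + of_real ((e n)\<^sup>2)))) \<le> (C / (1 + norm u) ^ 2) * (1 / norm u)"
        unfolding norm_mult by (intro mult_mono dbar_bound regularized_kernel_bound(2)[OF e]) (use C in auto)
      then show "norm ((D u 1 + \<i> * D u \<i>) * (cnj u / (u * cnj u + of_real ((e n)\<^sup>2)))) \<le> C * (1 / (norm u * (1 + norm u)\<^sup>2))"
        by (simp add: mult_ac)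
    qed
    show "(\<lambda>u. (D u 1 + \<i> * D u \<i>) / u) \<in> borel_measurable lborel"
      by (intro borel_measurable_divide m1) measurable
    show "(\<lambda>u. (D u 1 + \<i> * D u \<i>) * (cnj u / (u * cnj u + of_real ((e n)\<^sup>2)))) \<in> borel_measurable lborel" for n
      by (intro borel_measurable_times m1) (auto intro!: borel_measurable_continuous_onI continuous_intros regularized_kernel_bound(3)[OF e, simplified])
  qed
  have "(\<lambda>n. \<integral>v. \<phi> (e n *\<^sub>R v) / (1 + (norm v)\<^sup>2)\<^sup>2 \<partial>lborel) \<longlonglongrightarrow> (\<integral>v. \<phi> 0 / (1 + (norm (v::complex))\<^sup>2)\<^sup>2 \<partial>lborel)"
  proof (rule integral_dominated_convergence[where w="\<lambda>v. C * (1 / (1 + (norm v)\<^sup>2)\<^sup>2)"])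
    show "integrable lborel (\<lambda>v::complex. C * (1 / (1 + (norm v)\<^sup>2)\<^sup>2))"
      using integrable_fubini_study by (rule integrable_mult_right)
    show "AE v in lborel. (\<lambda>n. \<phi> (e n *\<^sub>R v) / (1 + (norm v)\<^sup>2)\<^sup>2) \<longlonglongrightarrow> \<phi> 0 / (1 + (norm v)\<^sup>2)\<^sup>2"
    proof (rule AE_I2)
      fix v :: complex
      have "(\<lambda>n. e n *\<^sub>R v) \<longlonglongrightarrow> 0 *\<^sub>R v" by (intro tendsto_intros e0)
      then have "(\<lambda>n. \<phi> (e n *\<^sub>R v)) \<longlonglongrightarrow> \<phi> 0"
        using cphi by (intro continuous_on_tendsto_compose[OF cphi]) auto
      then show "(\<lambda>n. \<phi> (e n *\<^sub>R v) / (1 + (norm v)\<^sup>2)\<^sup>2) \<longlonglongrightarrow> \<phi> 0 / (1 + (norm v)\<^sup>2)\<^sup>2"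
        unfolding divide_inverse by (rule tendsto_mult_right)
    qed
    show "AE v in lborel. norm (\<phi> (e n *\<^sub>R v) / (1 + (norm v)\<^sup>2)\<^sup>2) \<le> C * (1 / (1 + (norm v)\<^sup>2)\<^sup>2)" for n
    proof (rule AE_I2)
      fix v :: complex
      have "norm (\<phi> (e n *\<^sub>R v)) \<le> C"
      proof (rule order_trans[OF bound])
        have "C / (1 + norm (e n *\<^sub>R v)) ^ 2 \<le> C / 1"
          using C by (intro divide_left_mono one_le_power mult_pos_pos zero_less_power) (auto intro: add_pos_nonneg)
        then show "C / (1 + norm (e n *\<^sub>R v)) ^ 2 \<le> C" by simp
      qed
      moreover have "norm (1 + (complex_of_real (norm v))\<^sup>2) = 1 + (norm v)\<^sup>2"
      proof -
        have "1 + (complex_of_real (norm v))\<^sup>2 = of_real (1 + (norm v)\<^sup>2)" by simp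
        then show ?thesis by (simp only: norm_of_real) (simp add: add_nonneg_nonneg)
      qed
      ultimately show "norm (\<phi> (e n *\<^sub>R v) / (1 + (norm v)\<^sup>2)\<^sup>2) \<le> C * (1 / (1 + (norm v)\<^sup>2)\<^sup>2)"
        by (simp add: norm_divide norm_power divide_right_mono)
    qed
  qed measurable
  moreover have "(\<integral>v. \<phi> 0 / (1 + (norm (v::complex))\<^sup>2)\<^sup>2 \<partial>lborel) = of_real fs_area * \<phi> 0"
  proof -
    have "(\<integral>v. \<phi> 0 / (1 + (norm (v::complex))\<^sup>2)\<^sup>2 \<partial>lborel) = (\<integral>v. (1 / (1 + (norm (v::complex))\<^sup>2)\<^sup>2) *\<^sub>R \<phi> 0 \<partial>lborel)"
      by (rule Bochner_Integration.integral_cong) (auto simp: scaleR_conv_of_real)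
    also have "\<dots> = fs_area *\<^sub>R \<phi> 0"
      unfolding fs_area_def by (rule integral_scaleR_left) (use integrable_fubini_study in auto)
    finally show ?thesis by (simp add: scaleR_conv_of_real)
  qed
  ultimately have "(\<lambda>n. - 2 * (\<integral>v. \<phi> (e n *\<^sub>R v) / (1 + (norm v)\<^sup>2)\<^sup>2 \<partial>lborel)) \<longlonglongrightarrow> - 2 * (of_real fs_area * \<phi> 0)"
    by (intro tendsto_mult tendsto_const) simp
  then have "(\<lambda>n. \<integral>u. (D u 1 + \<i> * D u \<i>) * (cnj u / (u * cnj u + of_real ((e n)\<^sup>2))) \<partial>lborel) \<longlonglongrightarrow> - 2 * (of_real fs_area * \<phi> 0)"
    by (simp only: regularized_cauchy_pompeiu[OF der cont bound dbar_bound e])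
  from LIMSEQ_unique[OF lim this] show ?thesis by (simp only: mult.assoc)
qed

section \<open>Functions extending over infinity\<close>

text \<open>The condition says that \<open>h\<close> is, in the chart \<open>z \<noteq> \<infinity>\<close>, the coefficient of a smooth section over the
  whole sphere of a line bundle with transition function \<open>z\<^sup>-\<^sup>a cnj z\<^sup>-\<^sup>b\<close>, so it comes with decay of order
  \<open>a + b\<close> for \<open>h\<close> and for all of its derivatives.\<close>

definition decaying :: "nat \<Rightarrow> nat \<Rightarrow> 'x::euclidean_space set \<Rightarrow> (complex \<times> 'x \<Rightarrow> complex) \<Rightarrow> bool" where
  "decaying a b U h \<longleftrightarrow> smooth_on (UNIV \<times> U) h \<and> (\<exists>H. smooth_on (UNIV \<times> U) H \<and>
     (\<forall>z x. z \<noteq> 0 \<longrightarrow> x \<in> U \<longrightarrow> h (z, x) = inverse z ^ a * cnj (inverse z) ^ b * H (inverse z, x)))"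

lemma decayingI:
  assumes "smooth_on (UNIV \<times> U) h" "smooth_on (UNIV \<times> U) H"
    "\<And>z x. z \<noteq> 0 \<Longrightarrow> x \<in> U \<Longrightarrow> h (z, x) = inverse z ^ a * cnj (inverse z) ^ b * H (inverse z, x)"
  shows "decaying a b U h"
  using assms unfolding decaying_def by blast

lemma decaying_smooth: "decaying a b U h \<Longrightarrow> smooth_on (UNIV \<times> U) h"
  by (simp add: decaying_def)

lemma has_derivative_linear_expand:
  assumes "(f has_derivative D) F"
  shows "D (c, y) = Re c *\<^sub>R D (1, 0) + Im c *\<^sub>R D (\<i>, 0) + D (0, y)"
proof -
  have l: "linear D" using assms has_derivative_linear by blast
  have eq: "(c, y) = (Re c *\<^sub>R (1, 0) + Im c *\<^sub>R (\<i>, 0)) + (0, y)"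
    by (auto simp: complex_eq_iff)
  show ?thesis by (subst eq) (simp only: linear_add[OF l] linear_cmul[OF l])
qed

text \<open>In the coordinate w = 1/z the differentials of w and of its conjugate carry the factor
  w^2 and its conjugate. These restore the power lost in differentiating the prefactor and are
  smooth at w = 0, so no order of decay is lost.\<close>

lemma decaying_frechet_derivative:
  fixes h :: "complex \<times> 'x::euclidean_space \<Rightarrow> complex"
  assumes U: "open U" and dec: "decaying a b U h"
  shows "decaying a b U (\<lambda>p. frechet_derivative h (at p) v)"
proof -
  obtain c y where v: "v = (c, y)" by (cases v)
  from dec obtain H where h: "smooth_on (UNIV \<times> U) h" and H: "smooth_on (UNIV \<times> U) H"
    and hH: "\<And>z x. z \<noteq> 0 \<Longrightarrow> x \<in> U \<Longrightarrow> h (z, x) = inverse z ^ a * cnj (inverse z) ^ b * H (inverse z, x)"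
    unfolding decaying_def by blast
  have o: "open (UNIV \<times> U :: (complex \<times> 'x) set)" using U by (simp add: open_Times)
  define S where "S = (- {0::complex}) \<times> U"
  have oS: "open S" unfolding S_def using U by (auto intro: open_Times)
  \<comment> \<open>The product rule for
    \<open>inverse z ^ a * cnj (inverse z) ^ b * H (inverse z, x)\<close> with the prefactor taken
    out; the direction in which \<open>H\<close> is differentiated moves with the point and is
    expanded along 1 and \<i>.\<close>
  define H' where "H' p = - (of_nat a * fst p * c + of_nat b * cnj (fst p) * cnj c) * H p
     + (Re (- ((fst p)\<^sup>2 * c)) *\<^sub>R frechet_derivative H (at p) (1, 0)
        + Im (- ((fst p)\<^sup>2 * c)) *\<^sub>R frechet_derivative H (at p) (\<i>, 0) + frechet_derivative H (at p) (0, y))" for p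
  show ?thesis
  proof (rule decayingI[where H=H'])
    show "smooth_on (UNIV \<times> U) (\<lambda>p. frechet_derivative h (at p) v)"
      by (rule smooth_on_frechet_derivative[OF h])
    show "smooth_on (UNIV \<times> U) H'"
      unfolding H'_def[abs_def]
      by (intro smooth_intros o H smooth_on_frechet_derivative)
    fix z x assume z: "z \<noteq> (0::complex)" and x: "x \<in> U"
    define w where "w = inverse z"
    have w: "w \<noteq> 0" using z by (simp add: w_def)
    define D where "D = frechet_derivative H (at (w, x))"
    have D: "(H has_derivative D) (at (w, x))"
      unfolding D_def using smooth_on_has_derivative[OF H] x by auto
    define j where "j p = (inverse (fst p), snd p)" for p :: "complex \<times> 'x"
    have j: "(j has_derivative (\<lambda>v. (- (w * fst v * w), snd v))) (at (z, x))"
      unfolding j_def[abs_def] w_def using z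
      by (auto intro!: derivative_eq_intros has_derivative_inverse)
    have jz: "j (z, x) = (w, x)" by (simp add: j_def w_def)
    have Hj: "((\<lambda>p. H (j p)) has_derivative (\<lambda>v. D (- (w * fst v * w), snd v))) (at (z, x))"
      using has_derivative_compose[OF j, of H D] D jz by simp
    have w1: "((\<lambda>p. inverse (fst p)) has_derivative (\<lambda>v. - (w * fst v * w))) (at (z, x))"
      unfolding w_def using z by (auto intro!: derivative_eq_intros has_derivative_inverse)
    have wa: "((\<lambda>p. inverse (fst p) ^ a) has_derivative (\<lambda>v. of_nat a * (- (w * fst v * w)) * w ^ (a - 1))) (at (z, x))"
      using has_derivative_power[OF w1, of a] by (simp add: w_def)
    have wb: "((\<lambda>p. cnj (inverse (fst p)) ^ b) has_derivative (\<lambda>v. of_nat b * cnj (- (w * fst v * w)) * cnj w ^ (b - 1))) (at (z, x))"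
      using has_derivative_power[OF bounded_linear.has_derivative[OF bounded_linear_cnj w1], of b] by (simp add: w_def)
    have "((\<lambda>p. inverse (fst p) ^ a * cnj (inverse (fst p)) ^ b * H (j p)) has_derivative
       (\<lambda>v. w ^ a * cnj w ^ b * D (- (w * fst v * w), snd v) +
         (w ^ a * (of_nat b * cnj (- (w * fst v * w)) * cnj w ^ (b - 1)) + (of_nat a * (- (w * fst v * w)) * w ^ (a - 1)) * cnj w ^ b) * H (w, x))) (at (z, x))"
      using has_derivative_mult[OF has_derivative_mult[OF wa wb] Hj] by (simp add: w_def j_def)
    then have "(h has_derivative
       (\<lambda>v. w ^ a * cnj w ^ b * D (- (w * fst v * w), snd v) +
         (w ^ a * (of_nat b * cnj (- (w * fst v * w)) * cnj w ^ (b - 1)) + (of_nat a * (- (w * fst v * w)) * w ^ (a - 1)) * cnj w ^ b) * H (w, x))) (at (z, x))"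
    proof (rule has_derivative_transform_within_open[OF _ oS])
      show "(z, x) \<in> S" using z x by (simp add: S_def)
      show "inverse (fst p) ^ a * cnj (inverse (fst p)) ^ b * H (j p) = h p" if "p \<in> S" for p
        using hH[of "fst p" "snd p"] that by (cases p) (simp add: S_def j_def)
    qed
    then have "frechet_derivative h (at (z, x)) v = w ^ a * cnj w ^ b * D (- (w * c * w), y) +
         (w ^ a * (of_nat b * cnj (- (w * c * w)) * cnj w ^ (b - 1)) + (of_nat a * (- (w * c * w)) * w ^ (a - 1)) * cnj w ^ b) * H (w, x)"
      by (simp only: frechet_derivative_at[symmetric] v fst_conv snd_conv)
    also have "w ^ a * (of_nat b * cnj (- (w * c * w)) * cnj w ^ (b - 1)) = w ^ a * cnj w ^ b * (- (of_nat b * cnj w * cnj c))"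
      by (cases b) (simp_all add: mult_ac)
    also have "(of_nat a * (- (w * c * w)) * w ^ (a - 1)) * cnj w ^ b = w ^ a * cnj w ^ b * (- (of_nat a * w * c))"
      by (cases a) (simp_all add: mult_ac)
    also have "D (- (w * c * w), y) = Re (- (w\<^sup>2 * c)) *\<^sub>R D (1, 0) + Im (- (w\<^sup>2 * c)) *\<^sub>R D (\<i>, 0) + D (0, y)"
      using has_derivative_linear_expand[OF D, of "- (w\<^sup>2 * c)" y] by (simp add: power2_eq_square mult_ac)
    also have "w ^ a * cnj w ^ b * (Re (- (w\<^sup>2 * c)) *\<^sub>R D (1, 0) + Im (- (w\<^sup>2 * c)) *\<^sub>R D (\<i>, 0) + D (0, y)) +
       (w ^ a * cnj w ^ b * (- (of_nat b * cnj w * cnj c)) + w ^ a * cnj w ^ b * (- (of_nat a * w * c))) * H (w, x)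
       = w ^ a * cnj w ^ b * H' (w, x)"
      unfolding H'_def fst_conv D_def[symmetric] by (simp only: distrib_left distrib_right mult_minus_left mult_minus_right minus_add_distrib) (simp only: mult_ac add_ac)
    finally show "frechet_derivative h (at (z, x)) v = inverse z ^ a * cnj (inverse z) ^ b * H' (inverse z, x)"
      by (simp add: w_def)
  qed
qed

text \<open>Compactness bounds \<open>h\<close> on the unit disc and \<open>H\<close> on the disc
  around infinity, locally uniformly in \<open>x\<close>; the factor \<open>2 ^ n\<close> comes from
  1 + |z| \<le> 2 and 1 + |z| \<le> 2|z| respectively.\<close>

lemma decaying_bound:
  fixes h :: "complex \<times> 'x::euclidean_space \<Rightarrow> complex"
  assumes U: "open U" and dec: "decaying a b U h" and x0: "x0 \<in> U"
  shows "\<exists>r>0. \<exists>C\<ge>0. cball x0 r \<subseteq> U \<and> (\<forall>x\<in>cball x0 r. \<forall>z. norm (h (z, x)) \<le> C / (1 + norm z) ^ (a + b))"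
proof -
  from dec obtain H where h: "smooth_on (UNIV \<times> U) h" and H: "smooth_on (UNIV \<times> U) H"
    and hH: "\<And>z x. z \<noteq> 0 \<Longrightarrow> x \<in> U \<Longrightarrow> h (z, x) = inverse z ^ a * cnj (inverse z) ^ b * H (inverse z, x)"
    unfolding decaying_def by blast
  obtain r where r: "r > 0" "cball x0 r \<subseteq> U" using U x0 open_contains_cball by blast
  define K where "K = cball (0::complex) 1 \<times> cball x0 r"
  have K: "compact K" "K \<subseteq> UNIV \<times> U" unfolding K_def using r by (auto intro: compact_Times)
  have "bounded (h ` K)" "bounded (H ` K)"
    using K continuous_on_subset[OF smooth_on_continuous_on[OF h] K(2)]
      continuous_on_subset[OF smooth_on_continuous_on[OF H] K(2)]
    by (auto intro!: compact_imp_bounded compact_continuous_image)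
  then obtain A B where A: "\<And>p. p \<in> K \<Longrightarrow> norm (h p) \<le> A" and B: "\<And>p. p \<in> K \<Longrightarrow> norm (H p) \<le> B"
    unfolding bounded_iff by (metis imageI)
  have "(0, x0) \<in> K" using r by (simp add: K_def)
  then have AB: "0 \<le> A" "0 \<le> B" using A B norm_ge_zero order_trans by blast+
  define n where "n = a + b"
  define C where "C = 2 ^ n * (A + B)"
  have "norm (h (z, x)) \<le> C / (1 + norm z) ^ n" if x: "x \<in> cball x0 r" for z x
  proof (cases "norm z \<le> 1")
    case True
    have "norm (h (z, x)) * (1 + norm z) ^ n \<le> A * 2 ^ n"
      using A[of "(z, x)"] True x AB by (intro mult_mono power_mono) (auto simp: K_def)
    also have "\<dots> \<le> C" using AB by (simp add: C_def algebra_simps)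
    finally show ?thesis by (simp add: pos_le_divide_eq add_pos_nonneg)
  next
    case False
    then have z: "z \<noteq> 0" "norm (inverse z) \<le> 1" by (auto simp: norm_inverse inverse_le_1_iff)
    have "norm (h (z, x)) = norm (inverse z) ^ n * norm (H (inverse z, x))"
      using hH[OF z(1) subsetD[OF r(2) x]] by (simp add: norm_mult norm_power n_def power_add norm_inverse)
    also have "\<dots> \<le> norm (inverse z) ^ n * B"
      using B[of "(inverse z, x)"] x z(2) by (intro mult_left_mono) (auto simp: K_def)
    finally have "norm (h (z, x)) * (1 + norm z) ^ n \<le> (norm (inverse z) ^ n * B) * (2 * norm z) ^ n"
      using False AB by (intro mult_mono power_mono) auto
    also have "\<dots> = (norm (inverse z) * norm z) ^ n * (2 ^ n * B)"
      by (simp only: power_mult_distrib mult_ac)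
    also have "norm (inverse z) * norm z = 1" using z(1) by (simp add: norm_inverse)
    also have "1 ^ n * (2 ^ n * B) \<le> C" using AB by (simp add: C_def)
    finally show ?thesis by (simp add: pos_le_divide_eq add_pos_nonneg)
  qed
  moreover have "C \<ge> 0" using AB by (simp add: C_def)
  ultimately show ?thesis using r unfolding n_def by blast
qed

text \<open>The shift is absorbed by 1 + |u| \<le> (1 + |z - u|)(1 + |z|). The bound is uniform over
  a neighbourhood of \<open>p\<close>, as differentiation under the integral requires.\<close>

lemma decaying_bound_translate:
  fixes h :: "complex \<times> 'x::euclidean_space \<Rightarrow> complex"
  assumes U: "open U" and dec: "decaying a b U h" and p: "p \<in> UNIV \<times> U"
  shows "\<exists>C\<ge>0. eventually (\<lambda>q. \<forall>u. norm (h (q - (u, 0))) \<le> C / (1 + norm u) ^ (a + b)) (nhds p)"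
proof -
  obtain z0 x0 where p0: "p = (z0, x0)" "x0 \<in> U" using p by auto
  from decaying_bound[OF U dec p0(2)] obtain r C where rC: "r > 0" "C \<ge> 0"
    "\<And>x z. x \<in> cball x0 r \<Longrightarrow> norm (h (z, x)) \<le> C / (1 + norm z) ^ (a + b)" by blast
  define M where "M = C * (2 + norm z0) ^ (a + b)"
  have "norm (h (q - (u, 0))) \<le> M / (1 + norm u) ^ (a + b)" if q: "dist q p < min r 1" for q u
  proof -
    obtain z x where qzx: "q = (z, x)" by (cases q)
    have d: "dist z z0 < 1" "dist x x0 < r"
      using q dist_fst_le[of q p] dist_snd_le[of q p] by (auto simp: qzx p0)
    have "norm z \<le> norm z0 + 1" using d(1) norm_triangle_ineq2[of z z0] by (simp add: dist_norm)
    then have nz: "1 + norm z \<le> 2 + norm z0" by simp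
    have "norm u \<le> norm (z - u) + norm z" by (metis add.commute norm_minus_commute norm_triangle_sub)
    then have "1 + norm u \<le> (1 + norm (z - u)) * (1 + norm z)"
    proof -
      have "(1 + norm (z - u)) * (1 + norm z) = 1 + norm (z - u) + norm z + norm z * norm (z - u)"
        by (simp add: algebra_simps)
      moreover have "0 \<le> norm z * norm (z - u)" by simp
      ultimately show ?thesis using \<open>norm u \<le> norm (z - u) + norm z\<close> by linarith
    qed
    also have "\<dots> \<le> (1 + norm (z - u)) * (2 + norm z0)" using nz by (intro mult_left_mono) auto
    finally have "(1 + norm u) ^ (a + b) \<le> ((1 + norm (z - u)) * (2 + norm z0)) ^ (a + b)"
      by (intro power_mono) auto
    then have "C * (1 + norm u) ^ (a + b) \<le> C * ((1 + norm (z - u)) * (2 + norm z0)) ^ (a + b)"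
      using rC(2) by (rule mult_left_mono)
    also have "\<dots> = M * (1 + norm (z - u)) ^ (a + b)"
      by (simp only: M_def power_mult_distrib mult_ac)
    finally have "C * (1 + norm u) ^ (a + b) \<le> M * (1 + norm (z - u)) ^ (a + b)" .
    moreover have "0 < (1 + norm u) ^ (a + b)" "0 < (1 + norm (z - u)) ^ (a + b)"
      by (simp_all add: add_pos_nonneg)
    ultimately have "C / (1 + norm (z - u)) ^ (a + b) \<le> M / (1 + norm u) ^ (a + b)"
      by (simp add: field_simps)
    moreover have "norm (h (z - u, x)) \<le> C / (1 + norm (z - u)) ^ (a + b)"
      using rC(3) d(2) by (simp add: dist_commute)
    ultimately show ?thesis by (simp add: qzx)
  qed
  then have "eventually (\<lambda>q. \<forall>u. norm (h (q - (u, 0))) \<le> M / (1 + norm u) ^ (a + b)) (nhds p)"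
    unfolding eventually_nhds_metric using rC(1) by (intro exI[of _ "min r 1"]) auto
  moreover have "M \<ge> 0" using rC by (simp add: M_def)
  ultimately show ?thesis by blast
qed


text \<open>A possible singularity sits in the kernel while the point enters only through
  \<open>h\<close>, so that derivatives fall on \<open>h\<close> alone. The kernels used are 1/u for
  the Cauchy transform and 1 for integration over the fibre.\<close>

definition fibre_conv :: "(complex \<Rightarrow> complex) \<Rightarrow> (complex \<times> 'x::euclidean_space \<Rightarrow> complex) \<Rightarrow> complex \<times> 'x \<Rightarrow> complex" where
  "fibre_conv \<kappa> h p = (\<integral>u. \<kappa> u * h (p - (u, 0)) \<partial>lborel)"

context
  fixes \<kappa> :: "complex \<Rightarrow> complex" and a b :: nat and U :: "'x::euclidean_space set"
  assumes U: "open U" and \<kappa>m: "\<kappa> \<in> borel_measurable borel"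
    and \<kappa>i: "integrable lborel (\<lambda>u. norm (\<kappa> u) / (1 + norm u) ^ (a + b))"
begin

lemma integrable_fibre_conv:
  assumes h: "continuous_on (UNIV \<times> U) h" and p: "p \<in> UNIV \<times> U"
    and C: "\<And>u. norm (h (p - (u, 0))) \<le> C / (1 + norm u) ^ (a + b)"
  shows "integrable lborel (\<lambda>u. \<kappa> u * h (p - (u, 0)))"
proof (rule Bochner_Integration.integrable_bound)
  show "integrable lborel (\<lambda>u. C * (norm (\<kappa> u) / (1 + norm u) ^ (a + b)))"
    using \<kappa>i by (rule integrable_mult_right)
  have "continuous_on UNIV (\<lambda>u. h (p - (u, 0)))"
    by (rule continuous_on_compose2[OF h]) (use p in \<open>auto intro!: continuous_intros\<close>)
  then show "(\<lambda>u. \<kappa> u * h (p - (u, 0))) \<in> borel_measurable lborel"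
    using \<kappa>m by (intro borel_measurable_times) (auto intro: borel_measurable_continuous_onI)
  show "AE u in lborel. norm (\<kappa> u * h (p - (u, 0))) \<le> norm (C * (norm (\<kappa> u) / (1 + norm u) ^ (a + b)))"
  proof (rule AE_I2)
    fix u
    have "norm (\<kappa> u * h (p - (u, 0))) \<le> norm (\<kappa> u) * (C / (1 + norm u) ^ (a + b))"
      unfolding norm_mult by (intro mult_left_mono C) auto
    also have "\<dots> = C * (norm (\<kappa> u) / (1 + norm u) ^ (a + b))" by simp
    also have "\<dots> \<le> norm (C * (norm (\<kappa> u) / (1 + norm u) ^ (a + b)))"
      unfolding real_norm_def by (rule abs_ge_self)
    finally show "norm (\<kappa> u * h (p - (u, 0))) \<le> norm (C * (norm (\<kappa> u) / (1 + norm u) ^ (a + b)))" .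
  qed
qed

lemma integrable_fibre_conv_decaying:
  assumes h: "decaying a b U h" and p: "p \<in> UNIV \<times> U"
  shows "integrable lborel (\<lambda>u. \<kappa> u * h (p - (u, 0)))"
proof -
  from decaying_bound_translate[OF U h p] obtain C where
    "eventually (\<lambda>q. \<forall>u. norm (h (q - (u, 0))) \<le> C / (1 + norm u) ^ (a + b)) (nhds p)" by blast
  from eventually_nhds_x_imp_x[OF this] show ?thesis
    using integrable_fibre_conv[OF smooth_on_continuous_on[OF decaying_smooth[OF h]] p] by blast
qed

text \<open>Differentiation under the integral in all variables at once, by dominated convergence of
  the difference quotients; the mean value inequality with constants uniform near \<open>p\<close>
  gives the majorant.\<close>

lemma fibre_conv_has_derivative:
  assumes h: "decaying a b U h" and p: "p \<in> UNIV \<times> U"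
  shows "(fibre_conv \<kappa> h has_derivative (\<lambda>v. fibre_conv \<kappa> (\<lambda>q. frechet_derivative h (at q) v) p)) (at p)"
proof -
  define D where "D v q = frechet_derivative h (at q) v" for v q
  have oU: "open (UNIV \<times> U :: (complex \<times> 'x) set)" using U by (simp add: open_Times)
  have hs: "smooth_on (UNIV \<times> U) h" by (rule decaying_smooth[OF h])
  have Dd: "decaying a b U (D v)" for v
    unfolding D_def[abs_def] by (rule decaying_frechet_derivative[OF U h])
  have hD: "(h has_derivative (\<lambda>v. D v q)) (at q)" if "q \<in> UNIV \<times> U" for q
    unfolding D_def using smooth_on_has_derivative[OF hs that] by simp
  have lin: "linear (\<lambda>v. D v q)" if "q \<in> UNIV \<times> U" for q
    using hD[OF that] has_derivative_linear by blast
  have inU: "q - (u, 0) \<in> UNIV \<times> U \<longleftrightarrow> q \<in> UNIV \<times> U" for q u by (cases q) auto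
  have int: "integrable lborel (\<lambda>u. \<kappa> u * h (q - (u, 0)))" "integrable lborel (\<lambda>u. \<kappa> u * D v (q - (u, 0)))"
    if "q \<in> UNIV \<times> U" for q v
    using integrable_fibre_conv_decaying[OF h that] integrable_fibre_conv_decaying[OF Dd that] by auto
  have bl: "bounded_linear (\<lambda>v. fibre_conv \<kappa> (D v) p)"
  proof -
    have "linear (\<lambda>v. fibre_conv \<kappa> (D v) p)"
    proof (rule linearI)
      fix v w :: "complex \<times> 'x" and c :: real
      have pu: "p - (u, 0) \<in> UNIV \<times> U" for u using inU p by blast
      have 1: "D (v + w) (p - (u, 0)) = D v (p - (u, 0)) + D w (p - (u, 0))"
        "D (c *\<^sub>R v) (p - (u, 0)) = c *\<^sub>R D v (p - (u, 0))" for u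
        by (rule linear_add[OF lin[OF pu]] linear_cmul[OF lin[OF pu]])+
      show "fibre_conv \<kappa> (D (v + w)) p = fibre_conv \<kappa> (D v) p + fibre_conv \<kappa> (D w) p"
        unfolding fibre_conv_def 1 distrib_left by (rule Bochner_Integration.integral_add) (rule int[OF p])+
      show "fibre_conv \<kappa> (D (c *\<^sub>R v)) p = c *\<^sub>R fibre_conv \<kappa> (D v) p"
        unfolding fibre_conv_def 1 mult_scaleR_right by simp
    qed
    then show ?thesis by (simp add: linear_conv_bounded_linear)
  qed
  \<comment> \<open>One constant per direction; the finitely many basis directions then share a
    neighbourhood, and linearity bounds the derivative in every direction.\<close>
  have "\<exists>C. \<forall>v. C v \<ge> 0 \<and> eventually (\<lambda>q. \<forall>u. norm (D v (q - (u, 0))) \<le> C v / (1 + norm u) ^ (a + b)) (nhds p)"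
    by (rule choice) (use decaying_bound_translate[OF U Dd p] in blast)
  then obtain C where C: "\<And>v. C v \<ge> 0"
    "\<And>v. eventually (\<lambda>q. \<forall>u. norm (D v (q - (u, 0))) \<le> C v / (1 + norm u) ^ (a + b)) (nhds p)" by blast
  have "eventually (\<lambda>q. q \<in> UNIV \<times> U \<and> (\<forall>e\<in>Basis. \<forall>u. norm (D e (q - (u, 0))) \<le> C e / (1 + norm u) ^ (a + b))) (nhds p)"
    by (intro eventually_conj eventually_ball_finite ballI C(2) eventually_nhds_in_open oU p) auto
  then obtain r where r: "r > 0" and rU: "\<And>q. dist q p < r \<Longrightarrow> q \<in> UNIV \<times> U"
    and rb: "\<And>q e u. dist q p < r \<Longrightarrow> e \<in> Basis \<Longrightarrow> norm (D e (q - (u, 0))) \<le> C e / (1 + norm u) ^ (a + b)"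
    unfolding eventually_nhds_metric by blast
  define B where "B = (\<Sum>e\<in>Basis. C (e :: complex \<times> 'x))"
  have Db: "norm (D v (q - (u, 0))) \<le> B / (1 + norm u) ^ (a + b) * norm v" if q: "dist q p < r" for q v u
  proof -
    have l: "linear (\<lambda>v. D v (q - (u, 0)))" using lin inU rU[OF q] by blast
    have "D v (q - (u, 0)) = D (\<Sum>e\<in>Basis. (v \<bullet> e) *\<^sub>R e) (q - (u, 0))"
      by (simp add: euclidean_representation)
    also have "\<dots> = (\<Sum>e\<in>Basis. (v \<bullet> e) *\<^sub>R D e (q - (u, 0)))"
      by (simp only: linear_sum[OF l] linear_cmul[OF l])
    also have "norm \<dots> \<le> (\<Sum>e\<in>Basis. norm v * (C e / (1 + norm u) ^ (a + b)))"
    proof (rule sum_norm_le)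
      fix e :: "complex \<times> 'x" assume e: "e \<in> Basis"
      show "norm ((v \<bullet> e) *\<^sub>R D e (q - (u, 0))) \<le> norm v * (C e / (1 + norm u) ^ (a + b))"
        unfolding norm_scaleR by (intro mult_mono Basis_le_norm[OF e] rb[OF q e]) auto
    qed
    also have "\<dots> = B / (1 + norm u) ^ (a + b) * norm v"
      by (simp add: B_def sum_divide_distrib sum_distrib_left sum_distrib_right mult_ac)
    finally show ?thesis .
  qed
  have mv: "norm (h (q - (u, 0)) - h (p - (u, 0))) \<le> B / (1 + norm u) ^ (a + b) * norm (q - p)"
    if q: "dist q p < r" for q u
  proof (rule differentiable_bound[of "ball p r" "\<lambda>q. h (q - (u, 0))" "\<lambda>q v. D v (q - (u, 0))"])
    fix q' assume q': "q' \<in> ball p r"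
    then have d: "dist q' p < r" by (simp add: dist_commute)
    have "((\<lambda>q. q - (u, 0)) has_derivative (\<lambda>v. v)) (at q')"
      by (auto intro!: derivative_eq_intros)
    from has_derivative_compose[OF this, of h] hD[of "q' - (u, 0)"] inU rU[OF d]
    show "((\<lambda>q. h (q - (u, 0))) has_derivative (\<lambda>v. D v (q' - (u, 0)))) (at q' within ball p r)"
      by (auto intro: has_derivative_at_withinI)
    show "onorm (\<lambda>v. D v (q' - (u, 0))) \<le> B / (1 + norm u) ^ (a + b)"
      by (rule onorm_le) (rule Db[OF d])
  qed (use q r in \<open>auto simp: dist_commute\<close>)
  show ?thesis
    unfolding has_derivative_iff_norm D_def[symmetric]
  proof (intro conjI bl)
    show "((\<lambda>q. norm (fibre_conv \<kappa> h q - fibre_conv \<kappa> h p - fibre_conv \<kappa> (D (q - p)) p) / norm (q - p)) \<longlongrightarrow> 0) (at p)"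
      unfolding tendsto_at_iff_sequentially o_def
    proof (intro allI impI)
      fix X :: "nat \<Rightarrow> complex \<times> 'x"
      assume X: "\<forall>i. X i \<in> UNIV - {p}" "X \<longlonglongrightarrow> p"
      then obtain N where N: "\<And>i. i \<ge> N \<Longrightarrow> dist (X i) p < r"
        using r unfolding lim_sequentially by blast
      \<comment> \<open>Dropping the first terms keeps the whole sequence in the ball on which the
        bounds hold.\<close>
      define Y where "Y i = X (i + N)" for i
      have Y: "Y \<longlonglongrightarrow> p" "\<And>i. Y i \<noteq> p" "\<And>i. dist (Y i) p < r"
        using X N LIMSEQ_ignore_initial_segment[OF X(2), of N] by (auto simp: Y_def[abs_def])
      define S where "S i u = \<kappa> u * ((h (Y i - (u, 0)) - h (p - (u, 0)) - D (Y i - p) (p - (u, 0))) / of_real (norm (Y i - p)))" for i u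
      have S_int: "(\<integral>u. S i u \<partial>lborel) = (fibre_conv \<kappa> h (Y i) - fibre_conv \<kappa> h p - fibre_conv \<kappa> (D (Y i - p)) p) / of_real (norm (Y i - p))" for i
      proof -
        note I = int(1)[OF rU[OF Y(3)[of i]]] int(1)[OF p] int(2)[OF p, of "Y i - p"]
        have "(\<integral>u. S i u \<partial>lborel) = (\<integral>u. (\<kappa> u * h (Y i - (u, 0)) - \<kappa> u * h (p - (u, 0)) - \<kappa> u * D (Y i - p) (p - (u, 0))) / of_real (norm (Y i - p)) \<partial>lborel)"
          by (rule Bochner_Integration.integral_cong) (auto simp: S_def algebra_simps diff_divide_distrib)
        also have "\<dots> = (\<integral>u. \<kappa> u * h (Y i - (u, 0)) - \<kappa> u * h (p - (u, 0)) - \<kappa> u * D (Y i - p) (p - (u, 0)) \<partial>lborel) / of_real (norm (Y i - p))"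
          by simp
        also have "(\<integral>u. \<kappa> u * h (Y i - (u, 0)) - \<kappa> u * h (p - (u, 0)) - \<kappa> u * D (Y i - p) (p - (u, 0)) \<partial>lborel)
           = fibre_conv \<kappa> h (Y i) - fibre_conv \<kappa> h p - fibre_conv \<kappa> (D (Y i - p)) p"
          unfolding fibre_conv_def using I by (simp only: Bochner_Integration.integral_diff Bochner_Integration.integrable_diff)
        finally show ?thesis .
      qed
      have "(\<lambda>i. \<integral>u. S i u \<partial>lborel) \<longlonglongrightarrow> (\<integral>u. 0 \<partial>(lborel :: complex measure))"
      proof (rule integral_dominated_convergence[where w="\<lambda>u. (2 * B) * (norm (\<kappa> u) / (1 + norm u) ^ (a + b))"])
        show "integrable lborel (\<lambda>u. (2 * B) * (norm (\<kappa> u) / (1 + norm u) ^ (a + b)))"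
          using \<kappa>i by (rule integrable_mult_right)
        show "S i \<in> borel_measurable lborel" for i
        proof -
          note I = int(1)[OF rU[OF Y(3)[of i]]] int(1)[OF p] int(2)[OF p, of "Y i - p"]
          have "integrable lborel (\<lambda>u. (\<kappa> u * h (Y i - (u, 0)) - \<kappa> u * h (p - (u, 0)) - \<kappa> u * D (Y i - p) (p - (u, 0))) / of_real (norm (Y i - p)))"
            by (intro integrable_divide Bochner_Integration.integrable_diff I)
          also have "(\<lambda>u. (\<kappa> u * h (Y i - (u, 0)) - \<kappa> u * h (p - (u, 0)) - \<kappa> u * D (Y i - p) (p - (u, 0))) / of_real (norm (Y i - p))) = S i"
            by (auto simp: S_def fun_eq_iff algebra_simps diff_divide_distrib)
          finally show ?thesis by (rule borel_measurable_integrable)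
        qed
        show "AE u in lborel. (\<lambda>i. S i u) \<longlonglongrightarrow> 0"
        proof (rule AE_I2)
          fix u :: complex
          have "(h has_derivative (\<lambda>v. D v (p - (u, 0)))) (at (p - (u, 0)))"
            using hD inU p by blast
          then have lim: "((\<lambda>y. norm (h y - h (p - (u, 0)) - D (y - (p - (u, 0))) (p - (u, 0))) / norm (y - (p - (u, 0)))) \<longlongrightarrow> 0) (at (p - (u, 0)))"
            unfolding has_derivative_iff_norm by blast
          have f: "filterlim (\<lambda>i. Y i - (u, 0)) (at (p - (u, 0))) sequentially"
            unfolding filterlim_at using Y(1,2) by (auto intro!: tendsto_intros)
          from filterlim_compose[OF lim f]
          have "(\<lambda>i. norm (h (Y i - (u, 0)) - h (p - (u, 0)) - D (Y i - p) (p - (u, 0))) / norm (Y i - p)) \<longlonglongrightarrow> 0"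
            by simp
          then have "(\<lambda>i. (h (Y i - (u, 0)) - h (p - (u, 0)) - D (Y i - p) (p - (u, 0))) / of_real (norm (Y i - p))) \<longlonglongrightarrow> 0"
            by (subst tendsto_norm_zero_iff[symmetric]) (simp add: norm_divide)
          then show "(\<lambda>i. S i u) \<longlonglongrightarrow> 0"
            unfolding S_def using tendsto_mult_right_zero by blast
        qed
        show "AE u in lborel. norm (S i u) \<le> (2 * B) * (norm (\<kappa> u) / (1 + norm u) ^ (a + b))" for i
        proof (rule AE_I2)
          fix u
          have pos: "norm (Y i - p) > 0" using Y(2) by simp
          have "norm (h (Y i - (u, 0)) - h (p - (u, 0)) - D (Y i - p) (p - (u, 0)))
             \<le> norm (h (Y i - (u, 0)) - h (p - (u, 0))) + norm (D (Y i - p) (p - (u, 0)))"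
            by (rule norm_triangle_ineq4)
          also have "\<dots> \<le> B / (1 + norm u) ^ (a + b) * norm (Y i - p) + B / (1 + norm u) ^ (a + b) * norm (Y i - p)"
            by (intro add_mono mv Db Y(3)) (use r in auto)
          finally have "norm (h (Y i - (u, 0)) - h (p - (u, 0)) - D (Y i - p) (p - (u, 0))) / norm (Y i - p) \<le> 2 * (B / (1 + norm u) ^ (a + b))"
            using pos by (simp add: pos_divide_le_eq)
          then have "norm (\<kappa> u) * (norm (h (Y i - (u, 0)) - h (p - (u, 0)) - D (Y i - p) (p - (u, 0))) / norm (Y i - p)) \<le> norm (\<kappa> u) * (2 * (B / (1 + norm u) ^ (a + b)))"
            by (intro mult_left_mono) auto
          then show "norm (S i u) \<le> (2 * B) * (norm (\<kappa> u) / (1 + norm u) ^ (a + b))"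
            by (simp add: S_def norm_mult norm_divide mult_ac)
        qed
      qed simp
      then have "(\<lambda>i. norm (\<integral>u. S i u \<partial>lborel)) \<longlonglongrightarrow> 0"
        by (simp add: tendsto_norm_zero_iff)
      then have "(\<lambda>i. norm (fibre_conv \<kappa> h (Y i) - fibre_conv \<kappa> h p - fibre_conv \<kappa> (D (Y i - p)) p) / norm (Y i - p)) \<longlonglongrightarrow> 0"
        by (simp add: S_int norm_divide)
      then show "(\<lambda>i. norm (fibre_conv \<kappa> h (X i) - fibre_conv \<kappa> h p - fibre_conv \<kappa> (D (X i - p)) p) / norm (X i - p)) \<longlonglongrightarrow> 0"
        unfolding Y_def by (rule LIMSEQ_offset)
    qed
  qed
qed

text \<open>Each derivative is again a convolution of the same kernel with a function decaying to
  the same orders, so the induction runs over all \<open>h\<close>.\<close>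

lemma smooth_on_fibre_conv:
  assumes "decaying a b U h"
  shows "smooth_on (UNIV \<times> U) (fibre_conv \<kappa> h)"
proof (rule smooth_onI_Suc)
  have oU: "open (UNIV \<times> U :: (complex \<times> 'x) set)" using U by (simp add: open_Times)
  fix m
  show "Ck_on m (UNIV \<times> U) (fibre_conv \<kappa> h)"
    using assms
  proof (induction m arbitrary: h)
    case 0
    have "fibre_conv \<kappa> h differentiable_on (UNIV \<times> U)"
      using fibre_conv_has_derivative[OF 0]
      unfolding differentiable_on_def differentiable_def by (blast intro: has_derivative_at_withinI)
    then show ?case by (simp add: differentiable_imp_continuous_on)
  next
    case (Suc m)
    show ?case
      by (rule Ck_on_Suc_has_derivative[OF oU fibre_conv_has_derivative[OF Suc.prems]])
         (auto intro!: Suc.IH decaying_frechet_derivative[OF U Suc.prems])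
  qed
qed

end

section \<open>Solving the Cauchy-Riemann equation along the fibres\<close>

definition dzbar :: "(complex \<times> 'x::euclidean_space \<Rightarrow> complex) \<Rightarrow> complex \<times> 'x \<Rightarrow> complex" where
  "dzbar f p = (frechet_derivative f (at p) (1, 0) + \<i> * frechet_derivative f (at p) (\<i>, 0)) / 2"

text \<open>The chain rule for the antiholomorphic derivative under a holomorphic change of variable
  whose derivative is multiplication by \<open>c\<close>.\<close>

lemma linear_antilinear_part:
  fixes D :: "complex \<Rightarrow> complex"
  assumes l: "linear D"
  shows "D c + \<i> * D (c * \<i>) = cnj c * (D 1 + \<i> * D \<i>)"
proof -
  have e: "D d = of_real (Re d) * D 1 + of_real (Im d) * D \<i>" for d
  proof -
    have "d = Re d *\<^sub>R 1 + Im d *\<^sub>R \<i>" by (auto simp: complex_eq_iff)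
    then have "D d = D (Re d *\<^sub>R 1 + Im d *\<^sub>R \<i>)" by (rule arg_cong)
    then show ?thesis by (simp only: linear_add[OF l] linear_cmul[OF l]) (simp add: scaleR_conv_of_real)
  qed
  have c: "cnj c = of_real (Re c) - \<i> * of_real (Im c)" by (auto simp: complex_eq_iff)
  show ?thesis unfolding e[of c] e[of "c * \<i>"] c by (simp add: algebra_simps)
qed

lemma has_field_derivative_of_dbar_0:
  fixes f :: "complex \<Rightarrow> complex"
  assumes f: "(f has_derivative D) (at z)" and D: "D 1 + \<i> * D \<i> = 0"
  shows "(f has_field_derivative D 1) (at z)"
proof -
  have l: "linear D" using f has_derivative_linear by blast
  have "\<i> * (D 1 + \<i> * D \<i>) = 0" by (simp add: D)
  then have Di: "D \<i> = \<i> * D 1" by (simp add: algebra_simps)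
  have "D v = D 1 * v" for v
  proof -
    have "v = Re v *\<^sub>R 1 + Im v *\<^sub>R \<i>" by (auto simp: complex_eq_iff)
    then have "D v = D (Re v *\<^sub>R 1 + Im v *\<^sub>R \<i>)" by (rule arg_cong)
    also have "\<dots> = (of_real (Re v) + of_real (Im v) * \<i>) * D 1"
      by (simp only: linear_add[OF l] linear_cmul[OF l] Di) (simp add: scaleR_conv_of_real algebra_simps)
    also have "of_real (Re v) + of_real (Im v) * \<i> = v" by (auto simp: complex_eq_iff)
    finally show ?thesis by (simp add: mult.commute)
  qed
  then have "D = (\<lambda>v. D 1 * v)" by (rule ext)
  then show ?thesis using f unfolding has_field_derivative_def by simp
qed

lemma slice_has_derivative:
  assumes "(f has_derivative D) (at (z, x))"
  shows "((\<lambda>z. f (z, x)) has_derivative (\<lambda>v. D (v, 0))) (at z)"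
proof -
  have "((\<lambda>z. (z, x)) has_derivative (\<lambda>v. (v, 0))) (at z)"
    by (auto intro!: derivative_eq_intros)
  from has_derivative_compose[OF this assms] show ?thesis .
qed

lemma decaying_slice_bound:
  fixes h :: "complex \<times> 'x::euclidean_space \<Rightarrow> complex"
  assumes "open U" "decaying a b U h" "x \<in> U"
  shows "\<exists>C\<ge>0. \<forall>z. norm (h (z, x)) \<le> C / (1 + norm z) ^ (a + b)"
proof -
  from decaying_bound[OF assms] obtain r C where "r > 0" "C \<ge> 0"
    "\<forall>x\<in>cball x r. \<forall>z. norm (h (z, x)) \<le> C / (1 + norm z) ^ (a + b)" by blast
  then show ?thesis by (intro exI[of _ C]) auto
qed

lemma slice_continuous:
  assumes "smooth_on (UNIV \<times> U) h" "x \<in> U"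
  shows "continuous_on UNIV (\<lambda>z::complex. h (z, x))"
  by (rule continuous_on_compose2[OF smooth_on_continuous_on[OF assms(1)]])
     (use assms(2) in \<open>auto intro!: continuous_intros\<close>)

lemma weight_le:
  assumes "m \<le> n" "0 \<le> C"
  shows "C / (1 + norm z) ^ n \<le> C / (1 + norm z) ^ m"
  using assms by (intro divide_left_mono power_increasing mult_pos_pos zero_less_power) (auto intro: add_pos_nonneg)

lemma decaying_integrable:
  fixes h :: "complex \<times> 'x::euclidean_space \<Rightarrow> complex"
  assumes "open U" "decaying a b U h" "x \<in> U" "a + b \<ge> 3"
  shows "integrable lborel (\<lambda>z. h (z, x))"
proof -
  from decaying_slice_bound[OF assms(1-3)] obtain C where C: "C \<ge> 0" "\<And>z. norm (h (z, x)) \<le> C / (1 + norm z) ^ (a + b)" by blast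
  show ?thesis
  proof (rule Bochner_Integration.integrable_bound)
    show "integrable lborel (\<lambda>z::complex. C * (1 / (1 + norm z) ^ (a + b)))"
      by (rule integrable_mult_right[OF integrable_plane_weight3[OF assms(4)]])
    show "(\<lambda>z. h (z, x)) \<in> borel_measurable lborel"
      using borel_measurable_continuous_onI[OF slice_continuous[OF decaying_smooth[OF assms(2)] assms(3)]] by simp
    show "AE z in lborel. norm (h (z, x)) \<le> norm (C * (1 / (1 + norm z) ^ (a + b)))"
      using C by (auto intro!: AE_I2)
  qed
qed

text \<open>Stokes' theorem on a fibre. Integrability is a separate hypothesis because decay of
  order 2 of \<open>F\<close>, and thus of its derivatives, does not by itself provide it.\<close>

lemma integral_dzbar_decaying:
  fixes F :: "complex \<times> 'x::euclidean_space \<Rightarrow> complex"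
  assumes U: "open U" and F: "decaying a b U F" and ab: "a + b \<ge> 2" and x: "x \<in> U"
    and int: "integrable lborel (\<lambda>z. dzbar F (z, x))"
  shows "(\<integral>z. dzbar F (z, x) \<partial>lborel) = 0"
proof -
  define D where "D z v = frechet_derivative F (at (z, x)) (v, 0)" for z v
  have s: "smooth_on (UNIV \<times> U) F" by (rule decaying_smooth[OF F])
  have dz: "dzbar F (z, x) = (D z 1 + \<i> * D z \<i>) / 2" for z by (simp add: dzbar_def D_def)
  obtain C where C: "C \<ge> 0" "\<And>z. norm (F (z, x)) \<le> C / (1 + norm z) ^ (a + b)"
    using decaying_slice_bound[OF U F x] by blast
  have "(\<integral>z. D z 1 + \<i> * D z \<i> \<partial>lborel) = 0"
  proof (rule integral_dbar_eq_0)
    show "((\<lambda>z. F (z, x)) has_derivative D z) (at z)" for z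
      unfolding D_def[abs_def] by (rule slice_has_derivative[OF smooth_on_has_derivative[OF s]]) (use x in auto)
    show "continuous_on UNIV (\<lambda>z. D z 1)" "continuous_on UNIV (\<lambda>z. D z \<i>)"
      unfolding D_def by (rule slice_continuous[OF smooth_on_frechet_derivative[OF s] x])+
    show "norm (F (z, x)) \<le> C / (1 + norm z) ^ 2" for z
      using C(2)[of z] weight_le[OF ab C(1), of z] by (rule order_trans)
    show "integrable lborel (\<lambda>z. D z 1 + \<i> * D z \<i>)"
    proof -
      have "(\<lambda>z. D z 1 + \<i> * D z \<i>) = (\<lambda>z. 2 * dzbar F (z, x))"
        by (simp only: dz) (auto simp: field_simps)
      then show ?thesis using integrable_mult_right[OF int, of 2] by (simp only:)
    qed
  qed
  then show ?thesis by (simp add: dz)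
qed

lemma tendsto_0_at_infinity_weight:
  fixes f :: "complex \<Rightarrow> complex"
  assumes "\<And>z. z \<noteq> 0 \<Longrightarrow> norm (f z) \<le> C / norm z"
  shows "(f \<longlongrightarrow> 0) at_infinity"
proof (rule Lim_null_comparison)
  show "eventually (\<lambda>z. norm (f z) \<le> C / norm z) at_infinity"
  proof -
    have "z \<noteq> 0" if "1 \<le> norm z" for z :: complex using that by auto
    then show ?thesis unfolding eventually_at_infinity using assms by blast
  qed
  have "((\<lambda>z::complex. C * inverse (norm z)) \<longlongrightarrow> C * 0) at_infinity"
    by (intro tendsto_intros tendsto_inverse_0_at_top filterlim_norm_at_top)
  then show "((\<lambda>z::complex. C / norm z) \<longlongrightarrow> 0) at_infinity" by (simp add: divide_inverse)
qed

lemma decaying_tendsto_0: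
  fixes h :: "complex \<times> 'x::euclidean_space \<Rightarrow> complex"
  assumes "open U" "decaying a b U h" "x \<in> U" "a + b \<ge> 1"
  shows "((\<lambda>z. h (z, x)) \<longlongrightarrow> 0) at_infinity"
proof -
  obtain C where C: "C \<ge> 0" "\<And>z. norm (h (z, x)) \<le> C / (1 + norm z) ^ (a + b)"
    using decaying_slice_bound[OF assms(1-3)] by blast
  show ?thesis
  proof (rule tendsto_0_at_infinity_weight)
    fix z :: complex assume z: "z \<noteq> 0"
    have "norm (h (z, x)) \<le> C / (1 + norm z) ^ 1"
      using C(2)[of z] weight_le[OF assms(4) C(1), of z] by (rule order_trans)
    also have "\<dots> \<le> C / norm z" using z C(1) by (intro divide_left_mono) (auto intro!: mult_pos_pos add_pos_nonneg)
    finally show "norm (h (z, x)) \<le> C / norm z" .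
  qed
qed

text \<open>The fibrewise form of the fact that a line bundle of negative degree on the projective
  line has no holomorphic sections: an entire function tending to 0 is 0.\<close>

lemma decaying_holomorphic_eq_0:
  fixes h :: "complex \<times> 'x::euclidean_space \<Rightarrow> complex"
  assumes U: "open U" and h: "decaying a b U h" and x: "x \<in> U" and ab: "a + b \<ge> 1"
    and dz: "\<And>z. dzbar h (z, x) = 0"
  shows "h (z, x) = 0"
proof (rule Liouville_weak_0[where f="\<lambda>z. h (z, x)"])
  have "((\<lambda>z. h (z, x)) has_field_derivative frechet_derivative h (at (z, x)) (1, 0)) (at z)" for z
    using has_field_derivative_of_dbar_0[OF slice_has_derivative[OF smooth_on_has_derivative[OF decaying_smooth[OF h]]]]
      dz[of z] x by (auto simp: dzbar_def)
  then show "(\<lambda>z. h (z, x)) holomorphic_on UNIV"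
    by (auto simp: holomorphic_on_def field_differentiable_def)
  show "((\<lambda>z. h (z, x)) \<longlongrightarrow> 0) at_infinity"
    by (rule decaying_tendsto_0[OF U h x ab])
qed

section \<open>The Cauchy transform along the fibres\<close>

definition cauchy_transform :: "(complex \<times> 'x::euclidean_space \<Rightarrow> complex) \<Rightarrow> complex \<times> 'x \<Rightarrow> complex" where
  "cauchy_transform h p = fibre_conv (\<lambda>u. 1 / u) h p / of_real fs_area"

lemma cauchy_kernel_integrable:
  assumes "n \<ge> 2"
  shows "integrable lborel (\<lambda>u::complex. norm (1 / u) / (1 + norm u) ^ n)"
proof (rule Bochner_Integration.integrable_bound[OF integrable_plane_weight])
  show "AE u::complex in lborel. norm (norm (1 / u) / (1 + norm u) ^ n) \<le> norm (1 / (norm u * (1 + norm u)\<^sup>2))"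
  proof (rule AE_I2)
    fix u :: complex
    have "1 / norm u / (1 + norm u) ^ n \<le> 1 / norm u / (1 + norm u) ^ 2"
      by (rule weight_le[OF assms]) simp
    then show "norm (norm (1 / u) / (1 + norm u) ^ n) \<le> norm (1 / (norm u * (1 + norm u)\<^sup>2))"
      by (simp add: norm_divide)
  qed
qed measurable

context
  fixes a b :: nat and U :: "'x::euclidean_space set"
  assumes U: "open U" and ab: "a + b \<ge> 2"
begin

lemma cauchy_kernel_measurable: "(\<lambda>u::complex. 1 / u) \<in> borel_measurable borel"
  by measurable

lemmas cauchy_conv_has_derivative = fibre_conv_has_derivative[OF U cauchy_kernel_measurable cauchy_kernel_integrable[OF ab]]

lemma smooth_on_cauchy_transform:
  assumes "decaying a b U h"
  shows "smooth_on (UNIV \<times> U) (cauchy_transform h)"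
proof -
  have "open (UNIV \<times> U :: (complex \<times> 'x) set)" using U by (simp add: open_Times)
  then show ?thesis
    unfolding cauchy_transform_def[abs_def] using fs_area_pos
    by (intro smooth_intros smooth_on_fibre_conv[OF U cauchy_kernel_measurable cauchy_kernel_integrable[OF ab] assms]) auto
qed

text \<open>Differentiation moves onto \<open>h\<close>, and the Cauchy-Pompeiu formula is applied
  to the reflected slice \<open>\<phi> u = h (p - (u, 0))\<close>. The reflection changes the sign
  of its derivatives, which cancels the sign in the formula.\<close>

lemma dzbar_cauchy_transform:
  assumes h: "decaying a b U h" and p: "p \<in> UNIV \<times> U"
  shows "dzbar (cauchy_transform h) p = h p"
proof -
  obtain z x where zx: "p = (z, x)" "x \<in> U" using p by auto
  define D where "D v q = frechet_derivative h (at q) v" for v q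
  have s: "smooth_on (UNIV \<times> U) h" by (rule decaying_smooth[OF h])
  have Dd: "decaying a b U (D v)" for v
    unfolding D_def[abs_def] by (rule decaying_frechet_derivative[OF U h])
  have "(cauchy_transform h has_derivative (\<lambda>v. fibre_conv (\<lambda>u. 1 / u) (D v) p / of_real fs_area)) (at p)"
    unfolding cauchy_transform_def[abs_def] divide_inverse D_def[abs_def]
    by (rule has_derivative_mult_left[OF cauchy_conv_has_derivative[OF h p, unfolded divide_inverse]])
  then have "dzbar (cauchy_transform h) p = (fibre_conv (\<lambda>u. 1 / u) (D (1, 0)) p + \<i> * fibre_conv (\<lambda>u. 1 / u) (D (\<i>, 0)) p) / (2 * of_real fs_area)"
    unfolding dzbar_def by (simp add: frechet_derivative_at[symmetric] add_divide_distrib mult.commute[of "complex_of_real fs_area"])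
  also have "fibre_conv (\<lambda>u. 1 / u) (D (1, 0)) p + \<i> * fibre_conv (\<lambda>u. 1 / u) (D (\<i>, 0)) p
     = (\<integral>u. (1 / u) * D (1, 0) (p - (u, 0)) + \<i> * ((1 / u) * D (\<i>, 0) (p - (u, 0))) \<partial>lborel)"
  proof -
    note I = integrable_fibre_conv_decaying[OF U cauchy_kernel_measurable cauchy_kernel_integrable[OF ab] Dd p]
    show ?thesis unfolding fibre_conv_def
      by (simp only: Bochner_Integration.integral_add[OF I integrable_mult_right[OF I]] integral_mult_right_zero)
  qed
  also have "\<dots> = (\<integral>u. - ((- D (1, 0) (p - (u, 0)) + \<i> * (- D (\<i>, 0) (p - (u, 0)))) / u) \<partial>lborel)"
    by (rule Bochner_Integration.integral_cong) (simp_all add: diff_divide_distrib)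
  also have "\<dots> = 2 * of_real fs_area * h p"
  proof -
    define \<phi> where "\<phi> u = h (p - (u, 0))" for u
    define D' where "D' u v = - D (v, 0) (p - (u, 0))" for u v
    obtain C1 where C1: "C1 \<ge> 0" "\<And>u. norm (h (p - (u, 0))) \<le> C1 / (1 + norm u) ^ (a + b)"
      using decaying_bound_translate[OF U h p] eventually_nhds_x_imp_x by blast
    obtain C2 where C2: "C2 \<ge> 0" "\<And>u. norm (D (1, 0) (p - (u, 0))) \<le> C2 / (1 + norm u) ^ (a + b)"
      using decaying_bound_translate[OF U Dd p] eventually_nhds_x_imp_x by blast
    obtain C3 where C3: "C3 \<ge> 0" "\<And>u. norm (D (\<i>, 0) (p - (u, 0))) \<le> C3 / (1 + norm u) ^ (a + b)"
      using decaying_bound_translate[OF U Dd p] eventually_nhds_x_imp_x by blast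
    have cD: "continuous_on UNIV (\<lambda>u. D v (p - (u, 0)))" for v
      by (rule continuous_on_compose2[OF smooth_on_continuous_on[OF decaying_smooth[OF Dd]]])
         (use p in \<open>auto intro!: continuous_intros\<close>)
    have "(\<integral>u. (D' u 1 + \<i> * D' u \<i>) / u \<partial>lborel) = - 2 * of_real fs_area * \<phi> 0"
    proof (rule cauchy_pompeiu[where C="C1 + C2 + C3"])
      show "(\<phi> has_derivative D' u) (at u)" for u
      proof -
        have 1: "((\<lambda>u. p - (u, 0)) has_derivative (\<lambda>v. - (v, 0))) (at u)"
          by (auto intro!: derivative_eq_intros)
        have "p - (u, 0) \<in> UNIV \<times> U" using zx by simp
        note 2 = smooth_on_has_derivative[OF s this]
        have "linear (frechet_derivative h (at (p - (u, 0))))" using 2 has_derivative_linear by blast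
        then have "frechet_derivative h (at (p - (u, 0))) (- (v, 0)) = D' u v" for v
          unfolding D'_def D_def by (rule linear_neg)
        then show ?thesis using has_derivative_compose[OF 1 2] unfolding \<phi>_def[abs_def]
          by simp
      qed
      show "continuous_on UNIV (\<lambda>z. D' z 1)" "continuous_on UNIV (\<lambda>z. D' z \<i>)"
        unfolding D'_def by (intro continuous_intros cD)+
      show "norm (\<phi> u) \<le> (C1 + C2 + C3) / (1 + norm u) ^ 2" for u
      proof -
        have "norm (\<phi> u) \<le> C1 / (1 + norm u) ^ 2"
          unfolding \<phi>_def using C1(2)[of u] weight_le[OF ab C1(1), of u] by (rule order_trans)
        also have "\<dots> \<le> (C1 + C2 + C3) / (1 + norm u) ^ 2"
          using C2(1) C3(1) by (intro divide_right_mono) auto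
        finally show ?thesis .
      qed
      show "norm (D' u 1 + \<i> * D' u \<i>) \<le> (C1 + C2 + C3) / (1 + norm u) ^ 2" for u
      proof -
        have "norm (D' u 1 + \<i> * D' u \<i>) \<le> norm (D' u 1) + norm (\<i> * D' u \<i>)"
          by (rule norm_triangle_ineq)
        also have "\<dots> = norm (D (1, 0) (p - (u, 0))) + norm (D (\<i>, 0) (p - (u, 0)))"
          by (simp add: D'_def norm_mult)
        also have "\<dots> \<le> C2 / (1 + norm u) ^ 2 + C3 / (1 + norm u) ^ 2"
          using order_trans[OF C2(2)[of u] weight_le[OF ab C2(1)]] order_trans[OF C3(2)[of u] weight_le[OF ab C3(1)]]
          by (rule add_mono)
        also have "\<dots> = (C2 + C3) / (1 + norm u) ^ 2" by (simp add: add_divide_distrib)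
        also have "\<dots> \<le> (C1 + C2 + C3) / (1 + norm u) ^ 2"
          using C1(1) by (intro divide_right_mono) auto
        finally show ?thesis .
      qed
    qed
    moreover have "\<phi> 0 = h p" by (simp add: \<phi>_def zero_prod_def[symmetric])
    ultimately show ?thesis by (simp add: D'_def)
  qed
  finally show ?thesis using fs_area_pos by simp
qed

end

text \<open>Either |u| \<ge> |z|/2, and the kernel is at most 2/|z|; or |z - u| exceeds both |z|/2
  and |u|, and one of the three powers supplies the factor 1/|z| while the other two supply decay in
  u.\<close>

lemma cauchy_kernel_pointwise:
  fixes z u :: complex
  assumes z: "z \<noteq> 0" and u: "u \<noteq> 0"
  shows "1 / (1 + norm (z - u)) ^ 3 / norm u
     \<le> 2 / norm z * (1 / (1 + norm (z - u)) ^ 3 + 1 / (norm u * (1 + norm u)\<^sup>2))"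
proof (cases "norm u \<ge> norm z / 2")
  case True
  have "1 / (1 + norm (z - u)) ^ 3 / norm u \<le> 1 / (1 + norm (z - u)) ^ 3 / (norm z / 2)"
    using True z u by (intro divide_left_mono) auto
  also have "\<dots> = 2 / norm z * (1 / (1 + norm (z - u)) ^ 3)" by simp
  also have "\<dots> \<le> 2 / norm z * (1 / (1 + norm (z - u)) ^ 3 + 1 / (norm u * (1 + norm u)\<^sup>2))"
    by (intro mult_left_mono) auto
  finally show ?thesis .
next
  case False
  have "norm z \<le> norm (z - u) + norm u" by (metis add.commute norm_triangle_sub)
  then have 1: "norm z / 2 \<le> 1 + norm (z - u)" "1 + norm u \<le> 1 + norm (z - u)" using False by linarith+
  have "(norm z / 2) * (1 + norm u)\<^sup>2 \<le> (1 + norm (z - u)) * (1 + norm (z - u))\<^sup>2"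
    using 1 by (intro mult_mono power_mono) auto
  also have "\<dots> = (1 + norm (z - u)) ^ 3" by (simp add: power3_eq_cube power2_eq_square)
  finally have "1 / (1 + norm (z - u)) ^ 3 \<le> 1 / ((norm z / 2) * (1 + norm u)\<^sup>2)"
    using z by (intro divide_left_mono mult_pos_pos zero_less_power) (auto intro: add_pos_nonneg)
  then have "1 / (1 + norm (z - u)) ^ 3 / norm u \<le> 1 / ((norm z / 2) * (1 + norm u)\<^sup>2) / norm u"
    by (rule divide_right_mono) simp
  also have "\<dots> = 2 / norm z * (1 / (norm u * (1 + norm u)\<^sup>2))" by (simp add: mult_ac)
  also have "\<dots> \<le> 2 / norm z * (1 / (1 + norm (z - u)) ^ 3 + 1 / (norm u * (1 + norm u)\<^sup>2))"
    by (intro mult_left_mono) auto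
  finally show ?thesis .
qed

lemma
  fixes \<phi> :: "complex \<Rightarrow> complex"
  assumes m: "\<phi> \<in> borel_measurable borel" and bound: "\<And>u. norm (\<phi> u) \<le> C / (1 + norm u) ^ 3"
  shows cauchy_integrable: "z \<noteq> 0 \<Longrightarrow> integrable lborel (\<lambda>u. \<phi> (z - u) / u)"
    and cauchy_tendsto_0: "((\<lambda>z. \<integral>u. \<phi> (z - u) / u \<partial>lborel) \<longlongrightarrow> 0) at_infinity"
proof -
  note [measurable] = m
  have C: "0 \<le> C" using order_trans[OF norm_ge_zero bound[of 0]] by simp
  define W where "W z u = C * (2 / norm z * (1 / (1 + norm (z - u)) ^ 3 + 1 / (norm u * (1 + norm u)\<^sup>2)))" for z u :: complex
  define K where "K = 2 * C * ((\<integral>u. 1 / (1 + norm u) ^ 3 \<partial>(lborel :: complex measure)) + (\<integral>u. 1 / (norm u * (1 + norm u)\<^sup>2) \<partial>(lborel :: complex measure)))"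
  have i3: "integrable lborel (\<lambda>u. 1 / (1 + norm (z - u)) ^ 3)" for z :: complex
    using integrable_complex_reflect[of "\<lambda>u. 1 / (1 + norm u) ^ 3" z] integrable_plane_weight3[of 3] by simp
  have W: "integrable lborel (W z)" for z
    unfolding W_def[abs_def]
    by (intro integrable_mult_right Bochner_Integration.integrable_add i3 integrable_plane_weight)
  have intW: "(\<integral>u. W z u \<partial>lborel) = K / norm z" for z
  proof -
    have "(\<integral>u. W z u \<partial>lborel) = C * (2 / norm z * (\<integral>u. 1 / (1 + norm (z - u)) ^ 3 + 1 / (norm u * (1 + norm u)\<^sup>2) \<partial>lborel))"
      unfolding W_def by (simp only: integral_mult_right_zero)
    also have "\<dots> = C * (2 / norm z * ((\<integral>u. 1 / (1 + norm (z - u)) ^ 3 \<partial>lborel) + (\<integral>u. 1 / (norm u * (1 + norm u)\<^sup>2) \<partial>(lborel :: complex measure))))"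
      by (subst Bochner_Integration.integral_add[OF i3 integrable_plane_weight]) simp
    also have "(\<integral>u. 1 / (1 + norm (z - u)) ^ 3 \<partial>lborel) = (\<integral>u. 1 / (1 + norm u) ^ 3 \<partial>(lborel :: complex measure))"
      by (rule integral_complex_reflect) measurable
    finally show ?thesis by (simp add: K_def algebra_simps add_divide_distrib)
  qed
  have le: "AE u in lborel. norm (\<phi> (z - u) / u) \<le> W z u" if z: "z \<noteq> 0" for z
  proof -
    have "norm (\<phi> (z - u) / u) \<le> W z u" if "u \<noteq> 0" for u
    proof -
      have "norm (\<phi> (z - u) / u) \<le> C / (1 + norm (z - u)) ^ 3 / norm u"
        unfolding norm_divide by (intro divide_right_mono bound) auto
      also have "\<dots> = C * (1 / (1 + norm (z - u)) ^ 3 / norm u)" by simp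
      also have "\<dots> \<le> W z u" unfolding W_def
        by (rule mult_left_mono[OF cauchy_kernel_pointwise[OF z that] C])
      finally show ?thesis .
    qed
    then show ?thesis using AE_lborel_singleton[of "0::complex"] by (auto elim!: eventually_mono)
  qed
  show int: "integrable lborel (\<lambda>u. \<phi> (z - u) / u)" if z: "z \<noteq> 0" for z
  proof (rule Bochner_Integration.integrable_bound[OF W[of z]])
    show "AE u in lborel. norm (\<phi> (z - u) / u) \<le> norm (W z u)"
      using le[OF z] by eventually_elim simp
  qed measurable
  show "((\<lambda>z. \<integral>u. \<phi> (z - u) / u \<partial>lborel) \<longlongrightarrow> 0) at_infinity"
  proof (rule tendsto_0_at_infinity_weight)
    fix z :: complex assume z: "z \<noteq> 0"
    have "norm (\<integral>u. \<phi> (z - u) / u \<partial>lborel) \<le> (\<integral>u. W z u \<partial>lborel)"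
      by (rule order_trans[OF integral_norm_bound integral_mono_AE[OF integrable_norm[OF int[OF z]] W le[OF z]]])
    then show "norm (\<integral>u. \<phi> (z - u) / u \<partial>lborel) \<le> K / norm z" by (simp add: intW)
  qed
qed


text \<open>At infinity 1/(z - v) = 1/z + v/z^2 + ..., so the vanishing moments remove the two
  leading terms and the transform of \<open>h0\<close> is o(z^-2). The difference \<open>G\<close>
  of the two sides, written in w = 1/z, is holomorphic off 0, extends over 0 by this decay and tends
  to 0 at infinity, so it vanishes by Liouville's theorem.\<close>

lemma cauchy_transform_transition:
  fixes h0 h1 :: "complex \<times> 'x::euclidean_space \<Rightarrow> complex"
  assumes U: "open U" and h0: "smooth_on (UNIV \<times> U) h0" and h1: "smooth_on (UNIV \<times> U) h1"
    and trans: "\<And>z x. z \<noteq> 0 \<Longrightarrow> x \<in> U \<Longrightarrow> h1 (inverse z, x) = - (z ^ 3) * cnj z ^ 2 * h0 (z, x)"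
    and x: "x \<in> U"
    and mom: "(\<integral>z. h0 (z, x) \<partial>lborel) = 0" "(\<integral>z. z * h0 (z, x) \<partial>lborel) = 0"
    and z: "z \<noteq> 0"
  shows "cauchy_transform h1 (inverse z, x) = z ^ 3 * cauchy_transform h0 (z, x)"
proof -
  have oU: "open (UNIV \<times> U :: (complex \<times> 'x) set)" using U by (simp add: open_Times)
  have d0: "decaying 3 2 U h0"
  proof (rule decayingI[OF h0, of "\<lambda>p. - h1 p"])
    show "smooth_on (UNIV \<times> U) (\<lambda>p. - h1 p)" by (intro smooth_intros oU h1)
    show "h0 (z, x) = inverse z ^ 3 * cnj (inverse z) ^ 2 * - h1 (inverse z, x)" if "z \<noteq> 0" "x \<in> U" for z x
      using trans[OF that] that by (simp add: field_simps)
  qed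
  have d1: "decaying 3 2 U h1"
  proof (rule decayingI[OF h1, of "\<lambda>p. - h0 p"])
    show "smooth_on (UNIV \<times> U) (\<lambda>p. - h0 p)" by (intro smooth_intros oU h0)
    show "h1 (z, x) = inverse z ^ 3 * cnj (inverse z) ^ 2 * - h0 (inverse z, x)" if "z \<noteq> 0" "x \<in> U" for z x
      using trans[of "inverse z" x] that by simp
  qed
  have two: "(3::nat) + 2 \<ge> 2" by simp
  obtain C0 where C0: "C0 \<ge> 0" "\<And>z. norm (h0 (z, x)) \<le> C0 / (1 + norm z) ^ (3 + 2)"
    using decaying_slice_bound[OF U d0 x] by blast
  obtain C1 where C1: "C1 \<ge> 0" "\<And>z. norm (h1 (z, x)) \<le> C1 / (1 + norm z) ^ (3 + 2)"
    using decaying_slice_bound[OF U d1 x] by blast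
  have m0: "(\<lambda>z. h0 (z, x)) \<in> borel_measurable borel" and m1: "(\<lambda>z. h1 (z, x)) \<in> borel_measurable borel"
    by (rule borel_measurable_continuous_onI[OF slice_continuous[OF h0 x]] borel_measurable_continuous_onI[OF slice_continuous[OF h1 x]])+
  define g0 where "g0 z = cauchy_transform h0 (z, x)" for z
  define g1 where "g1 z = cauchy_transform h1 (z, x)" for z
  have g_eq: "g0 z = (\<integral>u. h0 (z - u, x) / u \<partial>lborel) / of_real fs_area"
    "g1 z = (\<integral>u. h1 (z - u, x) / u \<partial>lborel) / of_real fs_area" for z
    by (simp_all add: g0_def g1_def cauchy_transform_def fibre_conv_def)
  note s0 = smooth_on_cauchy_transform[OF U two d0] and s1 = smooth_on_cauchy_transform[OF U two d1]
  define D0 where "D0 z v = frechet_derivative (cauchy_transform h0) (at (z, x)) (v, 0)" for z v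
  define D1 where "D1 z v = frechet_derivative (cauchy_transform h1) (at (z, x)) (v, 0)" for z v
  have g0D: "(g0 has_derivative D0 z) (at z)" and g1D: "(g1 has_derivative D1 z) (at z)" for z
  proof -
    have "(z, x) \<in> UNIV \<times> U" using x by simp
    note D = slice_has_derivative[OF smooth_on_has_derivative[OF s0 this]] slice_has_derivative[OF smooth_on_has_derivative[OF s1 this]]
    show "(g0 has_derivative D0 z) (at z)" unfolding D0_def[abs_def] g0_def[abs_def] by (rule D)
    show "(g1 has_derivative D1 z) (at z)" unfolding D1_def[abs_def] g1_def[abs_def] by (rule D)
  qed
  have D0h: "D0 z 1 + \<i> * D0 z \<i> = 2 * h0 (z, x)" and D1h: "D1 z 1 + \<i> * D1 z \<i> = 2 * h1 (z, x)" for z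
    using dzbar_cauchy_transform[OF U two d0, of "(z, x)"] dzbar_cauchy_transform[OF U two d1, of "(z, x)"] x
    by (auto simp: dzbar_def D0_def D1_def)
  have lim1: "(g1 \<longlongrightarrow> 0) at_infinity" and lim0: "(g0 \<longlongrightarrow> 0) at_infinity"
  proof -
    have "norm (h1 (u, x)) \<le> C1 / (1 + norm u) ^ 3" "norm (h0 (u, x)) \<le> C0 / (1 + norm u) ^ 3" for u
      using order_trans[OF C1(2)[of u] weight_le[of 3 "3 + 2" C1 u]] C1(1)
        order_trans[OF C0(2)[of u] weight_le[of 3 "3 + 2" C0 u]] C0(1) by auto
    note b = this
    have fs: "complex_of_real fs_area \<noteq> 0" using fs_area_pos by simp
    show "(g1 \<longlongrightarrow> 0) at_infinity"
      using tendsto_divide[OF cauchy_tendsto_0[OF m1 b(1)] tendsto_const fs] by (simp add: g_eq(2)[abs_def])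
    show "(g0 \<longlongrightarrow> 0) at_infinity"
      using tendsto_divide[OF cauchy_tendsto_0[OF m0 b(2)] tendsto_const fs] by (simp add: g_eq(1)[abs_def])
  qed
  have lim2: "((\<lambda>z. z\<^sup>2 * g0 z) \<longlongrightarrow> 0) at_infinity"
  proof -
    define h2 where "h2 u = u\<^sup>2 * h0 (u, x)" for u
    have m2: "h2 \<in> borel_measurable borel" unfolding h2_def[abs_def] using m0 by measurable
    have b2: "norm (h2 u) \<le> C0 / (1 + norm u) ^ 3" for u
    proof -
      have "norm (h2 u) \<le> (1 + norm u) ^ 2 * (C0 / (1 + norm u) ^ (3 + 2))"
        unfolding h2_def norm_mult norm_power by (intro mult_mono power_mono C0(2)) auto
      also have "(1 + norm u) ^ (3 + 2) = (1 + norm u) ^ 2 * (1 + norm u) ^ 3"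
        unfolding power_add by (rule mult.commute)
      also have "(1 + norm u) ^ 2 * (C0 / ((1 + norm u) ^ 2 * (1 + norm u) ^ 3)) = C0 / (1 + norm u) ^ 3"
      proof -
        have "1 + norm u \<noteq> 0" using norm_ge_zero[of u] by linarith
        then have "(1 + norm u) ^ 2 \<noteq> 0" by (rule power_not_zero)
        from nonzero_mult_divide_mult_cancel_left[OF this, of C0 "(1 + norm u) ^ 3"]
        show ?thesis by (simp only: times_divide_eq_right)
      qed
      finally show ?thesis .
    qed
    have i0: "integrable lborel (\<lambda>z. h0 (z, x))" by (rule decaying_integrable[OF U d0 x]) simp
    have i1: "integrable lborel (\<lambda>z. z * h0 (z, x))"
    proof -
      have "decaying 2 2 U (\<lambda>p. fst p * h0 p)"
      proof (rule decayingI)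
        show "smooth_on (UNIV \<times> U) (\<lambda>p. fst p * h0 p)" "smooth_on (UNIV \<times> U) (\<lambda>p. - h1 p)"
          by (intro smooth_intros oU h0 h1)+
        show "fst (z, x) * h0 (z, x) = inverse z ^ 2 * cnj (inverse z) ^ 2 * - h1 (inverse z, x)" if "z \<noteq> 0" "x \<in> U" for z x
          using trans[OF that] that by (simp add: field_simps power3_eq_cube power2_eq_square)
      qed
      from decaying_integrable[OF U this x] show ?thesis by simp
    qed
    have "z\<^sup>2 * g0 z = (\<integral>u. h2 (z - u) / u \<partial>lborel) / of_real fs_area" if z: "z \<noteq> 0" for z
    proof -
      \<comment> \<open>By z^2/u = (z - u)^2/u + z + (z - u): the last two summands integrate
        \<open>h0\<close> against a polynomial of degree 1, which the vanishing moments
        annihilate.\<close>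
      define m where "m u = z * h0 (u, x) + u * h0 (u, x)" for u
      have mm: "m \<in> borel_measurable borel" unfolding m_def[abs_def] using m0 by measurable
      have im: "integrable lborel m" unfolding m_def[abs_def] using i0 i1 by (intro Bochner_Integration.integrable_add integrable_mult_right)
      have "integral\<^sup>L lborel m = z * (\<integral>u. h0 (u, x) \<partial>lborel) + (\<integral>u. u * h0 (u, x) \<partial>lborel)"
        unfolding m_def by (simp only: Bochner_Integration.integral_add[OF integrable_mult_right[OF i0] i1] integral_mult_right_zero)
      then have m_0: "(\<integral>u. m (z - u) \<partial>lborel) = 0"
        using integral_complex_reflect[OF mm, of z] mom by simp
      have im': "integrable lborel (\<lambda>u. m (z - u))" using integrable_complex_reflect[OF mm] im by simp
      have i2: "integrable lborel (\<lambda>u. h2 (z - u) / u)" by (rule cauchy_integrable[OF m2 b2 z])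
      have "z\<^sup>2 * (\<integral>u. h0 (z - u, x) / u \<partial>lborel) = (\<integral>u. z\<^sup>2 * (h0 (z - u, x) / u) \<partial>lborel)"
        by (simp only: integral_mult_right_zero)
      also have "\<dots> = (\<integral>u. h2 (z - u) / u + m (z - u) \<partial>lborel)"
      proof (rule integral_cong_AE)
        have "z\<^sup>2 * (h0 (z - u, x) / u) = h2 (z - u) / u + m (z - u)" if "u \<noteq> 0" for u
          using that by (simp add: h2_def m_def field_simps power2_eq_square)
        then show "AE u in lborel. z\<^sup>2 * (h0 (z - u, x) / u) = h2 (z - u) / u + m (z - u)"
          using AE_lborel_singleton[of "0::complex"] by (auto elim!: eventually_mono)
        have "(\<lambda>u. h0 (z - u, x)) \<in> borel_measurable borel"
          using measurable_compose[OF _ m0, of "\<lambda>u. z - u"] by measurable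
        then show "(\<lambda>u. z\<^sup>2 * (h0 (z - u, x) / u)) \<in> borel_measurable lborel" by measurable
        show "(\<lambda>u. h2 (z - u) / u + m (z - u)) \<in> borel_measurable lborel"
          using im' i2 by (intro borel_measurable_add) auto
      qed
      also have "\<dots> = (\<integral>u. h2 (z - u) / u \<partial>lborel)"
        by (simp add: Bochner_Integration.integral_add[OF i2 im'] m_0)
      finally show ?thesis by (simp add: g_eq)
    qed
    then have e: "(\<integral>u. h2 (z - u) / u \<partial>lborel) / of_real fs_area = z\<^sup>2 * g0 z" if "z \<noteq> 0" for z
      using that by (rule_tac sym)
    have ev: "eventually (\<lambda>z. (\<integral>u. h2 (z - u) / u \<partial>lborel) / of_real fs_area = z\<^sup>2 * g0 z) at_infinity"
      unfolding eventually_at_infinity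
    proof (intro exI[of _ 1] allI impI e)
      show "z \<noteq> 0" if "1 \<le> norm z" for z :: complex using that by auto
    qed
    have "((\<lambda>z. (\<integral>u. h2 (z - u) / u \<partial>lborel) / of_real fs_area) \<longlongrightarrow> 0 / of_real fs_area) at_infinity"
      using fs_area_pos by (intro tendsto_divide cauchy_tendsto_0[OF m2 b2] tendsto_const) auto
    then have "((\<lambda>z. (\<integral>u. h2 (z - u) / u \<partial>lborel) / of_real fs_area) \<longlongrightarrow> 0) at_infinity" by simp
    from Lim_transform_eventually[OF this ev] show ?thesis .
  qed
  define G where "G w = g1 w - g0 (inverse w) * inverse w ^ 3" for w
  have Gd: "G field_differentiable (at w)" if w: "w \<noteq> 0" for w
  proof -
    define v where "v = inverse w"
    have v: "v \<noteq> 0" using w by (simp add: v_def)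
    have inv: "(inverse has_derivative (\<lambda>h. - (v * h * v))) (at w)"
      unfolding v_def by (rule has_derivative_inverse'[OF w])
    have a: "((\<lambda>w. g0 (inverse w)) has_derivative (\<lambda>h. D0 v (- (v * h * v)))) (at w)"
      using has_derivative_compose[OF inv, of g0 "D0 v"] g0D by (simp add: v_def)
    have b: "((\<lambda>w. inverse w ^ 3) has_derivative (\<lambda>h. of_nat 3 * (- (v * h * v)) * v ^ (3 - 1))) (at w)"
      using has_derivative_power[OF inv, of 3] by (simp add: v_def)
    have G: "(G has_derivative (\<lambda>h. D1 w h - (g0 v * (of_nat 3 * (- (v * h * v)) * v ^ (3 - 1)) + D0 v (- (v * h * v)) * v ^ 3))) (at w)"
      unfolding G_def[abs_def] v_def
      by (rule has_derivative_diff[OF g1D has_derivative_mult[OF a[unfolded v_def] b[unfolded v_def]]])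
    have lD: "linear (D0 v)" by (rule has_derivative_linear[OF g0D])
    have A: "D0 v (- (v * 1 * v)) + \<i> * D0 v (- (v * \<i> * v)) = cnj (- (v * v)) * (2 * h0 (v, x))"
      using linear_antilinear_part[OF lD, of "- (v * v)"] by (simp add: D0h mult_ac)
    have B: "h1 (w, x) = - (v ^ 3) * cnj v ^ 2 * h0 (v, x)"
      using trans[OF v x] by (simp add: v_def)
    \<comment> \<open>The two antiholomorphic derivatives are \<open>2 * h1\<close> and the
      corresponding expression in \<open>h0\<close>; the transition rule of the forms makes them
      cancel.\<close>
    have anti: "(D1 w 1 - (g0 v * (of_nat 3 * (- (v * 1 * v)) * v ^ (3 - 1)) + D0 v (- (v * 1 * v)) * v ^ 3))
       + \<i> * (D1 w \<i> - (g0 v * (of_nat 3 * (- (v * \<i> * v)) * v ^ (3 - 1)) + D0 v (- (v * \<i> * v)) * v ^ 3)) = 0"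
    proof -
      have "(D1 w 1 - (g0 v * (of_nat 3 * (- (v * 1 * v)) * v ^ (3 - 1)) + D0 v (- (v * 1 * v)) * v ^ 3))
       + \<i> * (D1 w \<i> - (g0 v * (of_nat 3 * (- (v * \<i> * v)) * v ^ (3 - 1)) + D0 v (- (v * \<i> * v)) * v ^ 3))
       = (D1 w 1 + \<i> * D1 w \<i>) - v ^ 3 * (D0 v (- (v * 1 * v)) + \<i> * D0 v (- (v * \<i> * v)))"
        by (simp add: algebra_simps)
      also have "\<dots> = 0" unfolding A D1h B by (simp add: power2_eq_square mult_ac)
      finally show ?thesis .
    qed
    from has_field_derivative_of_dbar_0[OF G anti] show ?thesis
      unfolding field_differentiable_def by blast
  qed
  \<comment> \<open>By the decay of \<open>g0\<close>, multiplication by w gives a function tending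
    to 0 at 0. It is therefore entire with a zero at 0, and division by w extends
    \<open>G\<close>.\<close>
  define F where "F w = (if w = 0 then 0 else w * G w)" for w
  have "F holomorphic_on UNIV"
  proof -
    have "(\<lambda>w. w * G w) holomorphic_on UNIV - {0}"
    proof (rule holomorphic_on_mult[OF holomorphic_on_ident])
      show "G holomorphic_on UNIV - {0}"
        unfolding holomorphic_on_def by (rule ballI, rule field_differentiable_at_within, rule Gd) simp
    qed
    moreover have "((\<lambda>w. w * G w) \<longlongrightarrow> 0) (at 0)"
    proof -
      have "isCont g1 0" by (rule has_derivative_continuous[OF g1D])
      then have "((\<lambda>w. w * g1 w) \<longlongrightarrow> 0 * g1 0) (at 0)"
        by (rule tendsto_mult[OF tendsto_ident_at isContD])
      moreover have "((\<lambda>w. (inverse w)\<^sup>2 * g0 (inverse w)) \<longlongrightarrow> 0) (at 0)"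
        by (rule filterlim_compose[OF lim2 filterlim_inverse_at_infinity])
      ultimately have "((\<lambda>w. w * g1 w - (inverse w)\<^sup>2 * g0 (inverse w)) \<longlongrightarrow> 0 * g1 0 - 0) (at 0)"
        by (rule tendsto_diff)
      moreover have "eventually (\<lambda>w. w * g1 w - (inverse w)\<^sup>2 * g0 (inverse w) = w * G w) (at 0)"
      proof -
        have eq: "w * g1 w - (inverse w)\<^sup>2 * g0 (inverse w) = w * G w" if "w \<noteq> 0" for w
        proof -
          have e: "w * inverse w ^ 3 = (inverse w)\<^sup>2"
          proof -
            have "w * inverse w ^ 3 = (w * inverse w) * (inverse w)\<^sup>2"
              by (simp only: power3_eq_cube power2_eq_square mult.assoc)
            also have "w * inverse w = 1" using that by (rule right_inverse)
            finally show ?thesis by simp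
          qed
          have "w * G w = w * g1 w - (w * inverse w ^ 3) * g0 (inverse w)"
            by (simp only: G_def right_diff_distrib mult_ac)
          then show ?thesis unfolding e by (rule sym)
        qed
        show ?thesis unfolding eventually_at_filter
          by (intro always_eventually allI impI eq)
      qed
      ultimately have "((\<lambda>w. w * G w) \<longlongrightarrow> 0 * g1 0 - 0) (at 0)" by (rule Lim_transform_eventually)
      then show ?thesis by simp
    qed
    ultimately have "(\<lambda>y. if y = 0 then 0 else y * G y) holomorphic_on UNIV"
      by (intro removable_singularity) auto
    then show ?thesis by (simp add: F_def[abs_def])
  qed
  then have "(\<lambda>w. if w = 0 then deriv F 0 else G w - F 0 / (w - 0)) holomorphic_on UNIV"
    by (rule pole_theorem) (simp_all add: F_def)
  moreover have "F 0 = 0" by (simp add: F_def)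
  ultimately have K: "(\<lambda>w. if w = 0 then deriv F 0 else G w) holomorphic_on UNIV"
    by (simp cong: if_cong)
  have "(\<lambda>w. if w = 0 then deriv F 0 else G w) w = 0" for w
  proof (rule Liouville_weak_0[OF K])
    have "isCont g0 0" by (rule has_derivative_continuous[OF g0D])
    then have "((\<lambda>w. g0 (inverse w)) \<longlongrightarrow> g0 0) at_infinity"
      by (rule isCont_tendsto_compose[OF _ tendsto_inverse_0])
    then have "(G \<longlongrightarrow> 0 - g0 0 * 0 ^ 3) at_infinity"
      unfolding G_def[abs_def]
      by (rule tendsto_diff[OF lim1 tendsto_mult[OF _ tendsto_power[OF tendsto_inverse_0]]])
    moreover have "eventually (\<lambda>w. G w = (if w = 0 then deriv F 0 else G w)) at_infinity"
    proof -
      have "w \<noteq> 0" if "1 \<le> norm w" for w :: complex using that by auto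
      then show ?thesis unfolding eventually_at_infinity by (intro exI[of _ 1]) simp
    qed
    ultimately have "((\<lambda>w. if w = 0 then deriv F 0 else G w) \<longlongrightarrow> 0 - g0 0 * 0 ^ 3) at_infinity"
      by (rule Lim_transform_eventually)
    then show "((\<lambda>w. if w = 0 then deriv F 0 else G w) \<longlongrightarrow> 0) at_infinity" by simp
  qed
  from this[of "inverse z"] have "G (inverse z) = 0" using z by simp
  then show ?thesis by (simp add: G_def g0_def g1_def mult.commute)
qed

section \<open>Twistor coordinates\<close>

lemma hscale_nth [simp]: "hscale c \<xi> $ l = (c * fst (\<xi> $ l), c * snd (\<xi> $ l))"
  by (simp add: hscale_def)

lemma hscale_simps:
  "hscale c (x + y) = hscale c x + hscale c y"
  "hscale c (x - y) = hscale c x - hscale c y"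
  "hscale c (- x) = - hscale c x"
  "hscale (c + d) x = hscale c x + hscale d x"
  "hscale (c - d) x = hscale c x - hscale d x"
  "hscale (- c) x = - hscale c x"
  "hscale c (hscale d x) = hscale (c * d) x"
  "hscale 1 x = x" "hscale 0 x = 0" "hscale c 0 = 0"
  "hscale c (r *\<^sub>R x) = r *\<^sub>R hscale c x"
  "hscale (r *\<^sub>R c) x = r *\<^sub>R hscale c x"
  "hscale (of_real r) x = r *\<^sub>R x"
  by (simp_all add: vec_eq_iff prod_eq_iff algebra_simps scaleR_conv_of_real)

lemma bounded_bilinear_hscale: "bounded_bilinear (hscale :: complex \<Rightarrow> (complex \<times> complex) ^ 'n::finite \<Rightarrow> _)"
proof -
  have "bilinear (hscale :: complex \<Rightarrow> (complex \<times> complex) ^ 'n \<Rightarrow> _)"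
    unfolding bilinear_def by (auto intro!: linearI simp: hscale_simps)
  then show ?thesis by (simp add: bilinear_conv_bounded_bilinear)
qed

text \<open>Multiplication by a unit quaternion anticommuting with \<open>i\<close>, an antilinear map with square \<open>-1\<close>.\<close>

definition quatJ :: "(complex \<times> complex) ^ 'n::finite \<Rightarrow> (complex \<times> complex) ^ 'n" where
  "quatJ x = (\<chi> l. (- cnj (snd (x $ l)), cnj (fst (x $ l))))"

lemma quatJ_nth [simp]: "quatJ x $ l = (- cnj (snd (x $ l)), cnj (fst (x $ l)))"
  by (simp add: quatJ_def)

lemma quatJ_simps:
  "quatJ (x + y) = quatJ x + quatJ y" "quatJ (x - y) = quatJ x - quatJ y"
  "quatJ (- x) = - quatJ x" "quatJ (r *\<^sub>R x) = r *\<^sub>R quatJ x" "quatJ 0 = 0"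
  "quatJ (quatJ x) = - x" "quatJ (hscale c x) = hscale (cnj c) (quatJ x)"
  by (simp_all add: vec_eq_iff prod_eq_iff)

lemma bounded_linear_quatJ: "bounded_linear quatJ"
proof -
  have "linear (quatJ :: (complex \<times> complex) ^ 'n \<Rightarrow> _)"
    by (auto intro!: linearI simp: quatJ_simps)
  then show ?thesis by (simp add: linear_conv_bounded_linear)
qed

lemmas smooth_on_quatJ [smooth_intros] = smooth_on_bounded_linear_comp[OF bounded_linear_quatJ]
lemmas smooth_on_hscale [smooth_intros] = smooth_on_bounded_bilinear[OF bounded_bilinear_hscale]

text \<open>The operator a + bJ acting on x, with J antilinear and J^2 = -1; later identities about
  twistor coordinates are proved in this form.\<close>

lemma twistor_coord_eq: "twistor_coord a b x = hscale a x + hscale b (quatJ x)"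
  by (simp add: twistor_coord_def vec_eq_iff prod_eq_iff)

text \<open>As for quaternions, a + bJ is inverted by its conjugate, \<open>cnj a\<close> minus bJ,
  divided by |a|^2 + |b|^2.\<close>

definition twistor_inv :: "complex \<Rightarrow> complex \<Rightarrow> (complex \<times> complex) ^ 'n::finite \<Rightarrow> quat ^ 'n" where
  "twistor_inv a b \<xi> = hscale (inverse (a * cnj a + b * cnj b)) (hscale (cnj a) \<xi> - hscale b (quatJ \<xi>))"

lemma norm_pair_nonzero: "(a, b) \<noteq> (0, 0) \<Longrightarrow> a * cnj a + b * cnj b \<noteq> 0"
proof
  assume "a * cnj a + b * cnj b = 0" and ab: "(a, b) \<noteq> (0, 0)"
  then have "complex_of_real ((norm a)\<^sup>2 + (norm b)\<^sup>2) = 0" by (simp add: complex_norm_square[symmetric])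
  then have "(norm a)\<^sup>2 + (norm b)\<^sup>2 = 0" unfolding of_real_eq_0_iff .
  then show False using ab by (simp add: sum_power2_eq_zero_iff)
qed

lemma one_plus_norm_nonzero [simp]: "1 + z * cnj z \<noteq> 0" "z * cnj z + 1 \<noteq> 0"
  using norm_pair_nonzero[of 1 z] norm_pair_nonzero[of z 1] by simp_all

lemma twistor_inv_coord:
  assumes "(a, b) \<noteq> (0, 0)"
  shows "twistor_inv a b (twistor_coord a b x) = x"
proof -
  have "hscale (cnj a) (twistor_coord a b x) - hscale b (quatJ (twistor_coord a b x)) = hscale (a * cnj a + b * cnj b) x"
    by (simp add: twistor_coord_eq hscale_simps quatJ_simps mult.commute)
  then have "twistor_inv a b (twistor_coord a b x) = hscale (inverse (a * cnj a + b * cnj b) * (a * cnj a + b * cnj b)) x"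
    by (simp only: twistor_inv_def hscale_simps(7))
  then show ?thesis using norm_pair_nonzero[OF assms] by (simp add: hscale_simps(8))
qed

lemma twistor_coord_inv:
  assumes "(a, b) \<noteq> (0, 0)"
  shows "twistor_coord a b (twistor_inv a b \<xi>) = \<xi>"
proof -
  define d where "d = inverse (a * cnj a + b * cnj b)"
  have cd: "cnj d = d" by (simp add: d_def mult.commute)
  have "twistor_coord a b (twistor_inv a b \<xi>) = hscale (d * (a * cnj a + b * cnj b)) \<xi>"
    unfolding twistor_coord_eq twistor_inv_def d_def[symmetric]
    by (simp add: hscale_simps quatJ_simps cd distrib_left mult_ac)
  then show ?thesis using norm_pair_nonzero[OF assms] by (simp add: d_def hscale_simps)
qed

lemma twistor_coord_scale: "twistor_coord (c * a) (c * b) x = hscale c (twistor_coord a b x)"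
  by (simp add: twistor_coord_eq hscale_simps)

text \<open>Homogeneous representatives differ by a common factor, which scales the twistor
  coordinates along with [a : b]. All of them thus have the same base point \<open>x\<close>, and
  \<open>twistor_inv\<close> reads it off.\<close>

lemma proj_point_in_twistor_space:
  assumes ab: "(a, b) \<noteq> (0, 0)"
  shows "proj_point a b \<xi> \<in> twistor_space U \<longleftrightarrow> twistor_inv a b \<xi> \<in> U"
proof
  assume "proj_point a b \<xi> \<in> twistor_space U"
  then obtain a' b' x where x: "x \<in> U" "proj_point a b \<xi> = proj_point a' b' (twistor_coord a' b' x)"
    unfolding twistor_space_def by blast
  have "(a, b, \<xi>) \<in> proj_point a b \<xi>" unfolding proj_point_def by (intro CollectI exI[of _ 1]) (simp add: hscale_simps)
  with x(2) obtain c where "(a, b, \<xi>) = (c * a', c * b', hscale c (twistor_coord a' b' x))"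
    unfolding proj_point_def by auto
  then have "\<xi> = twistor_coord a b x" by (simp add: twistor_coord_scale)
  then show "twistor_inv a b \<xi> \<in> U" using twistor_inv_coord[OF ab, of x] x(1) by simp
next
  assume "twistor_inv a b \<xi> \<in> U"
  moreover have "proj_point a b \<xi> = proj_point a b (twistor_coord a b (twistor_inv a b \<xi>))"
    by (simp add: twistor_coord_inv[OF ab])
  ultimately show "proj_point a b \<xi> \<in> twistor_space U"
    unfolding twistor_space_def using ab by blast
qed

text \<open>The trivialisations by (z, x) and (w, x) are holomorphic along the fibres with fixed x,
  but not in x. The analysis takes place in these coordinates.\<close>

definition lift0 :: "complex \<times> (quat ^ 'n::finite) \<Rightarrow> 'n affine" where
  "lift0 p = (fst p, snd p + hscale (fst p) (quatJ (snd p)))"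

definition lift1 :: "complex \<times> (quat ^ 'n::finite) \<Rightarrow> 'n affine" where
  "lift1 p = (fst p, hscale (fst p) (snd p) + quatJ (snd p))"

definition unlift0 :: "'n::finite affine \<Rightarrow> complex \<times> (quat ^ 'n)" where
  "unlift0 p = (fst p, twistor_inv 1 (fst p) (snd p))"

definition unlift1 :: "'n::finite affine \<Rightarrow> complex \<times> (quat ^ 'n)" where
  "unlift1 p = (fst p, twistor_inv (fst p) 1 (snd p))"

lemma fibre_eq_lift: "fibre0 x z = lift0 (z, x)" "fibre1 x z = lift1 (z, x)"
  by (simp_all add: fibre0_def fibre1_def lift0_def lift1_def twistor_coord_eq hscale_simps)

lemma lift_simps [simp]:
  "unlift0 (lift0 p) = p" "unlift1 (lift1 p) = p" "lift0 (unlift0 q) = q" "lift1 (unlift1 q) = q"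
  "fst (lift0 p) = fst p" "fst (lift1 p) = fst p" "fst (unlift0 q) = fst q" "fst (unlift1 q) = fst q"
  using twistor_inv_coord[of 1 "fst p" "snd p"] twistor_inv_coord[of "fst p" 1 "snd p"]
    twistor_coord_inv[of 1 "fst q" "snd q"] twistor_coord_inv[of "fst q" 1 "snd q"]
  by (simp_all add: lift0_def lift1_def unlift0_def unlift1_def twistor_coord_eq hscale_simps prod_eq_iff)

lemma chart0_iff: "p \<in> chart0 U \<longleftrightarrow> snd (unlift0 p) \<in> U"
  by (cases p) (simp add: chart0_def unlift0_def proj_point_in_twistor_space)

lemma chart1_iff: "p \<in> chart1 U \<longleftrightarrow> snd (unlift1 p) \<in> U"
  by (cases p) (simp add: chart1_def unlift1_def proj_point_in_twistor_space)

lemma lift_in_chart: "lift0 p \<in> chart0 U \<longleftrightarrow> snd p \<in> U" "lift1 p \<in> chart1 U \<longleftrightarrow> snd p \<in> U"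
  by (simp_all add: chart0_iff chart1_iff)

lemma smooth_on_lift: "open S \<Longrightarrow> smooth_on S lift0" "open S \<Longrightarrow> smooth_on S lift1"
  unfolding lift0_def[abs_def] lift1_def[abs_def] by (intro smooth_intros; assumption)+

lemma smooth_on_unlift: "open S \<Longrightarrow> smooth_on S unlift0" "open S \<Longrightarrow> smooth_on S unlift1"
  unfolding unlift0_def[abs_def] unlift1_def[abs_def] twistor_inv_def
  by (intro smooth_intros; (assumption | simp))+

lemma open_chart: "open U \<Longrightarrow> open (chart0 U)" "open U \<Longrightarrow> open (chart1 U)"
proof -
  assume U: "open U"
  have "continuous_on UNIV (\<lambda>p. snd (unlift0 p))" "continuous_on UNIV (\<lambda>p. snd (unlift1 p))"
    by (intro continuous_on_snd smooth_on_continuous_on smooth_on_unlift open_UNIV)+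
  from open_vimage[OF U this(1)] open_vimage[OF U this(2)]
  moreover have "chart0 U = {p. snd (unlift0 p) \<in> U}" "chart1 U = {p. snd (unlift1 p) \<in> U}"
    by (auto simp: chart0_iff chart1_iff)
  ultimately show "open (chart0 U)" "open (chart1 U)" by (simp_all add: vimage_def)
qed

lemma smooth_on_comp_lift:
  assumes U: "open U"
  shows "smooth_on (chart0 U) F \<Longrightarrow> smooth_on (UNIV \<times> U) (\<lambda>p. F (lift0 p))"
    "smooth_on (chart1 U) F \<Longrightarrow> smooth_on (UNIV \<times> U) (\<lambda>p. F (lift1 p))"
    "smooth_on (UNIV \<times> U) f \<Longrightarrow> smooth_on (chart0 U) (\<lambda>p. f (unlift0 p))"
    "smooth_on (UNIV \<times> U) f \<Longrightarrow> smooth_on (chart1 U) (\<lambda>p. f (unlift1 p))"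
proof -
  have o: "open ((UNIV :: complex set) \<times> U)" using U by (simp add: open_Times)
  show "smooth_on (chart0 U) F \<Longrightarrow> smooth_on (UNIV \<times> U) (\<lambda>p. F (lift0 p))"
    by (rule smooth_on_compose[OF _ smooth_on_lift(1)[OF o] o open_chart(1)[OF U]]) (auto simp: lift_in_chart)
  show "smooth_on (chart1 U) F \<Longrightarrow> smooth_on (UNIV \<times> U) (\<lambda>p. F (lift1 p))"
    by (rule smooth_on_compose[OF _ smooth_on_lift(2)[OF o] o open_chart(2)[OF U]]) (auto simp: lift_in_chart)
  show "smooth_on (UNIV \<times> U) f \<Longrightarrow> smooth_on (chart0 U) (\<lambda>p. f (unlift0 p))"
    by (rule smooth_on_compose[OF _ smooth_on_unlift(1)[OF open_chart(1)[OF U]] open_chart(1)[OF U] o])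
       (auto simp: chart0_iff mem_Times_iff)
  show "smooth_on (UNIV \<times> U) f \<Longrightarrow> smooth_on (chart1 U) (\<lambda>p. f (unlift1 p))"
    by (rule smooth_on_compose[OF _ smooth_on_unlift(2)[OF open_chart(2)[OF U]] open_chart(2)[OF U] o])
       (auto simp: chart1_iff mem_Times_iff)
qed

lemma lift0_has_derivative:
  "(lift0 has_derivative (\<lambda>v. (fst v, snd v + (hscale z (quatJ (snd v)) + hscale (fst v) (quatJ x))))) (at (z, x))"
proof -
  have "((\<lambda>p. hscale (fst p) (quatJ (snd p))) has_derivative
     (\<lambda>v. hscale z (quatJ (snd v)) + hscale (fst v) (quatJ x))) (at (z, x))"
    using bounded_bilinear.FDERIV[OF bounded_bilinear_hscale bounded_linear_imp_has_derivative[OF bounded_linear_fst]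
       bounded_linear_imp_has_derivative[OF bounded_linear_compose[OF bounded_linear_quatJ bounded_linear_snd]], of "(z, x)"]
    by simp
  then show ?thesis unfolding lift0_def[abs_def]
    by (auto intro!: derivative_eq_intros)
qed

lemma fibre_frechet_derivative:
  "frechet_derivative (fibre0 x) (at z) 1 = (1, quatJ x)" "frechet_derivative (fibre1 x) (at z) 1 = (1, x)"
proof -
  have "((\<lambda>z. hscale z y) has_derivative (\<lambda>v. hscale v y)) (at z)" for y :: "(complex \<times> complex) ^ 'n"
    using bounded_bilinear.bounded_linear_left[OF bounded_bilinear_hscale] bounded_linear_imp_has_derivative by blast
  then have "((\<lambda>z. (z, x + hscale z (quatJ x))) has_derivative (\<lambda>v. (v, hscale v (quatJ x)))) (at z)"
    "((\<lambda>z. (z, hscale z x + quatJ x)) has_derivative (\<lambda>v. (v, hscale v x))) (at z)"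
    by (auto intro!: derivative_eq_intros)
  moreover have "fibre0 x = (\<lambda>z. (z, x + hscale z (quatJ x)))" "fibre1 x = (\<lambda>z. (z, hscale z x + quatJ x))"
    by (auto simp: fun_eq_iff fibre0_def fibre1_def twistor_coord_eq hscale_simps)
  ultimately show "frechet_derivative (fibre0 x) (at z) 1 = (1, quatJ x)" "frechet_derivative (fibre1 x) (at z) 1 = (1, x)"
    by (simp_all add: frechet_derivative_at[symmetric] hscale_simps)
qed

lemma pi_tau_eq:
  "pi_tau \<Omega> = ((\<lambda>(z, x). fst \<Omega> (lift0 (z, x)) (1, quatJ x)), (\<lambda>(w, x). snd \<Omega> (lift1 (w, x)) (1, x)))"
  by (simp add: pi_tau_def pullback_def fibre_frechet_derivative fibre_eq_lift)

lemma chart_change_has_derivative: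
  assumes "fst p \<noteq> 0"
  shows "(chart_change has_derivative (\<lambda>v. (- (inverse (fst p) * fst v * inverse (fst p)),
     hscale (inverse (fst p)) (snd v) + hscale (- (inverse (fst p) * fst v * inverse (fst p))) (snd p)))) (at p)"
proof -
  have i: "((\<lambda>p. inverse (fst p)) has_derivative (\<lambda>v. - (inverse (fst p) * fst v * inverse (fst p)))) (at p)"
    using assms by (auto intro!: derivative_eq_intros has_derivative_inverse)
  show ?thesis unfolding chart_change_def[abs_def]
    by (rule has_derivative_Pair[OF i bounded_bilinear.FDERIV[OF bounded_bilinear_hscale i
          bounded_linear_imp_has_derivative[OF bounded_linear_snd]]])
qed

lemma chart_change_frechet_derivative:
  assumes "fst p \<noteq> 0"
  shows "frechet_derivative chart_change (at p) v = (- (inverse (fst p) * fst v * inverse (fst p)),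
     hscale (inverse (fst p)) (snd v) + hscale (- (inverse (fst p) * fst v * inverse (fst p))) (snd p))"
  by (simp add: frechet_derivative_at[OF chart_change_has_derivative[OF assms], symmetric])

lemma chart_change_lift: "z \<noteq> 0 \<Longrightarrow> chart_change (lift0 (z, x)) = lift1 (inverse z, x)"
  by (simp add: chart_change_def lift0_def lift1_def hscale_simps)

text \<open>The fibre tangent of one chart goes to \<open>- ((inverse z)\<^sup>2)\<close> times that
  of the other, while slice directions scale by \<open>inverse z\<close>: the source of the
  different decay of the two kinds of components.\<close>

lemma chart_change_derivative_lift:
  assumes "z \<noteq> 0"
  shows "frechet_derivative chart_change (at (lift0 (z, x))) (1, quatJ x) = ascale (- ((inverse z)\<^sup>2)) (1, x)"
    "frechet_derivative chart_change (at (lift0 (z, x))) (0, e) = ascale (inverse z) (0, e)"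
  using assms by (simp_all add: chart_change_frechet_derivative ascale_def hscale_simps power2_eq_square)
    (simp add: lift0_def hscale_simps mult.assoc)

lemma ascale_simps:
  "ascale c (u + v) = ascale c u + ascale c v" "ascale c (r *\<^sub>R v) = r *\<^sub>R ascale c v"
  "ascale c (ascale d v) = ascale (c * d) v" "ascale 1 v = v" "ascale (of_real r) v = r *\<^sub>R v" "ascale (- c) v = - ascale c v"
  by (simp_all add: ascale_def hscale_simps prod_eq_iff algebra_simps scaleR_conv_of_real)

lemma vertical_decomposition: "v = ascale (fst v) (1, y) + (0, snd v - hscale (fst v) y)"
  by (simp add: ascale_def prod_eq_iff)

lemma conj_linear_simps:
  assumes "conj_linear g"
  shows "g (u + v) = g u + g v" "g (ascale c v) = cnj c * g v" "g (r *\<^sub>R v) = of_real r * g v"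
    "g (- v) = - g v" "g (u - v) = g u - g v" "g 0 = 0"
proof -
  show a: "g (u + v) = g u + g v" for u v using assms unfolding conj_linear_def by blast
  show s: "g (ascale c v) = cnj c * g v" for c v using assms unfolding conj_linear_def by blast
  show r: "g (r *\<^sub>R v) = of_real r * g v" for r v using s[of "of_real r" v] by (simp add: ascale_simps)
  show m: "g (- v) = - g v" for v using r[of "-1" v] by simp
  show "g (u - v) = g u - g v" using a[of u "- v"] m[of v] by simp
  show "g 0 = 0" using r[of 0 0] by simp
qed

text \<open>The vectors \<open>(1, y)\<close> and \<open>(0, e)\<close> span over the complex
  numbers; \<open>y\<close> will be \<open>quatJ x\<close> or \<open>x\<close>, which makes
  \<open>(1, y)\<close> the direction of the fibre through the point.\<close>

lemma conj_linear_eqI: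
  assumes "conj_linear g" "conj_linear g'" "g (1, y) = g' (1, y)" "\<And>e. g (0, e) = g' (0, e)"
  shows "g v = g' v"
  by (subst (1 2) vertical_decomposition[of v y])
     (simp only: conj_linear_simps(1,2)[OF assms(1)] conj_linear_simps(1,2)[OF assms(2)] assms(3,4))

section \<open>Horizontal vector fields\<close>

definition antilinear_part :: "((complex \<times> complex) ^ 'n::finite \<Rightarrow> complex) \<Rightarrow> (complex \<times> complex) ^ 'n \<Rightarrow> complex" where
  "antilinear_part A e = (A e + \<i> * A (hscale \<i> e)) / 2"

definition clinear_part :: "((complex \<times> complex) ^ 'n::finite \<Rightarrow> complex) \<Rightarrow> (complex \<times> complex) ^ 'n \<Rightarrow> complex" where
  "clinear_part A e = (A e - \<i> * A (hscale \<i> e)) / 2"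

lemma linear_hscale:
  assumes "linear A"
  shows "A (hscale c e) = of_real (Re c) * A e + of_real (Im c) * A (hscale \<i> e)"
proof -
  have "hscale c e = Re c *\<^sub>R e + Im c *\<^sub>R hscale \<i> e"
    by (simp add: vec_eq_iff prod_eq_iff complex_eq_iff)
  then have "A (hscale c e) = A (Re c *\<^sub>R e + Im c *\<^sub>R hscale \<i> e)" by (rule arg_cong)
  then show ?thesis by (simp only: linear_add[OF assms] linear_cmul[OF assms]) (simp add: scaleR_conv_of_real)
qed

lemma parts_hscale:
  assumes l: "linear A"
  shows "antilinear_part A (hscale c e) = cnj c * antilinear_part A e"
    "clinear_part A (hscale c e) = c * clinear_part A e"
proof -
  have c: "cnj c = of_real (Re c) - \<i> * of_real (Im c)" "c = of_real (Re c) + \<i> * of_real (Im c)"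
    by (auto simp: complex_eq_iff)
  have 1: "A (hscale \<i> (hscale c e)) = of_real (Re c) * A (hscale \<i> e) - of_real (Im c) * A e"
    using linear_hscale[OF l, of "\<i> * c" e] by (simp add: hscale_simps)
  show "antilinear_part A (hscale c e) = cnj c * antilinear_part A e"
    unfolding antilinear_part_def 1 linear_hscale[OF l, of c] c(1) by (simp add: field_simps)
  show "clinear_part A (hscale c e) = c * clinear_part A e"
    unfolding clinear_part_def 1 linear_hscale[OF l, of c] by (subst (5) c(2)) (simp add: field_simps)
qed

lemma parts_sum: "A e = clinear_part A e + antilinear_part A e"
  by (simp add: clinear_part_def antilinear_part_def field_simps)

lemma parts_linear:
  assumes l: "linear A"
  shows "antilinear_part A (x + y) = antilinear_part A x + antilinear_part A y"
    "clinear_part A (x + y) = clinear_part A x + clinear_part A y"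
    "antilinear_part A (- x) = - antilinear_part A x"
    "clinear_part A (- x) = - clinear_part A x"
    "antilinear_part A (r *\<^sub>R x) = r *\<^sub>R antilinear_part A x"
    "clinear_part A (r *\<^sub>R x) = r *\<^sub>R clinear_part A x"
  by (simp_all add: antilinear_part_def clinear_part_def hscale_simps linear_add[OF l] linear_neg[OF l] linear_cmul[OF l]
      scaleR_conv_of_real field_simps)

text \<open>\<open>quatJ\<close> exchanges types. With P and Q the linear and antilinear parts of
  \<open>A\<close>, the antilinear part of \<open>B\<close> at \<open>e\<close> is Q e + z P(J e),
  and its linear part at J e is P(J e) minus \<open>cnj z\<close> times Q e, because J^2 = -1. The
  combination removes P and collects 1 + |z|^2 in front of Q.\<close>

lemma twisted_antilinear_part:
  assumes l: "linear A" and B: "\<And>y. B y = A (y + hscale z (quatJ y))"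
  shows "antilinear_part B e - z * clinear_part B (quatJ e) = (1 + z * cnj z) * antilinear_part A e"
proof -
  define P where "P = clinear_part A"
  define Q where "Q = antilinear_part A"
  have PQ: "A x = P x + Q x" for x unfolding P_def Q_def by (rule parts_sum)
  have Ps: "P (hscale c x) = c * P x" "Q (hscale c x) = cnj c * Q x" "P (x + y) = P x + P y" "Q (x + y) = Q x + Q y"
     "P (- x) = - P x" "Q (- x) = - Q x" for c x y
    unfolding P_def Q_def by (simp_all add: parts_hscale[OF l] parts_linear[OF l])
  have Bs: "B y = P y + z * P (quatJ y) + (Q y + cnj z * Q (quatJ y))" for y
    by (simp add: B PQ Ps)
  show ?thesis
    unfolding antilinear_part_def[of B] clinear_part_def[of B] Bs quatJ_simps Ps Q_def[symmetric]
    by (simp add: field_simps)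
qed

definition xbar :: "(complex \<times> complex) ^ 'n::finite \<Rightarrow> (complex \<times> (quat ^ 'n) \<Rightarrow> complex) \<Rightarrow> complex \<times> (quat ^ 'n) \<Rightarrow> complex" where
  "xbar e f p = antilinear_part (\<lambda>y. frechet_derivative f (at p) (0, y)) e"

definition xhol :: "(complex \<times> complex) ^ 'n::finite \<Rightarrow> (complex \<times> (quat ^ 'n) \<Rightarrow> complex) \<Rightarrow> complex \<times> (quat ^ 'n) \<Rightarrow> complex" where
  "xhol e f p = clinear_part (\<lambda>y. frechet_derivative f (at p) (0, y)) e"

text \<open>The vector fields of type \<open>(0,1)\<close> that are tangent to the slices with fixed \<open>z\<close>, seen through
  the non-holomorphic trivialization.\<close>

definition horiz :: "(complex \<times> complex) ^ 'n::finite \<Rightarrow> (complex \<times> (quat ^ 'n) \<Rightarrow> complex) \<Rightarrow> complex \<times> (quat ^ 'n) \<Rightarrow> complex" where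
  "horiz e f p = xbar e f p - fst p * xhol (quatJ e) f p"

lemma slice_linear:
  assumes l: "linear D"
  shows "linear (\<lambda>y. D (0, y))"
proof (rule linearI)
  show "D (0, x + y) = D (0, x) + D (0, y)" for x y using linear_add[OF l, of "(0, x)" "(0, y)"] by simp
  show "D (0, r *\<^sub>R x) = r *\<^sub>R D (0, x)" for r x using linear_cmul[OF l, of r "(0, x)"] by simp
qed

lemma dbar_dir_slice: "dbar_dir F p (0, e) = antilinear_part (\<lambda>y. frechet_derivative F (at p) (0, y)) e"
  by (simp add: dbar_dir_def antilinear_part_def ascale_def)

text \<open>The fibre over x is a holomorphic curve with tangent \<open>(1, quatJ x)\<close>, whence
  the equation for \<open>dzbar\<close>; the one for \<open>horiz\<close> is the twisted identity
  applied to the derivative of \<open>F\<close> along the slice.\<close>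

lemma
  assumes F: "F differentiable (at (lift0 (z, x)))"
  shows dzbar_comp_lift0: "dzbar (\<lambda>p. F (lift0 p)) (z, x) = dbar_dir F (lift0 (z, x)) (1, quatJ x)"
    and horiz_comp_lift0: "horiz e (\<lambda>p. F (lift0 p)) (z, x) = (1 + z * cnj z) * dbar_dir F (lift0 (z, x)) (0, e)"
proof -
  define A where "A = frechet_derivative F (at (lift0 (z, x)))"
  have A: "(F has_derivative A) (at (lift0 (z, x)))" unfolding A_def using F frechet_derivative_works by blast
  have l: "linear A" by (rule has_derivative_linear[OF A])
  have fd: "frechet_derivative (\<lambda>p. F (lift0 p)) (at (z, x)) = (\<lambda>v. A (fst v, snd v + (hscale z (quatJ (snd v)) + hscale (fst v) (quatJ x))))"
    by (rule frechet_derivative_at[symmetric]) (rule has_derivative_compose[OF lift0_has_derivative A])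
  show "dzbar (\<lambda>p. F (lift0 p)) (z, x) = dbar_dir F (lift0 (z, x)) (1, quatJ x)"
    by (simp add: dzbar_def dbar_dir_def fd A_def[symmetric] hscale_simps quatJ_simps ascale_def)
  show "horiz e (\<lambda>p. F (lift0 p)) (z, x) = (1 + z * cnj z) * dbar_dir F (lift0 (z, x)) (0, e)"
    unfolding horiz_def xbar_def xhol_def dbar_dir_slice fd A_def[symmetric] fst_conv snd_conv
    by (rule twisted_antilinear_part[OF slice_linear[OF l]]) (simp add: hscale_simps)
qed

lemma smooth_on_xbar: "open S \<Longrightarrow> smooth_on S f \<Longrightarrow> smooth_on S (xbar e f)"
  unfolding xbar_def[abs_def] antilinear_part_def by (intro smooth_intros smooth_on_frechet_derivative) auto

lemma smooth_on_xhol: "open S \<Longrightarrow> smooth_on S f \<Longrightarrow> smooth_on S (xhol e f)"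
  unfolding xhol_def[abs_def] clinear_part_def by (intro smooth_intros smooth_on_frechet_derivative) auto

lemma smooth_on_horiz: "open S \<Longrightarrow> smooth_on S f \<Longrightarrow> smooth_on S (horiz e f)"
  unfolding horiz_def[abs_def] by (intro smooth_intros smooth_on_xbar smooth_on_xhol) auto

lemma horiz_has_derivative:
  fixes f :: "complex \<times> (quat ^ 'n::finite) \<Rightarrow> complex"
  assumes o: "open S" and f: "smooth_on S f" and p: "p \<in> S"
  defines "D u v \<equiv> frechet_derivative (\<lambda>q. frechet_derivative f (at q) u) (at p) v"
  shows "frechet_derivative (horiz e f) (at p) v =
     antilinear_part (\<lambda>y. D (0, y) v) e - fst p * clinear_part (\<lambda>y. D (0, y) v) (quatJ e) - fst v * xhol (quatJ e) f p"
proof -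
  have d: "((\<lambda>q. frechet_derivative f (at q) u) has_derivative D u) (at p)" for u
    unfolding D_def using smooth_on_has_derivative[OF smooth_on_frechet_derivative[OF f] p] by simp
  have a: "(xbar e f has_derivative (\<lambda>v. antilinear_part (\<lambda>y. D (0, y) v) e)) (at p)"
    unfolding xbar_def[abs_def] antilinear_part_def divide_inverse
    by (intro has_derivative_mult_left has_derivative_add has_derivative_mult_right d)
  have b: "(xhol (quatJ e) f has_derivative (\<lambda>v. clinear_part (\<lambda>y. D (0, y) v) (quatJ e))) (at p)"
    unfolding xhol_def[abs_def] clinear_part_def divide_inverse
    by (intro has_derivative_mult_left has_derivative_diff has_derivative_mult_right d)
  have "(horiz e f has_derivative (\<lambda>v. antilinear_part (\<lambda>y. D (0, y) v) e -
     (fst p * clinear_part (\<lambda>y. D (0, y) v) (quatJ e) + fst v * xhol (quatJ e) f p))) (at p)"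
    unfolding horiz_def[abs_def]
    by (intro has_derivative_diff[OF a] has_derivative_mult[OF bounded_linear_imp_has_derivative[OF bounded_linear_fst] b])
  from frechet_derivative_at[OF this, symmetric] show ?thesis by simp
qed

lemma smooth_on_commute:
  assumes "open S" "smooth_on S f" "p \<in> S"
  shows "frechet_derivative (\<lambda>q. frechet_derivative f (at q) u) (at p) v = frechet_derivative (\<lambda>q. frechet_derivative f (at q) v) (at p) u"
  using assms by (intro frechet_derivative_commute[of S]) (auto simp: smooth_on_def)

text \<open>Partial derivatives commute, and the only nonconstant coefficient of
  \<open>horiz\<close> is z, whose antiholomorphic derivative vanishes: the extra terms carry the
  factor 1 + \<i>\<i> = 0.\<close>

lemma dzbar_horiz_commute:
  fixes f :: "complex \<times> (quat ^ 'n::finite) \<Rightarrow> complex"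
  assumes o: "open S" and f: "smooth_on S f" and p: "p \<in> S"
  shows "dzbar (horiz e f) p = horiz e (dzbar f) p"
proof -
  define D where "D u v = frechet_derivative (\<lambda>q. frechet_derivative f (at q) u) (at p) v" for u v
  have sym: "D u v = D v u" for u v unfolding D_def by (rule smooth_on_commute[OF o f p])
  have d: "((\<lambda>q. frechet_derivative f (at q) u) has_derivative D u) (at p)" for u
    unfolding D_def using smooth_on_has_derivative[OF smooth_on_frechet_derivative[OF f] p] by simp
  have "(dzbar f has_derivative (\<lambda>v. (D (1, 0) v + \<i> * D (\<i>, 0) v) * inverse 2)) (at p)"
    unfolding dzbar_def[abs_def] divide_inverse
    by (intro has_derivative_mult_left has_derivative_add has_derivative_mult_right d)
  define k where "k = inverse (2 :: complex)"
  have parts: "antilinear_part A a = k * (A a + \<i> * A (hscale \<i> a))"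
    "clinear_part A a = k * (A a - \<i> * A (hscale \<i> a))" for A and a :: "(complex \<times> complex) ^ 'n"
    by (simp_all only: antilinear_part_def clinear_part_def k_def divide_inverse mult.commute)
  from frechet_derivative_at[OF \<open>(dzbar f has_derivative _) _\<close>, symmetric]
  have 1: "frechet_derivative (dzbar f) (at p) v = k * (D (1, 0) v + \<i> * D (\<i>, 0) v)" for v
    by (simp only: k_def mult.commute)
  have 3: "dzbar g p = k * (frechet_derivative g (at p) (1, 0) + \<i> * frechet_derivative g (at p) (\<i>, 0))" for g
    by (simp only: dzbar_def k_def divide_inverse mult.commute)
  note 2 = horiz_has_derivative[OF o f p, folded D_def]
  show ?thesis
    unfolding 3[of "horiz e f"] 2 horiz_def[of e "dzbar f"] xbar_def[of e "dzbar f"] xhol_def[of _ "dzbar f"] 1 parts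
      sym[of "(0, _)"] fst_conv
    by (simp add: algebra_simps)
qed

text \<open>\<open>horiz\<close> differentiates in x alone and its coefficients depend on z alone,
  so on each slice these are operators with constant coefficients.\<close>

lemma horiz_commute:
  fixes f :: "complex \<times> (quat ^ 'n::finite) \<Rightarrow> complex"
  assumes o: "open S" and f: "smooth_on S f" and p: "p \<in> S"
  shows "horiz e (horiz e' f) p = horiz e' (horiz e f) p"
proof -
  define D where "D u v = frechet_derivative (\<lambda>q. frechet_derivative f (at q) u) (at p) v" for u v
  define T where "T a b = D (0, a) (0, b)" for a b
  have sym: "T a b = T b a" for a b unfolding D_def T_def by (rule smooth_on_commute[OF o f p])
  note 2 = horiz_has_derivative[OF o f p, folded D_def]
  define k where "k = inverse (2 :: complex)"
  have parts: "antilinear_part A a = k * (A a + \<i> * A (hscale \<i> a))"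
    "clinear_part A a = k * (A a - \<i> * A (hscale \<i> a))" for A and a :: "(complex \<times> complex) ^ 'n"
    by (simp_all only: antilinear_part_def clinear_part_def k_def divide_inverse mult.commute)
  define W where "W e' b = k * (T e' b + \<i> * T (hscale \<i> e') b)
    - fst p * (k * (T (quatJ e') b - \<i> * T (hscale \<i> (quatJ e')) b))" for e' b
  have W: "frechet_derivative (horiz e' f) (at p) (0, b) = W e' b" for e' b
    by (simp only: 2 parts W_def T_def fst_conv mult_zero_left diff_zero)
  have eq: "horiz e (horiz e' f) p = k * (W e' e + \<i> * W e' (hscale \<i> e))
      - fst p * (k * (W e' (quatJ e) - \<i> * W e' (hscale \<i> (quatJ e))))" for e e'
    by (simp only: horiz_def[of e "horiz e' f"] xbar_def[of e "horiz e' f"] xhol_def[of _ "horiz e' f"] parts W)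
  show ?thesis unfolding eq W_def
    by (simp only: sym[of e'] sym[of "hscale \<i> e'"] sym[of "quatJ e'"] sym[of "hscale \<i> (quatJ e')"])
       (simp add: algebra_simps)
qed

section \<open>Bookkeeping of decay orders\<close>

lemma decaying_add:
  assumes U: "open U" and f: "decaying a b U f" and g: "decaying a b U g"
  shows "decaying a b U (\<lambda>p. f p + g p)"
proof -
  have o: "open ((UNIV :: complex set) \<times> U)" using U by (simp add: open_Times)
  from f obtain F where F: "smooth_on (UNIV \<times> U) F" "\<And>z x. z \<noteq> 0 \<Longrightarrow> x \<in> U \<Longrightarrow> f (z, x) = inverse z ^ a * cnj (inverse z) ^ b * F (inverse z, x)"
    unfolding decaying_def by blast
  from g obtain G where G: "smooth_on (UNIV \<times> U) G" "\<And>z x. z \<noteq> 0 \<Longrightarrow> x \<in> U \<Longrightarrow> g (z, x) = inverse z ^ a * cnj (inverse z) ^ b * G (inverse z, x)"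
    unfolding decaying_def by blast
  show ?thesis
    by (rule decayingI[where H="\<lambda>p. F p + G p"])
       (auto intro!: smooth_on_add o decaying_smooth[OF f] decaying_smooth[OF g] F(1) G(1) simp: F(2) G(2) distrib_left)
qed

lemma decaying_cmult:
  assumes U: "open U" and f: "decaying a b U f"
  shows "decaying a b U (\<lambda>p. c * f p)"
proof -
  have o: "open ((UNIV :: complex set) \<times> U)" using U by (simp add: open_Times)
  from f obtain F where F: "smooth_on (UNIV \<times> U) F" "\<And>z x. z \<noteq> 0 \<Longrightarrow> x \<in> U \<Longrightarrow> f (z, x) = inverse z ^ a * cnj (inverse z) ^ b * F (inverse z, x)"
    unfolding decaying_def by blast
  show ?thesis
    by (rule decayingI[where H="\<lambda>p. c * F p"])
       (auto intro!: smooth_on_mult smooth_on_const o decaying_smooth[OF f] F(1) simp: F(2) mult_ac)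
qed

lemma decaying_diff:
  assumes "open U" "decaying a b U f" "decaying a b U g"
  shows "decaying a b U (\<lambda>p. f p - g p)"
  using decaying_add[OF assms(1,2) decaying_cmult[OF assms(1,3), of "-1"]] by simp

text \<open>Either one factor 1/z is absorbed into the smooth function at infinity, or z cancels one
  of the powers in front of it.\<close>

lemma decaying_Suc:
  assumes U: "open U" and f: "decaying (Suc a) b U f"
  shows "decaying a b U f" "decaying a b U (\<lambda>p. fst p * f p)"
proof -
  have o: "open ((UNIV :: complex set) \<times> U)" using U by (simp add: open_Times)
  from f obtain F where F: "smooth_on (UNIV \<times> U) F" "\<And>z x. z \<noteq> 0 \<Longrightarrow> x \<in> U \<Longrightarrow> f (z, x) = inverse z ^ Suc a * cnj (inverse z) ^ b * F (inverse z, x)"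
    unfolding decaying_def by blast
  show "decaying a b U f"
    by (rule decayingI[where H="\<lambda>p. fst p * F p"])
       (auto intro!: smooth_intros o decaying_smooth[OF f] F(1) simp: F(2))
  show "decaying a b U (\<lambda>p. fst p * f p)"
    by (rule decayingI[where H=F])
       (auto intro!: smooth_intros o decaying_smooth[OF f] F(1) simp: F(2))
qed

lemma decaying_horiz:
  assumes U: "open U" and f: "decaying (Suc a) b U f"
  shows "decaying a b U (horiz e f)"
proof -
  note d = decaying_frechet_derivative[OF U f]
  have "decaying (Suc a) b U (\<lambda>p. inverse 2 * (frechet_derivative f (at p) u + c * frechet_derivative f (at p) v))" for u v c
    by (intro decaying_cmult decaying_add d U)
  note D = this
  have 1: "decaying (Suc a) b U (xbar e f)" 
    using D[of "(0, e)" \<i> "(0, hscale \<i> e)"] by (simp only: xbar_def[abs_def] antilinear_part_def divide_inverse mult.commute)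
  have 2: "decaying (Suc a) b U (xhol (quatJ e) f)" 
    using D[of "(0, quatJ e)" "- \<i>" "(0, hscale \<i> (quatJ e))"]
    by (simp only: xhol_def[abs_def] clinear_part_def divide_inverse mult.commute diff_conv_add_uminus mult_minus_left mult_minus_right)
  show ?thesis unfolding horiz_def[abs_def]
    by (intro decaying_diff U decaying_Suc(1)[OF U 1] decaying_Suc(2)[OF U 2])
qed

lemma linear_ascale:
  fixes D :: "'n::finite affine \<Rightarrow> complex"
  assumes "linear D"
  shows "D (ascale c v) = of_real (Re c) * D v + of_real (Im c) * D (ascale \<i> v)"
proof -
  have "ascale c v = Re c *\<^sub>R v + Im c *\<^sub>R ascale \<i> v"
    by (simp add: ascale_def vec_eq_iff prod_eq_iff complex_eq_iff)
  then have "D (ascale c v) = D (Re c *\<^sub>R v + Im c *\<^sub>R ascale \<i> v)" by (rule arg_cong)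
  then show ?thesis by (simp only: linear_add[OF assms] linear_cmul[OF assms]) (simp add: scaleR_conv_of_real)
qed

lemma conj_linear_antilinear_part:
  fixes D :: "'n::finite affine \<Rightarrow> complex"
  assumes l: "linear D"
  shows "conj_linear (\<lambda>v. (D v + \<i> * D (ascale \<i> v)) / 2)"
proof -
  have "(D (ascale c v) + \<i> * D (ascale \<i> (ascale c v))) / 2 = cnj c * ((D v + \<i> * D (ascale \<i> v)) / 2)" for c v
  proof -
    have c: "cnj c = of_real (Re c) - \<i> * of_real (Im c)" by (auto simp: complex_eq_iff)
    have 1: "D (ascale \<i> (ascale c v)) = of_real (Re c) * D (ascale \<i> v) - of_real (Im c) * D v"
      using linear_ascale[OF l, of "\<i> * c" v] by (simp add: ascale_simps)
    show ?thesis unfolding 1 linear_ascale[OF l, of c] c by (simp add: field_simps)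
  qed
  moreover have "(D (u + v) + \<i> * D (ascale \<i> (u + v))) / 2 = (D u + \<i> * D (ascale \<i> u)) / 2 + (D v + \<i> * D (ascale \<i> v)) / 2" for u v
    by (simp only: ascale_simps linear_add[OF l]) (simp add: field_simps)
  ultimately show ?thesis unfolding conj_linear_def by blast
qed

lemma conj_linear_dbar_dir: "F differentiable (at p) \<Longrightarrow> conj_linear (dbar_dir F p)"
  unfolding dbar_dir_def[abs_def]
  by (rule conj_linear_antilinear_part[OF has_derivative_linear[OF iffD1[OF frechet_derivative_works]]])

lemma dbar_dir_add:
  assumes F: "F differentiable (at p)" and G: "G differentiable (at p)"
  shows "dbar_dir (\<lambda>q. F q + G q) p v = dbar_dir F p v + dbar_dir G p v"
  unfolding dbar_dir_def
  by (simp add: frechet_derivative_at[OF has_derivative_add[OF iffD1[OF frechet_derivative_works F] iffD1[OF frechet_derivative_works G]], symmetric]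
      algebra_simps add_divide_distrib)

lemma dbar_dir_cmult:
  assumes F: "F differentiable (at p)"
  shows "dbar_dir (\<lambda>q. c * F q) p v = c * dbar_dir F p v"
  unfolding dbar_dir_def
  by (simp add: frechet_derivative_at[OF has_derivative_mult_right[OF iffD1[OF frechet_derivative_works F]], symmetric]
      algebra_simps)

lemma dbar_dir_cong_open:
  "open S \<Longrightarrow> p \<in> S \<Longrightarrow> (\<And>q. q \<in> S \<Longrightarrow> F q = G q) \<Longrightarrow> dbar_dir F p v = dbar_dir G p v"
  using frechet_derivative_cong_open[of S p F G] by (simp add: dbar_dir_def)

section \<open>Components of (0,1)-forms\<close>

text \<open>The vector inserted is the velocity of the fibre, so \<open>vert0\<close> and
  \<open>vert1\<close> are the coefficients of the restriction to the fibres; \<open>coef0\<close>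
  and \<open>coef1\<close> insert slice directions instead.\<close>

definition vert0 :: "'n::finite form01 \<Rightarrow> complex \<times> (quat ^ 'n) \<Rightarrow> complex" where
  "vert0 \<omega> q = \<omega> (lift0 q) (1, quatJ (snd q))"

definition vert1 :: "'n::finite form01 \<Rightarrow> complex \<times> (quat ^ 'n) \<Rightarrow> complex" where
  "vert1 \<omega> q = \<omega> (lift1 q) (1, snd q)"

definition coef0 :: "'n::finite form01 \<Rightarrow> (complex \<times> complex) ^ 'n \<Rightarrow> complex \<times> (quat ^ 'n) \<Rightarrow> complex" where
  "coef0 \<omega> e q = \<omega> (lift0 q) (0, e)"

definition coef1 :: "'n::finite form01 \<Rightarrow> (complex \<times> complex) ^ 'n \<Rightarrow> complex \<times> (quat ^ 'n) \<Rightarrow> complex" where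
  "coef1 \<omega> e q = \<omega> (lift1 q) (0, e)"

lemma pi_tau_vert: "pi_tau \<Omega> = (vert0 (fst \<Omega>), vert1 (snd \<Omega>))"
  by (auto simp: pi_tau_eq vert0_def vert1_def fun_eq_iff)

lemma conj_linear_hscale: "conj_linear g \<Longrightarrow> g (0, hscale c e) = cnj c * g (0, e)"
  using conj_linear_simps(2)[of g c "(0, e)"] by (simp add: ascale_def)

lemma conj_linear_expand:
  assumes g: "conj_linear g"
  shows "g (c, y) = cnj c * g (1, 0) + (\<Sum>b\<in>Basis. (y \<bullet> b) *\<^sub>R g (0, b))"
proof -
  have l: "linear (\<lambda>y. g (0, y))"
  proof (rule linearI)
    show "g (0, x + y) = g (0, x) + g (0, y)" for x y using conj_linear_simps(1)[OF g, of "(0, x)" "(0, y)"] by simp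
    show "g (0, r *\<^sub>R x) = r *\<^sub>R g (0, x)" for r x
      using conj_linear_simps(3)[OF g, of r "(0, x)"] by (simp add: scaleR_conv_of_real)
  qed
  have "g (0, y) = g (0, \<Sum>b\<in>Basis. (y \<bullet> b) *\<^sub>R b)" by (simp add: euclidean_representation)
  also have "\<dots> = (\<Sum>b\<in>Basis. (y \<bullet> b) *\<^sub>R g (0, b))"
    by (simp only: linear_sum[OF l] linear_cmul[OF l])
  finally have "g (0, y) = (\<Sum>b\<in>Basis. (y \<bullet> b) *\<^sub>R g (0, b))" .
  moreover have "(c, y) = ascale c (1, 0) + (0, y)" by (simp add: ascale_def hscale_simps)
  then have "g (c, y) = g (ascale c (1, 0) + (0, y))" by (rule arg_cong)
  ultimately show ?thesis by (simp only: conj_linear_simps(1,2)[OF g])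
qed

lemma conj_linear_expand0:
  assumes g: "conj_linear g"
  shows "g (0, y) = (\<Sum>b\<in>Basis. (y \<bullet> b) *\<^sub>R g (0, b))"
  using conj_linear_expand[OF g, of 0 y] by simp

text \<open>Forms are smooth by definition on constant vectors; a finite basis expansion extends
  this to vectors that move with the point, such as the fibre directions.\<close>

lemma smooth_on_form_eval:
  assumes o: "open S" and g: "\<And>v. smooth_on S (\<lambda>q. g q v)" and l: "\<And>q. q \<in> S \<Longrightarrow> conj_linear (g q)"
    and c: "smooth_on S c" and y: "smooth_on S y"
  shows "smooth_on S (\<lambda>q. g q (c q, y q))"
proof -
  have yb: "smooth_on S (\<lambda>q. y q \<bullet> b)" for b
    by (rule smooth_on_bounded_linear_comp[OF bounded_linear_inner_left o y])
  have "smooth_on S (\<lambda>q. cnj (c q) * g q (1, 0) + (\<Sum>b\<in>Basis. (y q \<bullet> b) *\<^sub>R g q (0, b)))"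
    by (rule smooth_on_add[OF o smooth_on_mult[OF o smooth_on_cnj[OF o c] g] smooth_on_sum[OF o smooth_on_scaleR[OF o yb g]]])
  moreover have "smooth_on S (\<lambda>q. g q (c q, y q)) \<longleftrightarrow>
      smooth_on S (\<lambda>q. cnj (c q) * g q (1, 0) + (\<Sum>b\<in>Basis. (y q \<bullet> b) *\<^sub>R g q (0, b)))"
    by (rule smooth_on_cong[OF o]) (rule conj_linear_expand[OF l])
  ultimately show ?thesis by (rule_tac iffD2)
qed

lemma smooth_form01_conj_linear: "smooth_form01 V \<omega> \<Longrightarrow> p \<in> V \<Longrightarrow> conj_linear (\<omega> p)"
  by (simp add: smooth_form01_def)

lemma smooth_form01_smooth: "smooth_form01 V \<omega> \<Longrightarrow> smooth_on V (\<lambda>p. \<omega> p v)"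
  unfolding smooth_form01_def by blast

lemma smooth_form01_comp:
  assumes U: "open U"
  shows "smooth_form01 (chart0 U) \<omega> \<Longrightarrow> smooth_on (UNIV \<times> U) (\<lambda>q. \<omega> (lift0 q) v)"
    "smooth_form01 (chart1 U) \<omega> \<Longrightarrow> smooth_on (UNIV \<times> U) (\<lambda>q. \<omega> (lift1 q) v)"
  by (rule smooth_on_comp_lift(1)[OF U], erule smooth_form01_smooth)
     (rule smooth_on_comp_lift(2)[OF U], erule smooth_form01_smooth)

lemma
  assumes U: "open U"
  shows smooth_on_vert0: "smooth_form01 (chart0 U) \<omega> \<Longrightarrow> smooth_on (UNIV \<times> U) (vert0 \<omega>)"
    and smooth_on_vert1: "smooth_form01 (chart1 U) \<omega> \<Longrightarrow> smooth_on (UNIV \<times> U) (vert1 \<omega>)"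
    and smooth_on_coef0: "smooth_form01 (chart0 U) \<omega> \<Longrightarrow> smooth_on (UNIV \<times> U) (coef0 \<omega> e)"
    and smooth_on_coef1: "smooth_form01 (chart1 U) \<omega> \<Longrightarrow> smooth_on (UNIV \<times> U) (coef1 \<omega> e)"
proof -
  have o: "open ((UNIV :: complex set) \<times> U)" using U by (simp add: open_Times)
  show "smooth_on (UNIV \<times> U) (vert0 \<omega>)" if "smooth_form01 (chart0 U) \<omega>"
    unfolding vert0_def[abs_def]
  proof (rule smooth_on_form_eval[where g="\<lambda>q. \<omega> (lift0 q)" and c="\<lambda>q. 1" and y="\<lambda>q. quatJ (snd q)", OF o])
    show "smooth_on (UNIV \<times> U) (\<lambda>q. \<omega> (lift0 q) v)" for v by (rule smooth_form01_comp(1)[OF U that])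
    show "conj_linear (\<omega> (lift0 q))" if "q \<in> UNIV \<times> U" for q
      using smooth_form01_conj_linear[OF \<open>smooth_form01 (chart0 U) \<omega>\<close>, of "lift0 q"] that by (simp add: lift_in_chart mem_Times_iff)
  qed (rule smooth_on_const smooth_on_quatJ[OF o smooth_on_snd[OF o smooth_on_id[OF o]]])+
  show "smooth_on (UNIV \<times> U) (vert1 \<omega>)" if "smooth_form01 (chart1 U) \<omega>"
    unfolding vert1_def[abs_def]
  proof (rule smooth_on_form_eval[where g="\<lambda>q. \<omega> (lift1 q)" and c="\<lambda>q. 1" and y="snd", OF o])
    show "smooth_on (UNIV \<times> U) (\<lambda>q. \<omega> (lift1 q) v)" for v by (rule smooth_form01_comp(2)[OF U that])
    show "conj_linear (\<omega> (lift1 q))" if "q \<in> UNIV \<times> U" for q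
      using smooth_form01_conj_linear[OF \<open>smooth_form01 (chart1 U) \<omega>\<close>, of "lift1 q"] that by (simp add: lift_in_chart mem_Times_iff)
  qed (rule smooth_on_const smooth_on_snd[OF o smooth_on_id[OF o]])+
  show "smooth_on (UNIV \<times> U) (coef0 \<omega> e)" if "smooth_form01 (chart0 U) \<omega>"
    unfolding coef0_def[abs_def] by (rule smooth_form01_comp(1)[OF U that])
  show "smooth_on (UNIV \<times> U) (coef1 \<omega> e)" if "smooth_form01 (chart1 U) \<omega>"
    unfolding coef1_def[abs_def] by (rule smooth_form01_comp(2)[OF U that])
qed

text \<open>The factor turns \<open>dbar\<close>-closedness into \<open>dzbar (gcoef \<omega> e) = horiz e (vert0 \<omega>)\<close>.\<close>

definition gcoef :: "'n::finite form01 \<Rightarrow> (complex \<times> complex) ^ 'n \<Rightarrow> complex \<times> (quat ^ 'n) \<Rightarrow> complex" where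
  "gcoef \<omega> e q = (1 + fst q * cnj (fst q)) * coef0 \<omega> e q"

section \<open>Closedness in terms of fibre and slice components\<close>

context
  fixes U :: "(quat ^ 'n::finite) set" and \<omega> :: "'n form01"
  assumes U: "open U" and \<omega>: "smooth_form01 (chart0 U) \<omega>"
begin

lemma oU: "open ((UNIV :: complex set) \<times> U)"
  using U by (simp add: open_Times)

lemma form_differentiable: "p \<in> chart0 U \<Longrightarrow> (\<lambda>q. \<omega> q v) differentiable (at p)"
  by (rule smooth_on_differentiable[OF smooth_form01_smooth[OF \<omega>]])

text \<open>The last term is the antiholomorphic derivative z of the weight 1 + |z|^2; it will match
  a correction in the horizontal derivative of \<open>vert0\<close>.\<close>

lemma dzbar_gcoef:
  assumes x: "x \<in> U"
  shows "dzbar (gcoef \<omega> e) (z, x) = (1 + z * cnj z) * dzbar (coef0 \<omega> e) (z, x) + z * coef0 \<omega> e (z, x)"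
proof -
  have c: "(coef0 \<omega> e has_derivative frechet_derivative (coef0 \<omega> e) (at (z, x))) (at (z, x))"
    using smooth_on_has_derivative[OF smooth_on_coef0[OF U \<omega>]] x by simp
  have "((\<lambda>q :: complex \<times> (quat ^ 'n). 1 + fst q * cnj (fst q)) has_derivative (\<lambda>v. fst v * cnj z + z * cnj (fst v))) (at (z, x))"
    by (auto intro!: derivative_eq_intros bounded_linear.has_derivative[OF bounded_linear_cnj])
  from has_derivative_mult[OF this c]
  have "(gcoef \<omega> e has_derivative (\<lambda>v. (1 + z * cnj z) * frechet_derivative (coef0 \<omega> e) (at (z, x)) v
     + (fst v * cnj z + z * cnj (fst v)) * coef0 \<omega> e (z, x))) (at (z, x))"
    unfolding gcoef_def[abs_def] by simp
  from frechet_derivative_at[OF this, symmetric] show ?thesis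
    by (simp add: dzbar_def field_simps)
qed

text \<open>The fibre direction \<open>(1, quatJ x)\<close> turns with x. Its variation along y
  contributes the value of the form on J y, which is complex linear in y; \<open>horiz\<close> sees
  it only through its term with coefficient z, and J^2 = -1 fixes the sign.\<close>

lemma horiz_vert0:
  assumes x: "x \<in> U"
  shows "horiz e (vert0 \<omega>) (z, x) = horiz e (\<lambda>q. \<omega> (lift0 q) (1, quatJ x)) (z, x) + z * coef0 \<omega> e (z, x)"
proof -
  define p where "p = (z, x)"
  define h where "h q = \<omega> (lift0 q) (1, quatJ x)" for q
  have pU: "p \<in> UNIV \<times> U" using x by (simp add: p_def)
  have cl: "conj_linear (\<omega> (lift0 q))" if "q \<in> UNIV \<times> U" for q
    using smooth_form01_conj_linear[OF \<omega>, of "lift0 q"] that by (auto simp: lift_in_chart)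
  \<comment> \<open>The contribution of the variation of the fibre direction relative to the fixed
    \<open>x\<close>; its scalar factors vanish at \<open>p\<close>, so the product rule leaves no
    derivative of the coefficients.\<close>
  define s where "s q = (\<Sum>b\<in>Basis. ((quatJ (snd q) - quatJ x) \<bullet> b) *\<^sub>R coef0 \<omega> b q)" for q
  have eq: "h q + s q = vert0 \<omega> q" if "q \<in> UNIV \<times> U" for q
  proof -
    have "vert0 \<omega> q = \<omega> (lift0 q) ((1, quatJ x) + (0, quatJ (snd q) - quatJ x))"
      by (simp add: vert0_def)
    also have "\<dots> = h q + \<omega> (lift0 q) (0, quatJ (snd q) - quatJ x)"
      unfolding h_def by (rule conj_linear_simps(1)[OF cl[OF that]])
    also have "\<omega> (lift0 q) (0, quatJ (snd q) - quatJ x) = s q"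
      unfolding s_def coef0_def by (rule conj_linear_expand0[OF cl[OF that]])
    finally show ?thesis by (rule sym)
  qed
  have h: "(h has_derivative frechet_derivative h (at p)) (at p)"
    unfolding h_def[abs_def] using smooth_on_has_derivative[OF smooth_form01_comp(1)[OF U \<omega>] pU] .
  have s: "(s has_derivative (\<lambda>v. \<Sum>b\<in>Basis. (quatJ (snd v) \<bullet> b) *\<^sub>R coef0 \<omega> b p)) (at p)"
    unfolding s_def[abs_def]
  proof (rule has_derivative_sum)
    fix b :: "(complex \<times> complex) ^ 'n"
    have c: "(coef0 \<omega> b has_derivative frechet_derivative (coef0 \<omega> b) (at p)) (at p)"
      using smooth_on_has_derivative[OF smooth_on_coef0[OF U \<omega>] pU] .
    have "((\<lambda>q :: complex \<times> (quat ^ 'n). (quatJ (snd q) - quatJ x) \<bullet> b) has_derivative (\<lambda>v. (quatJ (snd v) - 0) \<bullet> b)) (at p)"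
      by (intro bounded_linear.has_derivative[OF bounded_linear_inner_left] has_derivative_diff has_derivative_const
            bounded_linear.has_derivative[OF bounded_linear_quatJ] bounded_linear.has_derivative[OF bounded_linear_snd] has_derivative_ident)
    from has_derivative_scaleR[OF this c]
    show "((\<lambda>q. ((quatJ (snd q) - quatJ x) \<bullet> b) *\<^sub>R coef0 \<omega> b q) has_derivative (\<lambda>v. (quatJ (snd v) \<bullet> b) *\<^sub>R coef0 \<omega> b p)) (at p)"
      by (simp add: p_def)
  qed
  have s2: "(\<Sum>b\<in>Basis. (y \<bullet> b) *\<^sub>R coef0 \<omega> b p) = \<omega> (lift0 p) (0, y)" for y
    unfolding coef0_def by (rule conj_linear_expand0[OF cl[OF pU], symmetric])
  have "(vert0 \<omega> has_derivative (\<lambda>v. frechet_derivative h (at p) v + \<omega> (lift0 p) (0, quatJ (snd v)))) (at p)"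
    using has_derivative_transform_within_open[OF has_derivative_add[OF h s] oU pU eq] by (simp add: s2)
  from frechet_derivative_at[OF this, symmetric]
  have fd: "frechet_derivative (vert0 \<omega>) (at p) (0, y) = frechet_derivative h (at p) (0, y) + \<omega> (lift0 p) (0, quatJ y)" for y
    by simp
  note cs = conj_linear_hscale[OF cl[OF pU]]
  have neg: "\<omega> (lift0 p) (0, - y) = - \<omega> (lift0 p) (0, y)" for y
    using conj_linear_simps(4)[OF cl[OF pU], of "(0, y)"] by simp
  have "horiz e (vert0 \<omega>) p = horiz e h p + fst p * coef0 \<omega> e p"
    unfolding horiz_def xbar_def xhol_def antilinear_part_def clinear_part_def fd quatJ_simps hscale_simps cs neg coef0_def
    by (simp add: field_simps)
  then show ?thesis by (simp add: p_def h_def[abs_def])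
qed

text \<open>The corrections from the weight and from the moving fibre direction are both z times the
  coefficient and cancel. Closedness thereby becomes a Cauchy-Riemann equation along the
  fibre.\<close>

lemma dbar1_vertical_horizontal:
  assumes x: "x \<in> U"
  shows "(1 + z * cnj z) * dbar1 \<omega> (lift0 (z, x)) (1, quatJ x) (0, e)
    = dzbar (gcoef \<omega> e) (z, x) - horiz e (vert0 \<omega>) (z, x)"
proof -
  have p: "lift0 (z, x) \<in> chart0 U" using x by (simp add: lift_in_chart)
  have "dzbar (coef0 \<omega> e) (z, x) = dbar_dir (\<lambda>q. \<omega> q (0, e)) (lift0 (z, x)) (1, quatJ x)"
    unfolding coef0_def[abs_def] by (rule dzbar_comp_lift0[OF form_differentiable[OF p]])
  moreover have "horiz e (\<lambda>q. \<omega> (lift0 q) (1, quatJ x)) (z, x)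
     = (1 + z * cnj z) * dbar_dir (\<lambda>q. \<omega> q (1, quatJ x)) (lift0 (z, x)) (0, e)"
    by (rule horiz_comp_lift0[OF form_differentiable[OF p]])
  ultimately show ?thesis
    unfolding dbar1_def dzbar_gcoef[OF x] horiz_vert0[OF x] by (simp add: algebra_simps)
qed

lemma dbar1_horizontal:
  assumes x: "x \<in> U"
  shows "(1 + z * cnj z) * dbar1 \<omega> (lift0 (z, x)) (0, e) (0, e')
    = horiz e (coef0 \<omega> e') (z, x) - horiz e' (coef0 \<omega> e) (z, x)"
proof -
  have p: "lift0 (z, x) \<in> chart0 U" using x by (simp add: lift_in_chart)
  have "horiz e (coef0 \<omega> e') (z, x) = (1 + z * cnj z) * dbar_dir (\<lambda>q. \<omega> q (0, e')) (lift0 (z, x)) (0, e)" for e e'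
    unfolding coef0_def[abs_def] by (rule horiz_comp_lift0[OF form_differentiable[OF p]])
  then show ?thesis unfolding dbar1_def by (simp add: algebra_simps)
qed

text \<open>Tensoriality in one argument, which together with antisymmetry reduces closedness to
  pairs of frame vectors.\<close>

lemma conj_linear_dbar1:
  assumes p: "p \<in> chart0 U"
  shows "conj_linear (\<lambda>u. dbar1 \<omega> p u v)"
proof -
  have 1: "conj_linear (dbar_dir (\<lambda>q. \<omega> q v) p)" by (rule conj_linear_dbar_dir[OF form_differentiable[OF p]])
  have a: "dbar_dir (\<lambda>q. \<omega> q (u + u')) p v = dbar_dir (\<lambda>q. \<omega> q u) p v + dbar_dir (\<lambda>q. \<omega> q u') p v" for u u'
  proof -
    have "dbar_dir (\<lambda>q. \<omega> q (u + u')) p v = dbar_dir (\<lambda>q. \<omega> q u + \<omega> q u') p v"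
      by (rule dbar_dir_cong_open[OF open_chart(1)[OF U] p]) (rule conj_linear_simps(1)[OF smooth_form01_conj_linear[OF \<omega>]])
    also have "\<dots> = dbar_dir (\<lambda>q. \<omega> q u) p v + dbar_dir (\<lambda>q. \<omega> q u') p v"
      by (rule dbar_dir_add) (rule form_differentiable[OF p])+
    finally show ?thesis .
  qed
  have b: "dbar_dir (\<lambda>q. \<omega> q (ascale c u)) p v = cnj c * dbar_dir (\<lambda>q. \<omega> q u) p v" for c u
  proof -
    have "dbar_dir (\<lambda>q. \<omega> q (ascale c u)) p v = dbar_dir (\<lambda>q. cnj c * \<omega> q u) p v"
      by (rule dbar_dir_cong_open[OF open_chart(1)[OF U] p]) (rule conj_linear_simps(2)[OF smooth_form01_conj_linear[OF \<omega>]])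
    also have "\<dots> = cnj c * dbar_dir (\<lambda>q. \<omega> q u) p v"
      by (rule dbar_dir_cmult) (rule form_differentiable[OF p])
    finally show ?thesis .
  qed
  have "dbar1 \<omega> p (u + u') v = dbar1 \<omega> p u v + dbar1 \<omega> p u' v" for u u'
    unfolding dbar1_def a conj_linear_simps(1)[OF 1] by (rule add_diff_add)
  moreover have "dbar1 \<omega> p (ascale c u) v = cnj c * dbar1 \<omega> p u v" for c u
    unfolding dbar1_def b conj_linear_simps(2)[OF 1] by (rule right_diff_distrib[symmetric])
  ultimately show ?thesis unfolding conj_linear_def by blast
qed

text \<open>On pairs of frame vectors the value is 0 by antisymmetry (fibre with fibre), by
  \<open>E1\<close> (fibre with slice) and by \<open>E2\<close> (slice with slice); conjugate
  linearity in each argument does the rest.\<close>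

lemma dbar1_eq_0I:
  assumes E1: "\<And>z x e. x \<in> U \<Longrightarrow> dzbar (gcoef \<omega> e) (z, x) = horiz e (vert0 \<omega>) (z, x)"
    and E2: "\<And>z x e e'. x \<in> U \<Longrightarrow> horiz e (coef0 \<omega> e') (z, x) = horiz e' (coef0 \<omega> e) (z, x)"
    and p: "p \<in> chart0 U"
  shows "dbar1 \<omega> p u v = 0"
proof -
  obtain z x where zx: "unlift0 p = (z, x)" by (cases "unlift0 p")
  have pl: "p = lift0 (z, x)" using lift_simps(3)[of p] zx by simp
  have x: "x \<in> U" using p zx by (simp add: chart0_iff)
  have skew: "dbar1 \<omega> p u v = - dbar1 \<omega> p v u" for u v by (simp add: dbar1_def)
  have z0: "conj_linear (\<lambda>u :: 'n affine. 0)" by (simp add: conj_linear_def)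
  have vh: "dbar1 \<omega> p (1, quatJ x) (0, e) = 0" for e
    using dbar1_vertical_horizontal[OF x, of z e] E1[OF x, of e z] by (simp add: pl)
  have hh: "dbar1 \<omega> p (0, e) (0, e') = 0" for e e'
    using dbar1_horizontal[OF x, of z e e'] E2[OF x, of e e' z] by (simp add: pl)
  have h: "dbar1 \<omega> p u (0, e) = 0" for u e
    by (rule conj_linear_eqI[OF conj_linear_dbar1[OF p] z0 vh hh])
  have vv: "dbar1 \<omega> p (1, quatJ x) (1, quatJ x) = 0" by (simp add: dbar1_def)
  have hv: "dbar1 \<omega> p (0, e) (1, quatJ x) = 0" for e using skew[of "(0, e)" "(1, quatJ x)"] vh[of e] by simp
  have v: "dbar1 \<omega> p u (1, quatJ x) = 0" for u
    by (rule conj_linear_eqI[OF conj_linear_dbar1[OF p] z0 vv hv])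
  have "dbar1 \<omega> p v u = 0"
  proof (rule conj_linear_eqI[OF conj_linear_dbar1[OF p] z0])
    show "dbar1 \<omega> p (1, quatJ x) u = 0" using skew[of "(1, quatJ x)" u] v[of u] by simp
    show "dbar1 \<omega> p (0, e) u = 0" for e using skew[of "(0, e)" u] h[of u e] by simp
  qed
  then show ?thesis using skew[of u v] by simp
qed

end

lemma form0_eqI:
  assumes \<omega>: "smooth_form01 (chart0 U) \<omega>" and x: "x \<in> U" and g: "conj_linear g"
    and v: "vert0 \<omega> (z, x) = g (1, quatJ x)" and c: "\<And>e. coef0 \<omega> e (z, x) = g (0, e)"
  shows "\<omega> (lift0 (z, x)) v = g v"
proof (rule conj_linear_eqI)
  show "conj_linear (\<omega> (lift0 (z, x)))"
    by (rule smooth_form01_conj_linear[OF \<omega>]) (simp add: lift_in_chart x)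
  show "\<omega> (lift0 (z, x)) (1, quatJ x) = g (1, quatJ x)" using v by (simp add: vert0_def)
  show "\<omega> (lift0 (z, x)) (0, e) = g (0, e)" for e using c[of e] by (simp add: coef0_def)
qed (rule g)

lemma forms01_iff:
  "(\<omega>0, \<omega>1) \<in> forms01 (-3) U \<longleftrightarrow> smooth_form01 (chart0 U) \<omega>0 \<and> smooth_form01 (chart1 U) \<omega>1 \<and>
     (\<forall>p\<in>chart0 U. fst p \<noteq> 0 \<longrightarrow>
        (\<forall>v. \<omega>1 (chart_change p) (frechet_derivative chart_change (at p) v) = fst p ^ 3 * \<omega>0 p v))"
  unfolding forms01_def pullback_def mem_Collect_eq prod.case minus_minus power_int_numeral by (rule refl)

text \<open>Conjugate linearity moves the factors of the coordinate change out as their conjugates.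
  With the factor z^3 of the bundle, the fibre component carries five powers of 1/z or its conjugate
  and a slice component four.\<close>

lemma
  assumes \<Omega>: "(\<omega>0, \<omega>1) \<in> forms01 (-3) U" and z: "z \<noteq> 0" and x: "x \<in> U"
  shows vert_transition: "vert1 \<omega>1 (inverse z, x) = - (z ^ 3) * cnj z ^ 2 * vert0 \<omega>0 (z, x)"
    and coef_transition: "coef0 \<omega>0 e (z, x) = inverse z ^ 3 * cnj (inverse z) * coef1 \<omega>1 e (inverse z, x)"
proof -
  have p: "lift0 (z, x) \<in> chart0 U" "lift1 (inverse z, x) \<in> chart1 U" using x by (simp_all add: lift_in_chart)
  note F = iffD1[OF forms01_iff \<Omega>]
  have cl: "conj_linear (\<omega>1 (lift1 (inverse z, x)))"
    by (rule smooth_form01_conj_linear[OF conjunct1[OF conjunct2[OF F]] p(2)])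
  have t: "\<omega>1 (lift1 (inverse z, x)) (frechet_derivative chart_change (at (lift0 (z, x))) v) = z ^ 3 * \<omega>0 (lift0 (z, x)) v" for v
  proof -
    have "fst (lift0 (z, x)) \<noteq> 0" using z by simp
    with bspec[OF conjunct2[OF conjunct2[OF F]] p(1)]
    have "\<omega>1 (chart_change (lift0 (z, x))) (frechet_derivative chart_change (at (lift0 (z, x))) v) = fst (lift0 (z, x)) ^ 3 * \<omega>0 (lift0 (z, x)) v"
      by blast
    then show ?thesis by (simp only: chart_change_lift[OF z] lift_simps fst_conv)
  qed
  have 1: "cnj (- ((inverse z)\<^sup>2)) * vert1 \<omega>1 (inverse z, x) = z ^ 3 * vert0 \<omega>0 (z, x)"
    using t[of "(1, quatJ x)"] by (simp only: chart_change_derivative_lift[OF z] conj_linear_simps(2)[OF cl] vert0_def vert1_def snd_conv)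
  have "cnj z ^ 2 * cnj (- ((inverse z)\<^sup>2)) = - (cnj (z * inverse z))\<^sup>2"
    by (simp only: complex_cnj_mult complex_cnj_minus complex_cnj_power power_mult_distrib mult_minus_right)
  also have "z * inverse z = 1" using z by (rule right_inverse)
  finally have i: "cnj z ^ 2 * cnj (- ((inverse z)\<^sup>2)) = - 1" by simp
  have "- vert1 \<omega>1 (inverse z, x) = (cnj z ^ 2 * cnj (- ((inverse z)\<^sup>2))) * vert1 \<omega>1 (inverse z, x)"
    unfolding i by (rule mult_minus1[symmetric])
  also have "\<dots> = cnj z ^ 2 * (z ^ 3 * vert0 \<omega>0 (z, x))"
    unfolding mult.assoc 1 by (rule refl)
  finally have m: "- vert1 \<omega>1 (inverse z, x) = cnj z ^ 2 * (z ^ 3 * vert0 \<omega>0 (z, x))" .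
  have "vert1 \<omega>1 (inverse z, x) = - (cnj z ^ 2 * (z ^ 3 * vert0 \<omega>0 (z, x)))"
    unfolding m[symmetric] by (rule minus_minus[symmetric])
  also have "\<dots> = - (z ^ 3) * cnj z ^ 2 * vert0 \<omega>0 (z, x)"
    by (simp add: algebra_simps)
  finally show "vert1 \<omega>1 (inverse z, x) = - (z ^ 3) * cnj z ^ 2 * vert0 \<omega>0 (z, x)" .
  have 2: "cnj (inverse z) * coef1 \<omega>1 e (inverse z, x) = z ^ 3 * coef0 \<omega>0 e (z, x)"
    using t[of "(0, e)"] by (simp only: chart_change_derivative_lift[OF z] conj_linear_simps(2)[OF cl] coef0_def coef1_def)
  have "inverse z ^ 3 * z ^ 3 = (inverse z * z) ^ 3" by (simp only: power_mult_distrib)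
  then have i: "inverse z ^ 3 * z ^ 3 = 1" using z by simp
  show "coef0 \<omega>0 e (z, x) = inverse z ^ 3 * cnj (inverse z) * coef1 \<omega>1 e (inverse z, x)"
    unfolding mult.assoc 2 unfolding mult.assoc[symmetric] i by (rule mult_1_left[symmetric])
qed

lemma transition_invert:
  fixes z u v :: complex
  assumes z: "z \<noteq> 0" and u: "u = - (z ^ 3) * cnj z ^ 2 * v"
  shows "v = inverse z ^ 3 * cnj (inverse z) ^ 2 * - u"
proof -
  define w where "w = inverse z"
  have zw: "z * w = 1" "cnj z * cnj w = 1"
    using z unfolding w_def complex_cnj_mult[symmetric] by simp_all
  have "w ^ 3 * cnj w ^ 2 * - (- (z ^ 3) * cnj z ^ 2 * v) = (z * w) ^ 3 * (cnj z * cnj w) ^ 2 * v"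
    by (simp add: algebra_simps power_mult_distrib)
  then show ?thesis unfolding u w_def[symmetric] zw by simp
qed

lemma forms01_decaying:
  assumes U: "open U" and \<Omega>: "(\<omega>0, \<omega>1) \<in> forms01 (-3) U"
  shows "decaying 3 2 U (vert0 \<omega>0)" "decaying 2 0 U (gcoef \<omega>0 e)"
proof -
  have o: "open ((UNIV :: complex set) \<times> U)" using U by (simp add: open_Times)
  note F = iffD1[OF forms01_iff \<Omega>]
  note f = conjunct1[OF F] conjunct1[OF conjunct2[OF F]]
  show "decaying 3 2 U (vert0 \<omega>0)"
  proof (rule decayingI[where H="\<lambda>p. - vert1 \<omega>1 p"])
    show "smooth_on (UNIV \<times> U) (vert0 \<omega>0)" by (rule smooth_on_vert0[OF U f(1)])
    show "smooth_on (UNIV \<times> U) (\<lambda>p. - vert1 \<omega>1 p)" by (intro smooth_intros o smooth_on_vert1[OF U f(2)])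
    show "vert0 \<omega>0 (z, x) = inverse z ^ 3 * cnj (inverse z) ^ 2 * - vert1 \<omega>1 (inverse z, x)" if "z \<noteq> 0" "x \<in> U" for z x
      by (rule transition_invert[OF that(1) vert_transition[OF \<Omega> that]])
  qed
  show "decaying 2 0 U (gcoef \<omega>0 e)"
  proof (rule decayingI[where H="\<lambda>p. (1 + fst p * cnj (fst p)) * coef1 \<omega>1 e p"])
    show "smooth_on (UNIV \<times> U) (gcoef \<omega>0 e)"
      unfolding gcoef_def[abs_def] by (intro smooth_intros o smooth_on_coef0[OF U f(1)])
    show "smooth_on (UNIV \<times> U) (\<lambda>p. (1 + fst p * cnj (fst p)) * coef1 \<omega>1 e p)"
      by (intro smooth_intros o smooth_on_coef1[OF U f(2)])
    show "gcoef \<omega>0 e (z, x) = inverse z ^ 2 * cnj (inverse z) ^ 0 * ((1 + fst (inverse z, x) * cnj (fst (inverse z, x))) * coef1 \<omega>1 e (inverse z, x))"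
      if z: "z \<noteq> 0" "x \<in> U" for z x
    proof -
      define w where "w = inverse z"
      have zw: "z * w = 1" "cnj z * cnj w = 1"
        using z(1) unfolding w_def complex_cnj_mult[symmetric] by simp_all
      \<comment> \<open>The weight grows like |z|^2 and consumes one power of w and the power of its
        conjugate, leaving order 2.\<close>
      have "(1 + z * cnj z) * (w ^ 3 * cnj w) = w ^ 3 * cnj w + (z * w) * (cnj z * cnj w) * w ^ 2"
        by (simp add: algebra_simps power2_eq_square power3_eq_cube)
      also have "\<dots> = w ^ 2 * (1 + w * cnj w)"
        unfolding zw by (simp add: algebra_simps power2_eq_square power3_eq_cube)
      finally have e: "(1 + z * cnj z) * (w ^ 3 * cnj w) = w ^ 2 * (1 + w * cnj w)" .
      have "gcoef \<omega>0 e (z, x) = ((1 + z * cnj z) * (w ^ 3 * cnj w)) * coef1 \<omega>1 e (w, x)"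
        unfolding gcoef_def coef_transition[OF \<Omega> z] fst_conv w_def mult.assoc by (rule refl)
      then show ?thesis unfolding e w_def[symmetric] fst_conv power_0 mult_1_right mult.assoc .
    qed
  qed
qed

section \<open>Fibre integration\<close>

definition fibre_int :: "(complex \<times> 'x::euclidean_space \<Rightarrow> complex) \<Rightarrow> 'x \<Rightarrow> complex" where
  "fibre_int h x = (\<integral>z. h (z, x) \<partial>lborel)"

context
  fixes a b :: nat and U :: "'x::euclidean_space set"
  assumes U: "open U" and ab: "a + b \<ge> 3"
begin

lemma one_kernel_integrable: "integrable lborel (\<lambda>u::complex. norm (1 :: complex) / (1 + norm u) ^ (a + b))"
  using integrable_plane_weight3[OF ab] by simp

text \<open>Up to the reflection of u to -u, integration over the fibre is convolution with the
  constant kernel, evaluated at z = 0; the results on differentiation thereby carry over.\<close>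

lemma fibre_int_eq_conv:
  assumes h: "decaying a b U h" and x: "x \<in> U"
  shows "fibre_int h x = fibre_conv (\<lambda>u. 1) h (0, x)"
proof -
  have "(\<lambda>z. h (z, x)) \<in> borel_measurable borel"
    by (rule borel_measurable_continuous_onI[OF slice_continuous[OF decaying_smooth[OF h] x]])
  from integral_complex_reflect[OF this, of 0] show ?thesis
    by (simp add: fibre_int_def fibre_conv_def)
qed

lemma fibre_int_has_derivative:
  assumes h: "decaying a b U h" and x: "x \<in> U"
  shows "(fibre_int h has_derivative (\<lambda>y. fibre_int (\<lambda>q. frechet_derivative h (at q) (0, y)) x)) (at x)"
proof -
  have p: "(0, x) \<in> UNIV \<times> U" using x by simp
  have j: "((\<lambda>x. (0 :: complex, x)) has_derivative (\<lambda>y. (0, y))) (at x)"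
    by (rule has_derivative_Pair[OF has_derivative_const has_derivative_ident])
  have "((\<lambda>x. fibre_conv (\<lambda>u. 1) h (0, x)) has_derivative
     (\<lambda>y. fibre_conv (\<lambda>u. 1) (\<lambda>q. frechet_derivative h (at q) (0, y)) (0, x))) (at x)"
    by (rule has_derivative_compose[OF j fibre_conv_has_derivative[OF U borel_measurable_const one_kernel_integrable h p]])
  then have "(fibre_int h has_derivative
     (\<lambda>y. fibre_conv (\<lambda>u. 1) (\<lambda>q. frechet_derivative h (at q) (0, y)) (0, x))) (at x)"
    by (rule has_derivative_transform_within_open[OF _ U x]) (rule fibre_int_eq_conv[OF h, symmetric])
  then show ?thesis
    by (simp only: fibre_int_eq_conv[OF decaying_frechet_derivative[OF U h] x])
qed

lemma smooth_on_fibre_int: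
  assumes h: "decaying a b U h"
  shows "smooth_on U (fibre_int h)"
proof -
  have o: "open ((UNIV :: complex set) \<times> U)" using U by (simp add: open_Times)
  have "smooth_on U (\<lambda>x. fibre_conv (\<lambda>u. 1) h (0, x))"
  proof (rule smooth_on_compose[OF smooth_on_fibre_conv[OF U borel_measurable_const one_kernel_integrable h] _ U o])
    show "smooth_on U (\<lambda>x. (0, x))" by (rule smooth_on_Pair[OF U smooth_on_const smooth_on_id[OF U]])
    show "(0, x) \<in> UNIV \<times> U" if "x \<in> U" for x using that by simp
  qed
  then show ?thesis using smooth_on_cong[OF U fibre_int_eq_conv[OF h]] by (rule_tac iffD2)
qed

end

lemma tau_push_eq:
  "tau_push h x = (fibre_int (fst h) x / pi, fibre_int (\<lambda>q. fst q * fst h q) x / pi)"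
proof -
  have "1 / (2 * pi * \<i>) * (I * (2 * \<i>)) = I / pi" for I :: complex by (simp add: field_simps)
  then show ?thesis
    unfolding tau_push_def fibre_int_def by (simp only: integral_mult_left_zero fst_conv)
qed

lemma forms01_tau_decaying:
  assumes U: "open U" and h: "(h0, h1) \<in> forms01_tau (-3) U"
  shows "decaying 3 2 U h0" "decaying 2 2 U (\<lambda>q. fst q * h0 q)"
proof -
  have o: "open ((UNIV :: complex set) \<times> U)" using U by (simp add: open_Times)
  have s: "smooth_on (UNIV \<times> U) h0" "smooth_on (UNIV \<times> U) h1"
    and t: "\<And>z x. z \<noteq> 0 \<Longrightarrow> x \<in> U \<Longrightarrow> h1 (inverse z, x) = - (z ^ 3) * cnj z ^ 2 * h0 (z, x)"
    using h unfolding forms01_tau_def by simp_all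
  show d: "decaying 3 2 U h0"
  proof (rule decayingI[where H="\<lambda>p. - h1 p"])
    show "smooth_on (UNIV \<times> U) h0" by (rule s(1))
    show "smooth_on (UNIV \<times> U) (\<lambda>p. - h1 p)" by (rule smooth_on_minus[OF o s(2)])
    show "h0 (z, x) = inverse z ^ 3 * cnj (inverse z) ^ 2 * - h1 (inverse z, x)" if "z \<noteq> 0" "x \<in> U" for z x
      by (rule transition_invert[OF that(1) t[OF that]])
  qed
  have "decaying (Suc 2) 2 U h0" using d by (simp only: numeral_3_eq_3 numeral_2_eq_2)
  then show "decaying 2 2 U (\<lambda>q. fst q * h0 q)" by (rule decaying_Suc(2)[OF U])
qed

lemma pi_tau_in_forms01_tau:
  assumes U: "open U" and \<Omega>: "\<Omega> \<in> forms01 (-3) U"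
  shows "pi_tau \<Omega> \<in> forms01_tau (-3) U"
proof -
  obtain \<omega>0 \<omega>1 where e: "\<Omega> = (\<omega>0, \<omega>1)" by (cases \<Omega>)
  note \<Omega>' = \<Omega>[unfolded e]
  note F = iffD1[OF forms01_iff \<Omega>']
  have "vert0 \<omega>0 (z, x) = 0" "vert1 \<omega>1 (z, x) = 0" if "x \<notin> U" for z x
  proof -
    have "lift0 (z, x) \<notin> chart0 U" "lift1 (z, x) \<notin> chart1 U" using that by (simp_all add: lift_in_chart)
    then show "vert0 \<omega>0 (z, x) = 0" "vert1 \<omega>1 (z, x) = 0"
      using F unfolding smooth_form01_def vert0_def vert1_def by blast+
  qed
  moreover have "smooth_on (UNIV \<times> U) (vert0 \<omega>0)" "smooth_on (UNIV \<times> U) (vert1 \<omega>1)"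
    by (rule smooth_on_vert0[OF U conjunct1[OF F]], rule smooth_on_vert1[OF U conjunct1[OF conjunct2[OF F]]])
  ultimately show ?thesis
    unfolding pi_tau_vert e forms01_tau_def using vert_transition[OF \<Omega>'] by simp
qed

lemma tau_push_smooth:
  assumes U: "open U" and h: "h \<in> forms01_tau (-3) U"
  shows "tau_push h \<in> smooth_maps U"
proof -
  obtain h0 h1 where e: "h = (h0, h1)" by (cases h)
  note d = forms01_tau_decaying[OF U h[unfolded e]]
  have "smooth_on U (fibre_int h0)" "smooth_on U (fibre_int (\<lambda>q. fst q * h0 q))"
    by (rule smooth_on_fibre_int[OF U _ d(1)], simp, rule smooth_on_fibre_int[OF U _ d(2)], simp)
  then have "smooth_on U (\<lambda>x. (fibre_int h0 x / pi, fibre_int (\<lambda>q. fst q * h0 q) x / pi))"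
    by (intro smooth_on_Pair smooth_on_divide smooth_on_const U) simp_all
  moreover have "tau_push h = (\<lambda>x. (fibre_int h0 x / pi, fibre_int (\<lambda>q. fst q * h0 q) x / pi))"
    by (rule ext) (simp add: tau_push_eq e)
  moreover have "tau_push h x = 0" if "x \<notin> U" for x
    using h that unfolding forms01_tau_def e tau_push_eq fibre_int_def by (auto simp: zero_prod_def)
  ultimately show ?thesis unfolding smooth_maps_def by simp
qed

text \<open>The defect \<open>R\<close> is antilinear in \<open>e\<close>, hence determined by its
  values on the complex basis of the \<open>axis l q1\<close> and \<open>axis l qk\<close>. Doubled,
  these values are the two complex components of the quaternionic equation.\<close>

lemma antilinear_part_axis_eq:
  fixes D :: "quat ^ 'n::finite \<Rightarrow> complex \<times> complex"
  assumes l: "linear D"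
  defines "A0 \<equiv> \<lambda>y. fst (D y)" and "A1 \<equiv> \<lambda>y. snd (D y)"
  shows "(\<forall>l. D (axis l q1) + qmult qi (D (axis l qi)) + qmult qj (D (axis l qj)) + qmult qk (D (axis l qk)) = 0)
    \<longleftrightarrow> (\<forall>e. antilinear_part A0 e = clinear_part A1 (quatJ e))"
proof -
  define R where "R e = antilinear_part A0 e - clinear_part A1 (quatJ e)" for e
  have l0: "linear A0" unfolding A0_def using linear_compose[OF l bounded_linear.linear[OF bounded_linear_fst]] by (simp add: o_def)
  have l1: "linear A1" unfolding A1_def using linear_compose[OF l bounded_linear.linear[OF bounded_linear_snd]] by (simp add: o_def)
  have Rs: "R (hscale c e) = cnj c * R e" for c e
    unfolding R_def quatJ_simps parts_hscale[OF l0] parts_hscale[OF l1] by (rule right_diff_distrib[symmetric])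
  have Rl: "linear R"
  proof (rule linearI)
    show "R (x + y) = R x + R y" for x y
      unfolding R_def quatJ_simps parts_linear(1,2)[OF l0] parts_linear(1,2)[OF l1] by (rule add_diff_add)
    show "R (r *\<^sub>R x) = r *\<^sub>R R x" for r x
      unfolding R_def quatJ_simps parts_linear(5,6)[OF l0] parts_linear(5,6)[OF l1] by (rule scaleR_diff_right[symmetric])
  qed
  have hs: "hscale \<i> (axis l q1) = axis l qi" "quatJ (axis l q1) = axis l qk" "hscale \<i> (axis l qk) = axis l qj"
    "quatJ (axis l qk) = - axis l q1" for l :: 'n
    by (simp_all add: vec_eq_iff axis_def q1_def qi_def qk_def qj_def zero_prod_def)
  have R1: "2 * R (axis l q1) = A0 (axis l q1) + \<i> * A0 (axis l qi) - A1 (axis l qk) + \<i> * A1 (axis l qj)" for l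
    unfolding R_def hs antilinear_part_def clinear_part_def by (simp add: field_simps)
  have R2: "2 * R (axis l qk) = A0 (axis l qk) + \<i> * A0 (axis l qj) + A1 (axis l q1) - \<i> * A1 (axis l qi)" for l
    unfolding R_def hs(4) parts_linear(4)[OF l1] unfolding antilinear_part_def clinear_part_def hs by (simp add: field_simps)
  have L: "D (axis l q1) + qmult qi (D (axis l qi)) + qmult qj (D (axis l qj)) + qmult qk (D (axis l qk))
      = (2 * R (axis l q1), 2 * R (axis l qk))" for l
    unfolding R1 R2 A0_def A1_def by (simp add: prod_eq_iff qmult_def qi_def qj_def qk_def)
  have ex: "e = (\<Sum>l\<in>UNIV. hscale (fst (e $ l)) (axis l q1) + hscale (snd (e $ l)) (axis l qk))" for e :: "quat ^ 'n"
  proof -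
    have "(\<Sum>l\<in>UNIV. hscale (fst (e $ l)) (axis l q1) + hscale (snd (e $ l)) (axis l qk)) $ m = e $ m" for m
    proof -
      have "(\<Sum>l\<in>UNIV. hscale (fst (e $ l)) (axis l q1) + hscale (snd (e $ l)) (axis l qk)) $ m
         = (\<Sum>l\<in>UNIV. if l = m then e $ m else 0)"
        unfolding sum_component by (rule sum.cong) (auto simp: axis_def q1_def qk_def zero_prod_def prod_eq_iff)
      then show ?thesis by simp
    qed
    then show ?thesis by (simp add: vec_eq_iff)
  qed
  have "(\<forall>l. R (axis l q1) = 0 \<and> R (axis l qk) = 0) \<longleftrightarrow> (\<forall>e. R e = 0)"
  proof (intro iffI allI)
    fix e assume z: "\<forall>l. R (axis l q1) = 0 \<and> R (axis l qk) = 0"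
    have "R e = (\<Sum>l\<in>UNIV. R (hscale (fst (e $ l)) (axis l q1)) + R (hscale (snd (e $ l)) (axis l qk)))"
      by (subst ex[of e]) (simp only: linear_sum[OF Rl] linear_add[OF Rl])
    also have "\<dots> = 0" using z by (simp only: Rs) simp
    finally show "R e = 0" .
  qed simp
  then show ?thesis unfolding L by (simp add: zero_prod_def R_def)
qed

lemma monogenic_iff:
  "\<psi> \<in> monogenic U \<longleftrightarrow> \<psi> \<in> smooth_maps U \<and> (\<forall>x\<in>U. \<forall>e.
     antilinear_part (frechet_derivative (\<lambda>x. fst (\<psi> x)) (at x)) e = clinear_part (frechet_derivative (\<lambda>x. snd (\<psi> x)) (at x)) (quatJ e))"
proof -
  have "(\<forall>l. partial_q q1 l \<psi> x + qmult qi (partial_q qi l \<psi> x)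
       + qmult qj (partial_q qj l \<psi> x) + qmult qk (partial_q qk l \<psi> x) = 0) \<longleftrightarrow>
     (\<forall>e. antilinear_part (frechet_derivative (\<lambda>x. fst (\<psi> x)) (at x)) e = clinear_part (frechet_derivative (\<lambda>x. snd (\<psi> x)) (at x)) (quatJ e))"
    if s: "\<psi> \<in> smooth_maps U" and x: "x \<in> U" for x
  proof -
    have "smooth_on U \<psi>" using s unfolding smooth_maps_def by blast
    from smooth_on_has_derivative[OF this x]
    have D: "(\<psi> has_derivative frechet_derivative \<psi> (at x)) (at x)" .
    have "frechet_derivative (\<lambda>x. fst (\<psi> x)) (at x) = (\<lambda>y. fst (frechet_derivative \<psi> (at x) y))"
      "frechet_derivative (\<lambda>x. snd (\<psi> x)) (at x) = (\<lambda>y. snd (frechet_derivative \<psi> (at x) y))"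
      by (rule frechet_derivative_at[symmetric], rule bounded_linear.has_derivative[OF bounded_linear_fst D])
         (rule frechet_derivative_at[symmetric], rule bounded_linear.has_derivative[OF bounded_linear_snd D])
    then show ?thesis
      unfolding partial_q_def antilinear_part_axis_eq[OF has_derivative_linear[OF D]] by simp
  qed
  then show ?thesis unfolding monogenic_def by blast
qed

lemma closed_forms01_eq:
  assumes U: "open U" and \<Omega>: "(\<omega>0, \<omega>1) \<in> closed_forms01 (-3) U" and x: "x \<in> U"
  shows "dzbar (gcoef \<omega>0 e) (z, x) = horiz e (vert0 \<omega>0) (z, x)"
proof -
  have f: "(\<omega>0, \<omega>1) \<in> forms01 (-3) U" and c: "\<forall>p\<in>chart0 U. \<forall>u v. dbar1 \<omega>0 p u v = 0"
    using \<Omega> unfolding closed_forms01_def by simp_all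
  have p: "lift0 (z, x) \<in> chart0 U" using x by (simp add: lift_in_chart)
  have "dbar1 \<omega>0 (lift0 (z, x)) (1, quatJ x) (0, e) = 0" using c p by blast
  then show ?thesis
    using dbar1_vertical_horizontal[OF U conjunct1[OF iffD1[OF forms01_iff f]] x, of z e] by simp
qed

lemma push_monogenic:
  assumes U: "open U" and \<Omega>: "\<Omega> \<in> closed_forms01 (-3) U"
  shows "tau_push (pi_tau \<Omega>) \<in> monogenic U"
  unfolding monogenic_iff
proof (intro conjI ballI allI)
  have f: "\<Omega> \<in> forms01 (-3) U" using \<Omega> unfolding closed_forms01_def by simp
  show "tau_push (pi_tau \<Omega>) \<in> smooth_maps U"
    by (rule tau_push_smooth[OF U pi_tau_in_forms01_tau[OF U f]])
  fix x e assume x: "x \<in> U"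
  obtain \<omega>0 \<omega>1 where eq: "\<Omega> = (\<omega>0, \<omega>1)" by (cases \<Omega>)
  define h where "h = vert0 \<omega>0"
  have h: "decaying 3 2 U h" and g: "decaying 2 0 U (gcoef \<omega>0 e)"
    unfolding h_def using forms01_decaying[OF U f[unfolded eq]] by blast+
  have h3: "decaying (Suc 2) 2 U h" using h by (simp only: numeral_3_eq_3 numeral_2_eq_2)
  define D where "D y q = frechet_derivative h (at q) (0, y)" for y q
  have hs: "smooth_on (UNIV \<times> U) h" by (rule decaying_smooth[OF h])
  have Dd: "decaying (Suc 2) 2 U (D y)" for y
    unfolding D_def[abs_def] by (rule decaying_frechet_derivative[OF U h3])
  have zD: "decaying 2 2 U (\<lambda>q. fst q * D y q)" for y by (rule decaying_Suc(2)[OF U Dd])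
  have i1: "integrable lborel (\<lambda>z. D y (z, x))" for y
    by (rule decaying_integrable[OF U Dd x]) simp
  have i2: "integrable lborel (\<lambda>z. z * D y (z, x))" for y
    using decaying_integrable[OF U zD x] by simp
  define I0 where "I0 y = fibre_int (D y) x" for y
  define I1 where "I1 y = fibre_int (\<lambda>q. fst q * D y q) x" for y
  have d0: "(fibre_int h has_derivative I0) (at x)"
    unfolding I0_def[abs_def] D_def[abs_def] by (rule fibre_int_has_derivative[OF U _ h x]) simp
  have d1: "(fibre_int (\<lambda>q. fst q * h q) has_derivative I1) (at x)"
  proof -
    have "frechet_derivative (\<lambda>q. fst q * h q) (at (z, x)) (0, y) = z * D y (z, x)" for z y
    proof -
      have "(h has_derivative frechet_derivative h (at (z, x))) (at (z, x))"
        by (rule smooth_on_has_derivative[OF hs]) (simp add: x)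
      from has_derivative_mult[OF bounded_linear_imp_has_derivative[OF bounded_linear_fst] this]
      have "((\<lambda>q. fst q * h q) has_derivative (\<lambda>v. z * frechet_derivative h (at (z, x)) v + fst v * h (z, x))) (at (z, x))"
        by simp
      from frechet_derivative_at[OF this, symmetric] show ?thesis by (simp add: D_def)
    qed
    then have "I1 y = fibre_int (\<lambda>q. frechet_derivative (\<lambda>q. fst q * h q) (at q) (0, y)) x" for y
      by (simp add: I1_def fibre_int_def)
    then have "I1 = (\<lambda>y. fibre_int (\<lambda>q. frechet_derivative (\<lambda>q. fst q * h q) (at q) (0, y)) x)" by (rule ext)
    then show ?thesis
      using fibre_int_has_derivative[OF U _ decaying_Suc(2)[OF U h3] x] by simp
  qed
  \<comment> \<open>Order 2 of \<open>gcoef\<close> controls the boundary terms but not the integral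
    of its derivative; integrability is read off the other side of the closedness equation, which
    has order 4.\<close>
  have "integrable lborel (\<lambda>z. dzbar (gcoef \<omega>0 e) (z, x))"
    using decaying_integrable[OF U decaying_horiz[OF U h3, of e] x]
    by (simp add: closed_forms01_eq[OF U \<Omega>[unfolded eq] x] h_def)
  from integral_dzbar_decaying[OF U g _ x this]
  have "0 = (\<integral>z. horiz e h (z, x) \<partial>lborel)"
    by (simp add: closed_forms01_eq[OF U \<Omega>[unfolded eq] x] h_def)
  \<comment> \<open>The part of \<open>horiz\<close> with coefficient z produces the first moment
    and the other part the zeroth; this is how both functions of the monogenic equation
    arise.\<close>
  also have "\<dots> = (\<integral>z. (D e (z, x) + \<i> * D (hscale \<i> e) (z, x)) / 2
     - (z * D (quatJ e) (z, x) - \<i> * (z * D (hscale \<i> (quatJ e)) (z, x))) / 2 \<partial>lborel)"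
    unfolding horiz_def xbar_def xhol_def antilinear_part_def clinear_part_def D_def[symmetric]
    by (rule Bochner_Integration.integral_cong[OF refl]) (simp add: algebra_simps)
  also have "\<dots> = (I0 e + \<i> * I0 (hscale \<i> e)) / 2 - (I1 (quatJ e) - \<i> * I1 (hscale \<i> (quatJ e))) / 2"
  proof -
    have i3: "integrable lborel (\<lambda>z. (D e (z, x) + \<i> * D (hscale \<i> e) (z, x)) / 2)"
      by (rule integrable_divide, rule Bochner_Integration.integrable_add[OF i1 integrable_mult_right[OF i1]])
    have i4: "integrable lborel (\<lambda>z. (z * D (quatJ e) (z, x) - \<i> * (z * D (hscale \<i> (quatJ e)) (z, x))) / 2)"
      by (rule integrable_divide, rule Bochner_Integration.integrable_diff[OF i2 integrable_mult_right[OF i2]])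
    show ?thesis
      unfolding Bochner_Integration.integral_diff[OF i3 i4] integral_divide_zero
        Bochner_Integration.integral_add[OF i1 integrable_mult_right[OF i1]]
        Bochner_Integration.integral_diff[OF i2 integrable_mult_right[OF i2]] integral_mult_right_zero
        I0_def I1_def fibre_int_def fst_conv ..
  qed
  finally have key: "antilinear_part I0 e = clinear_part I1 (quatJ e)"
    by (simp add: antilinear_part_def clinear_part_def)
  have fd: "frechet_derivative (\<lambda>x. fst (tau_push (pi_tau \<Omega>) x)) (at x) = (\<lambda>y. I0 y / pi)"
    "frechet_derivative (\<lambda>x. snd (tau_push (pi_tau \<Omega>) x)) (at x) = (\<lambda>y. I1 y / pi)"
  proof -
    have "((\<lambda>x. fibre_int h x / pi) has_derivative (\<lambda>y. I0 y / pi)) (at x)"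
      "((\<lambda>x. fibre_int (\<lambda>q. fst q * h q) x / pi) has_derivative (\<lambda>y. I1 y / pi)) (at x)"
      unfolding divide_inverse by (rule has_derivative_mult_left[OF d0], rule has_derivative_mult_left[OF d1])
    moreover have "(\<lambda>x. fst (tau_push (pi_tau \<Omega>) x)) = (\<lambda>x. fibre_int h x / pi)"
      "(\<lambda>x. snd (tau_push (pi_tau \<Omega>) x)) = (\<lambda>x. fibre_int (\<lambda>q. fst q * h q) x / pi)"
      unfolding tau_push_eq pi_tau_vert eq fst_conv snd_conv h_def by (rule refl)+
    ultimately show "frechet_derivative (\<lambda>x. fst (tau_push (pi_tau \<Omega>) x)) (at x) = (\<lambda>y. I0 y / pi)"
      "frechet_derivative (\<lambda>x. snd (tau_push (pi_tau \<Omega>) x)) (at x) = (\<lambda>y. I1 y / pi)"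
      by (simp_all only: frechet_derivative_at[symmetric])
  qed
  have "antilinear_part (\<lambda>y. I0 y / pi) e = antilinear_part I0 e / pi"
    "clinear_part (\<lambda>y. I1 y / pi) (quatJ e) = clinear_part I1 (quatJ e) / pi"
    by (simp_all add: antilinear_part_def clinear_part_def field_simps)
  then show "antilinear_part (frechet_derivative (\<lambda>x. fst (tau_push (pi_tau \<Omega>) x)) (at x)) e =
     clinear_part (frechet_derivative (\<lambda>x. snd (tau_push (pi_tau \<Omega>) x)) (at x)) (quatJ e)"
    unfolding fd key by simp
qed

section \<open>Exactness\<close>

lemma sections_iff:
  "(F0, F1) \<in> sections (-3) U \<longleftrightarrow> smooth_fun (chart0 U) F0 \<and> smooth_fun (chart1 U) F1 \<and>
     (\<forall>p\<in>chart0 U. fst p \<noteq> 0 \<longrightarrow> F1 (chart_change p) = fst p ^ 3 * F0 p)"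
  unfolding sections_def mem_Collect_eq prod.case minus_minus power_int_numeral by (rule refl)

lemma chart_change_in_chart1: "p \<in> chart0 U \<Longrightarrow> fst p \<noteq> 0 \<Longrightarrow> chart_change p \<in> chart1 U"
  using chart_change_lift[of "fst p" "snd (unlift0 p)"] lift_simps(3)[of p] lift_simps(7)[of p]
  by (metis chart0_iff lift_in_chart(2) prod.collapse snd_conv)

lemma smooth_form01_dbar:
  assumes V: "open V" and F: "smooth_fun V F"
  shows "smooth_form01 V (\<lambda>p v. if p \<in> V then dbar_dir F p v else 0)"
  unfolding smooth_form01_def
proof (intro conjI ballI allI impI)
  have s: "smooth_on V F" using F unfolding smooth_fun_def by blast
  fix p v
  show "conj_linear (\<lambda>v. if p \<in> V then dbar_dir F p v else 0)" if p: "p \<in> V"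
    using conj_linear_dbar_dir[OF smooth_on_differentiable[OF s p]] p by simp
  have "smooth_on V (\<lambda>p. dbar_dir F p v)"
    unfolding dbar_dir_def
    by (intro smooth_on_divide smooth_on_add smooth_on_mult smooth_on_const smooth_on_frechet_derivative s V) simp_all
  then show "smooth_on V (\<lambda>p. if p \<in> V then dbar_dir F p v else 0)"
    using smooth_on_cong[OF V, of "\<lambda>p. if p \<in> V then dbar_dir F p v else 0" "\<lambda>p. dbar_dir F p v"] by simp
qed simp

text \<open>Transition function and coordinate change are holomorphic: the derivative of z^3
  contributes a complex linear term, which the antilinear part discards.\<close>

lemma dbar_dir_section_transition:
  assumes U: "open U" and f: "(F0, F1) \<in> sections (-3) U" and p: "p \<in> chart0 U" and z: "fst p \<noteq> 0"
  shows "dbar_dir F1 (chart_change p) (frechet_derivative chart_change (at p) v) = fst p ^ 3 * dbar_dir F0 p v"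
proof -
  note F = iffD1[OF sections_iff f]
  define D0 where "D0 = frechet_derivative F0 (at p)"
  define D1 where "D1 = frechet_derivative F1 (at (chart_change p))"
  define L where "L = frechet_derivative chart_change (at p)"
  have s: "smooth_on (chart0 U) F0" "smooth_on (chart1 U) F1" using F unfolding smooth_fun_def by blast+
  have d0: "(F0 has_derivative D0) (at p)" unfolding D0_def by (rule smooth_on_has_derivative[OF s(1) p])
  have d1: "(F1 has_derivative D1) (at (chart_change p))"
    unfolding D1_def by (rule smooth_on_has_derivative[OF s(2) chart_change_in_chart1[OF p z]])
  have L: "(chart_change has_derivative L) (at p)"
    unfolding L_def by (rule iffD1[OF frechet_derivative_works differentiableI[OF chart_change_has_derivative[OF z]]])
  have "((\<lambda>q :: 'a affine. fst q ^ 3) has_derivative (\<lambda>v. of_nat 3 * fst v * fst p ^ (3 - 1))) (at p)"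
    by (rule has_derivative_power[OF bounded_linear_imp_has_derivative[OF bounded_linear_fst]])
  note r = has_derivative_mult[OF this d0]
  have oS: "open (chart0 U \<inter> {q. fst q \<noteq> 0})"
    by (intro open_Int open_chart(1)[OF U] open_Collect_neq continuous_intros)
  have "((\<lambda>q. F1 (chart_change q)) has_derivative
     (\<lambda>v. fst p ^ 3 * D0 v + of_nat 3 * fst v * fst p ^ (3 - 1) * F0 p)) (at p)"
    by (rule has_derivative_transform_within_open[OF r oS]) (use p z F in auto)
  from has_derivative_unique[OF this has_derivative_compose[OF L d1]]
  have e: "D1 (L v) = fst p ^ 3 * D0 v + of_nat 3 * fst v * fst p ^ (3 - 1) * F0 p" for v
    by (rule fun_cong[OF sym])
  have Li: "ascale \<i> (L v) = L (ascale \<i> v)"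
    unfolding L_def chart_change_frechet_derivative[OF z]
    by (simp add: ascale_def hscale_simps mult_ac)
  show ?thesis
    unfolding dbar_dir_def D0_def[symmetric] D1_def[symmetric] L_def[symmetric] Li e
    by (simp add: ascale_def algebra_simps add_divide_distrib)
qed

lemma dbar0_in_forms01:
  assumes U: "open U" and f: "f \<in> sections (-3) U"
  shows "dbar0 U f \<in> forms01 (-3) U"
proof -
  obtain F0 F1 where e: "f = (F0, F1)" by (cases f)
  note f' = f[unfolded e]
  note F = iffD1[OF sections_iff f']
  show ?thesis
    unfolding dbar0_def forms01_iff e fst_conv snd_conv
  proof (intro conjI ballI impI allI)
    show "smooth_form01 (chart0 U) (\<lambda>p v. if p \<in> chart0 U then dbar_dir F0 p v else 0)"
      by (rule smooth_form01_dbar[OF open_chart(1)[OF U] conjunct1[OF F]])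
    show "smooth_form01 (chart1 U) (\<lambda>p v. if p \<in> chart1 U then dbar_dir F1 p v else 0)"
      by (rule smooth_form01_dbar[OF open_chart(2)[OF U] conjunct1[OF conjunct2[OF F]]])
    fix p v assume p: "p \<in> chart0 U" "fst p \<noteq> 0"
    show "(if chart_change p \<in> chart1 U then dbar_dir F1 (chart_change p) (frechet_derivative chart_change (at p) v) else 0) =
      fst p ^ 3 * (if p \<in> chart0 U then dbar_dir F0 p v else 0)"
      using dbar_dir_section_transition[OF U f' p, of v] p(1) chart_change_in_chart1[OF p] by simp
  qed
qed

section \<open>Vector space operations on forms\<close>

lemma conj_linear_add: "conj_linear g \<Longrightarrow> conj_linear h \<Longrightarrow> conj_linear (\<lambda>v. g v + h v)"
  unfolding conj_linear_def by (simp only: distrib_left) (simp only: add_ac, blast)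

lemma conj_linear_cmult: "conj_linear g \<Longrightarrow> conj_linear (\<lambda>v. c * g v)"
  unfolding conj_linear_def by (simp only: distrib_left mult.left_commute) blast

lemma smooth_form01_add:
  assumes V: "open V" and a: "smooth_form01 V \<omega>" and b: "smooth_form01 V \<eta>"
  shows "smooth_form01 V (\<lambda>p v. \<omega> p v + \<eta> p v)"
  unfolding smooth_form01_def
proof (intro conjI ballI allI impI)
  show "conj_linear (\<lambda>v. \<omega> p v + \<eta> p v)" if "p \<in> V" for p
    by (rule conj_linear_add[OF smooth_form01_conj_linear[OF a that] smooth_form01_conj_linear[OF b that]])
  show "smooth_on V (\<lambda>p. \<omega> p v + \<eta> p v)" for v
    by (rule smooth_on_add[OF V smooth_form01_smooth[OF a] smooth_form01_smooth[OF b]])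
  show "\<omega> p v + \<eta> p v = 0" if "p \<notin> V" for p v
  proof -
    have "\<omega> p v = 0" "\<eta> p v = 0" using a b that unfolding smooth_form01_def by blast+
    then show ?thesis by simp
  qed
qed

lemma smooth_form01_cmult:
  assumes V: "open V" and a: "smooth_form01 V \<omega>"
  shows "smooth_form01 V (\<lambda>p v. c * \<omega> p v)"
  unfolding smooth_form01_def
proof (intro conjI ballI allI impI)
  show "conj_linear (\<lambda>v. c * \<omega> p v)" if "p \<in> V" for p
    by (rule conj_linear_cmult[OF smooth_form01_conj_linear[OF a that]])
  show "smooth_on V (\<lambda>p. c * \<omega> p v)" for v
    by (rule smooth_on_mult[OF V smooth_on_const smooth_form01_smooth[OF a]])
  show "c * \<omega> p v = 0" if "p \<notin> V" for p v
  proof -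
    have "\<omega> p v = 0" using a that unfolding smooth_form01_def by blast
    then show ?thesis by simp
  qed
qed

lemma forms01_add:
  assumes U: "open U" and a: "\<Omega> \<in> forms01 (-3) U" and b: "\<Omega>' \<in> forms01 (-3) U"
  shows "\<Omega> + \<Omega>' \<in> forms01 (-3) U"
proof -
  obtain \<omega>0 \<omega>1 where e: "\<Omega> = (\<omega>0, \<omega>1)" by (cases \<Omega>)
  obtain \<eta>0 \<eta>1 where e': "\<Omega>' = (\<eta>0, \<eta>1)" by (cases \<Omega>')
  have s: "\<Omega> + \<Omega>' = ((\<lambda>p v. \<omega>0 p v + \<eta>0 p v), (\<lambda>p v. \<omega>1 p v + \<eta>1 p v))"
    by (simp add: e e' plus_fun_def)
  note A = iffD1[OF forms01_iff a[unfolded e]] and B = iffD1[OF forms01_iff b[unfolded e']]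
  show ?thesis unfolding s forms01_iff
  proof (intro conjI ballI impI allI)
    show "smooth_form01 (chart0 U) (\<lambda>p v. \<omega>0 p v + \<eta>0 p v)"
      by (rule smooth_form01_add[OF open_chart(1)[OF U] conjunct1[OF A] conjunct1[OF B]])
    show "smooth_form01 (chart1 U) (\<lambda>p v. \<omega>1 p v + \<eta>1 p v)"
      by (rule smooth_form01_add[OF open_chart(2)[OF U] conjunct1[OF conjunct2[OF A]] conjunct1[OF conjunct2[OF B]]])
    fix p v assume p: "p \<in> chart0 U" "fst p \<noteq> 0"
    note ta = spec[OF mp[OF bspec[OF conjunct2[OF conjunct2[OF A]] p(1)] p(2)], of v]
    note tb = spec[OF mp[OF bspec[OF conjunct2[OF conjunct2[OF B]] p(1)] p(2)], of v]
    show "\<omega>1 (chart_change p) (frechet_derivative chart_change (at p) v) + \<eta>1 (chart_change p) (frechet_derivative chart_change (at p) v)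
      = fst p ^ 3 * (\<omega>0 p v + \<eta>0 p v)"
      unfolding ta tb by (rule distrib_left[symmetric])
  qed
qed

lemma forms01_scale:
  assumes U: "open U" and a: "\<Omega> \<in> forms01 (-3) U"
  shows "form_scale c \<Omega> \<in> forms01 (-3) U"
proof -
  obtain \<omega>0 \<omega>1 where e: "\<Omega> = (\<omega>0, \<omega>1)" by (cases \<Omega>)
  note A = iffD1[OF forms01_iff a[unfolded e]]
  show ?thesis unfolding form_scale_def e fst_conv snd_conv forms01_iff
  proof (intro conjI ballI impI allI)
    show "smooth_form01 (chart0 U) (\<lambda>p v. c * \<omega>0 p v)"
      by (rule smooth_form01_cmult[OF open_chart(1)[OF U] conjunct1[OF A]])
    show "smooth_form01 (chart1 U) (\<lambda>p v. c * \<omega>1 p v)"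
      by (rule smooth_form01_cmult[OF open_chart(2)[OF U] conjunct1[OF conjunct2[OF A]]])
    fix p v assume p: "p \<in> chart0 U" "fst p \<noteq> 0"
    note ta = spec[OF mp[OF bspec[OF conjunct2[OF conjunct2[OF A]] p(1)] p(2)], of v]
    show "c * \<omega>1 (chart_change p) (frechet_derivative chart_change (at p) v) = fst p ^ 3 * (c * \<omega>0 p v)"
      unfolding ta by (rule mult.left_commute)
  qed
qed

lemma form_diff_eq: "\<Omega> - \<Omega>' = \<Omega> + form_scale (- 1) \<Omega>'"
  by (simp add: form_scale_def prod_eq_iff fun_eq_iff)

lemma forms01_diff:
  assumes "open U" "\<Omega> \<in> forms01 (-3) U" "\<Omega>' \<in> forms01 (-3) U"
  shows "\<Omega> - \<Omega>' \<in> forms01 (-3) U"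
  unfolding form_diff_eq by (rule forms01_add[OF assms(1,2) forms01_scale[OF assms(1,3)]])

lemma continuous_eq_0_at_0:
  fixes f :: "complex \<Rightarrow> complex"
  assumes c: "continuous_on UNIV f" and z: "\<And>w. w \<noteq> 0 \<Longrightarrow> f w = 0"
  shows "f w = 0"
proof (cases "w = 0")
  case True
  have "isCont f 0" using c by (simp add: continuous_on_eq_continuous_at)
  then have "(f \<longlongrightarrow> f 0) (at 0)" by (rule isContD)
  then have "((\<lambda>w::complex. 0) \<longlongrightarrow> f 0) (at 0)"
    by (rule Lim_transform_eventually) (auto simp: eventually_at_filter z)
  from LIM_const_eq[OF this] show ?thesis using True by simp
qed (rule z)

text \<open>The first chart misses the single point w = 0 of each fibre, so the second
  representative vanishes off w = 0 by the transition rule and at w = 0 by continuity.\<close>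

lemma forms01_chart1_eq_0:
  assumes U: "open U" and \<Omega>: "(\<omega>0, \<omega>1) \<in> forms01 (-3) U" and z: "\<And>p v. \<omega>0 p v = 0"
  shows "\<omega>1 p v = 0"
proof (cases "p \<in> chart1 U")
  case False
  then show ?thesis using conjunct1[OF conjunct2[OF iffD1[OF forms01_iff \<Omega>]]] unfolding smooth_form01_def by blast
next
  case True
  define w where "w = fst (unlift1 p)"
  define x where "x = snd (unlift1 p)"
  have p: "p = lift1 (w, x)" unfolding w_def x_def prod.collapse by (rule lift_simps(4)[symmetric])
  have x: "x \<in> U" using True by (simp add: chart1_iff x_def)
  note s1 = conjunct1[OF conjunct2[OF iffD1[OF forms01_iff \<Omega>]]]
  have v0: "vert1 \<omega>1 (w, x) = 0" if w: "w \<noteq> 0" for w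
  proof -
    have "inverse w \<noteq> 0" using w by simp
    from vert_transition[OF \<Omega> this x] show ?thesis by (simp add: vert0_def z)
  qed
  have c0: "coef1 \<omega>1 e (w, x) = 0" if w: "w \<noteq> 0" for w e
  proof -
    have "inverse w \<noteq> 0" using w by simp
    from coef_transition[OF \<Omega> this x, of e] show ?thesis using w by (simp add: coef0_def z)
  qed
  have "vert1 \<omega>1 (w, x) = 0"
    by (rule continuous_eq_0_at_0[OF slice_continuous[OF smooth_on_vert1[OF U s1] x] v0])
  moreover have "coef1 \<omega>1 e (w, x) = 0" for e
    by (rule continuous_eq_0_at_0[OF slice_continuous[OF smooth_on_coef1[OF U s1] x] c0])
  ultimately have a: "\<omega>1 p (1, x) = 0" "\<omega>1 p (0, e) = 0" for e
    unfolding p vert1_def coef1_def by simp_all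
  have "conj_linear (\<lambda>v :: 'a affine. 0)" by (simp add: conj_linear_def)
  from conj_linear_eqI[OF smooth_form01_conj_linear[OF s1 True] this a] show ?thesis .
qed

lemma dzbar_cong:
  assumes "open S" "p \<in> S" "\<And>q. q \<in> S \<Longrightarrow> f q = g q"
  shows "dzbar f p = dzbar g p" "horiz e f p = horiz e g p"
  using frechet_derivative_cong_open[of S p f g, OF assms] by (simp_all add: dzbar_def horiz_def xbar_def xhol_def)

lemma dzbar_diff:
  assumes "f differentiable (at p)" "g differentiable (at p)"
  shows "dzbar (\<lambda>q. f q - g q) p = dzbar f p - dzbar g p"
  unfolding dzbar_def
  by (simp add: frechet_derivative_at[OF has_derivative_diff[OF iffD1[OF frechet_derivative_works assms(1)] iffD1[OF frechet_derivative_works assms(2)]], symmetric]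
      diff_divide_distrib algebra_simps)

lemma dzbar_fst_mult:
  assumes "f differentiable (at p)"
  shows "dzbar (\<lambda>q. fst q * f q) p = fst p * dzbar f p"
  unfolding dzbar_def
  by (simp add: frechet_derivative_at[OF has_derivative_mult[OF bounded_linear_imp_has_derivative[OF bounded_linear_fst] iffD1[OF frechet_derivative_works assms]], symmetric]
      algebra_simps)

lemma decaying_of_transition:
  assumes f0: "smooth_on (UNIV \<times> U) f0" and f1: "smooth_on (UNIV \<times> U) f1"
    and t: "\<And>z x. z \<noteq> 0 \<Longrightarrow> x \<in> U \<Longrightarrow> f1 (inverse z, x) = z ^ Suc n * f0 (z, x)"
  shows "decaying (Suc n) 0 U f0"
proof (rule decayingI[OF f0 f1])
  fix z :: complex and x assume z: "z \<noteq> 0" and x: "x \<in> U"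
  have "inverse z ^ Suc n * z ^ Suc n = (inverse z * z) ^ Suc n" by (simp only: power_mult_distrib)
  also have "\<dots> = 1" using z by simp
  finally have i: "inverse z ^ Suc n * z ^ Suc n = 1" .
  show "f0 (z, x) = inverse z ^ Suc n * cnj (inverse z) ^ 0 * f1 (inverse z, x)"
    unfolding t[OF z x] power_0 mult_1_right mult.assoc[symmetric] by (simp only: i mult_1_left)
qed

text \<open>Multiplication by z commutes with \<open>dzbar\<close>, and both \<open>f0\<close>
  (order 3) and z times \<open>f0\<close> (order 2) decay enough for Stokes' theorem. A further
  factor z would leave order 1 only.\<close>

lemma push_dbar0:
  assumes U: "open U" and f: "f \<in> sections (-3) U"
  shows "tau_push (pi_tau (dbar0 U f)) = 0"
proof
  fix x
  obtain F0 F1 where e: "f = (F0, F1)" by (cases f)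
  note f' = f[unfolded e]
  note F = iffD1[OF sections_iff f']
  define \<omega>0 where "\<omega>0 = (\<lambda>p v. if p \<in> chart0 U then dbar_dir F0 p v else 0)"
  define \<omega>1 where "\<omega>1 = (\<lambda>p v. if p \<in> chart1 U then dbar_dir F1 p v else 0)"
  have d: "dbar0 U f = (\<omega>0, \<omega>1)" unfolding dbar0_def e \<omega>0_def \<omega>1_def fst_conv snd_conv by (rule refl)
  have \<Omega>: "(\<omega>0, \<omega>1) \<in> forms01 (-3) U" using dbar0_in_forms01[OF U f] d by simp
  define f0 where "f0 q = F0 (lift0 q)" for q
  have s: "smooth_on (chart0 U) F0" "smooth_on (chart1 U) F1" using F unfolding smooth_fun_def by blast+
  have f0s: "smooth_on (UNIV \<times> U) f0" unfolding f0_def[abs_def] by (rule smooth_on_comp_lift(1)[OF U s(1)])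
  have f0d: "decaying (Suc 2) 0 U f0"
  proof (rule decaying_of_transition[OF f0s smooth_on_comp_lift(2)[OF U s(2)]])
    fix z :: complex and x assume z: "z \<noteq> 0" and x: "x \<in> U"
    have "F1 (chart_change (lift0 (z, x))) = fst (lift0 (z, x)) ^ 3 * F0 (lift0 (z, x))"
      using F x z by (simp add: lift_in_chart)
    then show "F1 (lift1 (inverse z, x)) = z ^ Suc 2 * f0 (z, x)"
      by (simp only: chart_change_lift[OF z] lift_simps fst_conv f0_def numeral_3_eq_3 numeral_2_eq_2)
  qed
  show "tau_push (pi_tau (dbar0 U f)) x = 0 x"
  proof (cases "x \<in> U")
    case False
    then have "vert0 \<omega>0 (z, x) = 0" for z by (simp add: vert0_def \<omega>0_def lift_in_chart)
    then show ?thesis by (simp add: d tau_push_eq pi_tau_vert fibre_int_def zero_prod_def)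
  next
    case x: True
    have v: "vert0 \<omega>0 (z, x) = dzbar f0 (z, x)" for z
    proof -
      have "lift0 (z, x) \<in> chart0 U" using x by (simp add: lift_in_chart)
      from dzbar_comp_lift0[OF smooth_on_differentiable[OF s(1) this]] this show ?thesis
        by (simp add: vert0_def \<omega>0_def f0_def[abs_def])
    qed
    have h: "decaying (Suc 2) 2 U (vert0 \<omega>0)"
      using forms01_decaying(1)[OF U \<Omega>] by (simp only: numeral_3_eq_3 numeral_2_eq_2)
    have i1: "integrable lborel (\<lambda>z. dzbar f0 (z, x))"
      using decaying_integrable[OF U h x] by (simp add: v)
    have z1: "(\<integral>z. dzbar f0 (z, x) \<partial>lborel) = 0"
      by (rule integral_dzbar_decaying[OF U f0d _ x i1]) simp
    have m: "dzbar (\<lambda>q. fst q * f0 q) (z, x) = z * dzbar f0 (z, x)" for z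
      using dzbar_fst_mult[OF smooth_on_differentiable[OF f0s, of "(z, x)"]] x by simp
    have i2: "integrable lborel (\<lambda>z. dzbar (\<lambda>q. fst q * f0 q) (z, x))"
      using decaying_integrable[OF U decaying_Suc(2)[OF U h] x] by (simp add: v m)
    have z2: "(\<integral>z. dzbar (\<lambda>q. fst q * f0 q) (z, x) \<partial>lborel) = 0"
      by (rule integral_dzbar_decaying[OF U decaying_Suc(2)[OF U f0d] _ x i2]) simp
    show ?thesis
      using z1 z2 by (simp add: d tau_push_eq pi_tau_vert fibre_int_def v m zero_prod_def)
  qed
qed

lemma exact_of_push_eq_0:
  assumes U: "open U" and \<Omega>: "\<Omega> \<in> closed_forms01 (-3) U" and z: "tau_push (pi_tau \<Omega>) = 0"
  shows "\<exists>f\<in>sections (-3) U. \<Omega> = dbar0 U f"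
proof -
  obtain \<omega>0 \<omega>1 where eq: "\<Omega> = (\<omega>0, \<omega>1)" by (cases \<Omega>)
  have fo: "(\<omega>0, \<omega>1) \<in> forms01 (-3) U" using \<Omega> unfolding closed_forms01_def eq by simp
  note FF = iffD1[OF forms01_iff fo]
  have o: "open ((UNIV :: complex set) \<times> U)" using U by (simp add: open_Times)
  define h0 where "h0 = vert0 \<omega>0"
  define h1 where "h1 = vert1 \<omega>1"
  have hs: "smooth_on (UNIV \<times> U) h0" "smooth_on (UNIV \<times> U) h1"
    unfolding h0_def h1_def by (rule smooth_on_vert0[OF U conjunct1[OF FF]], rule smooth_on_vert1[OF U conjunct1[OF conjunct2[OF FF]]])
  have tr: "h1 (inverse z, x) = - (z ^ 3) * cnj z ^ 2 * h0 (z, x)" if "z \<noteq> 0" "x \<in> U" for z x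
    unfolding h0_def h1_def by (rule vert_transition[OF fo that])
  have d0: "decaying 3 2 U h0" unfolding h0_def by (rule forms01_decaying(1)[OF U fo])
  have d1: "decaying 3 2 U h1"
  proof (rule decayingI[OF hs(2), of "\<lambda>p. - h0 p"])
    show "smooth_on (UNIV \<times> U) (\<lambda>p. - h0 p)" by (rule smooth_on_minus[OF o hs(1)])
    show "h1 (z, x) = inverse z ^ 3 * cnj (inverse z) ^ 2 * - h0 (inverse z, x)" if "z \<noteq> 0" "x \<in> U" for z x
      using tr[of "inverse z" x] that by simp
  qed
  have two: "(3::nat) + 2 \<ge> 2" by simp
  define f0 where "f0 = cauchy_transform h0"
  define f1 where "f1 = cauchy_transform h1"
  have fs: "smooth_on (UNIV \<times> U) f0" "smooth_on (UNIV \<times> U) f1"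
    unfolding f0_def f1_def by (rule smooth_on_cauchy_transform[OF U two d0], rule smooth_on_cauchy_transform[OF U two d1])
  have dz: "dzbar f0 q = h0 q" if "q \<in> UNIV \<times> U" for q
    unfolding f0_def by (rule dzbar_cauchy_transform[OF U two d0 that])
  have ft: "f1 (inverse z, x) = z ^ 3 * f0 (z, x)" if "z \<noteq> 0" "x \<in> U" for z x
  proof -
    have "tau_push (pi_tau \<Omega>) x = 0" using z by (simp add: zero_fun_def)
    then have "(\<integral>z. h0 (z, x) \<partial>lborel) = 0" "(\<integral>z. z * h0 (z, x) \<partial>lborel) = 0"
      by (simp_all add: tau_push_eq pi_tau_vert eq fibre_int_def zero_prod_def h0_def)
    from cauchy_transform_transition[OF U hs tr that(2) this that(1)] show ?thesis
      by (simp add: f0_def f1_def)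
  qed
  define F0 where "F0 p = (if p \<in> chart0 U then f0 (unlift0 p) else 0)" for p
  define F1 where "F1 p = (if p \<in> chart1 U then f1 (unlift1 p) else 0)" for p
  have F0s: "smooth_on (chart0 U) F0"
    using smooth_on_cong[OF open_chart(1)[OF U], of F0 "\<lambda>p. f0 (unlift0 p)"] smooth_on_comp_lift(3)[OF U fs(1)]
    by (simp add: F0_def)
  have F1s: "smooth_on (chart1 U) F1"
    using smooth_on_cong[OF open_chart(2)[OF U], of F1 "\<lambda>p. f1 (unlift1 p)"] smooth_on_comp_lift(4)[OF U fs(2)]
    by (simp add: F1_def)
  have sec: "(F0, F1) \<in> sections (-3) U"
    unfolding sections_iff
  proof (intro conjI ballI impI)
    show "smooth_fun (chart0 U) F0" "smooth_fun (chart1 U) F1"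
      unfolding smooth_fun_def using F0s F1s by (simp_all add: F0_def F1_def)
    fix p assume p: "p \<in> chart0 U" "fst p \<noteq> 0"
    define x where "x = snd (unlift0 p)"
    have x: "x \<in> U" using p(1) by (simp add: chart0_iff x_def)
    have pl: "p = lift0 (fst p, x)" unfolding x_def using lift_simps(3,7)[of p] by (metis prod.collapse)
    have ul: "unlift0 p = (fst p, x)" unfolding x_def lift_simps(7)[of p, symmetric] by (rule prod.collapse[symmetric])
    have "chart_change p = lift1 (inverse (fst p), x)" by (subst pl) (rule chart_change_lift[OF p(2)])
    then show "F1 (chart_change p) = fst p ^ 3 * F0 p"
      using ft[OF p(2) x] p(1) x by (simp add: F0_def F1_def ul lift_in_chart)
  qed
  have f0d: "decaying (Suc 2) 0 U f0"
    by (rule decaying_of_transition[OF fs ft[unfolded numeral_3_eq_3 numeral_2_eq_2[symmetric]]])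
  have F0l: "F0 (lift0 q) = f0 q" if "q \<in> UNIV \<times> U" for q
    using that by (auto simp: F0_def lift_in_chart)
  have eq0: "\<omega>0 (lift0 (z, x)) v = dbar_dir F0 (lift0 (z, x)) v" if x: "x \<in> U" for z x v
  proof (rule form0_eqI[OF conjunct1[OF FF] x])
    have p: "lift0 (z, x) \<in> chart0 U" and q: "(z, x) \<in> UNIV \<times> U" for z using x by (simp_all add: lift_in_chart)
    note df = smooth_on_differentiable[OF F0s p]
    show "conj_linear (dbar_dir F0 (lift0 (z, x)))" by (rule conj_linear_dbar_dir[OF df])
    have "dbar_dir F0 (lift0 (z, x)) (1, quatJ x) = dzbar (\<lambda>q. F0 (lift0 q)) (z, x)"
      by (rule dzbar_comp_lift0[OF df, symmetric])
    also have "\<dots> = dzbar f0 (z, x)" by (rule dzbar_cong(1)[OF o q F0l])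
    finally show "vert0 \<omega>0 (z, x) = dbar_dir F0 (lift0 (z, x)) (1, quatJ x)" using dz[OF q] by (simp add: h0_def)
    fix e
    \<comment> \<open>The failure of \<open>F0\<close> to be a primitive in the slice direction
      \<open>e\<close>, weighted by 1 + |z|^2. Since \<open>dzbar\<close> and \<open>horiz\<close>
      commute, closedness makes it holomorphic along the fibres.\<close>
    define g where "g q = gcoef \<omega>0 e q - horiz e f0 q" for q
    have gs: "smooth_on (UNIV \<times> U) (gcoef \<omega>0 e)" by (rule decaying_smooth[OF forms01_decaying(2)[OF U fo]])
    have gd: "decaying 2 0 U g"
      unfolding g_def[abs_def] by (rule decaying_diff[OF U forms01_decaying(2)[OF U fo] decaying_horiz[OF U f0d]])
    have gz: "dzbar g (z, x) = 0" for z
    proof -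
      have "dzbar g (z, x) = dzbar (gcoef \<omega>0 e) (z, x) - dzbar (horiz e f0) (z, x)"
        unfolding g_def[abs_def]
        by (rule dzbar_diff[OF smooth_on_differentiable[OF gs q] smooth_on_differentiable[OF smooth_on_horiz[OF o fs(1)] q]])
      also have "dzbar (horiz e f0) (z, x) = horiz e h0 (z, x)"
        unfolding dzbar_horiz_commute[OF o fs(1) q] by (rule dzbar_cong(2)[OF o q dz])
      also have "dzbar (gcoef \<omega>0 e) (z, x) = horiz e h0 (z, x)"
        unfolding h0_def by (rule closed_forms01_eq[OF U \<Omega>[unfolded eq] x])
      finally show ?thesis by simp
    qed
    have "g (z, x) = 0" by (rule decaying_holomorphic_eq_0[OF U gd x _ gz]) simp
    moreover have "horiz e f0 (z, x) = (1 + z * cnj z) * dbar_dir F0 (lift0 (z, x)) (0, e)"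
      unfolding horiz_comp_lift0[OF df, symmetric] by (rule dzbar_cong(2)[OF o q F0l[symmetric]])
    ultimately show "coef0 \<omega>0 e (z, x) = dbar_dir F0 (lift0 (z, x)) (0, e)"
      by (simp add: g_def gcoef_def)
  qed
  \<comment> \<open>The comparison so far concerns the first chart. The difference is a form of the
    bundle vanishing there, hence also in the second chart by continuity at infinity.\<close>
  define \<eta>0 where "\<eta>0 = (\<lambda>p v. \<omega>0 p v - (if p \<in> chart0 U then dbar_dir F0 p v else 0))"
  define \<eta>1 where "\<eta>1 = (\<lambda>p v. \<omega>1 p v - (if p \<in> chart1 U then dbar_dir F1 p v else 0))"
  have "\<Omega> - dbar0 U (F0, F1) = (\<eta>0, \<eta>1)"
    unfolding eq dbar0_def \<eta>0_def \<eta>1_def fst_conv snd_conv by (simp only: minus_prod_def fst_conv snd_conv fun_diff_def)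
  then have \<eta>: "(\<eta>0, \<eta>1) \<in> forms01 (-3) U"
    using forms01_diff[OF U fo[folded eq] dbar0_in_forms01[OF U sec]] by simp
  have z0: "\<eta>0 p v = 0" for p v
  proof (cases "p \<in> chart0 U")
    case True
    have "snd (unlift0 p) \<in> U" using True by (simp add: chart0_iff)
    from eq0[OF this, of "fst (unlift0 p)" v] show ?thesis
      using True unfolding prod.collapse lift_simps(3) \<eta>0_def by simp
  next
    case False
    then have "\<omega>0 p v = 0" using conjunct1[OF FF] unfolding smooth_form01_def by blast
    then show ?thesis using False by (simp add: \<eta>0_def)
  qed
  have z1: "\<eta>1 p v = 0" for p v by (rule forms01_chart1_eq_0[OF U \<eta> z0])
  have e0: "\<omega>0 = (\<lambda>p v. if p \<in> chart0 U then dbar_dir F0 p v else 0)"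
    by (intro ext) (rule iffD1[OF right_minus_eq z0[unfolded \<eta>0_def]])
  have e1: "\<omega>1 = (\<lambda>p v. if p \<in> chart1 U then dbar_dir F1 p v else 0)"
    by (intro ext) (rule iffD1[OF right_minus_eq z1[unfolded \<eta>1_def]])
  have "\<Omega> = dbar0 U (F0, F1)"
    unfolding eq dbar0_def fst_conv snd_conv by (subst e0, subst e1) (rule refl)
  then show ?thesis using sec by blast
qed

section \<open>Moments of the Fubini-Study kernel\<close>

text \<open>Lets the derivative be computed in one variable at a time, once joint differentiability
  is known.\<close>

lemma frechet_derivative_slice:
  assumes f: "f differentiable (at (z, x))"
  shows "((\<lambda>z. f (z, x)) has_derivative D) (at z) \<Longrightarrow> frechet_derivative f (at (z, x)) (v, 0) = D v"
    and "((\<lambda>x. f (z, x)) has_derivative E) (at x) \<Longrightarrow> frechet_derivative f (at (z, x)) (0, y) = E y"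
proof -
  note d = iffD1[OF frechet_derivative_works f]
  have "((\<lambda>z. f (z, x)) has_derivative (\<lambda>v. frechet_derivative f (at (z, x)) (v, 0))) (at z)"
    by (rule has_derivative_compose[OF has_derivative_Pair[OF has_derivative_ident has_derivative_const] d])
  from has_derivative_unique[OF this]
  show "((\<lambda>z. f (z, x)) has_derivative D) (at z) \<Longrightarrow> frechet_derivative f (at (z, x)) (v, 0) = D v"
    by (rule fun_cong)
  have "((\<lambda>x. f (z, x)) has_derivative (\<lambda>y. frechet_derivative f (at (z, x)) (0, y))) (at x)"
    by (rule has_derivative_compose[OF has_derivative_Pair[OF has_derivative_const has_derivative_ident] d])
  from has_derivative_unique[OF this]
  show "((\<lambda>x. f (z, x)) has_derivative E) (at x) \<Longrightarrow> frechet_derivative f (at (z, x)) (0, y) = E y"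
    by (rule fun_cong)
qed

lemma smooth_on_comp_snd:
  fixes a :: "'x::euclidean_space \<Rightarrow> complex"
  assumes U: "open U" and a: "smooth_on U a"
  shows "smooth_on ((UNIV :: complex set) \<times> U) (\<lambda>q. a (snd q))"
proof (rule smooth_on_compose[OF a _ _ U])
  show o: "open ((UNIV :: complex set) \<times> U)" using U by (simp add: open_Times)
  show "smooth_on ((UNIV :: complex set) \<times> U) snd" by (rule smooth_on_snd[OF o smooth_on_id[OF o]])
qed auto

text \<open>Conjugates of quadratic polynomials in z, the sections of degree 2, divided by the
  matching power of the Fubini-Study weight: smooth sections of degree -2, with coefficients that
  vary over the base.\<close>

definition fs_kernel :: "('x \<Rightarrow> complex) \<Rightarrow> ('x \<Rightarrow> complex) \<Rightarrow> ('x \<Rightarrow> complex) \<Rightarrow> complex \<times> 'x \<Rightarrow> complex" where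
  "fs_kernel a b c q = (a (snd q) + b (snd q) * cnj (fst q) + c (snd q) * cnj (fst q) ^ 2) / (1 + fst q * cnj (fst q)) ^ 2"

lemma smooth_on_fs_kernel:
  fixes a b c :: "'x::euclidean_space \<Rightarrow> complex"
  assumes U: "open U" and "smooth_on U a" "smooth_on U b" "smooth_on U c"
  shows "smooth_on (UNIV \<times> U) (fs_kernel a b c)"
proof -
  have o: "open ((UNIV :: complex set) \<times> U)" using U by (simp add: open_Times)
  note s = smooth_on_comp_snd[OF U assms(2)] smooth_on_comp_snd[OF U assms(3)] smooth_on_comp_snd[OF U assms(4)]
  have f: "smooth_on ((UNIV :: complex set) \<times> U) fst" by (rule smooth_on_fst[OF o smooth_on_id[OF o]])
  have g: "smooth_on ((UNIV :: complex set) \<times> U) (\<lambda>q. cnj (fst q))" by (rule smooth_on_cnj[OF o f])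
  have n: "smooth_on (UNIV \<times> U) (\<lambda>q. a (snd q) + b (snd q) * cnj (fst q) + c (snd q) * cnj (fst q) ^ 2)"
    by (rule smooth_on_add[OF o smooth_on_add[OF o s(1) smooth_on_mult[OF o s(2) g]] smooth_on_mult[OF o s(3) smooth_on_power[OF o g]]])
  have d: "smooth_on (UNIV \<times> U) (\<lambda>q. (1 + fst q * cnj (fst q)) ^ 2)"
    by (rule smooth_on_power[OF o smooth_on_add[OF o smooth_on_const smooth_on_mult[OF o f g]]])
  show ?thesis unfolding fs_kernel_def[abs_def] by (rule smooth_on_divide[OF o n d]) simp
qed

lemma conj_sphere_inverse:
  fixes z :: complex
  assumes "z \<noteq> 0"
  shows "1 + z * cnj z = z * cnj z * (1 + inverse z * cnj (inverse z))"
  using assms by (simp add: field_simps)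

text \<open>The inversion of z to 1/z reverses the three coefficients, so the function at infinity
  is a kernel of the same kind.\<close>

lemma decaying_fs_kernel:
  fixes a b c :: "'x::euclidean_space \<Rightarrow> complex"
  assumes U: "open U" and s: "smooth_on U a" "smooth_on U b" "smooth_on U c"
  shows "decaying 2 0 U (fs_kernel a b c)"
proof (rule decayingI[OF smooth_on_fs_kernel[OF U s] smooth_on_fs_kernel[OF U s(3,2,1)]])
  fix z :: complex and x assume z: "z \<noteq> 0" and x: "x \<in> U"
  have c: "cnj z \<noteq> 0" using z by simp
  have "fs_kernel a b c (z, x) = (a x + b x * cnj z + c x * cnj z ^ 2) / (z * cnj z * (1 + inverse z * cnj (inverse z))) ^ 2"
    unfolding fs_kernel_def fst_conv snd_conv conj_sphere_inverse[OF z] ..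
  also have "a x + b x * cnj z + c x * cnj z ^ 2 = cnj z ^ 2 * (c x + b x * inverse (cnj z) + a x * inverse (cnj z) ^ 2)"
    using c by (simp add: field_simps power2_eq_square)
  also have "\<dots> / (z * cnj z * (1 + inverse z * cnj (inverse z))) ^ 2 =
     inverse z ^ 2 * ((c x + b x * inverse (cnj z) + a x * inverse (cnj z) ^ 2) / (1 + inverse z * cnj (inverse z)) ^ 2)"
    using z c unfolding power_mult_distrib power_inverse divide_inverse inverse_mult_distrib by simp
  finally show "fs_kernel a b c (z, x) = inverse z ^ 2 * cnj (inverse z) ^ 0 * fs_kernel c b a (inverse z, x)"
    unfolding fs_kernel_def fst_conv snd_conv power_0 mult_1_right complex_cnj_inverse .
qed

lemma dzbar_fs_kernel:
  fixes a b c :: "'x::euclidean_space \<Rightarrow> complex"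
  assumes U: "open U" and s: "smooth_on U a" "smooth_on U b" "smooth_on U c" and x: "x \<in> U"
  shows "dzbar (fs_kernel a b c) (z, x) =
    (b x * (1 - z * cnj z) + 2 * c x * cnj z - 2 * a x * z) / (1 + z * cnj z) ^ 3"
proof -
  define p where "p = a x + b x * cnj z + c x * cnj z ^ 2"
  define r where "r = 1 + z * cnj z"
  define D where "D v = ((b x * cnj v + c x * (2 * cnj z * cnj v)) * r\<^sup>2 - p * (2 * r * (z * cnj v + v * cnj z))) / (r\<^sup>2 * r\<^sup>2)" for v
  have r0: "r \<noteq> 0" unfolding r_def by simp
  have cd: "(cnj has_derivative cnj) (at z)" by (rule bounded_linear_imp_has_derivative[OF bounded_linear_cnj])
  have c2: "((\<lambda>z. cnj z ^ 2) has_derivative (\<lambda>v. 2 * cnj z * cnj v)) (at z)"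
    using has_derivative_power[OF cd, of 2] by (simp add: mult_ac)
  have nd: "((\<lambda>z. a x + b x * cnj z + c x * cnj z ^ 2) has_derivative (\<lambda>v. 0 + b x * cnj v + c x * (2 * cnj z * cnj v))) (at z)"
    by (intro has_derivative_add has_derivative_const has_derivative_mult_right cd c2)
  have rd: "((\<lambda>z. 1 + z * cnj z) has_derivative (\<lambda>v. 0 + (z * cnj v + v * cnj z))) (at z)"
    by (intro has_derivative_add has_derivative_const has_derivative_mult has_derivative_ident cd)
  have "(\<lambda>v. of_nat 2 * (0 + (z * cnj v + v * cnj z)) * (1 + z * cnj z) ^ (2 - 1)) = (\<lambda>v. 2 * r * (z * cnj v + v * cnj z))"
    by (simp add: r_def fun_eq_iff algebra_simps)
  with has_derivative_power[OF rd, of 2]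
  have r2: "((\<lambda>z. (1 + z * cnj z) ^ 2) has_derivative (\<lambda>v. 2 * r * (z * cnj v + v * cnj z))) (at z)"
    by (simp only:)
  have "((\<lambda>z. fs_kernel a b c (z, x)) has_derivative D) (at z)"
    using has_derivative_divide'[OF nd r2] r0 unfolding fs_kernel_def fst_conv snd_conv D_def[abs_def] p_def r_def by simp
  note e = frechet_derivative_slice(1)[OF smooth_on_differentiable[OF smooth_on_fs_kernel[OF U s]] this]
  have "dzbar (fs_kernel a b c) (z, x) = (D 1 + \<i> * D \<i>) / 2"
    unfolding dzbar_def using e x by simp
  also have "\<dots> = ((b x + c x * (2 * cnj z)) * r\<^sup>2 - p * (2 * r * z)) / (r\<^sup>2 * r\<^sup>2)"
  proof -
    have "(D 1 + \<i> * D \<i>) * (r\<^sup>2 * r\<^sup>2) = 2 * ((b x + c x * (2 * cnj z)) * r\<^sup>2 - p * (2 * r * z))"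
      unfolding D_def using r0 by (simp add: distrib_right) (simp add: algebra_simps)
    then show ?thesis using r0 by (simp add: field_simps)
  qed
  also have "(b x + c x * (2 * cnj z)) * r\<^sup>2 - p * (2 * r * z) = r * (b x * (1 - z * cnj z) + 2 * c x * cnj z - 2 * a x * z)"
    unfolding p_def r_def by (simp add: algebra_simps power2_eq_square)
  also have "\<dots> / (r\<^sup>2 * r\<^sup>2) = (b x * (1 - z * cnj z) + 2 * c x * cnj z - 2 * a x * z) / r ^ 3"
    using r0 by (simp add: field_simps power2_eq_square power3_eq_cube)
  finally show ?thesis unfolding r_def .
qed

lemma fs_moment_integrable:
  fixes f :: "complex \<Rightarrow> complex"
  assumes c: "continuous_on UNIV f" and b: "\<And>z. norm (f z) \<le> 1 + norm z ^ 2"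
  shows "integrable lborel (\<lambda>z. f z / (1 + z * cnj z) ^ 3)"
proof (rule Bochner_Integration.integrable_bound[OF integrable_fubini_study])
  have "continuous_on UNIV (\<lambda>z. f z / (1 + z * cnj z) ^ 3)"
    by (intro continuous_intros c) simp
  then show "(\<lambda>z. f z / (1 + z * cnj z) ^ 3) \<in> borel_measurable lborel"
    using borel_measurable_continuous_onI by simp
  have "norm (f z / (1 + z * cnj z) ^ 3) \<le> norm (1 / (1 + (norm z)\<^sup>2)\<^sup>2)" for z
  proof -
    have e: "norm (1 + z * cnj z) = 1 + (norm z)\<^sup>2"
    proof -
      have "1 + z * cnj z = of_real (1 + (norm z)\<^sup>2)" unfolding of_real_add of_real_1 complex_norm_square ..
      then show ?thesis by (simp only: norm_of_real) simp
    qed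
    have p: "1 + (norm z)\<^sup>2 > 0" by (simp add: add_pos_nonneg)
    have "norm (f z / (1 + z * cnj z) ^ 3) = norm (f z) / (1 + (norm z)\<^sup>2) ^ 3"
      by (simp only: norm_divide norm_power e)
    also have "\<dots> \<le> (1 + (norm z)\<^sup>2) / (1 + (norm z)\<^sup>2) ^ 3"
      by (rule divide_right_mono[OF b]) (use p in simp)
    also have "\<dots> = 1 / (1 + (norm z)\<^sup>2)\<^sup>2" using p by (simp add: power2_eq_square power3_eq_cube)
    finally show ?thesis by simp
  qed
  then show "AE z in lborel. norm (f z / (1 + z * cnj z) ^ 3) \<le> norm (1 / (1 + (norm z)\<^sup>2)\<^sup>2)" by simp
qed

lemma norm_le_one_plus_square: "norm (z :: complex) \<le> 1 + norm z ^ 2"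
proof -
  have "0 \<le> (norm z - 1/2)\<^sup>2" by simp
  then show ?thesis by (simp add: power2_eq_square algebra_simps)
qed

text \<open>Three relations come from Stokes' theorem for \<open>fs_kernel\<close> with one
  coefficient 1 and the others 0: the integrals with numerators z and \<open>cnj z\<close> vanish,
  and those with 1 and |z|^2 agree. The sum of the last two is the Fubini-Study area, which leaves
  half of it for each.\<close>

lemma fs_moments:
  "integrable lborel (\<lambda>z. 1 / (1 + z * cnj z) ^ 3)" "integrable lborel (\<lambda>z. z / (1 + z * cnj z) ^ 3)"
  "integrable lborel (\<lambda>z. cnj z / (1 + z * cnj z) ^ 3)" "integrable lborel (\<lambda>z. z * cnj z / (1 + z * cnj z) ^ 3)"
  "(\<integral>z. 1 / (1 + z * cnj z) ^ 3 \<partial>lborel) = of_real fs_area / 2"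
  "(\<integral>z. z / (1 + z * cnj z) ^ 3 \<partial>lborel) = 0"
  "(\<integral>z. cnj z / (1 + z * cnj z) ^ 3 \<partial>lborel) = 0"
  "(\<integral>z. z * cnj z / (1 + z * cnj z) ^ 3 \<partial>lborel) = of_real fs_area / 2"
proof -
  show i: "integrable lborel (\<lambda>z. 1 / (1 + z * cnj z) ^ 3)" "integrable lborel (\<lambda>z. z / (1 + z * cnj z) ^ 3)"
    "integrable lborel (\<lambda>z. cnj z / (1 + z * cnj z) ^ 3)" "integrable lborel (\<lambda>z. z * cnj z / (1 + z * cnj z) ^ 3)"
    by (rule fs_moment_integrable; auto intro!: continuous_intros norm_le_one_plus_square[unfolded power2_eq_square] simp: norm_mult power2_eq_square)+
  have key: "(\<integral>z. (b * (1 - z * cnj z) + 2 * c * cnj z - 2 * a * z) / (1 + z * cnj z) ^ 3 \<partial>lborel) = 0"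
    if "integrable lborel (\<lambda>z. (b * (1 - z * cnj z) + 2 * c * cnj z - 2 * a * z) / (1 + z * cnj z) ^ 3)" for a b c
  proof -
    \<comment> \<open>Constant coefficients over an arbitrary base, here
      \<open>real\<close>.\<close>
    let ?F = "fs_kernel (\<lambda>x::real. a) (\<lambda>x. b) (\<lambda>x. c)"
    have e: "dzbar ?F (z, 0) = (b * (1 - z * cnj z) + 2 * c * cnj z - 2 * a * z) / (1 + z * cnj z) ^ 3" for z
      by (rule dzbar_fs_kernel[OF open_UNIV smooth_on_const smooth_on_const smooth_on_const UNIV_I])
    have d: "decaying 2 0 UNIV ?F"
      by (rule decaying_fs_kernel[OF open_UNIV smooth_on_const smooth_on_const smooth_on_const])
    have "(\<integral>z. dzbar ?F (z, 0) \<partial>lborel) = 0"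
      by (rule integral_dzbar_decaying[OF open_UNIV d _ UNIV_I that[folded e]]) simp
    then show ?thesis by (simp only: e)
  qed
  have "(\<integral>z. -2 * (z / (1 + z * cnj z) ^ 3) \<partial>lborel) = 0"
    using key[of 0 0 1] integrable_mult_right[OF i(2), of "-2"] by simp
  then show "(\<integral>z. z / (1 + z * cnj z) ^ 3 \<partial>lborel) = 0" unfolding integral_mult_right_zero by simp
  have "(\<integral>z. 2 * (cnj z / (1 + z * cnj z) ^ 3) \<partial>lborel) = 0"
    using key[of 0 1 0] integrable_mult_right[OF i(3), of "2"] by simp
  then show "(\<integral>z. cnj z / (1 + z * cnj z) ^ 3 \<partial>lborel) = 0" unfolding integral_mult_right_zero by simp
  have "(\<integral>z. 1 / (1 + z * cnj z) ^ 3 - z * cnj z / (1 + z * cnj z) ^ 3 \<partial>lborel) = 0"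
    using key[of 1 0 0] Bochner_Integration.integrable_diff[OF i(1,4)] by (simp add: diff_divide_distrib)
  then have s: "(\<integral>z. 1 / (1 + z * cnj z) ^ 3 \<partial>lborel) = (\<integral>z. z * cnj z / (1 + z * cnj z) ^ 3 \<partial>lborel)"
    unfolding Bochner_Integration.integral_diff[OF i(1,4)] by simp
  have "(\<integral>z. 1 / (1 + z * cnj z) ^ 3 + z * cnj z / (1 + z * cnj z) ^ 3 \<partial>lborel)
    = (\<integral>z. complex_of_real (1 / (1 + (norm (z :: complex))\<^sup>2)\<^sup>2) \<partial>lborel)"
  proof (rule Bochner_Integration.integral_cong[OF refl])
    fix z :: complex
    have "1 / (1 + z * cnj z) ^ 3 + z * cnj z / (1 + z * cnj z) ^ 3 = (1 + z * cnj z) / (1 + z * cnj z) ^ 3"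
      by (simp add: add_divide_distrib)
    also have "\<dots> = 1 / (1 + z * cnj z)\<^sup>2"
      using one_plus_norm_nonzero(1)[of z] by (simp add: power2_eq_square power3_eq_cube)
    also have "\<dots> = of_real (1 / (1 + (norm z)\<^sup>2)\<^sup>2)"
      unfolding of_real_divide of_real_power of_real_add of_real_1 complex_norm_square[symmetric] ..
    finally show "1 / (1 + z * cnj z) ^ 3 + z * cnj z / (1 + z * cnj z) ^ 3 = of_real (1 / (1 + (norm z)\<^sup>2)\<^sup>2)" .
  qed
  also have "\<dots> = of_real fs_area" unfolding fs_area_def by (rule integral_complex_of_real)
  finally have t: "(\<integral>z. 1 / (1 + z * cnj z) ^ 3 \<partial>lborel) + (\<integral>z. z * cnj z / (1 + z * cnj z) ^ 3 \<partial>lborel) = of_real fs_area"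
    unfolding Bochner_Integration.integral_add[OF i(1,4)] .
  have t2: "of_real fs_area = 2 * (\<integral>z. z * cnj z / (1 + z * cnj z) ^ 3 \<partial>lborel)" using t unfolding s by simp
  show "(\<integral>z. 1 / (1 + z * cnj z) ^ 3 \<partial>lborel) = of_real fs_area / 2"
    "(\<integral>z. z * cnj z / (1 + z * cnj z) ^ 3 \<partial>lborel) = of_real fs_area / 2"
    unfolding s t2 by simp_all
qed

text \<open>\<open>g\<close> lists the components in the frame of fibre and slice directions. The
  shear subtracts from \<open>v\<close> its part along the fibre, so that the fibre velocity reaches
  \<open>g\<close> as \<open>(1, 0)\<close>.\<close>

definition form_from :: "(quat ^ 'n::finite) set \<Rightarrow> (complex \<times> (quat ^ 'n) \<Rightarrow> 'n affine \<Rightarrow> complex) \<Rightarrow> 'n form01" where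
  "form_from U g p v = (if p \<in> chart0 U then g (unlift0 p) (fst v, snd v - hscale (fst v) (quatJ (snd (unlift0 p)))) else 0)"

lemma form_from_lift0:
  assumes "x \<in> U"
  shows "form_from U g (lift0 (z, x)) v = g (z, x) (fst v, snd v - hscale (fst v) (quatJ x))"
  using assms by (simp add: form_from_def lift_in_chart)

lemma form_from_vert_coef:
  assumes "x \<in> U"
  shows "vert0 (form_from U g) (z, x) = g (z, x) (1, 0)" "coef0 (form_from U g) e (z, x) = g (z, x) (0, e)"
  unfolding vert0_def coef0_def form_from_lift0[OF assms] by (simp_all add: hscale_simps)

lemma conj_linear_shear:
  assumes g: "conj_linear g"
  shows "conj_linear (\<lambda>v. g (fst v, snd v - hscale (fst v) y))"
proof -
  have "g (fst (u + v), snd (u + v) - hscale (fst (u + v)) y) = g (fst u, snd u - hscale (fst u) y) + g (fst v, snd v - hscale (fst v) y)" for u v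
    unfolding conj_linear_simps(1)[OF g, symmetric] by (simp add: hscale_simps algebra_simps)
  moreover have "g (fst (ascale c v), snd (ascale c v) - hscale (fst (ascale c v)) y) = cnj c * g (fst v, snd v - hscale (fst v) y)" for c v
    unfolding conj_linear_simps(2)[OF g, symmetric] by (simp add: ascale_def hscale_simps)
  ultimately show ?thesis unfolding conj_linear_def by blast
qed

lemma smooth_form01_form_from:
  assumes U: "open U" and l: "\<And>q. q \<in> UNIV \<times> U \<Longrightarrow> conj_linear (g q)" and s: "\<And>v. smooth_on (UNIV \<times> U) (\<lambda>q. g q v)"
  shows "smooth_form01 (chart0 U) (form_from U g)"
  unfolding smooth_form01_def
proof (intro conjI ballI allI impI)
  have o: "open ((UNIV :: complex set) \<times> U)" using U by (simp add: open_Times)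
  fix p v
  show "conj_linear (form_from U g p)" if p: "p \<in> chart0 U"
  proof -
    have "unlift0 p \<in> UNIV \<times> U" using p by (simp add: chart0_iff mem_Times_iff)
    from conj_linear_shear[OF l[OF this]] p show ?thesis by (simp add: form_from_def[abs_def])
  qed
  have sn: "smooth_on ((UNIV :: complex set) \<times> U) (\<lambda>q. snd v - hscale (fst v) (quatJ (snd q)))"
    by (intro smooth_intros o)
  have "smooth_on (UNIV \<times> U) (\<lambda>q. g q (fst v, snd v - hscale (fst v) (quatJ (snd q))))"
    by (rule smooth_on_form_eval[OF o s l smooth_on_const sn])
  from smooth_on_comp_lift(3)[OF U this]
  have "smooth_on (chart0 U) (\<lambda>p. g (unlift0 p) (fst v, snd v - hscale (fst v) (quatJ (snd (unlift0 p)))))" .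
  then show "smooth_on (chart0 U) (\<lambda>p. form_from U g p v)"
    by (rule iffD2[OF smooth_on_cong[OF open_chart(1)[OF U]], rotated]) (simp add: form_from_def)
qed (simp add: form_from_def)

section \<open>Explicit representatives\<close>

text \<open>Three of the four derivatives that enter \<open>horiz\<close> of the representative; the
  fourth, the linear part for the second component at \<open>quatJ e\<close>, equals
  \<open>anti0\<close> for monogenic \<psi>.\<close>

definition anti0 :: "(quat ^ 'n::finite \<Rightarrow> complex \<times> complex) \<Rightarrow> quat ^ 'n \<Rightarrow> quat ^ 'n \<Rightarrow> complex" where
  "anti0 \<psi> e x = antilinear_part (frechet_derivative (\<lambda>x. fst (\<psi> x)) (at x)) e"

definition anti1 :: "(quat ^ 'n::finite \<Rightarrow> complex \<times> complex) \<Rightarrow> quat ^ 'n \<Rightarrow> quat ^ 'n \<Rightarrow> complex" where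
  "anti1 \<psi> e x = antilinear_part (frechet_derivative (\<lambda>x. snd (\<psi> x)) (at x)) e"

definition lin0 :: "(quat ^ 'n::finite \<Rightarrow> complex \<times> complex) \<Rightarrow> quat ^ 'n \<Rightarrow> quat ^ 'n \<Rightarrow> complex" where
  "lin0 \<psi> e x = clinear_part (frechet_derivative (\<lambda>x. fst (\<psi> x)) (at x)) (quatJ e)"

text \<open>The fibre part \<open>(\<psi>\<^sub>0 + z\<bar> \<psi>\<^sub>1) dz\<bar> / (1 + |z|\<^sup>2)\<^sup>3\<close> of the representative is harmonic for the Fubini-Study metric and
  has moments proportional to \<open>\<psi>\<^sub>0\<close> and \<open>\<psi>\<^sub>1\<close>. The horizontal part \<open>rep_kernel\<close> is the decaying solution of the
  closedness equation; that it exists is exactly the monogenicity of \<open>\<psi>\<close>.\<close>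

definition rep_fun :: "(quat ^ 'n::finite \<Rightarrow> complex \<times> complex) \<Rightarrow> complex \<times> (quat ^ 'n) \<Rightarrow> complex" where
  "rep_fun \<psi> q = (fst (\<psi> (snd q)) + cnj (fst q) * snd (\<psi> (snd q))) / (1 + fst q * cnj (fst q)) ^ 3"

definition rep_kernel :: "(quat ^ 'n::finite \<Rightarrow> complex \<times> complex) \<Rightarrow> quat ^ 'n \<Rightarrow> complex \<times> (quat ^ 'n) \<Rightarrow> complex" where
  "rep_kernel \<psi> e = fs_kernel (\<lambda>x. lin0 \<psi> e x / 2) (anti0 \<psi> e) (\<lambda>x. anti1 \<psi> e x / 2)"

text \<open>Division by 1 + |z|^2 undoes the weight in \<open>gcoef\<close>, so that the weighted
  slice coefficient is \<open>rep_kernel\<close> itself.\<close>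

definition rep_form :: "(quat ^ 'n::finite \<Rightarrow> complex \<times> complex) \<Rightarrow> complex \<times> (quat ^ 'n) \<Rightarrow> 'n affine \<Rightarrow> complex" where
  "rep_form \<psi> q v = cnj (fst v) * rep_fun \<psi> q + rep_kernel \<psi> (snd v) q / (1 + fst q * cnj (fst q))"

context
  fixes U :: "(quat ^ 'n::finite) set" and \<psi> :: "quat ^ 'n \<Rightarrow> complex \<times> complex"
  assumes U: "open U" and \<psi>: "\<psi> \<in> monogenic U"
begin

lemma psi_smooth: "smooth_on U (\<lambda>x. fst (\<psi> x))" "smooth_on U (\<lambda>x. snd (\<psi> x))"
proof -
  have "smooth_on U \<psi>" using \<psi> unfolding monogenic_def smooth_maps_def by simp
  then show "smooth_on U (\<lambda>x. fst (\<psi> x))" "smooth_on U (\<lambda>x. snd (\<psi> x))"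
    by (rule smooth_on_fst[OF U], rule smooth_on_snd[OF U])
qed

lemma psi_linear:
  assumes "x \<in> U"
  shows "linear (frechet_derivative (\<lambda>x. fst (\<psi> x)) (at x))" "linear (frechet_derivative (\<lambda>x. snd (\<psi> x)) (at x))"
  by (rule has_derivative_linear[OF smooth_on_has_derivative[OF psi_smooth(1) assms]],
      rule has_derivative_linear[OF smooth_on_has_derivative[OF psi_smooth(2) assms]])

lemma anti0_monogenic:
  assumes "x \<in> U"
  shows "clinear_part (frechet_derivative (\<lambda>x. snd (\<psi> x)) (at x)) (quatJ e) = anti0 \<psi> e x"
proof -
  have "\<forall>x\<in>U. \<forall>e. antilinear_part (frechet_derivative (\<lambda>x. fst (\<psi> x)) (at x)) e = clinear_part (frechet_derivative (\<lambda>x. snd (\<psi> x)) (at x)) (quatJ e)"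
    using \<psi> unfolding monogenic_iff by (rule conjunct2)
  then show ?thesis using assms unfolding anti0_def by simp
qed

lemma smooth_on_psi_parts:
  "smooth_on U (anti0 \<psi> e)" "smooth_on U (anti1 \<psi> e)" "smooth_on U (lin0 \<psi> e)"
  unfolding anti0_def[abs_def] anti1_def[abs_def] lin0_def[abs_def] antilinear_part_def clinear_part_def
  by (intro smooth_on_divide smooth_on_add smooth_on_diff smooth_on_mult smooth_on_const smooth_on_frechet_derivative psi_smooth U; simp)+

lemma smooth_on_psi_half:
  "smooth_on U (\<lambda>x. lin0 \<psi> e x / 2)" "smooth_on U (\<lambda>x. anti1 \<psi> e x / 2)"
  by (rule smooth_on_divide[OF U smooth_on_psi_parts(3) smooth_on_const], simp)
     (rule smooth_on_divide[OF U smooth_on_psi_parts(2) smooth_on_const], simp)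

lemmas rep_kernel_smooths = U smooth_on_psi_half(1) smooth_on_psi_parts(1) smooth_on_psi_half(2)

lemma smooth_on_rep_kernel: "smooth_on (UNIV \<times> U) (rep_kernel \<psi> e)"
  unfolding rep_kernel_def by (rule smooth_on_fs_kernel[OF rep_kernel_smooths])

lemma decaying_rep_kernel: "decaying 2 0 U (rep_kernel \<psi> e)"
  unfolding rep_kernel_def by (rule decaying_fs_kernel[OF rep_kernel_smooths])

lemma smooth_on_rep_fun: "smooth_on (UNIV \<times> U) (rep_fun \<psi>)"
proof -
  have o: "open ((UNIV :: complex set) \<times> U)" using U by (simp add: open_Times)
  have f: "smooth_on ((UNIV :: complex set) \<times> U) fst" by (rule smooth_on_fst[OF o smooth_on_id[OF o]])
  have g: "smooth_on ((UNIV :: complex set) \<times> U) (\<lambda>q. cnj (fst q))" by (rule smooth_on_cnj[OF o f])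
  note s = smooth_on_comp_snd[OF U psi_smooth(1)] smooth_on_comp_snd[OF U psi_smooth(2)]
  have d: "smooth_on ((UNIV :: complex set) \<times> U) (\<lambda>q. (1 + fst q * cnj (fst q)) ^ 3)"
    by (rule smooth_on_power[OF o smooth_on_add[OF o smooth_on_const smooth_on_mult[OF o f g]]])
  show ?thesis unfolding rep_fun_def[abs_def]
    by (rule smooth_on_divide[OF o smooth_on_add[OF o s(1) smooth_on_mult[OF o g s(2)]] d]) simp
qed

text \<open>Over the common denominator both numerators are \<open>anti0\<close> times 1 - |z|^2,
  plus \<open>cnj z\<close> times \<open>anti1\<close>, minus z times \<open>lin0\<close>.
  Monogenicity produces the combination 1 - |z|^2, whose integral over the fibre vanishes as a
  decaying solution requires; the halves in \<open>rep_kernel\<close> offset the factors 2 from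
  differentiation.\<close>

lemma horiz_rep_fun:
  assumes x: "x \<in> U"
  shows "horiz e (rep_fun \<psi>) (z, x) = dzbar (rep_kernel \<psi> e) (z, x)"
proof -
  define D0 where "D0 = frechet_derivative (\<lambda>x. fst (\<psi> x)) (at x)"
  define D1 where "D1 = frechet_derivative (\<lambda>x. snd (\<psi> x)) (at x)"
  define r where "r = inverse ((1 + z * cnj z) ^ 3)"
  have d: "((\<lambda>x. fst (\<psi> x)) has_derivative D0) (at x)" "((\<lambda>x. snd (\<psi> x)) has_derivative D1) (at x)"
    unfolding D0_def D1_def by (rule smooth_on_has_derivative[OF psi_smooth(1) x], rule smooth_on_has_derivative[OF psi_smooth(2) x])
  have q: "(z, x) \<in> UNIV \<times> U" using x by simp
  have "((\<lambda>x. (fst (\<psi> x) + cnj z * snd (\<psi> x)) * r) has_derivative (\<lambda>y. (D0 y + cnj z * D1 y) * r)) (at x)"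
    by (rule has_derivative_mult_left[OF has_derivative_add[OF d(1) has_derivative_mult_right[OF d(2)]]])
  then have "((\<lambda>x. rep_fun \<psi> (z, x)) has_derivative (\<lambda>y. (D0 y + cnj z * D1 y) * r)) (at x)"
    unfolding rep_fun_def fst_conv snd_conv r_def divide_inverse .
  note fd = frechet_derivative_slice(2)[OF smooth_on_differentiable[OF smooth_on_rep_fun q] this]
  have "xbar e (rep_fun \<psi>) (z, x) = (antilinear_part D0 e + cnj z * antilinear_part D1 e) * r"
    unfolding xbar_def fd antilinear_part_def by (simp add: algebra_simps add_divide_distrib)
  moreover have "xhol (quatJ e) (rep_fun \<psi>) (z, x) = (clinear_part D0 (quatJ e) + cnj z * clinear_part D1 (quatJ e)) * r"
    unfolding xhol_def fd clinear_part_def by (simp add: algebra_simps add_divide_distrib diff_divide_distrib)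
  ultimately have h: "horiz e (rep_fun \<psi>) (z, x) =
    ((anti0 \<psi> e x + cnj z * anti1 \<psi> e x) - z * (lin0 \<psi> e x + cnj z * anti0 \<psi> e x)) * r"
    unfolding horiz_def fst_conv D0_def D1_def anti0_monogenic[OF x]
    unfolding anti0_def[symmetric] anti1_def[symmetric] lin0_def[symmetric] by (simp add: left_diff_distrib mult.assoc)
  have "dzbar (rep_kernel \<psi> e) (z, x) = (anti0 \<psi> e x * (1 - z * cnj z) + 2 * (anti1 \<psi> e x / 2) * cnj z - 2 * (lin0 \<psi> e x / 2) * z) / (1 + z * cnj z) ^ 3"
    unfolding rep_kernel_def by (rule dzbar_fs_kernel[OF rep_kernel_smooths x])
  also have "\<dots> = ((anti0 \<psi> e x + cnj z * anti1 \<psi> e x) - z * (lin0 \<psi> e x + cnj z * anti0 \<psi> e x)) * r"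
    unfolding r_def divide_inverse[of _ "(1 + z * cnj z) ^ 3"] by (rule arg_cong2[where f="(*)", OF _ refl]) (simp add: algebra_simps)
  finally show ?thesis unfolding h by (rule sym)
qed

text \<open>Both sides have the same \<open>dzbar\<close>, a second horizontal derivative of
  \<open>rep_fun\<close>, because horizontal operators commute; their difference is therefore
  holomorphic along the fibres.\<close>

lemma horiz_rep_kernel_commute:
  assumes x: "x \<in> U"
  shows "horiz e (rep_kernel \<psi> e') (z, x) = horiz e' (rep_kernel \<psi> e) (z, x)"
proof -
  have o: "open ((UNIV :: complex set) \<times> U)" using U by (simp add: open_Times)
  define k where "k q = horiz e (rep_kernel \<psi> e') q - horiz e' (rep_kernel \<psi> e) q" for q
  \<comment> \<open>\<open>horiz\<close> costs one of the two orders of decay; the remaining one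
    suffices for Liouville's theorem.\<close>
  have kd: "decaying (Suc 1) 0 U (rep_kernel \<psi> e)" for e using decaying_rep_kernel[of e] by (simp only: Suc_1)
  have kdec: "decaying 1 0 U k"
    unfolding k_def[abs_def] by (rule decaying_diff[OF U decaying_horiz[OF U kd] decaying_horiz[OF U kd]])
  have s: "smooth_on (UNIV \<times> U) (horiz e (rep_kernel \<psi> e'))" for e e'
    by (rule smooth_on_horiz[OF o smooth_on_rep_kernel])
  have hr: "dzbar (rep_kernel \<psi> e) q = horiz e (rep_fun \<psi>) q" if "q \<in> UNIV \<times> U" for q e
    using horiz_rep_fun[of "snd q" e "fst q"] that by (simp add: mem_Times_iff)
  have dk: "dzbar k (z, x) = 0" for z
  proof -
    have q: "(z, x) \<in> UNIV \<times> U" using x by simp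
    have c: "dzbar (horiz e (rep_kernel \<psi> e')) (z, x) = horiz e (horiz e' (rep_fun \<psi>)) (z, x)" for e e'
      unfolding dzbar_horiz_commute[OF o smooth_on_rep_kernel q]
      by (rule dzbar_cong(2)[OF o q hr])
    show ?thesis
      unfolding k_def[abs_def] dzbar_diff[OF smooth_on_differentiable[OF s q] smooth_on_differentiable[OF s q]] c
        horiz_commute[OF o smooth_on_rep_fun q, of e e'] by simp
  qed
  have "k (z, x) = 0" by (rule decaying_holomorphic_eq_0[OF U kdec x _ dk]) simp
  then show ?thesis by (simp add: k_def)
qed

lemma conj_linear_rep_form:
  assumes q: "q \<in> UNIV \<times> U"
  shows "conj_linear (rep_form \<psi> q)"
proof -
  define x where "x = snd q"
  have x: "x \<in> U" using q by (auto simp: x_def)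
  note l = psi_linear[OF x]
  define C where "C e = rep_kernel \<psi> e q / (1 + fst q * cnj (fst q))" for e
  have p: "anti0 \<psi> (e + e') x = anti0 \<psi> e x + anti0 \<psi> e' x" "anti1 \<psi> (e + e') x = anti1 \<psi> e x + anti1 \<psi> e' x"
    "lin0 \<psi> (e + e') x = lin0 \<psi> e x + lin0 \<psi> e' x"
    "anti0 \<psi> (hscale c e) x = cnj c * anti0 \<psi> e x" "anti1 \<psi> (hscale c e) x = cnj c * anti1 \<psi> e x"
    "lin0 \<psi> (hscale c e) x = cnj c * lin0 \<psi> e x" for c e e'
    unfolding anti0_def anti1_def lin0_def quatJ_simps parts_hscale[OF l(1)] parts_hscale[OF l(2)]
      parts_linear(1,2)[OF l(1)] parts_linear(1,2)[OF l(2)] by (rule refl)+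
  have C1: "C (e + e') = C e + C e'" for e e'
    unfolding C_def rep_kernel_def fs_kernel_def x_def[symmetric] p by (simp add: add_divide_distrib[symmetric] algebra_simps)
  have C2: "C (hscale c e) = cnj c * C e" for c e
    unfolding C_def rep_kernel_def fs_kernel_def x_def[symmetric] p by (simp add: algebra_simps)
  have r: "rep_form \<psi> q v = cnj (fst v) * rep_fun \<psi> q + C (snd v)" for v
    unfolding rep_form_def C_def ..
  show ?thesis unfolding conj_linear_def r
    by (simp add: C1 C2 ascale_def algebra_simps)
qed

lemma smooth_on_rep_form: "smooth_on (UNIV \<times> U) (\<lambda>q. rep_form \<psi> q v)"
proof -
  have o: "open ((UNIV :: complex set) \<times> U)" using U by (simp add: open_Times)
  have f: "smooth_on ((UNIV :: complex set) \<times> U) fst" by (rule smooth_on_fst[OF o smooth_on_id[OF o]])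
  have d: "smooth_on ((UNIV :: complex set) \<times> U) (\<lambda>q. 1 + fst q * cnj (fst q))"
    by (rule smooth_on_add[OF o smooth_on_const smooth_on_mult[OF o f smooth_on_cnj[OF o f]]])
  show ?thesis unfolding rep_form_def
    by (rule smooth_on_add[OF o smooth_on_mult[OF o smooth_on_const smooth_on_rep_fun] smooth_on_divide[OF o smooth_on_rep_kernel d]]) simp
qed

lemma smooth_form01_rep: "smooth_form01 (chart0 U) (form_from U (rep_form \<psi>))"
  by (rule smooth_form01_form_from[OF U conj_linear_rep_form smooth_on_rep_form])

lemma rep_vert_coef:
  assumes x: "x \<in> U"
  shows "vert0 (form_from U (rep_form \<psi>)) (z, x) = rep_fun \<psi> (z, x)"
    "coef0 (form_from U (rep_form \<psi>)) e (z, x) = rep_kernel \<psi> e (z, x) / (1 + z * cnj z)"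
    "gcoef (form_from U (rep_form \<psi>)) e (z, x) = rep_kernel \<psi> e (z, x)"
proof -
  have q: "(z, x) \<in> UNIV \<times> U" using x by simp
  have k0: "rep_kernel \<psi> 0 (z, x) = 0"
  proof -
    have "rep_form \<psi> (z, x) 0 = 0" by (rule conj_linear_simps(6)[OF conj_linear_rep_form[OF q]])
    then show ?thesis by (simp add: rep_form_def)
  qed
  show "vert0 (form_from U (rep_form \<psi>)) (z, x) = rep_fun \<psi> (z, x)"
    unfolding form_from_vert_coef[OF x] rep_form_def by (simp add: k0)
  show c: "coef0 (form_from U (rep_form \<psi>)) e (z, x) = rep_kernel \<psi> e (z, x) / (1 + z * cnj z)"
    unfolding form_from_vert_coef[OF x] rep_form_def by simp
  show "gcoef (form_from U (rep_form \<psi>)) e (z, x) = rep_kernel \<psi> e (z, x)"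
    unfolding gcoef_def c fst_conv by simp
qed

lemma dbar1_rep:
  assumes p: "p \<in> chart0 U"
  shows "dbar1 (form_from U (rep_form \<psi>)) p u v = 0"
proof (rule dbar1_eq_0I[OF U smooth_form01_rep _ _ p])
  have o: "open ((UNIV :: complex set) \<times> U)" using U by (simp add: open_Times)
  let ?\<omega> = "form_from U (rep_form \<psi>)"
  fix z x e e' assume x: "x \<in> U"
  have q: "(z, x) \<in> UNIV \<times> U" for z using x by simp
  have g: "gcoef ?\<omega> e q = rep_kernel \<psi> e q" "rep_fun \<psi> q = vert0 ?\<omega> q" if "q \<in> UNIV \<times> U" for q e
    using rep_vert_coef(1)[where x="snd q" and z="fst q"] rep_vert_coef(3)[where x="snd q" and z="fst q"] that
    by (simp_all add: mem_Times_iff)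
  show "dzbar (gcoef ?\<omega> e) (z, x) = horiz e (vert0 ?\<omega>) (z, x)"
  proof -
    have "dzbar (gcoef ?\<omega> e) (z, x) = dzbar (rep_kernel \<psi> e) (z, x)"
      by (rule dzbar_cong(1)[OF o q g(1)])
    also have "\<dots> = horiz e (rep_fun \<psi>) (z, x)" by (rule horiz_rep_fun[OF x, symmetric])
    also have "\<dots> = horiz e (vert0 ?\<omega>) (z, x)"
      by (rule dzbar_cong(2)[OF o q g(2)])
    finally show ?thesis .
  qed
  \<comment> \<open>The weight depends on z alone and passes through \<open>horiz\<close>, which
    differentiates in x only.\<close>
  have h: "horiz e (coef0 ?\<omega> e') (z, x) = horiz e (rep_kernel \<psi> e') (z, x) * inverse (1 + z * cnj z)" for e e'
  proof -
    have d: "(coef0 ?\<omega> e') differentiable (at (z, x))"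
      by (rule smooth_on_differentiable[OF smooth_on_coef0[OF U smooth_form01_rep] q])
    note k = smooth_on_has_derivative[OF smooth_on_rep_kernel q]
    have "((\<lambda>x. rep_kernel \<psi> e' (z, x) * inverse (1 + z * cnj z)) has_derivative
       (\<lambda>y. frechet_derivative (rep_kernel \<psi> e') (at (z, x)) (0, y) * inverse (1 + z * cnj z))) (at x)"
      by (rule has_derivative_mult_left[OF has_derivative_compose[OF has_derivative_Pair[OF has_derivative_const has_derivative_ident] k]])
    then have "((\<lambda>x. coef0 ?\<omega> e' (z, x)) has_derivative
       (\<lambda>y. frechet_derivative (rep_kernel \<psi> e') (at (z, x)) (0, y) * inverse (1 + z * cnj z))) (at x)"
      by (rule has_derivative_transform_within_open[OF _ U x]) (simp add: rep_vert_coef divide_inverse)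
    note fd = frechet_derivative_slice(2)[OF d this]
    show ?thesis unfolding horiz_def xbar_def xhol_def fd antilinear_part_def clinear_part_def
      by (simp add: algebra_simps add_divide_distrib diff_divide_distrib)
  qed
  show "horiz e (coef0 ?\<omega> e') (z, x) = horiz e' (coef0 ?\<omega> e) (z, x)"
    unfolding h horiz_rep_kernel_commute[OF x, of e e'] ..
qed

end

section \<open>The symmetry exchanging the charts\<close>

text \<open>Since J^2 = -1, the coordinate wx + Jx of the second chart equals y - w Jy with y =
  Jx.\<close>

lemma conj_quatJ_symmetry:
  "lift0 (- w, quatJ x) = (- fst (lift1 (w, x)), snd (lift1 (w, x)))"
  by (simp add: lift0_def lift1_def quatJ_simps hscale_simps)

text \<open>The map \<open>[\<pi>\<^sub>0 : \<pi>\<^sub>1] \<mapsto> [- \<pi>\<^sub>1 : \<pi>\<^sub>0]\<close> combined with \<open>x \<mapsto> quatJ x\<close> is linear in the twistor coordinates and exchanges the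
  two charts. So the second chart for \<open>\<psi>\<close> on \<open>U\<close> is the first chart for a transformed function on \<open>quatJ_image U\<close>.\<close>

definition flip :: "'n::finite affine \<Rightarrow> 'n affine" where
  "flip v = (- fst v, snd v)"

lemma flip_lift1: "flip (lift1 (w, x)) = lift0 (- w, quatJ x)"
  unfolding flip_def by (rule conj_quatJ_symmetry[symmetric])

lemma flip_simps: "flip (u + v) = flip u + flip v" "flip (r *\<^sub>R v) = r *\<^sub>R flip v" "flip (ascale c v) = ascale c (flip v)"
  by (simp_all add: flip_def ascale_def)

lemma bounded_linear_flip: "bounded_linear flip"
  by (rule iffD1[OF linear_conv_bounded_linear linearI]) (rule flip_simps)+

definition quatJ_image :: "(quat ^ 'n::finite) set \<Rightarrow> (quat ^ 'n) set" where
  "quatJ_image U = {y. - quatJ y \<in> U}"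

lemma quatJ_in_image: "quatJ x \<in> quatJ_image U \<longleftrightarrow> x \<in> U"
  by (simp add: quatJ_image_def quatJ_simps)

lemma bounded_linear_minus_quatJ: "bounded_linear (\<lambda>y. - quatJ y)"
  by (rule bounded_linear_minus[OF bounded_linear_quatJ])

lemma open_quatJ_image:
  assumes "open U"
  shows "open (quatJ_image U)"
proof -
  have "continuous_on UNIV (\<lambda>y :: quat ^ 'n::finite. - quatJ y)"
    by (rule linear_continuous_on[OF bounded_linear_minus_quatJ])
  from open_vimage[OF assms this] show ?thesis by (simp add: quatJ_image_def vimage_def)
qed

lemma flip_chart: "p \<in> chart1 U \<longleftrightarrow> flip p \<in> chart0 (quatJ_image U)"
proof -
  have p: "p = lift1 (fst (unlift1 p), snd (unlift1 p))" unfolding prod.collapse by (rule lift_simps(4)[symmetric])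
  have "flip p = lift0 (- fst (unlift1 p), quatJ (snd (unlift1 p)))"
    by (subst p) (rule flip_lift1)
  then show ?thesis by (simp only: lift_in_chart chart1_iff snd_conv quatJ_in_image)
qed

text \<open>The components of \<psi> belong to 1 and z, that is, to the homogeneous coordinates
  which the symmetry exchanges up to sign; the swap and the sign follow this exchange.\<close>

definition quatJ_map :: "(quat ^ 'n::finite \<Rightarrow> complex \<times> complex) \<Rightarrow> quat ^ 'n \<Rightarrow> complex \<times> complex" where
  "quatJ_map \<psi> y = (snd (\<psi> (- quatJ y)), - fst (\<psi> (- quatJ y)))"

lemma parts_comp_quatJ:
  assumes l: "linear A"
  shows "antilinear_part (\<lambda>v. A (- quatJ v)) e = - clinear_part A (quatJ e)"
    "clinear_part (\<lambda>v. A (- quatJ v)) (quatJ e) = antilinear_part A e"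
proof -
  have n: "A (- v) = - A v" for v by (rule linear_neg[OF l])
  show "antilinear_part (\<lambda>v. A (- quatJ v)) e = - clinear_part A (quatJ e)"
    unfolding antilinear_part_def clinear_part_def quatJ_simps complex_cnj_i hscale_simps n
    by (simp add: field_simps)
  show "clinear_part (\<lambda>v. A (- quatJ v)) (quatJ e) = antilinear_part A e"
    unfolding antilinear_part_def clinear_part_def quatJ_simps complex_cnj_i hscale_simps n
    by (simp add: field_simps)
qed

context
  fixes U :: "(quat ^ 'n::finite) set" and \<psi> :: "quat ^ 'n \<Rightarrow> complex \<times> complex"
  assumes U: "open U" and \<psi>: "\<psi> \<in> monogenic U"
begin

lemma quatJ_map_derivative:
  assumes x: "- quatJ y \<in> U"
  shows "((\<lambda>y. fst (quatJ_map \<psi> y)) has_derivative (\<lambda>v. frechet_derivative (\<lambda>x. snd (\<psi> x)) (at (- quatJ y)) (- quatJ v))) (at y)"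
    "((\<lambda>y. snd (quatJ_map \<psi> y)) has_derivative (\<lambda>v. - frechet_derivative (\<lambda>x. fst (\<psi> x)) (at (- quatJ y)) (- quatJ v))) (at y)"
proof -
  have j: "((\<lambda>y. - quatJ y) has_derivative (\<lambda>y. - quatJ y)) (at y)"
    by (rule bounded_linear_imp_has_derivative[OF bounded_linear_minus_quatJ])
  show "((\<lambda>y. fst (quatJ_map \<psi> y)) has_derivative (\<lambda>v. frechet_derivative (\<lambda>x. snd (\<psi> x)) (at (- quatJ y)) (- quatJ v))) (at y)"
    unfolding quatJ_map_def fst_conv
    by (rule has_derivative_compose[OF j smooth_on_has_derivative[OF psi_smooth(2)[OF U \<psi>] x]])
  show "((\<lambda>y. snd (quatJ_map \<psi> y)) has_derivative (\<lambda>v. - frechet_derivative (\<lambda>x. fst (\<psi> x)) (at (- quatJ y)) (- quatJ v))) (at y)"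
    unfolding quatJ_map_def snd_conv
    by (rule has_derivative_minus[OF has_derivative_compose[OF j smooth_on_has_derivative[OF psi_smooth(1)[OF U \<psi>] x]]])
qed

text \<open>\<open>anti1\<close> and \<open>lin0\<close> are exchanged and \<open>anti0\<close>
  changes sign: this is the reversal of coefficients that \<open>rep_kernel\<close> undergoes at
  infinity, the sign being absorbed by the passage from w to -w.\<close>

lemma quatJ_map_parts:
  assumes x: "x \<in> U"
  shows "anti0 (quatJ_map \<psi>) e (quatJ x) = - anti0 \<psi> e x"
    "anti1 (quatJ_map \<psi>) e (quatJ x) = lin0 \<psi> e x"
    "lin0 (quatJ_map \<psi>) e (quatJ x) = anti1 \<psi> e x"
    "clinear_part (frechet_derivative (\<lambda>x. snd (quatJ_map \<psi> x)) (at (quatJ x))) (quatJ e) = - anti0 \<psi> e x"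
proof -
  have xx: "- quatJ (quatJ x) = x" by (simp add: quatJ_simps)
  note d = quatJ_map_derivative[of "quatJ x", unfolded xx, OF x]
  note f = frechet_derivative_at[OF d(1), symmetric] frechet_derivative_at[OF d(2), symmetric]
  note l = psi_linear[OF U \<psi> x]
  show "anti0 (quatJ_map \<psi>) e (quatJ x) = - anti0 \<psi> e x"
    unfolding anti0_def f parts_comp_quatJ[OF l(2)] anti0_monogenic[OF U \<psi> x] unfolding anti0_def ..
  show "lin0 (quatJ_map \<psi>) e (quatJ x) = anti1 \<psi> e x"
    unfolding lin0_def anti1_def f parts_comp_quatJ[OF l(2)] ..
  have m: "antilinear_part (\<lambda>v. - A v) e = - antilinear_part A e" "clinear_part (\<lambda>v. - A v) e = - clinear_part A e" for A and e :: "quat ^ 'n"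
    unfolding antilinear_part_def clinear_part_def by (simp_all add: field_simps)
  show "anti1 (quatJ_map \<psi>) e (quatJ x) = lin0 \<psi> e x"
    unfolding lin0_def anti1_def f m parts_comp_quatJ[OF l(1)] by simp
  show "clinear_part (frechet_derivative (\<lambda>x. snd (quatJ_map \<psi> x)) (at (quatJ x))) (quatJ e) = - anti0 \<psi> e x"
    unfolding f m parts_comp_quatJ[OF l(1)] anti0_def ..
qed

lemma quatJ_map_monogenic: "quatJ_map \<psi> \<in> monogenic (quatJ_image U)"
  unfolding monogenic_iff
proof (intro conjI ballI allI)
  note o = open_quatJ_image[OF U]
  have j: "smooth_on (quatJ_image U) (\<lambda>y. - quatJ y)"
    by (rule smooth_on_bounded_linear[OF bounded_linear_minus_quatJ o])
  have jU: "- quatJ y \<in> U" if "y \<in> quatJ_image U" for y using that by (simp add: quatJ_image_def)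
  have "smooth_on (quatJ_image U) (quatJ_map \<psi>)"
    unfolding quatJ_map_def[abs_def]
    by (rule smooth_on_Pair[OF o smooth_on_compose[OF psi_smooth(2)[OF U \<psi>] j o U jU]
      smooth_on_minus[OF o smooth_on_compose[OF psi_smooth(1)[OF U \<psi>] j o U jU]]])
  moreover have "quatJ_map \<psi> y = 0" if "y \<notin> quatJ_image U" for y
  proof -
    have "\<psi> (- quatJ y) = 0" using \<psi> that unfolding monogenic_def smooth_maps_def quatJ_image_def by simp
    then show ?thesis by (simp add: quatJ_map_def zero_prod_def)
  qed
  ultimately show "quatJ_map \<psi> \<in> smooth_maps (quatJ_image U)" unfolding smooth_maps_def by simp
  fix y e assume y: "y \<in> quatJ_image U"
  define x where "x = - quatJ y"
  have x: "x \<in> U" and yx: "y = quatJ x" using jU[OF y] by (simp_all add: x_def quatJ_simps)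
  show "antilinear_part (frechet_derivative (\<lambda>x. fst (quatJ_map \<psi> x)) (at y)) e =
    clinear_part (frechet_derivative (\<lambda>x. snd (quatJ_map \<psi> x)) (at y)) (quatJ e)"
    unfolding yx by (rule trans[OF quatJ_map_parts(1)[OF x, unfolded anti0_def[of "quatJ_map \<psi>"]] quatJ_map_parts(4)[OF x, symmetric]])
qed

end

text \<open>\<open>flip\<close> is complex linear, so composition with it respects antilinear
  parts.\<close>

lemma dbar_dir_flip:
  assumes F: "F differentiable (at (flip p))"
  shows "dbar_dir (\<lambda>q. F (flip q)) p v = dbar_dir F (flip p) (flip v)"
proof -
  have "((\<lambda>q. F (flip q)) has_derivative (\<lambda>v. frechet_derivative F (at (flip p)) (flip v))) (at p)"
    by (rule has_derivative_compose[OF bounded_linear_imp_has_derivative[OF bounded_linear_flip] iffD1[OF frechet_derivative_works F]])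
  from frechet_derivative_at[OF this, symmetric] show ?thesis
    unfolding dbar_dir_def by (simp only: flip_simps)
qed

text \<open>The second component is the pullback under \<open>flip\<close> of a first-chart
  representative, so smoothness and closedness in the second chart are inherited from the
  first.\<close>

definition rep_pair :: "(quat ^ 'n::finite) set \<Rightarrow> (quat ^ 'n \<Rightarrow> complex \<times> complex) \<Rightarrow> 'n form01 \<times> 'n form01" where
  "rep_pair U \<psi> = (form_from U (rep_form \<psi>),
     (\<lambda>p v. form_from (quatJ_image U) (rep_form (quatJ_map \<psi>)) (flip p) (flip v)))"

context
  fixes U :: "(quat ^ 'n::finite) set" and \<psi> :: "quat ^ 'n \<Rightarrow> complex \<times> complex"
  assumes U: "open U" and \<psi>: "\<psi> \<in> monogenic U"
begin

lemmas image_rep = open_quatJ_image[OF U] quatJ_map_monogenic[OF U \<psi>]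

lemma smooth_form01_rep1: "smooth_form01 (chart1 U) (snd (rep_pair U \<psi>))"
  unfolding smooth_form01_def rep_pair_def snd_conv
proof (intro conjI ballI allI impI)
  note s = smooth_form01_rep[OF image_rep]
  fix p and v :: "'n affine"
  show "conj_linear (\<lambda>v. form_from (quatJ_image U) (rep_form (quatJ_map \<psi>)) (flip p) (flip v))" if "p \<in> chart1 U"
    using smooth_form01_conj_linear[OF s that[unfolded flip_chart]]
    unfolding conj_linear_def flip_simps by blast
  show "smooth_on (chart1 U) (\<lambda>p. form_from (quatJ_image U) (rep_form (quatJ_map \<psi>)) (flip p) (flip v))"
    by (rule smooth_on_compose[OF smooth_form01_smooth[OF s] smooth_on_bounded_linear[OF bounded_linear_flip open_chart(2)[OF U]]
        open_chart(2)[OF U] open_chart(1)[OF open_quatJ_image[OF U]]]) (rule iffD1[OF flip_chart])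
  show "form_from (quatJ_image U) (rep_form (quatJ_map \<psi>)) (flip p) (flip v) = 0" if "p \<notin> chart1 U"
    using that by (simp add: form_from_def flip_chart)
qed

lemma rep1_vert_coef:
  assumes x: "x \<in> U"
  shows "vert1 (snd (rep_pair U \<psi>)) (w, x) = - rep_fun (quatJ_map \<psi>) (- w, quatJ x)"
    "coef1 (snd (rep_pair U \<psi>)) e (w, x) = rep_kernel (quatJ_map \<psi>) e (- w, quatJ x) / (1 + w * cnj w)"
proof -
  let ?g = "rep_form (quatJ_map \<psi>) (- w, quatJ x)"
  let ?\<omega> = "form_from (quatJ_image U) (rep_form (quatJ_map \<psi>))"
  have x': "quatJ x \<in> quatJ_image U" using x by (simp only: quatJ_in_image)
  have p: "lift0 (- w, quatJ x) \<in> chart0 (quatJ_image U)" using x' by (simp add: lift_in_chart)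
  \<comment> \<open>The fibre parameter goes from w to -w, whence the sign in the fibre component
    and none in the slice components.\<close>
  have f: "flip (1, x) = - (1, quatJ (quatJ x))" by (simp add: flip_def quatJ_simps)
  have "vert1 (snd (rep_pair U \<psi>)) (w, x) = ?\<omega> (lift0 (- w, quatJ x)) (- (1, quatJ (quatJ x)))"
    unfolding vert1_def rep_pair_def snd_conv flip_lift1 f ..
  also have "\<dots> = - vert0 ?\<omega> (- w, quatJ x)"
    unfolding vert0_def snd_conv
    by (rule conj_linear_simps(4)[OF smooth_form01_conj_linear[OF smooth_form01_rep[OF image_rep] p]])
  also have "\<dots> = - rep_fun (quatJ_map \<psi>) (- w, quatJ x)"
    unfolding rep_vert_coef(1)[OF image_rep x'] ..
  finally show "vert1 (snd (rep_pair U \<psi>)) (w, x) = - rep_fun (quatJ_map \<psi>) (- w, quatJ x)" .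
  have f: "flip (0, e) = (0, e)" by (simp add: flip_def)
  have "coef1 (snd (rep_pair U \<psi>)) e (w, x) = coef0 ?\<omega> e (- w, quatJ x)"
    unfolding coef1_def coef0_def rep_pair_def snd_conv flip_lift1 f ..
  also have "\<dots> = rep_kernel (quatJ_map \<psi>) e (- w, quatJ x) / (1 + w * cnj w)"
    unfolding rep_vert_coef(2)[OF image_rep x'] by simp
  finally show "coef1 (snd (rep_pair U \<psi>)) e (w, x) = rep_kernel (quatJ_map \<psi>) e (- w, quatJ x) / (1 + w * cnj w)" .
qed

text \<open>With zw = 1 the weights satisfy 1/(1 + |z|^2) = |w|^2/(1 + |w|^2); the remaining algebra
  collects powers of zw and its conjugate.\<close>

lemma rep_pair_transition:
  assumes x: "x \<in> U" and z: "z \<noteq> 0"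
  shows "vert1 (snd (rep_pair U \<psi>)) (inverse z, x) = - (z ^ 3) * cnj z ^ 2 * vert0 (fst (rep_pair U \<psi>)) (z, x)"
    "coef1 (snd (rep_pair U \<psi>)) e (inverse z, x) = z ^ 3 * cnj z * coef0 (fst (rep_pair U \<psi>)) e (z, x)"
proof -
  define w where "w = inverse z"
  define s where "s = inverse (1 + w * cnj w)"
  have zw: "z * w = 1" "cnj z * cnj w = 1"
    using z unfolding w_def complex_cnj_mult[symmetric] by simp_all
  have r: "inverse (1 + z * cnj z) = w * cnj w * s"
  proof -
    have "1 + z * cnj z = z * cnj z * (1 + w * cnj w)" unfolding w_def by (rule conj_sphere_inverse[OF z])
    then have "(1 + z * cnj z) * (w * cnj w * s) = (z * w) * (cnj z * cnj w) * ((1 + w * cnj w) * s)" by (simp only: mult_ac)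
    also have "\<dots> = 1" unfolding zw s_def by simp
    finally show ?thesis by (rule inverse_unique)
  qed
  have xx: "- quatJ (quatJ x) = x" by (simp add: quatJ_simps)
  define a where "a = fst (\<psi> x)"
  define b where "b = snd (\<psi> x)"
  have "vert1 (snd (rep_pair U \<psi>)) (w, x) = - ((b + cnj w * a) * s ^ 3)"
    unfolding rep1_vert_coef[OF x] rep_fun_def quatJ_map_def fst_conv snd_conv xx a_def b_def s_def divide_inverse power_inverse
    by simp
  also have "\<dots> = - (z ^ 3) * cnj z ^ 2 * ((a + cnj z * b) * (w * cnj w * s) ^ 3)"
  proof -
    have "- (z ^ 3) * cnj z ^ 2 * ((a + cnj z * b) * (w * cnj w * s) ^ 3)
      = - ((z * w) ^ 3 * (cnj z * cnj w) ^ 2 * ((a * cnj w + (cnj z * cnj w) * b) * s ^ 3))"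
      by (simp add: algebra_simps power2_eq_square power3_eq_cube)
    also have "\<dots> = - ((b + cnj w * a) * s ^ 3)" unfolding zw by (simp add: algebra_simps)
    finally show ?thesis ..
  qed
  also have "(a + cnj z * b) * (w * cnj w * s) ^ 3 = vert0 (fst (rep_pair U \<psi>)) (z, x)"
    unfolding rep_pair_def fst_conv rep_vert_coef(1)[OF U \<psi> x] rep_fun_def snd_conv a_def b_def r[symmetric] divide_inverse power_inverse ..
  finally show "vert1 (snd (rep_pair U \<psi>)) (inverse z, x) = - (z ^ 3) * cnj z ^ 2 * vert0 (fst (rep_pair U \<psi>)) (z, x)"
    unfolding w_def .
  define a where "a = anti0 \<psi> e x"
  define b where "b = lin0 \<psi> e x / 2"
  define c where "c = anti1 \<psi> e x / 2"
  have "coef1 (snd (rep_pair U \<psi>)) e (w, x) = (c + a * cnj w + b * cnj w ^ 2) * s ^ 3"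
    unfolding rep1_vert_coef[OF x] rep_kernel_def fs_kernel_def fst_conv snd_conv quatJ_map_parts[OF U \<psi> x]
      a_def b_def c_def s_def divide_inverse power_inverse[symmetric]
    by (simp add: power2_eq_square power3_eq_cube)
  also have "\<dots> = z ^ 3 * cnj z * ((b + a * cnj z + c * cnj z ^ 2) * (w * cnj w * s) ^ 3)"
  proof -
    have "z ^ 3 * cnj z * ((b + a * cnj z + c * cnj z ^ 2) * (w * cnj w * s) ^ 3)
      = (z * w) ^ 3 * (cnj z * cnj w) * ((b * cnj w ^ 2 + a * cnj w * (cnj z * cnj w) + c * (cnj z * cnj w) ^ 2) * s ^ 3)"
      by (simp add: algebra_simps power2_eq_square power3_eq_cube)
    also have "\<dots> = (c + a * cnj w + b * cnj w ^ 2) * s ^ 3" unfolding zw by (simp add: algebra_simps)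
    finally show ?thesis ..
  qed
  also have "(b + a * cnj z + c * cnj z ^ 2) * (w * cnj w * s) ^ 3 = coef0 (fst (rep_pair U \<psi>)) e (z, x)"
    unfolding rep_pair_def fst_conv rep_vert_coef(2)[OF U \<psi> x] rep_kernel_def fs_kernel_def snd_conv
      a_def b_def c_def r[symmetric] divide_inverse power_inverse[symmetric]
    by (simp add: power2_eq_square power3_eq_cube)
  finally show "coef1 (snd (rep_pair U \<psi>)) e (inverse z, x) = z ^ 3 * cnj z * coef0 (fst (rep_pair U \<psi>)) e (z, x)"
    unfolding w_def .
qed

end

section \<open>The Penrose transform\<close>

text \<open>Both sides of the transition rule are conjugate-linear in the tangent vector, so the
  frame of fibre and slice directions suffices.\<close>

lemma forms01I:
  assumes s0: "smooth_form01 (chart0 U) \<omega>0" and s1: "smooth_form01 (chart1 U) \<omega>1"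
    and v: "\<And>z x. z \<noteq> 0 \<Longrightarrow> x \<in> U \<Longrightarrow> vert1 \<omega>1 (inverse z, x) = - (z ^ 3) * cnj z ^ 2 * vert0 \<omega>0 (z, x)"
    and c: "\<And>z x e. z \<noteq> 0 \<Longrightarrow> x \<in> U \<Longrightarrow> coef1 \<omega>1 e (inverse z, x) = z ^ 3 * cnj z * coef0 \<omega>0 e (z, x)"
  shows "(\<omega>0, \<omega>1) \<in> forms01 (-3) U"
  unfolding forms01_iff
proof (intro conjI ballI impI allI s0 s1)
  fix p v assume p: "p \<in> chart0 U" and z0: "fst p \<noteq> 0"
  define z where "z = fst p"
  define x where "x = snd (unlift0 p)"
  have z: "z \<noteq> 0" using z0 by (simp add: z_def)
  have x: "x \<in> U" using p by (simp add: chart0_iff x_def)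
  have pl: "p = lift0 (z, x)" unfolding x_def z_def lift_simps(7)[of p, symmetric] prod.collapse by (rule lift_simps(3)[symmetric])
  define L where "L = frechet_derivative chart_change (at p)"
  have q: "chart_change p = lift1 (inverse z, x)" unfolding pl by (rule chart_change_lift[OF z])
  have q1: "lift1 (inverse z, x) \<in> chart1 U" using x by (simp add: lift_in_chart)
  note l1 = smooth_form01_conj_linear[OF s1 q1]
  have La: "L (u + v) = L u + L v" "L (ascale a v) = ascale a (L v)" for u v a
    unfolding L_def chart_change_frechet_derivative[OF z0]
    by (simp_all add: ascale_def hscale_simps algebra_simps)
  have g: "conj_linear (\<lambda>v. \<omega>1 (lift1 (inverse z, x)) (L v))"
    unfolding conj_linear_def La conj_linear_simps(1,2)[OF l1] by simp
  have g': "conj_linear (\<lambda>v. z ^ 3 * \<omega>0 p v)"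
    by (rule conj_linear_cmult[OF smooth_form01_conj_linear[OF s0 p]])
  have zz: "cnj (inverse z) * cnj z = 1" using z unfolding complex_cnj_mult[symmetric] by simp
  have "\<omega>1 (lift1 (inverse z, x)) (L v) = z ^ 3 * \<omega>0 p v"
  proof (rule conj_linear_eqI[OF g g', where y="quatJ x"])
    have "\<omega>1 (lift1 (inverse z, x)) (L (1, quatJ x)) = cnj (- ((inverse z)\<^sup>2)) * vert1 \<omega>1 (inverse z, x)"
      unfolding L_def pl chart_change_derivative_lift(1)[OF z] conj_linear_simps(2)[OF l1] vert1_def snd_conv ..
    also have "\<dots> = (cnj (inverse z) * cnj z) ^ 2 * z ^ 3 * vert0 \<omega>0 (z, x)"
      unfolding v[OF z x] by (simp add: power_mult_distrib)
    finally show "\<omega>1 (lift1 (inverse z, x)) (L (1, quatJ x)) = z ^ 3 * \<omega>0 p (1, quatJ x)"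
      unfolding zz vert0_def snd_conv pl by simp
    fix e
    have "\<omega>1 (lift1 (inverse z, x)) (L (0, e)) = cnj (inverse z) * coef1 \<omega>1 e (inverse z, x)"
      unfolding L_def pl chart_change_derivative_lift(2)[OF z] conj_linear_simps(2)[OF l1] coef1_def ..
    also have "\<dots> = (cnj (inverse z) * cnj z) * z ^ 3 * coef0 \<omega>0 e (z, x)"
      unfolding c[OF z x] by (simp only: mult_ac)
    finally show "\<omega>1 (lift1 (inverse z, x)) (L (0, e)) = z ^ 3 * \<omega>0 p (0, e)"
      unfolding zz coef0_def pl by simp
  qed
  then show "\<omega>1 (chart_change p) (frechet_derivative chart_change (at p) v) = fst p ^ 3 * \<omega>0 p v"
    unfolding q L_def z_def .
qed

lemma rep_pair_closed:
  assumes U: "open U" and \<psi>: "\<psi> \<in> monogenic U"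
  shows "rep_pair U \<psi> \<in> closed_forms01 (-3) U"
  unfolding closed_forms01_def mem_Collect_eq
proof (intro conjI ballI allI)
  note im = open_quatJ_image[OF U] quatJ_map_monogenic[OF U \<psi>]
  let ?\<omega> = "form_from (quatJ_image U) (rep_form (quatJ_map \<psi>))"
  have "(fst (rep_pair U \<psi>), snd (rep_pair U \<psi>)) \<in> forms01 (-3) U"
  proof (rule forms01I)
    show "smooth_form01 (chart0 U) (fst (rep_pair U \<psi>))"
      unfolding rep_pair_def fst_conv by (rule smooth_form01_rep[OF U \<psi>])
    show "smooth_form01 (chart1 U) (snd (rep_pair U \<psi>))" by (rule smooth_form01_rep1[OF U \<psi>])
  qed (rule rep_pair_transition[OF U \<psi>]; assumption)+
  then show "rep_pair U \<psi> \<in> forms01 (-3) U" by simp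
  show "dbar1 (fst (rep_pair U \<psi>)) p u v = 0" if "p \<in> chart0 U" for p u v
    unfolding rep_pair_def fst_conv by (rule dbar1_rep[OF U \<psi> that])
  show "dbar1 (snd (rep_pair U \<psi>)) p u v = 0" if p: "p \<in> chart1 U" for p u v
  proof -
    note p' = iffD1[OF flip_chart p]
    have d: "(\<lambda>q. ?\<omega> q v) differentiable (at (flip p))" for v
      by (rule smooth_on_differentiable[OF smooth_form01_smooth[OF smooth_form01_rep[OF im]] p'])
    have "dbar1 (snd (rep_pair U \<psi>)) p u v = dbar1 ?\<omega> (flip p) (flip u) (flip v)"
      unfolding dbar1_def rep_pair_def snd_conv dbar_dir_flip[OF d] ..
    also have "\<dots> = 0" by (rule dbar1_rep[OF im p'])
    finally show ?thesis .
  qed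
qed

text \<open>The integrals with numerators z and \<open>cnj z\<close> vanish and those with 1 and
  |z|^2 agree, so both components are recovered with one common factor.\<close>

lemma push_rep_pair:
  assumes U: "open U" and \<psi>: "\<psi> \<in> monogenic U"
  shows "tau_push (pi_tau (rep_pair U \<psi>)) = map_scale (of_real (fs_area / (2 * pi))) \<psi>"
proof
  fix x
  let ?\<omega> = "form_from U (rep_form \<psi>)"
  show "tau_push (pi_tau (rep_pair U \<psi>)) x = map_scale (of_real (fs_area / (2 * pi))) \<psi> x"
  proof (cases "x \<in> U")
    case False
    then have "vert0 ?\<omega> (z, x) = 0" for z by (simp add: vert0_def form_from_def lift_in_chart)
    moreover have "\<psi> x = 0" using \<psi> False unfolding monogenic_def smooth_maps_def by simp
    ultimately show ?thesis by (simp add: tau_push_eq pi_tau_vert rep_pair_def fibre_int_def map_scale_def)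
  next
    case x: True
    define a where "a = fst (\<psi> x)"
    define b where "b = snd (\<psi> x)"
    have v: "vert0 ?\<omega> (z, x) = a * (1 / (1 + z * cnj z) ^ 3) + b * (cnj z / (1 + z * cnj z) ^ 3)" for z
      unfolding rep_vert_coef(1)[OF U \<psi> x] rep_fun_def fst_conv snd_conv a_def[symmetric] b_def[symmetric]
      by (simp add: add_divide_distrib mult.commute)
    have zv: "z * vert0 ?\<omega> (z, x) = a * (z / (1 + z * cnj z) ^ 3) + b * (z * cnj z / (1 + z * cnj z) ^ 3)" for z
      unfolding v by (simp add: algebra_simps)
    have "fibre_int (vert0 ?\<omega>) x = a * (of_real fs_area / 2) + b * 0"
      unfolding fibre_int_def v
        Bochner_Integration.integral_add[OF integrable_mult_right[OF fs_moments(1)] integrable_mult_right[OF fs_moments(3)]]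
        integral_mult_right_zero fs_moments ..
    moreover have "fibre_int (\<lambda>q. fst q * vert0 ?\<omega> q) x = a * 0 + b * (of_real fs_area / 2)"
      unfolding fibre_int_def fst_conv zv
        Bochner_Integration.integral_add[OF integrable_mult_right[OF fs_moments(2)] integrable_mult_right[OF fs_moments(4)]]
        integral_mult_right_zero fs_moments ..
    ultimately show ?thesis
      unfolding tau_push_eq pi_tau_vert rep_pair_def fst_conv map_scale_def a_def[symmetric] b_def[symmetric]
      by (simp only: mult_zero_right add_0_left add_0_right) (simp add: mult.commute)
  qed
qed

text \<open>Outside \<open>U\<close> the representatives are 0, so integrability holds at every
  \<open>x\<close> and linearity of the transform can be shown pointwise without a case
  distinction.\<close>

lemma vert0_integrable:
  assumes U: "open U" and \<Omega>: "\<Omega> \<in> forms01 (-3) U"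
  shows "integrable lborel (\<lambda>z. vert0 (fst \<Omega>) (z, x))" "integrable lborel (\<lambda>z. z * vert0 (fst \<Omega>) (z, x))"
proof -
  obtain \<omega>0 \<omega>1 where e: "\<Omega> = (\<omega>0, \<omega>1)" by (cases \<Omega>)
  have h: "decaying (Suc 2) 2 U (vert0 \<omega>0)"
    using forms01_decaying(1)[OF U \<Omega>[unfolded e]] by (simp only: numeral_3_eq_3 numeral_2_eq_2)
  have z: "vert0 \<omega>0 (z, x) = 0" if "x \<notin> U" for z
  proof -
    have "lift0 (z, x) \<notin> chart0 U" using that by (simp add: lift_in_chart)
    then show ?thesis using conjunct1[OF iffD1[OF forms01_iff \<Omega>[unfolded e]]] unfolding smooth_form01_def vert0_def by blast
  qed
  show "integrable lborel (\<lambda>z. vert0 (fst \<Omega>) (z, x))" "integrable lborel (\<lambda>z. z * vert0 (fst \<Omega>) (z, x))"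
    using decaying_integrable[OF U h, of x] decaying_integrable[OF U decaying_Suc(2)[OF U h], of x] z
    by (cases "x \<in> U"; simp add: e)+
qed

section \<open>Linearity of the transform and of closedness\<close>

lemma push_add:
  assumes U: "open U" and "\<Omega> \<in> forms01 (-3) U" "\<Omega>' \<in> forms01 (-3) U"
  shows "tau_push (pi_tau (\<Omega> + \<Omega>')) = tau_push (pi_tau \<Omega>) + tau_push (pi_tau \<Omega>')"
proof
  fix x
  note i = vert0_integrable[OF U assms(2), of x] and i' = vert0_integrable[OF U assms(3), of x]
  have v: "vert0 (fst (\<Omega> + \<Omega>')) q = vert0 (fst \<Omega>) q + vert0 (fst \<Omega>') q" for q
    by (simp add: vert0_def)
  have "fibre_int (vert0 (fst (\<Omega> + \<Omega>'))) x = fibre_int (vert0 (fst \<Omega>)) x + fibre_int (vert0 (fst \<Omega>')) x"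
    unfolding fibre_int_def v by (rule Bochner_Integration.integral_add[OF i(1) i'(1)])
  moreover have "fibre_int (\<lambda>q. fst q * vert0 (fst (\<Omega> + \<Omega>')) q) x =
      fibre_int (\<lambda>q. fst q * vert0 (fst \<Omega>) q) x + fibre_int (\<lambda>q. fst q * vert0 (fst \<Omega>') q) x"
    unfolding fibre_int_def v fst_conv distrib_left by (rule Bochner_Integration.integral_add[OF i(2) i'(2)])
  ultimately show "tau_push (pi_tau (\<Omega> + \<Omega>')) x = (tau_push (pi_tau \<Omega>) + tau_push (pi_tau \<Omega>')) x"
    unfolding tau_push_eq pi_tau_vert fst_conv plus_fun_apply by (simp add: add_divide_distrib)
qed

lemma push_scale: "tau_push (pi_tau (form_scale c \<Omega>)) = map_scale c (tau_push (pi_tau \<Omega>))"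
proof
  fix x
  have v: "vert0 (fst (form_scale c \<Omega>)) q = c * vert0 (fst \<Omega>) q" for q
    by (simp add: vert0_def form_scale_def)
  have "fibre_int (vert0 (fst (form_scale c \<Omega>))) x = c * fibre_int (vert0 (fst \<Omega>)) x"
    unfolding fibre_int_def v by (rule integral_mult_right_zero)
  moreover have "fibre_int (\<lambda>q. fst q * vert0 (fst (form_scale c \<Omega>)) q) x = c * fibre_int (\<lambda>q. fst q * vert0 (fst \<Omega>) q) x"
    unfolding fibre_int_def v fst_conv mult.left_commute[of _ c] by (rule integral_mult_right_zero)
  ultimately show "tau_push (pi_tau (form_scale c \<Omega>)) x = map_scale c (tau_push (pi_tau \<Omega>)) x"
    unfolding tau_push_eq pi_tau_vert fst_conv map_scale_def snd_conv by simp
qed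

lemma push_diff:
  assumes U: "open U" and "\<Omega> \<in> forms01 (-3) U" "\<Omega>' \<in> forms01 (-3) U"
  shows "tau_push (pi_tau (\<Omega> - \<Omega>')) = tau_push (pi_tau \<Omega>) - tau_push (pi_tau \<Omega>')"
  unfolding form_diff_eq push_add[OF U assms(2) forms01_scale[OF U assms(3)]] push_scale
  by (simp add: fun_eq_iff map_scale_def prod_eq_iff)

lemma dbar1_add:
  assumes a: "smooth_form01 V \<omega>" and b: "smooth_form01 V \<eta>" and p: "p \<in> V"
  shows "dbar1 (\<omega> + \<eta>) p u v = dbar1 \<omega> p u v + dbar1 \<eta> p u v"
proof -
  note d = smooth_on_differentiable[OF smooth_form01_smooth[OF a] p] smooth_on_differentiable[OF smooth_form01_smooth[OF b] p]
  show ?thesis unfolding dbar1_def plus_fun_apply dbar_dir_add[OF d] by simp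
qed

lemma dbar1_cmult:
  assumes a: "smooth_form01 V \<omega>" and p: "p \<in> V"
  shows "dbar1 (\<lambda>p v. c * \<omega> p v) p u v = c * dbar1 \<omega> p u v"
proof -
  note d = smooth_on_differentiable[OF smooth_form01_smooth[OF a] p]
  show ?thesis unfolding dbar1_def dbar_dir_cmult[OF d] by (simp add: right_diff_distrib)
qed

lemma closed_forms01_iff:
  "\<Omega> \<in> closed_forms01 (-3) U \<longleftrightarrow> \<Omega> \<in> forms01 (-3) U \<and> (\<forall>p\<in>chart0 U. \<forall>u v. dbar1 (fst \<Omega>) p u v = 0) \<and>
     (\<forall>p\<in>chart1 U. \<forall>u v. dbar1 (snd \<Omega>) p u v = 0)"
  unfolding closed_forms01_def by simp

lemma forms01_smooth_form01:
  assumes "\<Omega> \<in> forms01 (-3) U"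
  shows "smooth_form01 (chart0 U) (fst \<Omega>)" "smooth_form01 (chart1 U) (snd \<Omega>)"
  using assms unfolding forms01_def by auto

lemma closed_forms01_add:
  assumes U: "open U" and a: "\<Omega> \<in> closed_forms01 (-3) U" and b: "\<Omega>' \<in> closed_forms01 (-3) U"
  shows "\<Omega> + \<Omega>' \<in> closed_forms01 (-3) U"
proof -
  have f: "\<Omega> \<in> forms01 (-3) U" "\<Omega>' \<in> forms01 (-3) U" using a b unfolding closed_forms01_iff by simp_all
  note s = forms01_smooth_form01[OF f(1)] and s' = forms01_smooth_form01[OF f(2)]
  show ?thesis
    using a b forms01_add[OF U f] unfolding closed_forms01_iff fst_add snd_add
    by (simp add: dbar1_add[OF s(1) s'(1)] dbar1_add[OF s(2) s'(2)])
qed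

lemma closed_forms01_scale:
  assumes U: "open U" and a: "\<Omega> \<in> closed_forms01 (-3) U"
  shows "form_scale c \<Omega> \<in> closed_forms01 (-3) U"
proof -
  have f: "\<Omega> \<in> forms01 (-3) U" using a unfolding closed_forms01_iff by simp
  note s = forms01_smooth_form01[OF f]
  have e: "fst (form_scale c \<Omega>) = (\<lambda>p v. c * fst \<Omega> p v)" "snd (form_scale c \<Omega>) = (\<lambda>p v. c * snd \<Omega> p v)"
    by (simp_all add: form_scale_def)
  show ?thesis
    using a forms01_scale[OF U f, of c] unfolding closed_forms01_iff e
    by (simp add: dbar1_cmult[OF s(1)] dbar1_cmult[OF s(2)])
qed

text \<open>By this equivalence no closure properties of \<open>sections\<close> are needed for the classes to form a quotient.\<close>

lemma cohomologous_iff: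
  assumes U: "open U"
  shows "(\<Omega>, \<Omega>') \<in> cohomologous (-3) U \<longleftrightarrow> \<Omega> \<in> closed_forms01 (-3) U \<and> \<Omega>' \<in> closed_forms01 (-3) U \<and>
    tau_push (pi_tau \<Omega>) = tau_push (pi_tau \<Omega>')"
proof -
  have "(\<exists>f\<in>sections (-3) U. \<Omega> - \<Omega>' = dbar0 U f) \<longleftrightarrow> tau_push (pi_tau \<Omega>) = tau_push (pi_tau \<Omega>')"
    if a: "\<Omega> \<in> closed_forms01 (-3) U" and b: "\<Omega>' \<in> closed_forms01 (-3) U"
  proof -
    have f: "\<Omega> \<in> forms01 (-3) U" "\<Omega>' \<in> forms01 (-3) U" using a b unfolding closed_forms01_iff by simp_all
    have d: "\<Omega> - \<Omega>' \<in> closed_forms01 (-3) U"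
      unfolding form_diff_eq by (rule closed_forms01_add[OF U a closed_forms01_scale[OF U b]])
    show ?thesis
    proof
      assume "\<exists>f\<in>sections (-3) U. \<Omega> - \<Omega>' = dbar0 U f"
      then obtain g where g: "g \<in> sections (-3) U" "\<Omega> - \<Omega>' = dbar0 U g" by (rule bexE)
      have "tau_push (pi_tau (\<Omega> - \<Omega>')) = 0" unfolding g(2) by (rule push_dbar0[OF U g(1)])
      then show "tau_push (pi_tau \<Omega>) = tau_push (pi_tau \<Omega>')" unfolding push_diff[OF U f] by simp
    next
      assume "tau_push (pi_tau \<Omega>) = tau_push (pi_tau \<Omega>')"
      then have "tau_push (pi_tau (\<Omega> - \<Omega>')) = 0" unfolding push_diff[OF U f] by simp
      from exact_of_push_eq_0[OF U d this] show "\<exists>f\<in>sections (-3) U. \<Omega> - \<Omega>' = dbar0 U f" .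
    qed
  qed
  then show ?thesis unfolding cohomologous_def mem_Collect_eq prod.case by (rule_tac conj_cong[OF refl conj_cong[OF refl]])
qed

lemma H1_class_eq:
  assumes U: "open U" and a: "\<Omega> \<in> closed_forms01 (-3) U"
  shows "H1_class (-3) U \<Omega> = {\<Omega>' \<in> closed_forms01 (-3) U. tau_push (pi_tau \<Omega>') = tau_push (pi_tau \<Omega>)}"
  unfolding H1_class_def Image_singleton cohomologous_iff[OF U] using a by auto

text \<open>The explicit representative reproduces \<psi> up to the nonzero constant
  \<open>c\<close>, which rescaling of the form removes.\<close>

lemma monogenic_is_push:
  assumes U: "open U" and \<psi>: "\<psi> \<in> monogenic U"
  shows "\<exists>\<Omega>\<in>closed_forms01 (-3) U. tau_push (pi_tau \<Omega>) = \<psi>"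
proof
  define c :: complex where "c = of_real (fs_area / (2 * pi))"
  have c: "c \<noteq> 0" unfolding c_def using fs_area_pos by simp
  show "form_scale (inverse c) (rep_pair U \<psi>) \<in> closed_forms01 (-3) U"
    by (rule closed_forms01_scale[OF U rep_pair_closed[OF U \<psi>]])
  show "tau_push (pi_tau (form_scale (inverse c) (rep_pair U \<psi>))) = \<psi>"
    unfolding push_scale push_rep_pair[OF U \<psi>] c_def[symmetric]
    using c by (simp add: fun_eq_iff map_scale_def mult.assoc[symmetric])
qed

theorem theorem5p2:
  fixes U :: "(quat ^ 'n::finite) set"
  assumes "open U"
  shows "pi_tau \<in> forms01 (-3) U \<rightarrow> forms01_tau (-3) U
    \<and> tau_push \<in> forms01_tau (-3) U \<rightarrow> smooth_maps U
    \<and> (\<forall>\<Omega>\<in>closed_forms01 (-3) U. (tau_push \<circ> pi_tau) \<Omega> \<in> monogenic U)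
    \<and> (\<exists>P. H1_linear_iso (-3) U (monogenic U) P
         \<and> (\<forall>\<Omega>\<in>closed_forms01 (-3) U. P (H1_class (-3) U \<Omega>) = (tau_push \<circ> pi_tau) \<Omega>))"
proof (intro conjI)
  note U = \<open>open U\<close>
  show "pi_tau \<in> forms01 (-3) U \<rightarrow> forms01_tau (-3) U" by (rule Pi_I[OF pi_tau_in_forms01_tau[OF U]])
  show "tau_push \<in> forms01_tau (-3) U \<rightarrow> smooth_maps U" by (rule Pi_I[OF tau_push_smooth[OF U]])
  show "\<forall>\<Omega>\<in>closed_forms01 (-3) U. (tau_push \<circ> pi_tau) \<Omega> \<in> monogenic U"
    unfolding o_apply by (rule ballI[OF push_monogenic[OF U]])
  let ?Z = "closed_forms01 (-3) U"
  define S where "S \<Omega> = tau_push (pi_tau \<Omega>)" for \<Omega> :: "'n form01 \<times> 'n form01"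
  define cl where "cl \<Omega> = H1_class (-3) U \<Omega>" for \<Omega>
  \<comment> \<open>The value on a chosen representative; the choice is immaterial because the
    classes are the level sets of \<open>S\<close> on closed forms.\<close>
  define P where "P A = S (SOME \<Omega>. \<Omega> \<in> A)" for A
  have cl: "cl \<Omega> = {\<Omega>' \<in> ?Z. S \<Omega>' = S \<Omega>}" if "\<Omega> \<in> ?Z" for \<Omega>
    unfolding cl_def S_def by (rule H1_class_eq[OF U that])
  have P: "P (cl \<Omega>) = S \<Omega>" if z: "\<Omega> \<in> ?Z" for \<Omega>
  proof -
    have "\<Omega> \<in> cl \<Omega>" using z by (simp add: cl)
    then have "(SOME \<Omega>'. \<Omega>' \<in> cl \<Omega>) \<in> cl \<Omega>" by (rule someI)
    then show ?thesis unfolding P_def using z by (simp add: cl)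
  qed
  have cl_eq: "cl \<Omega> = cl \<Omega>'" if "\<Omega> \<in> ?Z" "\<Omega>' \<in> ?Z" "S \<Omega> = S \<Omega>'" for \<Omega> \<Omega>'
    using that by (simp add: cl)
  have H1: "H1 (-3) U = cl ` ?Z"
    unfolding H1_def quotient_def cl_def H1_class_def by (rule UNION_singleton_eq_range)
  have fo: "\<Omega> \<in> forms01 (-3) U" if "\<Omega> \<in> ?Z" for \<Omega> using that unfolding closed_forms01_iff by (rule conjunct1)
  have add: "H1_add (-3) U (cl \<Omega>) (cl \<Omega>') = cl (\<Omega> + \<Omega>')" if z: "\<Omega> \<in> ?Z" "\<Omega>' \<in> ?Z" for \<Omega> \<Omega>'
  proof -
    have m: "\<Omega> \<in> cl \<Omega>" "\<Omega>' \<in> cl \<Omega>'" using z by (simp_all add: cl)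
    \<comment> \<open>\<open>H1_add\<close> is a union over all pairs of representatives; it is a
      single class because every pair yields the same one.\<close>
    have "cl (\<Omega>1 + \<Omega>2) = cl (\<Omega> + \<Omega>')" if "\<Omega>1 \<in> cl \<Omega>" "\<Omega>2 \<in> cl \<Omega>'" for \<Omega>1 \<Omega>2
    proof -
      have w: "\<Omega>1 \<in> ?Z" "S \<Omega>1 = S \<Omega>" "\<Omega>2 \<in> ?Z" "S \<Omega>2 = S \<Omega>'" using that z by (simp_all add: cl)
      show ?thesis
        by (rule cl_eq[OF closed_forms01_add[OF U w(1,3)] closed_forms01_add[OF U z]])
           (use w(2,4) in \<open>simp add: S_def push_add[OF U fo[OF w(1)] fo[OF w(3)]] push_add[OF U fo[OF z(1)] fo[OF z(2)]]\<close>)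
    qed
    then show ?thesis unfolding H1_add_def cl_def[symmetric] using m by blast
  qed
  have scale: "H1_scale (-3) U c (cl \<Omega>) = cl (form_scale c \<Omega>)" if z: "\<Omega> \<in> ?Z" for c \<Omega>
  proof -
    have m: "\<Omega> \<in> cl \<Omega>" using z by (simp add: cl)
    have "cl (form_scale c \<Omega>1) = cl (form_scale c \<Omega>)" if "\<Omega>1 \<in> cl \<Omega>" for \<Omega>1
    proof -
      have w: "\<Omega>1 \<in> ?Z" "S \<Omega>1 = S \<Omega>" using that z by (simp_all add: cl)
      show ?thesis
        by (rule cl_eq[OF closed_forms01_scale[OF U w(1)] closed_forms01_scale[OF U z]])
           (use w(2) in \<open>simp add: S_def push_scale\<close>)
    qed
    then show ?thesis unfolding H1_scale_def cl_def[symmetric] using m by blast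
  qed
  have "bij_betw P (cl ` ?Z) (monogenic U)"
  proof (rule bij_betw_imageI)
    show "inj_on P (cl ` ?Z)"
    proof (rule inj_onI)
      fix A B assume "A \<in> cl ` ?Z" "B \<in> cl ` ?Z" and e: "P A = P B"
      then obtain \<Omega> \<Omega>' where w: "A = cl \<Omega>" "\<Omega> \<in> ?Z" "B = cl \<Omega>'" "\<Omega>' \<in> ?Z" by (elim imageE)
      show "A = B" using e cl_eq[OF w(2,4)] unfolding w(1,3) P[OF w(2)] P[OF w(4)] by simp
    qed
    have "P ` cl ` ?Z = S ` ?Z" unfolding image_image using P by (rule image_cong[OF refl])
    also have "\<dots> = monogenic U"
      unfolding S_def using push_monogenic[OF U] monogenic_is_push[OF U] by blast
    finally show "P ` cl ` ?Z = monogenic U" .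
  qed
  moreover have "P (H1_add (-3) U A B) = P A + P B" if AB: "A \<in> cl ` ?Z" "B \<in> cl ` ?Z" for A B
  proof -
    obtain \<Omega> \<Omega>' where w: "A = cl \<Omega>" "\<Omega> \<in> ?Z" "B = cl \<Omega>'" "\<Omega>' \<in> ?Z" using AB by (elim imageE)
    show ?thesis
      unfolding w(1,3) add[OF w(2,4)] P[OF closed_forms01_add[OF U w(2,4)]] P[OF w(2)] P[OF w(4)]
      unfolding S_def by (rule push_add[OF U fo[OF w(2)] fo[OF w(4)]])
  qed
  moreover have "P (H1_scale (-3) U c A) = map_scale c (P A)" if A: "A \<in> cl ` ?Z" for c A
  proof -
    obtain \<Omega> where w: "A = cl \<Omega>" "\<Omega> \<in> ?Z" using A by (elim imageE)
    show ?thesis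
      unfolding w(1) scale[OF w(2)] P[OF closed_forms01_scale[OF U w(2)]] P[OF w(2)]
      unfolding S_def by (rule push_scale)
  qed
  ultimately have "H1_linear_iso (-3) U (monogenic U) P"
    unfolding H1_linear_iso_def H1 by blast
  moreover have "\<forall>\<Omega>\<in>?Z. P (H1_class (-3) U \<Omega>) = (tau_push \<circ> pi_tau) \<Omega>"
    using P unfolding cl_def S_def o_apply by (rule ballI)
  ultimately show "\<exists>P. H1_linear_iso (-3) U (monogenic U) P
         \<and> (\<forall>\<Omega>\<in>?Z. P (H1_class (-3) U \<Omega>) = (tau_push \<circ> pi_tau) \<Omega>)" by (intro exI conjI)
qed

end
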